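(* Let $m \in \mathbb{N}_{>0}$, $b>0$, $\rho \in (0,b^{-\frac{1}{2b}})$, $\mathfrak{s}_{1}>\dots>\mathfrak{s}_{m}>0$ and $\alpha > -1$ be fixed, and for $n \in \mathbb{N}_{>0}$ let $r_{\ell} = \rho \big( 1-\frac{\sqrt{2}\, \mathfrak{s}_{\ell}}{\rho^{b}\sqrt{n}} \big)^{\frac{1}{2b}}$, $\ell=1,\dots,m$. For any fixed $x_{1},\dots,x_{m} \in \mathbb{R}$ there exists $\delta > 0$ such that $$\mathbb{E}\bigg[ \prod_{j=1}^{m} e^{u_{j}\mathrm{N}(r_{j})} \bigg] = \exp \bigg( C_{1} n + C_{2} \sqrt{n} + C_{3} + \frac{C_{4}}{\sqrt{n}} + {\cal O}\bigg(\frac{(\ln n)^{4}}{n}\bigg)\bigg), \qquad n \to + \infty,$$ uniformly for $u_{1} \in D_\delta(x_1),\dots,u_{m} \in D_\delta(x_m)$, where, writing $U=\sum_{j=1}^m u_j$, \begin{align*} & C_{1} = b \rho^{2b} U, \qquad C_{2} = \sqrt{2} \, b \rho^{b} \int_{-\infty}^{+\infty} \big( h_{0}(y)-\chi_{(-\infty,0)}(y) U \big)dy, \\ & C_{3} = -\Big(\frac{1}{2}+\alpha \Big)U + b \int_{-\infty}^{+\infty} \Big( 4y \big( h_{0}(y) - \chi_{(-\infty,0)}(y) U \big) + \sqrt{2} \, h_{1}(y) \Big)dy, \\ & C_{4} = b\rho^{-b} \int_{-\infty}^{+\infty} \Big[ 6\sqrt{2} y^{2} \big( h_{0}(y)-\chi_{(-\infty,0)}(y)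 U \big) + 4yh_{1}(y)+\sqrt{2} \, h_{2}(y) \Big]dy, \end{align*} with $h_{0} = \ln g_{0}$, $h_{1} = \frac{g_{1}}{g_{0}}$, $h_{2} = \frac{g_{2}}{g_{0}} - \frac{1}{2} \big( \frac{g_{1}}{g_{0}} \big)^{2}$ and \begin{align*} g_{0}(y) = &\; 1+\sum_{\ell=1}^{m} \omega_{\ell} \frac{\mathrm{erfc}(y+\mathfrak{s}_{\ell})}{\mathrm{erfc}(y)}, \\ g_{1}(y) = &\; \sum_{\ell=1}^{m} \frac{\sqrt{2}}{3\sqrt{\pi}} \omega_{\ell} \bigg\{ (5y^{2}-1)\frac{e^{-y^{2}}}{\mathrm{erfc}(y)} \frac{\mathrm{erfc}(y+\mathfrak{s}_{\ell})}{\mathrm{erfc}(y)} - \big( 5y^{2}+\mathfrak{s}_{\ell} y + 2\mathfrak{s}_{\ell}^{2}-1 \big) \frac{e^{-(y+\mathfrak{s}_{\ell})^{2}}}{\mathrm{erfc}(y)} \bigg\}, \\ g_{2}(y) = &\; \sum_{\ell=1}^{m} \omega_{\ell}\bigg\{ \frac{1}{18\sqrt{\pi}} \Big[ 50 y^{5} + 70 y^{4} \mathfrak{s}_{\ell} + y^{3}(62\mathfrak{s}_{\ell}^{2}-73) + y^{2}\mathfrak{s}_{\ell}(50\mathfrak{s}_{\ell}^{2}-33) -y (3+18\mathfrak{s}_{\ell}^{2}-16\mathfrak{s}_{\ell}^{4}) + \mathfrak{s}_{\ell}(3-22\mathfrak{s}_{\ell}^{2}+8\mathfrak{s}_{\ell}^{4})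 \Big] \frac{e^{-(y+\mathfrak{s}_{\ell})^{2}}}{\mathrm{erfc}(y)} \\ & + \frac{2(1-5y^{2})(5y^{2}+y \mathfrak{s}_{\ell} -1 + 2\mathfrak{s}_{\ell}^{2})}{9\pi} \frac{e^{-y^{2}}}{\mathrm{erfc}(y)} \frac{e^{-(y+\mathfrak{s}_{\ell})^{2}}}{\mathrm{erfc}(y)} + \frac{y(3+73y^{2}-50y^{4})}{18 \sqrt{\pi}} \frac{e^{-y^{2}}}{\mathrm{erfc}(y)} \frac{\mathrm{erfc}(y+\mathfrak{s}_{\ell})}{\mathrm{erfc}(y)} \\ & + \frac{2(1-5y^{2})^{2}}{9\pi} \bigg( \frac{e^{-y^{2}}}{\mathrm{erfc}(y)} \bigg)^{2} \frac{\mathrm{erfc}(y+\mathfrak{s}_{\ell})}{\mathrm{erfc}(y)} \bigg\}. \end{align*} Moreover, for any $k_{1},\dots,k_{m}\in \mathbb{N}$ and $u_{1},\dots,u_{m}\in \mathbb{R}$, $$\partial_{u_{1}}^{k_{1}}\dots \partial_{u_{m}}^{k_{m}} \bigg\{ \ln \mathbb{E}\bigg[ \prod_{j=1}^{m} e^{u_{j}\mathrm{N}(r_{j})} \bigg] - \bigg( C_{1} n + C_{2} \sqrt{n} + C_{3} + \frac{C_{4}}{\sqrt{n}} \bigg) \bigg\} = {\cal O}\bigg(\frac{(\ln n)^{4}}{n}\bigg), \qquad n\to+\infty.$$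
   Context: For $n\in\mathbb{N}_{>0}$, $b>0$, $\alpha>-1$ and $0<\rho<b^{-1/(2b)}$, consider $n$ random points $z_1,\dots,z_n\in\mathbb{C}$ with joint density $\frac{1}{n!\mathcal{Z}_{n}} \prod_{1 \leq j < k \leq n} |z_{k} -z_{j}|^{2} \prod_{j=1}^{n} e^{-nQ(z_{j})}$, where $\mathcal{Z}_n$ normalizes and $Q(z)=|z|^{2b}-\frac{2\alpha}{n}\ln|z|$ if $|z|\le\rho$, $Q(z)=+\infty$ if $|z|>\rho$. $\mathrm{N}(y):=\#\{j: |z_{j}| < y\}$. $D_\delta(x)$ is the open disk of radius $\delta$ centered at $x$. $\omega_{\ell} = e^{u_{\ell}+\dots+u_{m}}-e^{u_{\ell+1}+\dots+u_{m}}$ for $\ell<m$ and $\omega_m=e^{u_m}-1$. $\mathrm{erfc}(t) = \frac{2}{\sqrt{\pi}}\int_{t}^{\infty} e^{-x^{2}}dx$; $\ln$ is the principal branch. *)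

theory Defs
  imports "HOL-Analysis.Analysis"
begin

definition erfc :: "real \<Rightarrow> real" where
  "erfc t = 2 / sqrt pi * (LBINT x:{t..}. exp (- (x\<^sup>2)))"

text \<open>The one-particle weight e^{-n Q(z)} with
  Q(z) = |z|^{2b} - (2 alpha / n) ln|z| for |z| \<le> rho and Q = +\<infinity> otherwise,
  i.e. e^{-nQ(z)} = |z|^{2 alpha} e^{-n |z|^{2b}} on the closed disk and 0 outside
  (the value at z = 0 is irrelevant, being a null set).\<close>
definition wQ :: "real \<Rightarrow> real \<Rightarrow> real \<Rightarrow> nat \<Rightarrow> complex \<Rightarrow> real" where
  "wQ b \<alpha> \<rho> n z =
     (if cmod z \<le> \<rho> then exp (- real n * cmod z powr (2 * b)) * cmod z powr (2 * \<alpha>) else 0)"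

definition jointW :: "real \<Rightarrow> real \<Rightarrow> real \<Rightarrow> nat \<Rightarrow> (nat \<Rightarrow> complex) \<Rightarrow> real" where
  "jointW b \<alpha> \<rho> n z =
     (\<Prod>k\<in>{..<n}. \<Prod>j\<in>{..<k}. (cmod (z k - z j))\<^sup>2) * (\<Prod>j\<in>{..<n}. wQ b \<alpha> \<rho> n (z j))"

definition countN :: "nat \<Rightarrow> (nat \<Rightarrow> complex) \<Rightarrow> real \<Rightarrow> nat" where
  "countN n z y = card {j\<in>{..<n}. cmod (z j) < y}"

definition expect :: "real \<Rightarrow> real \<Rightarrow> real \<Rightarrow> nat \<Rightarrow> ((nat \<Rightarrow> complex) \<Rightarrow> complex) \<Rightarrow> complex" where
  "expect b \<alpha> \<rho> n F =
     (integral\<^sup>L (PiM {..<n} (\<lambda>_. lborel :: complex measure))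
        (\<lambda>z. complex_of_real (jointW b \<alpha> \<rho> n z) * F z))
     / complex_of_real (integral\<^sup>L (PiM {..<n} (\<lambda>_. lborel :: complex measure)) (jointW b \<alpha> \<rho> n))"

definition radius :: "real \<Rightarrow> real \<Rightarrow> (nat \<Rightarrow> real) \<Rightarrow> nat \<Rightarrow> nat \<Rightarrow> real" where
  "radius b \<rho> s n l = \<rho> * (1 - sqrt 2 * s l / (\<rho> powr b * sqrt (real n))) powr (1 / (2 * b))"

definition mgf :: "nat \<Rightarrow> real \<Rightarrow> real \<Rightarrow> real \<Rightarrow> (nat \<Rightarrow> real) \<Rightarrow> nat \<Rightarrow> (nat \<Rightarrow> complex) \<Rightarrow> complex" where
  "mgf m b \<alpha> \<rho> s n u =
     expect b \<alpha> \<rho> n (\<lambda>z. \<Prod>j\<in>{1..m}. exp (u j * of_nat (countN n z (radius b \<rho> s n j))))"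

definition omega :: "nat \<Rightarrow> (nat \<Rightarrow> complex) \<Rightarrow> nat \<Rightarrow> complex" where
  "omega m u l = exp (\<Sum>j\<in>{l..m}. u j) - exp (\<Sum>j\<in>{l+1..m}. u j)"

definition g0 :: "nat \<Rightarrow> (nat \<Rightarrow> real) \<Rightarrow> (nat \<Rightarrow> complex) \<Rightarrow> real \<Rightarrow> complex" where
  "g0 m s u y = 1 + (\<Sum>l\<in>{1..m}. omega m u l * of_real (erfc (y + s l) / erfc y))"

definition g1 :: "nat \<Rightarrow> (nat \<Rightarrow> real) \<Rightarrow> (nat \<Rightarrow> complex) \<Rightarrow> real \<Rightarrow> complex" where
  "g1 m s u y = (\<Sum>l\<in>{1..m}. omega m u l * of_real (sqrt 2 / (3 * sqrt pi) *
      ((5 * y\<^sup>2 - 1) * (exp (- y\<^sup>2) / erfc y) * (erfc (y + s l) / erfc y)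
       - (5 * y\<^sup>2 + s l * y + 2 * (s l)\<^sup>2 - 1) * (exp (- (y + s l)\<^sup>2) / erfc y))))"

definition g2 :: "nat \<Rightarrow> (nat \<Rightarrow> real) \<Rightarrow> (nat \<Rightarrow> complex) \<Rightarrow> real \<Rightarrow> complex" where
  "g2 m s u y = (\<Sum>l\<in>{1..m}. omega m u l * of_real (
      1 / (18 * sqrt pi) *
        (50 * y ^ 5 + 70 * y ^ 4 * s l + y ^ 3 * (62 * (s l)\<^sup>2 - 73)
         + y\<^sup>2 * s l * (50 * (s l)\<^sup>2 - 33) - y * (3 + 18 * (s l)\<^sup>2 - 16 * (s l) ^ 4)
         + s l * (3 - 22 * (s l)\<^sup>2 + 8 * (s l) ^ 4))
        * (exp (- (y + s l)\<^sup>2) / erfc y)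
      + 2 * (1 - 5 * y\<^sup>2) * (5 * y\<^sup>2 + y * s l - 1 + 2 * (s l)\<^sup>2) / (9 * pi)
        * (exp (- y\<^sup>2) / erfc y) * (exp (- (y + s l)\<^sup>2) / erfc y)
      + y * (3 + 73 * y\<^sup>2 - 50 * y ^ 4) / (18 * sqrt pi)
        * (exp (- y\<^sup>2) / erfc y) * (erfc (y + s l) / erfc y)
      + 2 * (1 - 5 * y\<^sup>2)\<^sup>2 / (9 * pi)
        * (exp (- y\<^sup>2) / erfc y)\<^sup>2 * (erfc (y + s l) / erfc y)))"

definition h0 :: "nat \<Rightarrow> (nat \<Rightarrow> real) \<Rightarrow> (nat \<Rightarrow> complex) \<Rightarrow> real \<Rightarrow> complex" where
  "h0 m s u y = Ln (g0 m s u y)"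

definition h1 :: "nat \<Rightarrow> (nat \<Rightarrow> real) \<Rightarrow> (nat \<Rightarrow> complex) \<Rightarrow> real \<Rightarrow> complex" where
  "h1 m s u y = g1 m s u y / g0 m s u y"

definition h2 :: "nat \<Rightarrow> (nat \<Rightarrow> real) \<Rightarrow> (nat \<Rightarrow> complex) \<Rightarrow> real \<Rightarrow> complex" where
  "h2 m s u y = g2 m s u y / g0 m s u y - (g1 m s u y / g0 m s u y)\<^sup>2 / 2"

definition Usum :: "nat \<Rightarrow> (nat \<Rightarrow> complex) \<Rightarrow> complex" where
  "Usum m u = (\<Sum>j\<in>{1..m}. u j)"

definition h0c :: "nat \<Rightarrow> (nat \<Rightarrow> real) \<Rightarrow> (nat \<Rightarrow> complex) \<Rightarrow> real \<Rightarrow> complex" where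
  "h0c m s u y = h0 m s u y - (if y < 0 then Usum m u else 0)"

definition C1 :: "nat \<Rightarrow> real \<Rightarrow> real \<Rightarrow> (nat \<Rightarrow> complex) \<Rightarrow> complex" where
  "C1 m b \<rho> u = of_real (b * \<rho> powr (2 * b)) * Usum m u"

definition C2 :: "nat \<Rightarrow> real \<Rightarrow> real \<Rightarrow> (nat \<Rightarrow> real) \<Rightarrow> (nat \<Rightarrow> complex) \<Rightarrow> complex" where
  "C2 m b \<rho> s u = of_real (sqrt 2 * b * \<rho> powr b) * (LBINT y. h0c m s u y)"

definition C3 :: "nat \<Rightarrow> real \<Rightarrow> real \<Rightarrow> (nat \<Rightarrow> real) \<Rightarrow> (nat \<Rightarrow> complex) \<Rightarrow> complex" where
  "C3 m b \<alpha> s u = - of_real (1 / 2 + \<alpha>) * Usum m u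
     + of_real b * (LBINT y. 4 * of_real y * h0c m s u y + of_real (sqrt 2) * h1 m s u y)"

definition C4 :: "nat \<Rightarrow> real \<Rightarrow> real \<Rightarrow> (nat \<Rightarrow> real) \<Rightarrow> (nat \<Rightarrow> complex) \<Rightarrow> complex" where
  "C4 m b \<rho> s u = of_real (b * \<rho> powr (- b)) *
     (LBINT y. of_real (6 * sqrt 2 * y\<^sup>2) * h0c m s u y + 4 * of_real y * h1 m s u y
               + of_real (sqrt 2) * h2 m s u y)"

definition mainterm :: "nat \<Rightarrow> real \<Rightarrow> real \<Rightarrow> real \<Rightarrow> (nat \<Rightarrow> real) \<Rightarrow> nat \<Rightarrow> (nat \<Rightarrow> complex) \<Rightarrow> complex" where
  "mainterm m b \<alpha> \<rho> s n u =
     C1 m b \<rho> u * of_nat n + C2 m b \<rho> s u * of_real (sqrt (real n)) + C3 m b \<alpha> s u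
     + C4 m b \<rho> s u / of_real (sqrt (real n))"

fun mpartial :: "((nat \<Rightarrow> real) \<Rightarrow> complex) \<Rightarrow> nat list \<Rightarrow> (nat \<Rightarrow> real) \<Rightarrow> complex" where
  "mpartial F [] = F"
| "mpartial F (j # js) = (\<lambda>u. vector_derivative (\<lambda>t. mpartial F js (u(j := t))) (at (u j)))"

definition multi_index :: "nat \<Rightarrow> (nat \<Rightarrow> nat) \<Rightarrow> nat list" where
  "multi_index m k = concat (map (\<lambda>j. replicate (k j) j) [1..<m+1])"

end

theory Submission
 imports Defs "HOL-Complex_Analysis.Complex_Analysis" "HOL-Real_Asymp.Real_Asymp"
begin

text \<open>The joint density is radial, so expanding the Vandermonde determinants and using the orthogonality
of the monomials turns the moment generating function into the product over \<open>1 \<le> j \<le> n\<close> of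
\<open>1 + (\<Sum>l. omega l * R l j)\<close>, where \<open>R l j\<close> is a quotient of incomplete gamma integrals.
With \<open>eps = sqrt 2 / (\<rho> powr b * sqrt n)\<close> and the radial coordinate \<open>t\<close> defined by
\<open>r = \<rho> * (1 - eps * t) powr (1 / (2 * b))\<close>, the radii sit at \<open>t = s l\<close>, the hard wall at \<open>t = 0\<close>,
and the radial weight is \<open>(1 - eps * t) powr (a - 1) * exp (2 * t / eps)\<close> with \<open>a = (j + \<alpha>) / b\<close>.

Writing \<open>a = 2 / (eps\<^sup>2 * (1 - eps * y))\<close> makes this weight a perturbation of \<open>exp (- (y + t)\<^sup>2)\<close>, which
gives each quotient as a quotient of error functions with explicit corrections of order \<open>eps\<close> and \<open>eps\<^sup>2\<close>,
the error being smaller by a factor that decays exponentially in \<open>y\<close>.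
Factors with \<open>y\<close> far from \<open>0\<close> equal \<open>exp U\<close> or \<open>1\<close> up to high powers of \<open>eps\<close>.
The sum of the logarithms over the remaining \<open>j\<close> is a midpoint sum, whose boundary terms are negligible
by the same decay; the change of variables from \<open>j\<close> to \<open>y\<close> has density
\<open>2 * b / (eps * (1 - eps * y)\<^sup>2)\<close>, whose expansion supplies the weights \<open>1\<close>, \<open>2 * y\<close>, \<open>3 * y\<^sup>2\<close>.

All estimates are uniform for \<open>u\<close> in a complex polydisc, on which the error term is holomorphic in each variable;
the statement on derivatives then follows from Cauchy's estimates.\<close>

section \<open>Factorisation of the moment generating function\<close>

text \<open>The hypothesis \<open>\<rho> < b powr (- 1 / (2 * b))\<close> puts the critical index
  \<open>2 * b / eps^2\<close>, which equals \<open>b * \<rho> powr (2 * b) * n\<close>, strictly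
  below \<open>n\<close>, so that both plateaus occur in the product. The weight with parameter
  \<open>y\<close> peaks near \<open>t = - y\<close>; the wall at \<open>t = 0\<close> cuts off a
  part of a Gaussian, hence the error functions. Roughly \<open>1 / eps\<close> factors are in
  transition and \<open>1 / n\<close> has the order \<open>eps^2\<close>, so each logarithm is
  needed up to \<open>eps^3\<close>. The branch of the logarithm is the other obstacle. Instead of
  following \<open>Ln\<close> of the product for complex \<open>u\<close>, the logarithms of the
  factors are added. By Abel summation a factor is a convex combination of \<open>1\<close> and the
  tail exponentials \<open>exp (u l + ... + u m)\<close>; on a polydisc of radius
  \<open>1 / m\<close> their arguments stay in \<open>[-1, 1]\<close>, which keeps every factor in a
  fixed right half-plane. For real \<open>u\<close> the factors are positive and the sum is the
  logarithm of the product. The error obtained is \<open>O(1 / n)\<close>; it passes to the stated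
  form by \<open>ln n >= 1\<close>.\<close>

text \<open>Composing a permutation with the transposition of \<open>i\<close> and \<open>j\<close>
  flips its sign and, as \<open>w i = w j\<close>, keeps its product; the sum is therefore its own
  negative. This is the determinant with two equal rows.\<close>

lemma sum_sign_permutations_eq_0:
 fixes w :: "nat \<Rightarrow> complex"
 assumes "i < N" "j < N" "i \<noteq> j" "w i = w j"
 shows "(\<Sum>p | p permutes {..<N}. of_int (sign p) * (\<Prod>k<N. w k ^ p k)) = 0"
proof -
 define t where "t = Transposition.transpose i j"
 define f where "f = (\<lambda>p. of_int (sign p) * (\<Prod>k<N. w k ^ p k))"
 have t: "t permutes {..<N}" unfolding t_def using assms by (intro permutes_swap_id) auto
 have w: "w (t k) = w k" for k unfolding t_def Transposition.transpose_def using assms by auto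
 have ft: "f (p \<circ> t) = - f p" if "p permutes {..<N}" for p
 proof -
  have "sign t = -1" unfolding t_def using assms by (simp add: sign_swap_id)
  moreover have "permutation p" "permutation t" using that t permutation_permutes by blast+
  ultimately have "sign (p \<circ> t) = - sign p" by (simp add: sign_compose)
  moreover have "(\<Prod>k<N. w k ^ (p \<circ> t) k) = (\<Prod>k<N. w k ^ p k)"
  proof -
   have "(\<Prod>k<N. w k ^ p k) = (\<Prod>k<N. w (t k) ^ p (t k))"
    using prod.permute[OF t, of "\<lambda>k. w k ^ p k"] by (simp add: o_def)
   then show ?thesis by (simp add: w)
  qed
  ultimately show ?thesis by (simp add: f_def)
 qed
 have "sum f {p. p permutes {..<N}} = sum (\<lambda>p. f (p \<circ> t)) {p. p permutes {..<N}}"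
  by (rule sum_permutations_compose_right[OF t])
 also have "... = - sum f {p. p permutes {..<N}}"
  by (simp add: ft sum_negf)
 finally show ?thesis by (simp add: f_def)
qed

text \<open>Both sides are compared as polynomials in the last variable: the permutation sum has
  degree at most \<open>n\<close>, its coefficient at \<open>n\<close> is the sum of the previous
  size, and it vanishes at the earlier nodes by \<open>sum_sign_permutations_eq_0\<close>.\<close>

lemma vandermonde_permutations:
 fixes z :: "nat \<Rightarrow> complex"
 shows "(\<Prod>k\<in>{..<n}. \<Prod>j\<in>{..<k}. z k - z j) =
    (\<Sum>p | p permutes {..<n}. of_int (sign p) * (\<Prod>i<n. z i ^ p i))"
proof (induction n)
 case 0
 show ?case by simp
next
 case (Suc n)
 define V where "V = (\<lambda>n. \<Sum>p | p permutes {..<n}. of_int (sign p) * (\<Prod>i<n. z i ^ p i))"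
 define P where "P = (\<Sum>p | p permutes {..<Suc n}. monom (of_int (sign p) * (\<Prod>i<n. z i ^ p i)) (p n))"
 have polyP: "poly P x = (\<Sum>p | p permutes {..<Suc n}. of_int (sign p) * (\<Prod>i<Suc n. (z(n := x)) i ^ p i))" for x
  unfolding P_def by (simp add: poly_sum poly_monom mult.assoc)
 have fin: "finite {p. p permutes {..<k}}" for k :: nat by (rule finite_permutations) simp
 have degP: "degree P \<le> n"
  unfolding P_def
 proof (rule degree_sum_le[OF fin])
  fix p assume "p \<in> {p. p permutes {..<Suc n}}"
  then have "p n < Suc n" using permutes_in_image[of p "{..<Suc n}" n] by simp
  then show "degree (monom (of_int (sign p) * (\<Prod>i<n. z i ^ p i)) (p n)) \<le> n"
   by (meson degree_monom_le le_trans less_Suc_eq_le)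
 qed
 have perm_eq: "{p. p permutes {..<Suc n} \<and> p n = n} = {p. p permutes {..<n}}"
 proof -
  have "p permutes {..<n}" if "p permutes {..<Suc n}" "p n = n" for p
   using that by (intro permutes_superset[OF that(1)]) (auto simp: less_Suc_eq)
  moreover have "p permutes {..<Suc n} \<and> p n = n" if "p permutes {..<n}" for p
   using that permutes_subset[OF that, of "{..<Suc n}"] permutes_not_in[OF that, of n] by auto
  ultimately show ?thesis by blast
 qed
 have coeffP: "coeff P n = V n"
 proof -
  have "coeff P n = (\<Sum>p | p permutes {..<Suc n}. if p n = n then of_int (sign p) * (\<Prod>i<n. z i ^ p i) else 0)"
   unfolding P_def by (simp add: coeff_sum)
  also have "... = (\<Sum>p | p permutes {..<Suc n} \<and> p n = n. of_int (sign p) * (\<Prod>i<n. z i ^ p i))"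
   using fin[of "Suc n"] by (simp add: sum.If_cases Int_def)
  finally show ?thesis by (simp add: perm_eq V_def)
 qed
 have root: "poly P (z k) = 0" if k: "k < n" for k
  unfolding polyP using k by (intro sum_sign_permutations_eq_0[of k _ n]) auto
 have IH: "V n = (\<Prod>k\<in>{..<n}. \<Prod>j\<in>{..<k}. z k - z j)" using Suc by (simp add: V_def)
 have "poly P (z n) = V n * (\<Prod>j<n. z n - z j)"
 \<comment> \<open>If two earlier nodes coincide, the roots no longer determine \<open>P\<close>; in
   that case \<open>V n\<close> and the value of \<open>P\<close> are both shown to vanish.\<close>
 proof (cases "inj_on z {..<n}")
  case True
  define Q where "Q = smult (V n) (\<Prod>j<n. [:- z j, 1:])"
  have degm: "degree (\<Prod>j<n. [:- z j, 1:]) = n" by (subst degree_prod_eq_sum_degree) auto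
  have lcm: "coeff (\<Prod>j<n. [:- z j, 1:]) n = 1"
   using lead_coeff_prod[of "\<lambda>j. [:- z j, 1:]" "{..<n}"] degm by simp
  have "P - Q = 0"
  \<comment> \<open>For \<open>n = 0\<close> the degree of the difference cannot drop below
    \<open>n\<close>, so two constants are compared directly.\<close>
  proof (cases "n = 0")
   case True
   then have "degree P = 0" "degree Q = 0" using degP degm by (auto simp: Q_def)
   then obtain c d where "P = [:c:]" "Q = [:d:]" by (metis degree_eq_zeroE)
   moreover have "coeff P 0 = coeff Q 0" using True coeffP lcm by (simp add: Q_def)
   ultimately show ?thesis by simp
  next
   case False
   have "degree (P - Q) < n"
   proof -
    have "degree Q \<le> n" unfolding Q_def using degm by (metis degree_smult_le)
    then have "degree (P - Q) \<le> n" using degP by (meson degree_diff_le)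
    moreover have "coeff (P - Q) n = 0" using coeffP lcm by (simp add: Q_def)
    ultimately show ?thesis using False
     by (metis degree_0 leading_coeff_0_iff nat_less_le neq0_conv)
   qed
   moreover have "card (z ` {..<n}) = n" using True by (simp add: card_image)
   moreover have "poly (P - Q) x = poly 0 x" if "x \<in> z ` {..<n}" for x
    using that root by (auto simp: Q_def poly_prod)
   ultimately show ?thesis
    using False by (intro poly_eqI_degree[of "z ` {..<n}"]) auto
  qed
  then have "poly P (z n) = poly Q (z n)" by simp
  then show ?thesis by (simp add: Q_def poly_prod)
 next
  case False
  then obtain i j where ij: "i < n" "j < n" "i < j" "z i = z j"
   unfolding inj_on_def by (metis lessThan_iff linorder_neqE_nat)
  have "(\<Prod>i\<in>{..<j}. z j - z i) = 0"
  proof (rule prod_zero[OF finite_lessThan])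
   show "\<exists>a\<in>{..<j}. z j - z a = 0" using ij by (intro bexI[of _ i]) auto
  qed
  then have "V n = 0"
   unfolding IH using ij by (intro prod_zero[OF finite_lessThan]) blast
  moreover have "poly P (z n) = 0"
   unfolding polyP using ij by (intro sum_sign_permutations_eq_0[of i _ j]) auto
  ultimately show ?thesis by simp
 qed
 moreover have "poly P (z n) = V (Suc n)"
  unfolding polyP V_def by simp
 ultimately show ?case unfolding V_def[symmetric] using IH by (simp add: V_def)
qed

section \<open>Rotation invariance of planar Lebesgue measure and orthogonality of monomials\<close>

text \<open>The bridge over which invariance under orthogonal maps is carried from
  \<open>real^2\<close> to \<open>complex\<close>.\<close>

definition plane_complex :: "real^2 \<Rightarrow> complex" where
 "plane_complex v = Complex (v $ 1) (v $ 2)"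

lemma plane_complex_measurable [measurable]: "plane_complex \<in> borel_measurable borel"
proof -
 have "plane_complex = (\<lambda>v. complex_of_real (v $ 1) + \<i> * complex_of_real (v $ 2))"
  by (simp add: plane_complex_def fun_eq_iff complex_eq_iff)
 moreover have "(\<lambda>v::real^2. complex_of_real (v $ 1) + \<i> * complex_of_real (v $ 2)) \<in> borel_measurable borel"
  by (intro borel_measurable_continuous_onI continuous_intros)
 ultimately show ?thesis by simp
qed

lemma norm_plane_complex: "cmod (plane_complex v) = norm v"
 by (simp add: plane_complex_def norm_vec_def L2_set_def sum_2 cmod_def)

lemma vimage_plane_complex_box:
 "plane_complex -` box l u = box (vector [Re l, Im l]) (vector [Re u, Im u])"
 by (auto simp: plane_complex_def in_box_complex_iff mem_box_cart forall_2)

text \<open>Lebesgue measure is determined by its values on boxes, and preimages of boxes are boxes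
  with the same side lengths.\<close>

lemma lborel_complex_plane: "(lborel :: complex measure) = distr lborel borel plane_complex"
proof (rule lborel_eqI)
 fix l u :: complex assume le: "\<And>b. b \<in> Basis \<Longrightarrow> l \<bullet> b \<le> u \<bullet> b"
 then have lu: "Re l \<le> Re u" "Im l \<le> Im u"
  using le[of 1] le[of "\<i>"] by (auto simp: Basis_complex_def inner_complex_def)
 have "emeasure (distr lborel borel plane_complex) (box l u) = emeasure lborel (plane_complex -` box l u)"
  by (subst emeasure_distr) auto
 also have "... = ennreal ((Re u - Re l) * (Im u - Im l))"
  unfolding vimage_plane_complex_box using lu
  by (subst emeasure_lborel_box)
   (auto simp: Basis_vec_def inner_axis' forall_2 UNIV_2 cart_eq_inner_axis[symmetric] axis_eq_axis
    intro!: prod.reindex_cong)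
 finally show "emeasure (distr lborel borel plane_complex) (box l u) = (\<Prod>b\<in>Basis. (u - l) \<bullet> b)"
  by (simp add: Basis_complex_def inner_complex_def)
qed simp

text \<open>Again it suffices to look at boxes. The preimage of a set under multiplication by
  \<open>c\<close> is its image under multiplication by \<open>cnj c\<close>, and the latter is an
  orthogonal transformation of \<open>real^2\<close>.\<close>

lemma lborel_rotate:
 assumes c: "cmod c = 1"
 shows "distr lborel borel (times c) = (lborel :: complex measure)"
proof (rule sym, rule lborel_eqI)
 fix l u :: complex assume le: "\<And>b. b \<in> Basis \<Longrightarrow> l \<bullet> b \<le> u \<bullet> b"
 define T where "T = plane_complex"
 define S where "S = (\<lambda>z. (vector [Re z, Im z] :: real^2))"
 define g where "g = (\<lambda>v. S (cnj c * T v))"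
 define f where "f = (\<lambda>v. S (c * T v))"
 have cc: "c * cnj c = 1" using c by (metis complex_norm_square of_real_1 power_one)
 have TS: "T (S z) = z" for z by (simp add: T_def S_def plane_complex_def)
 have ST: "S (T v) = v" for v by (simp add: T_def S_def plane_complex_def vec_eq_iff forall_2)
 have nS: "norm (S z) = cmod z" for z by (metis TS norm_plane_complex T_def)
 have lin: "linear g"
  by (rule linearI) (auto simp: g_def S_def T_def plane_complex_def vec_eq_iff forall_2 algebra_simps)
 have orth: "orthogonal_transformation g"
  unfolding orthogonal_transformation
  using lin c by (auto simp: g_def nS norm_mult T_def norm_plane_complex)
 define A where "A = T -` box l u"
 have A: "A \<in> sets borel" "A \<in> lmeasurable"
  unfolding A_def T_def vimage_plane_complex_box by auto
 have eq: "T -` (times c -` box l u) = g ` A"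
 proof (intro subset_antisym subsetI)
  fix v assume "v \<in> T -` (times c -` box l u)"
  then have "f v \<in> A" by (simp add: A_def f_def TS)
  moreover have "g (f v) = v"
   using cc by (simp add: g_def f_def TS mult.assoc[symmetric] mult.commute ST)
  ultimately show "v \<in> g ` A" by (metis imageI)
 next
  fix v assume "v \<in> g ` A"
  then show "v \<in> T -` (times c -` box l u)"
   using cc by (auto simp: A_def g_def TS mult.assoc[symmetric])
 qed
 have borel: "g ` A \<in> sets borel"
  unfolding eq[symmetric] T_def
  by (intro measurable_sets_borel[OF plane_complex_measurable] measurable_sets_borel[of "times c" borel]) auto
 have "emeasure (distr lborel borel (times c)) (box l u) = emeasure lborel (times c -` box l u)"
  by (subst emeasure_distr) auto
 also have "... = emeasure (distr lborel borel plane_complex) (times c -` box l u)"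
  by (subst lborel_complex_plane) simp
 also have "... = emeasure lborel (g ` A)"
  unfolding eq[symmetric] T_def
  by (subst emeasure_distr) (auto intro!: measurable_sets_borel[of "times c" borel])
 also have "... = emeasure lebesgue (g ` A)"
  using borel by simp
 also have "... = ennreal (measure lebesgue (g ` A))"
  using measurable_orthogonal_image[OF orth A(2)] by (simp add: emeasure_eq_measure2)
 also have "... = ennreal (measure lebesgue A)"
  using measure_orthogonal_image[OF orth A(2)] by simp
 also have "... = emeasure lebesgue A"
  by (rule emeasure_eq_measure2[OF A(2), symmetric])
 also have "... = emeasure lborel A"
  using A(1) by simp
 also have "... = emeasure (distr lborel borel plane_complex) (box l u)"
  by (subst emeasure_distr) (auto simp: A_def T_def)
 also have "... = emeasure lborel (box l u)"
  by (simp add: lborel_complex_plane[symmetric])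
 also have "... = (\<Prod>b\<in>Basis. (u - l) \<bullet> b)"
  using le by (subst emeasure_lborel_box) auto
 finally show "emeasure (distr lborel borel (times c)) (box l u) = (\<Prod>b\<in>Basis. (u - l) \<bullet> b)" .
qed simp

text \<open>The rotation by the angle \<open>pi / (p - q)\<close> multiplies the monomial by
  \<open>-1\<close>, leaves \<open>w\<close> alone and preserves the measure, so the integral equals
  its own negative.\<close>

lemma integral_monomial_radial_eq_0:
 fixes w :: "complex \<Rightarrow> complex"
 assumes meas: "w \<in> borel_measurable borel"
  and radial: "\<And>c z. cmod c = 1 \<Longrightarrow> w (c * z) = w z"
  and "p \<noteq> q"
 shows "(LINT z|lborel. z ^ p * cnj z ^ q * w z) = 0"
proof -
 define f where "f = (\<lambda>z. z ^ p * cnj z ^ q * w z)"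
 have f: "f \<in> borel_measurable borel" unfolding f_def using meas
  by (intro borel_measurable_times borel_measurable_continuous_onI[of "\<lambda>z. z ^ p"]
    borel_measurable_continuous_onI[of "\<lambda>z. cnj z ^ q"] continuous_intros) auto
 define d where "d = int p - int q"
 define c where "c = cis (pi / d)"
 have d0: "real_of_int d \<noteq> 0" using assms(3) by (simp add: d_def)
 have c1: "cmod c = 1" by (simp add: c_def)
 have "c ^ p * cnj c ^ q = cis (real p * (pi / d)) * cis (real q * (- (pi / d)))"
  by (simp add: c_def cis_cnj Complex.DeMoivre)
 also have "... = cis ((real p - real q) * (pi / d))"
  by (simp add: cis_mult algebra_simps)
 also have "... = -1" using d0 by (simp add: d_def)
 finally have cpq: "c ^ p * cnj c ^ q = -1" .
 have fc: "f (c * z) = - f z" for z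
 proof -
  have "f (c * z) = (c ^ p * cnj c ^ q) * f z"
   using radial[OF c1] by (simp add: f_def power_mult_distrib)
  then show ?thesis by (simp add: cpq)
 qed
 have "integral\<^sup>L lborel f = integral\<^sup>L (distr lborel borel (times c)) f"
  by (simp add: lborel_rotate[OF c1])
 also have "... = (LINT z|lborel. f (c * z))"
  using f by (intro integral_distr) auto
 also have "... = - integral\<^sup>L lborel f"
  by (simp add: fc)
 finally have "integral\<^sup>L lborel f = 0" by simp
 then show ?thesis by (simp add: f_def)
qed

lemma prod_cmod_diff_power2:
 "complex_of_real (\<Prod>k\<in>{..<n}. \<Prod>j\<in>{..<k}. (cmod (z k - z j))\<^sup>2) =
  (\<Sum>p | p permutes {..<n}. \<Sum>q | q permutes {..<n}. of_int (sign p * sign q) *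
   (\<Prod>i<n. z i ^ p i * cnj (z i) ^ q i))"
proof -
 have "complex_of_real (\<Prod>k\<in>{..<n}. \<Prod>j\<in>{..<k}. (cmod (z k - z j))\<^sup>2) =
  (\<Prod>k\<in>{..<n}. \<Prod>j\<in>{..<k}. (z k - z j)) * cnj (\<Prod>k\<in>{..<n}. \<Prod>j\<in>{..<k}. (z k - z j))"
  by (simp only: cnj_prod of_real_prod complex_norm_square prod.distrib)
 also have "... = (\<Sum>p | p permutes {..<n}. \<Sum>q | q permutes {..<n}. of_int (sign p * sign q) *
   (\<Prod>i<n. z i ^ p i * cnj (z i) ^ q i))"
  unfolding vandermonde_permutations
  by (simp add: sum_product prod.distrib mult_ac)
 finally show ?thesis .
qed

text \<open>After expansion over pairs of permutations the integral splits into products of the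
  moments \<open>c (p i) (q i)\<close>. Orthogonality leaves only the pairs with
  \<open>p = q\<close>, and each of these \<open>n!\<close> pairs contributes the same product. The
  weight is allowed to be complex so that the factors coming from the counting functions can be
  absorbed into it.\<close>

lemma integral_vandermonde_radial:
 fixes w :: "complex \<Rightarrow> complex"
 assumes meas: "w \<in> borel_measurable borel"
  and radial: "\<And>c z. cmod c = 1 \<Longrightarrow> w (c * z) = w z"
  and int: "\<And>k. integrable lborel (\<lambda>z. of_real (cmod z ^ k) * w z)"
 shows "(LINT z|PiM {..<n} (\<lambda>_. lborel).
     complex_of_real (\<Prod>k\<in>{..<n}. \<Prod>j\<in>{..<k}. (cmod (z k - z j))\<^sup>2) * (\<Prod>j\<in>{..<n}. w (z j)))
    = fact n * (\<Prod>j<n. LINT z|lborel. of_real (cmod z ^ (2 * j)) * w z)"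
proof -
 interpret product_sigma_finite "\<lambda>_::nat. lborel :: complex measure" ..
 define f where "f = (\<lambda>p q z. z ^ p * cnj z ^ q * w z)"
 have int_f: "integrable lborel (f p q)" for p q
 proof (rule Bochner_Integration.integrable_bound[OF int[of "p + q"]])
  have "f p q \<in> borel_measurable borel" unfolding f_def using meas
   by (intro borel_measurable_times borel_measurable_continuous_onI[of "\<lambda>z. z ^ p"]
     borel_measurable_continuous_onI[of "\<lambda>z. cnj z ^ q"] continuous_intros) auto
  then show "f p q \<in> borel_measurable lborel" by simp
 qed (auto simp: f_def norm_mult norm_power power_add)
 define c where "c = (\<lambda>p q. integral\<^sup>L lborel (f p q))"
 have c0: "c p q = 0" if "p \<noteq> q" for p q
  using integral_monomial_radial_eq_0[OF meas radial that] by (simp add: c_def f_def)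
 have cd: "c p p = (LINT z|lborel. of_real (cmod z ^ (2 * p)) * w z)" for p
  unfolding c_def f_def
  by (simp add: power_mult_distrib[symmetric] complex_norm_square[symmetric] power_mult del: of_real_power)
   (simp add: complex_norm_square)
 define Q where "Q = {p. p permutes {..<n}}"
 have finQ: "finite Q" unfolding Q_def by (rule finite_permutations) simp
 have "(LINT z|PiM {..<n} (\<lambda>_. lborel).
     complex_of_real (\<Prod>k\<in>{..<n}. \<Prod>j\<in>{..<k}. (cmod (z k - z j))\<^sup>2) * (\<Prod>j\<in>{..<n}. w (z j)))
   = (LINT z|PiM {..<n} (\<lambda>_. lborel).
      (\<Sum>p\<in>Q. \<Sum>q\<in>Q. of_int (sign p * sign q) * (\<Prod>i<n. f (p i) (q i) (z i))))"
  unfolding prod_cmod_diff_power2 Q_def f_def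
  by (simp add: sum_distrib_right prod.distrib mult.assoc)
 also have "... = (\<Sum>p\<in>Q. \<Sum>q\<in>Q. of_int (sign p * sign q) *
      (LINT z|PiM {..<n} (\<lambda>_. lborel). (\<Prod>i<n. f (p i) (q i) (z i))))"
  by (subst Bochner_Integration.integral_sum | intro Bochner_Integration.integrable_sum
    integrable_mult_right product_integrable_prod int_f finite_lessThan
   | subst integral_mult_right_zero | rule sum.cong refl)+
 also have "... = (\<Sum>p\<in>Q. \<Sum>q\<in>Q. of_int (sign p * sign q) * (\<Prod>i<n. c (p i) (q i)))"
  unfolding c_def
  by (intro sum.cong refl arg_cong2[where f = times] product_integral_prod int_f finite_lessThan)
 also have "... = (\<Sum>p\<in>Q. \<Sum>q\<in>Q. if q = p then (\<Prod>i<n. c i i) else 0)"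
 proof (intro sum.cong refl)
  fix p q assume pq: "p \<in> Q" "q \<in> Q"
  show "of_int (sign p * sign q) * (\<Prod>i<n. c (p i) (q i)) = (if q = p then (\<Prod>i<n. c i i) else 0)"
  proof (cases "q = p")
   case True
   have "sign p * sign p = 1" by (simp add: sign_def)
   moreover have "(\<Prod>i<n. c (p i) (p i)) = (\<Prod>i<n. c i i)"
    using prod.permute[of p "{..<n}" "\<lambda>i. c i i"] pq by (simp add: Q_def o_def)
   ultimately show ?thesis using True by simp
  next
   case False
   then obtain i where i: "p i \<noteq> q i" by (metis ext)
   with pq have "i \<in> {..<n}" unfolding Q_def using permutes_not_in by (metis mem_Collect_eq)
   with i have "(\<Prod>i<n. c (p i) (q i)) = 0" by (intro prod_zero) (auto intro!: bexI[of _ i] c0)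
   then show ?thesis using False by simp
  qed
 qed
 also have "... = of_nat (card Q) * (\<Prod>i<n. c i i)"
  using finQ by simp
 also have "card Q = fact n" unfolding Q_def by (subst card_permutations[of _ n]) auto
 finally show ?thesis by (simp add: cd)
qed

section \<open>The radial coordinate and the one-dimensional weights\<close>

text \<open>Together with the convention \<open>0 powr c = 0\<close>, the clipping by
  \<open>max 0\<close> extends the weight by zero beyond \<open>t = 1 / eps\<close>, the coordinate
  of the centre of the disc.\<close>

definition wall_density :: "real \<Rightarrow> real \<Rightarrow> real \<Rightarrow> real" where
 "wall_density eps a t = max 0 (1 - eps * t) powr (a - 1) * exp (2 * t / eps)"

definition wall_coord :: "real \<Rightarrow> real \<Rightarrow> real \<Rightarrow> complex \<Rightarrow> real" where
 "wall_coord b \<rho> eps z = (1 - (cmod z / \<rho>) powr (2 * b)) / eps"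

lemma wall_density_nonneg: "0 \<le> wall_density eps a t"
 by (simp add: wall_density_def)

lemma wall_density_measurable [measurable]: "wall_density eps a \<in> borel_measurable borel"
 unfolding wall_density_def by measurable

lemma wall_density_pos: "0 < eps \<Longrightarrow> t < 1 / eps \<Longrightarrow> 0 < wall_density eps a t"
 by (simp add: wall_density_def max_def field_simps)

lemma wall_density_eq_0: "0 < eps \<Longrightarrow> 1 / eps \<le> t \<Longrightarrow> wall_density eps a t = 0"
 by (simp add: wall_density_def max_def field_simps)

lemma powr_wall_has_integral:
 fixes eps c s :: real
 assumes "0 < eps" "0 < c" "s \<le> 1 / eps"
 shows "((\<lambda>t. max 0 (1 - eps * t) powr (c - 1)) has_integral (1 - eps * s) powr c / (eps * c)) {s..1/eps}"
proof -
 have "((\<lambda>t. max 0 (1 - eps * t) powr (c - 1)) has_integral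
  (- ((1 - eps * (1/eps)) powr c / (eps * c)) - (- ((1 - eps * s) powr c / (eps * c))))) {s..1/eps}"
 \<comment> \<open>For \<open>c < 1\<close> the integrand is unbounded near \<open>1 / eps\<close>,
   so the derivative is only available in the open interval.\<close>
 proof (rule fundamental_theorem_of_calculus_interior)
  show "continuous_on {s..1/eps} (\<lambda>t. - ((1 - eps * t) powr c / (eps * c)))"
   using assms by (intro continuous_intros continuous_on_powr') (auto simp: field_simps)
 next
  fix t assume t: "t \<in> {s<..<1/eps}"
  then have "0 < 1 - eps * t" using assms by (simp add: field_simps)
  then show "((\<lambda>t. - ((1 - eps * t) powr c / (eps * c))) has_vector_derivative
    max 0 (1 - eps * t) powr (c - 1)) (at t)"
   using assms unfolding has_real_derivative_iff_has_vector_derivative[symmetric]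
   by (auto intro!: derivative_eq_intros simp: powr_diff field_simps)
 qed (use assms in auto)
 then show ?thesis using assms by simp
qed

lemma nn_integral_powr_wall:
 fixes eps c s :: real
 assumes "0 < eps" "0 < c" "s \<le> 1 / eps"
 shows "(\<integral>\<^sup>+t. ennreal (indicator {s<..} t * max 0 (1 - eps * t) powr (c - 1)) \<partial>lborel)
  = ennreal ((1 - eps * s) powr c / (eps * c))"
proof -
 have "(\<integral>\<^sup>+t. ennreal (indicator {s<..} t * max 0 (1 - eps * t) powr (c - 1)) \<partial>lborel)
  = (\<integral>\<^sup>+t. ennreal (indicator {s..1/eps} t * max 0 (1 - eps * t) powr (c - 1)) \<partial>lborel)"
 proof (rule nn_integral_cong_AE)
  have "AE t in lborel. t \<noteq> s" by (rule AE_lborel_singleton)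
  then show "AE t in lborel. ennreal (indicator {s<..} t * max 0 (1 - eps * t) powr (c - 1)) =
    ennreal (indicator {s..1/eps} t * max 0 (1 - eps * t) powr (c - 1))"
  proof eventually_elim
   case (elim t)
   have "max 0 (1 - eps * t) = 0" if "\<not> t \<le> 1 / eps"
    using that assms by (simp add: max_def field_simps)
   with elim show ?case
    by (auto simp: indicator_def)
  qed
 qed
 also have "... = ennreal ((1 - eps * s) powr c / (eps * c))"
  by (rule nn_integral_has_integral_lebesgue[OF _ powr_wall_has_integral]) (use assms in auto)
 finally show ?thesis .
qed

lemma set_integrable_powr_wall:
 fixes eps c s :: real
 assumes "0 < eps" "0 < c"
 shows "set_integrable lborel {s..} (\<lambda>t. max 0 (1 - eps * t) powr (c - 1))"
proof -
 \<comment> \<open>The start must lie strictly left of \<open>s\<close>, to contain the closed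
   half-line, and not beyond \<open>1 / eps\<close>, where \<open>nn_integral_powr_wall\<close>
   applies.\<close>
 define r where "r = min (s - 1) (1 / eps)"
 have r: "r \<le> 1 / eps" by (simp add: r_def)
 have "set_integrable lborel {r<..} (\<lambda>t. max 0 (1 - eps * t) powr (c - 1))"
  unfolding set_integrable_def
 proof (rule integrableI_nonneg)
  show "(\<integral>\<^sup>+ x. ennreal (indicator {r<..} x *\<^sub>R max 0 (1 - eps * x) powr (c - 1)) \<partial>lborel) < \<infinity>"
   using nn_integral_powr_wall[OF assms r] by simp
 qed auto
 then show ?thesis
  by (rule set_integrable_subset) (auto simp: r_def)
qed

lemma set_integrable_wall_density:
 assumes "0 < eps" "0 < a"
 shows "set_integrable lborel {s..} (wall_density eps a)"
proof -
 have "set_integrable lborel {s..} (\<lambda>t. max 0 (1 - eps * t) powr (a - 1) * exp (2 / eps\<^sup>2))"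
  using set_integrable_powr_wall[OF assms] by simp
 then show ?thesis
 proof (rule set_integrable_bound)
  show "set_borel_measurable lborel {s..} (wall_density eps a)"
   unfolding set_borel_measurable_def by measurable
  show "AE x in lborel. x \<in> {s..} \<longrightarrow>
   norm (wall_density eps a x) \<le> norm (max 0 (1 - eps * x) powr (a - 1) * exp (2 / eps\<^sup>2))"
  proof (intro AE_I2 impI)
   fix t :: real
   show "norm (wall_density eps a t) \<le> norm (max 0 (1 - eps * t) powr (a - 1) * exp (2 / eps\<^sup>2))"
   proof (cases "t < 1 / eps")
    case True
    then have "2 * t / eps \<le> 2 / eps\<^sup>2" using assms by (simp add: field_simps power2_eq_square)
    then show ?thesis by (auto simp: wall_density_def intro!: mult_left_mono)
   qed (use assms in \<open>simp add: wall_density_eq_0\<close>)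
  qed
 qed
qed

lemma wall_coord_measurable [measurable]: "wall_coord b \<rho> eps \<in> borel_measurable borel"
 unfolding wall_coord_def by measurable

lemma powr_less_iff2:
 fixes x y c :: real
 assumes "0 \<le> x" "0 \<le> y" "0 < c"
 shows "x powr c < y powr c \<longleftrightarrow> x < y"
 using assms powr_less_mono2[of c x y] powr_mono2[of c y x] by linarith

lemma less_wall_coord_iff:
 assumes "0 < b" "0 < \<rho>" "0 < eps" "s \<le> 1 / eps"
 shows "s < wall_coord b \<rho> eps z \<longleftrightarrow> cmod z < \<rho> * (1 - eps * s) powr (1 / (2 * b))"
proof -
 have 0: "0 \<le> 1 - eps * s" using assms by (simp add: field_simps)
 have "s < wall_coord b \<rho> eps z \<longleftrightarrow> (cmod z / \<rho>) powr (2 * b) < 1 - eps * s"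
  using assms by (simp add: wall_coord_def field_simps)
 also have "... \<longleftrightarrow> (cmod z / \<rho>) powr (2 * b) < ((1 - eps * s) powr (1 / (2 * b))) powr (2 * b)"
  using assms 0 by (simp add: powr_powr)
 also have "... \<longleftrightarrow> cmod z / \<rho> < (1 - eps * s) powr (1 / (2 * b))"
  by (rule powr_less_iff2) (use assms in auto)
 finally show ?thesis using assms by (simp add: field_simps)
qed

text \<open>Two measures that are finite on the rays \<open>{s<..}\<close> and agree there are
  equal. The preimage of such a ray is a disc, or empty beyond \<open>1 / eps\<close>, and the area
  of a disc is explicit.\<close>

lemma distr_wall_coord:
 assumes "0 < b" "0 < \<rho>" "0 < eps"
 shows "distr lborel borel (wall_coord b \<rho> eps) =
  density lborel (\<lambda>t. ennreal (pi * \<rho>\<^sup>2 * eps / b * max 0 (1 - eps * t) powr (1 / b - 1)))"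
proof (rule measure_eqI_lessThan)
 have eq: "emeasure (distr lborel borel (wall_coord b \<rho> eps)) {s<..} =
   (if s \<le> 1 / eps then ennreal (pi * \<rho>\<^sup>2 * (1 - eps * s) powr (1 / b)) else 0)" for s
 proof (cases "s \<le> 1 / eps")
  case True
  have "(wall_coord b \<rho> eps) -` {s<..} = ball 0 (\<rho> * (1 - eps * s) powr (1 / (2 * b)))"
   using less_wall_coord_iff[OF assms True] by auto
  then have "emeasure (distr lborel borel (wall_coord b \<rho> eps)) {s<..} =
   emeasure lborel (ball (0::complex) (\<rho> * (1 - eps * s) powr (1 / (2 * b))))"
   by (subst emeasure_distr) auto
  also have "... = ennreal (pi * (\<rho> * (1 - eps * s) powr (1 / (2 * b)))\<^sup>2)"
   using assms by (subst emeasure_ball) (auto simp: unit_ball_vol_2)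
  also have "(\<rho> * (1 - eps * s) powr (1 / (2 * b)))\<^sup>2 = \<rho>\<^sup>2 * (1 - eps * s) powr (1 / b)"
   by (simp add: power_mult_distrib power2_eq_square powr_add[symmetric])
  finally show ?thesis using True by (simp add: mult.assoc)
 next
  case False
  have "\<not> s < wall_coord b \<rho> eps z" for z
  proof -
   have "wall_coord b \<rho> eps z \<le> 1 / eps"
    using assms by (simp add: wall_coord_def divide_right_mono)
   then show ?thesis using False by linarith
  qed
  then have "(wall_coord b \<rho> eps) -` {s<..} = {}" by auto
  then show ?thesis using False by (subst emeasure_distr) auto
 qed
 show "emeasure (distr lborel borel (wall_coord b \<rho> eps)) {s<..} < \<infinity>" for s
  unfolding eq by simp
 show "emeasure (distr lborel borel (wall_coord b \<rho> eps)) {s<..} =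
   emeasure (density lborel (\<lambda>t. ennreal (pi * \<rho>\<^sup>2 * eps / b * max 0 (1 - eps * t) powr (1 / b - 1)))) {s<..}" for s
 proof -
  have "emeasure (density lborel (\<lambda>t. ennreal (pi * \<rho>\<^sup>2 * eps / b * max 0 (1 - eps * t) powr (1 / b - 1)))) {s<..}
   = (\<integral>\<^sup>+t. ennreal (pi * \<rho>\<^sup>2 * eps / b) * ennreal (indicator {s<..} t * max 0 (1 - eps * t) powr (1 / b - 1)) \<partial>lborel)"
   using assms
   by (subst emeasure_density) (auto intro!: nn_integral_cong simp: indicator_def ennreal_mult[symmetric] mult_ac)
  also have "... = ennreal (pi * \<rho>\<^sup>2 * eps / b) * (\<integral>\<^sup>+t. ennreal (indicator {s<..} t * max 0 (1 - eps * t) powr (1 / b - 1)) \<partial>lborel)"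
   by (rule nn_integral_cmult) auto
  finally have dens: "emeasure (density lborel (\<lambda>t. ennreal (pi * \<rho>\<^sup>2 * eps / b * max 0 (1 - eps * t) powr (1 / b - 1)))) {s<..}
   = ennreal (pi * \<rho>\<^sup>2 * eps / b) * (\<integral>\<^sup>+t. ennreal (indicator {s<..} t * max 0 (1 - eps * t) powr (1 / b - 1)) \<partial>lborel)" .
  show ?thesis
  proof (cases "s \<le> 1 / eps")
   case True
   then show ?thesis unfolding eq dens
    using assms nn_integral_powr_wall[OF assms(3) _ True, of "1 / b"]
    by (simp add: ennreal_mult'[symmetric])
  next
   case False
   have "(\<integral>\<^sup>+t. ennreal (indicator {s<..} t * max 0 (1 - eps * t) powr (1 / b - 1)) \<partial>lborel)
    = (\<integral>\<^sup>+(t::real). 0 \<partial>lborel)"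
   proof (intro nn_integral_cong)
    fix t
    have "max 0 (1 - eps * t) = 0" if "s < t"
    proof -
     have "1 / eps < t" using False that by simp
     then show ?thesis using assms by (simp add: max_def field_simps)
    qed
    then show "ennreal (indicator {s<..} t * max 0 (1 - eps * t) powr (1 / b - 1)) = 0"
     by (auto simp: indicator_def)
   qed
   then show ?thesis unfolding eq dens using False by simp
  qed
 qed
qed auto

text \<open>For \<open>s <= 1 / eps\<close>, the substitution
  \<open>x = 2 * (1 - eps * t) / eps^2\<close> shows that this is, up to a factor independent of
  \<open>s\<close>, the lower incomplete gamma function with parameter \<open>a\<close> at
  \<open>2 * (1 - eps * s) / eps^2\<close>.\<close>

definition wall_mass :: "real \<Rightarrow> real \<Rightarrow> real \<Rightarrow> real" where
 "wall_mass eps a s = (LBINT t:{s..}. wall_density eps a t)"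

abbreviation wall_ratio :: "real \<Rightarrow> real \<Rightarrow> real \<Rightarrow> real" where
 "wall_ratio eps a r \<equiv> wall_mass eps a r / wall_mass eps a 0"

lemma wQ_measurable [measurable]: "wQ b \<alpha> \<rho> n \<in> borel_measurable borel"
 unfolding wQ_def by measurable

text \<open>The exponent is \<open>a - 1 / b\<close> and not \<open>a - 1\<close>, because the
  missing \<open>1 / b - 1\<close> is the area density supplied by
  \<open>distr_wall_coord\<close>.\<close>

lemma wQ_wall_coord:
 fixes b \<alpha> \<rho> eps :: real and n p :: nat
 assumes "0 < b" "0 < \<rho>" "0 < eps" and X: "real n * \<rho> powr (2 * b) = 2 / eps\<^sup>2"
 defines "a \<equiv> (real p / 2 + \<alpha> + 1) / b"
 shows "cmod z ^ p * wQ b \<alpha> \<rho> n z = indicator {0..} (wall_coord b \<rho> eps z) *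
  (\<rho> powr (real p + 2 * \<alpha>) * exp (- (2 / eps\<^sup>2)) *
  (max 0 (1 - eps * wall_coord b \<rho> eps z) powr (a - 1 / b) * exp (2 * wall_coord b \<rho> eps z / eps)))"
proof -
 define M where "M = (cmod z / \<rho>) powr (2 * b)"
 have mM: "max 0 (1 - eps * wall_coord b \<rho> eps z) = M"
  using assms by (simp add: wall_coord_def M_def)
 have iM: "0 \<le> wall_coord b \<rho> eps z \<longleftrightarrow> cmod z \<le> \<rho>"
 proof -
  have "0 \<le> wall_coord b \<rho> eps z \<longleftrightarrow> M \<le> 1 powr (2 * b)"
   using assms by (simp add: wall_coord_def M_def field_simps)
  also have "... \<longleftrightarrow> cmod z / \<rho> \<le> 1"
  proof -
   have "0 \<le> cmod z / \<rho>" using assms by simp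
   then show ?thesis
    unfolding M_def using powr_less_iff2[of 1 "cmod z / \<rho>" "2 * b"] assms
    by (simp add: not_less[symmetric] del: powr_one_eq_one)
  qed
  finally show ?thesis using assms by simp
 qed
 show ?thesis
 \<comment> \<open>At the origin both sides vanish by \<open>0 powr c = 0\<close>, whatever the sign
   of the exponent.\<close>
 proof (cases "z = 0")
  case True
  then have "M = 0" by (simp add: M_def)
  then show ?thesis unfolding mM using True by (simp add: wQ_def)
 next
  case False
  then have z: "cmod z > 0" by simp
  have zb: "cmod z powr (2 * b) = \<rho> powr (2 * b) * M"
   using assms by (simp add: M_def powr_divide)
  have e: "exp (- real n * cmod z powr (2 * b)) = exp (- (2 / eps\<^sup>2)) * exp (2 * wall_coord b \<rho> eps z / eps)"
  proof -
   have "- real n * cmod z powr (2 * b) = - (2 / eps\<^sup>2) * M"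
    unfolding zb X[symmetric] by simp
   moreover have "2 * wall_coord b \<rho> eps z / eps = 2 / eps\<^sup>2 * (1 - M)"
    by (simp add: wall_coord_def M_def power2_eq_square)
   ultimately show ?thesis by (simp add: exp_add[symmetric] algebra_simps diff_divide_distrib)
  qed
  have "cmod z ^ p * cmod z powr (2 * \<alpha>) = cmod z powr (real p + 2 * \<alpha>)"
   using z by (simp add: powr_add powr_realpow)
  also have "... = \<rho> powr (real p + 2 * \<alpha>) * (cmod z / \<rho>) powr (real p + 2 * \<alpha>)"
   using assms z by (simp add: powr_divide)
  also have "(cmod z / \<rho>) powr (real p + 2 * \<alpha>) = M powr (a - 1 / b)"
  proof -
   have "a - 1 / b = (real p / 2 + \<alpha>) / b"
    unfolding a_def by (simp add: diff_divide_distrib[symmetric])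
   then have "2 * b * (a - 1 / b) = real p + 2 * \<alpha>" using assms(1) by simp
   then show ?thesis unfolding M_def powr_powr by simp
  qed
  finally have p: "cmod z ^ p * cmod z powr (2 * \<alpha>) = \<rho> powr (real p + 2 * \<alpha>) * M powr (a - 1 / b)" .
  show ?thesis
  proof (cases "cmod z \<le> \<rho>")
   case True
   have "cmod z ^ p * wQ b \<alpha> \<rho> n z =
    exp (- real n * cmod z powr (2 * b)) * (cmod z ^ p * cmod z powr (2 * \<alpha>))"
    using True by (simp add: wQ_def)
   then show ?thesis unfolding e p mM using True iM by (simp add: indicator_def)
  next
   case False
   then show ?thesis using iM by (simp add: indicator_def wQ_def)
  qed
 qed
qed

text \<open>Planar integrals are pushed forward along \<open>wall_coord\<close>. The function
  \<open>\<psi>\<close> will be the constant \<open>1\<close> for the normalisation and the step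
  function of the counts for the numerator; the constant \<open>K\<close> does not depend on
  \<open>\<psi>\<close> and cancels in the quotient.\<close>

lemma
 fixes \<psi> :: "real \<Rightarrow> complex" and b \<alpha> \<rho> eps :: real and n p :: nat
 assumes pos: "0 < b" "0 < \<rho>" "0 < eps" "-1 < \<alpha>" and X: "real n * \<rho> powr (2 * b) = 2 / eps\<^sup>2"
  and \<psi> [measurable]: "\<psi> \<in> borel_measurable borel" and bound: "\<And>t. cmod (\<psi> t) \<le> B"
 defines "a \<equiv> (real p / 2 + \<alpha> + 1) / b"
 defines "K \<equiv> pi * \<rho>\<^sup>2 * eps / b * (\<rho> powr (real p + 2 * \<alpha>) * exp (- (2 / eps\<^sup>2)))"
 shows integrable_radial_weight:
   "integrable lborel (\<lambda>z. of_real (cmod z ^ p) * (of_real (wQ b \<alpha> \<rho> n z) * \<psi> (wall_coord b \<rho> eps z)))"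
  and integral_radial_weight:
   "(LINT z|lborel. of_real (cmod z ^ p) * (of_real (wQ b \<alpha> \<rho> n z) * \<psi> (wall_coord b \<rho> eps z)))
    = of_real K * (LBINT t:{0..}. of_real (wall_density eps a t) * \<psi> t)"
proof -
 define f where "f = (\<lambda>t. complex_of_real (indicator {0..} t *
  (\<rho> powr (real p + 2 * \<alpha>) * exp (- (2 / eps\<^sup>2)) *
  (max 0 (1 - eps * t) powr (a - 1 / b) * exp (2 * t / eps)))) * \<psi> t)"
 define d where "d = (\<lambda>t. pi * \<rho>\<^sup>2 * eps / b * max 0 (1 - eps * t) powr (1 / b - 1))"
 have [measurable]: "f \<in> borel_measurable borel" unfolding f_def by measurable
 have [measurable]: "d \<in> borel_measurable borel" unfolding d_def by measurable
 have d0: "0 \<le> d t" for t using pos by (simp add: d_def)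
 have F: "(\<lambda>z. of_real (cmod z ^ p) * (of_real (wQ b \<alpha> \<rho> n z) * \<psi> (wall_coord b \<rho> eps z))) = (\<lambda>z. f (wall_coord b \<rho> eps z))"
  unfolding f_def a_def
  by (subst wQ_wall_coord[OF pos(1-3) X, where \<alpha> = \<alpha> and p = p, symmetric]) (simp add: mult.assoc)
 have fd: "d t *\<^sub>R f t = of_real K * (indicator {0..} t *\<^sub>R (of_real (wall_density eps a t) * \<psi> t))" for t
 proof -
  have "max 0 (1 - eps * t) powr (1 / b - 1) * max 0 (1 - eps * t) powr (a - 1 / b) = max 0 (1 - eps * t) powr (a - 1)"
   by (subst powr_add[symmetric]) simp
  then have "d t * (indicator {0..} t * (\<rho> powr (real p + 2 * \<alpha>) * exp (- (2 / eps\<^sup>2)) *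
  (max 0 (1 - eps * t) powr (a - 1 / b) * exp (2 * t / eps)))) = K * (indicator {0..} t * wall_density eps a t)"
   by (simp add: d_def K_def wall_density_def mult_ac)
  then have "complex_of_real (d t * (indicator {0..} t * (\<rho> powr (real p + 2 * \<alpha>) * exp (- (2 / eps\<^sup>2)) *
  (max 0 (1 - eps * t) powr (a - 1 / b) * exp (2 * t / eps))))) * \<psi> t
   = complex_of_real (K * (indicator {0..} t * wall_density eps a t)) * \<psi> t" by (rule arg_cong)
  then show ?thesis
   by (simp add: f_def scaleR_conv_of_real mult.assoc)
 qed
 have a: "0 < a" using pos by (simp add: a_def)
 have "set_integrable lborel {0..} (\<lambda>t. of_real (wall_density eps a t) * \<psi> t)"
 proof (rule set_integrable_bound[of lborel _ "\<lambda>t. B * wall_density eps a t"])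
  show "set_integrable lborel {0..} (\<lambda>t. B * wall_density eps a t)"
   using set_integrable_wall_density[OF pos(3) a, of 0] by simp
  show "set_borel_measurable lborel {0..} (\<lambda>t. complex_of_real (wall_density eps a t) * \<psi> t)"
   unfolding set_borel_measurable_def by measurable
  show "AE t in lborel. t \<in> {0..} \<longrightarrow> norm (of_real (wall_density eps a t) * \<psi> t) \<le> norm (B * wall_density eps a t)"
  proof (intro AE_I2 impI)
   fix t
   have "norm (of_real (wall_density eps a t) * \<psi> t) = wall_density eps a t * cmod (\<psi> t)"
    by (simp add: norm_mult wall_density_nonneg)
   also have "... \<le> wall_density eps a t * B"
    using bound wall_density_nonneg by (intro mult_left_mono)
   finally show "norm (of_real (wall_density eps a t) * \<psi> t) \<le> norm (B * wall_density eps a t)"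
    by (simp add: mult.commute)
  qed
 qed
 then have "integrable lborel (\<lambda>t. d t *\<^sub>R f t)"
  unfolding fd set_integrable_def by (intro integrable_mult_right) auto
 then have "integrable (density lborel d) f"
  using d0 by (subst integrable_density) auto
 then show "integrable lborel (\<lambda>z. of_real (cmod z ^ p) * (of_real (wQ b \<alpha> \<rho> n z) * \<psi> (wall_coord b \<rho> eps z)))"
  unfolding F
  by (subst integrable_distr_eq[symmetric, where N = borel])
   (auto simp: distr_wall_coord[OF pos(1-3)] d_def)
 have "(LINT z|lborel. f (wall_coord b \<rho> eps z)) = integral\<^sup>L (distr lborel borel (wall_coord b \<rho> eps)) f"
  by (rule integral_distr[symmetric]) auto
 also have "... = integral\<^sup>L (density lborel d) f"
  by (simp add: distr_wall_coord[OF pos(1-3)] d_def)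
 also have "... = (LINT t|lborel. d t *\<^sub>R f t)"
  using d0 by (intro integral_density) auto
 also have "... = of_real K * (LBINT t:{0..}. of_real (wall_density eps a t) * \<psi> t)"
  unfolding fd set_lebesgue_integral_def by (rule integral_mult_right_zero)
 finally show "(LINT z|lborel. of_real (cmod z ^ p) * (of_real (wQ b \<alpha> \<rho> n z) * \<psi> (wall_coord b \<rho> eps z)))
    = of_real K * (LBINT t:{0..}. of_real (wall_density eps a t) * \<psi> t)"
  unfolding F .
qed

section \<open>The product formula for the moment generating function\<close>

text \<open>As the \<open>s l\<close> decrease, \<open>s l < t\<close> forces \<open>s j < t\<close>
  for all \<open>j >= l\<close>. Hence the partial product \<open>T l\<close> over
  \<open>{l..m}\<close> either equals the full tail exponential or agrees with
  \<open>T (Suc l)\<close>, and the differences \<open>T l - T (Suc l)\<close> telescope.\<close>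

lemma prod_step_eq_sum_omega:
 fixes u :: "nat \<Rightarrow> complex" and s :: "nat \<Rightarrow> real"
 assumes "\<And>i j. 1 \<le> i \<Longrightarrow> i < j \<Longrightarrow> j \<le> m \<Longrightarrow> s j < s i"
 shows "(\<Prod>j\<in>{1..m}. if s j < t then exp (u j) else 1)
  = 1 + (\<Sum>l\<in>{1..m}. omega m u l * of_real (indicator {s l<..} t))"
proof -
 define T where "T = (\<lambda>l. \<Prod>j\<in>{l..m}. if s j < t then exp (u j) else 1)"
 have "omega m u l * of_real (indicator {s l<..} t) = T l - T (Suc l)" if l: "l \<in> {1..m}" for l
 proof (cases "s l < t")
  case True
  have "s j < t" if "j \<in> {l..m}" for j
   using True assms[of l j] that l by (cases "j = l") auto
  then have "T l = (\<Prod>j\<in>{l..m}. exp (u j))" "T (Suc l) = (\<Prod>j\<in>{l+1..m}. exp (u j))"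
   unfolding T_def by (auto intro!: prod.cong)
  then show ?thesis using True by (simp add: omega_def exp_sum)
 next
  case False
  have "{l..m} = insert l {Suc l..m}" using l by auto
  then have "T l = T (Suc l)" using False unfolding T_def by simp
  then show ?thesis using False by simp
 qed
 then have "(\<Sum>l\<in>{1..m}. omega m u l * of_real (indicator {s l<..} t)) = (\<Sum>l\<in>{1..m}. T l - T (Suc l))"
  by (intro sum.cong) auto
 also have "... = T 1 - T (Suc m)"
  by (cases "m = 0") (use sum_natinterval_diff[of T 1 m] in simp_all)
 finally show ?thesis by (simp add: T_def)
qed

lemma wall_mass_pos:
 assumes "0 < eps" "0 < a" "s < 1 / eps"
 shows "0 < wall_mass eps a s"
proof -
 have int: "integrable lborel (\<lambda>t. indicator {s..} t *\<^sub>R wall_density eps a t)"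
  using set_integrable_wall_density[OF assms(1,2)] by (simp add: set_integrable_def)
 have "wall_mass eps a s \<noteq> 0"
 proof
  assume "wall_mass eps a s = 0"
  then have "AE t in lborel. indicator {s..} t *\<^sub>R wall_density eps a t = 0"
   using int by (simp add: wall_mass_def set_lebesgue_integral_def integral_nonneg_eq_0_iff_AE
    wall_density_nonneg)
  then have "AE t in lborel. t \<notin> {s<..<1/eps}"
  proof eventually_elim
   case (elim t)
   then show ?case using wall_density_pos[OF assms(1), of t a] by (auto simp: indicator_def)
  qed
  then have "emeasure lborel {s<..<1/eps} = 0"
   by (subst (asm) AE_iff_measurable[where N = "{s<..<1/eps}"]) auto
  then show False using assms by simp
 qed
 moreover have "0 \<le> wall_mass eps a s"
  unfolding wall_mass_def set_lebesgue_integral_def by (intro Bochner_Integration.integral_nonneg) (simp add: wall_density_nonneg)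
 ultimately show ?thesis by simp
qed

lemma LBINT_wall_density_step:
 fixes w :: "nat \<Rightarrow> complex" and s :: "nat \<Rightarrow> real"
 assumes "0 < eps" "0 < a" "\<And>l. l \<in> {1..m} \<Longrightarrow> 0 \<le> s l"
 shows "(LBINT t:{0..}. of_real (wall_density eps a t) * (1 + (\<Sum>l\<in>{1..m}. w l * of_real (indicator {s l<..} t))))
  = of_real (wall_mass eps a 0) + (\<Sum>l\<in>{1..m}. w l * of_real (wall_mass eps a (s l)))"
proof -
 have int: "integrable lborel (\<lambda>t. complex_of_real (indicator {r..} t *\<^sub>R wall_density eps a t))" for r
  using set_integrable_wall_density[OF assms(1,2)] unfolding set_integrable_def
  by (intro integrable_of_real)
 have mass: "(LINT t|lborel. complex_of_real (indicator {r..} t *\<^sub>R wall_density eps a t)) = of_real (wall_mass eps a r)" for r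
  by (subst integral_complex_of_real) (simp add: wall_mass_def set_lebesgue_integral_def)
 have "(LBINT t:{0..}. of_real (wall_density eps a t) * (1 + (\<Sum>l\<in>{1..m}. w l * of_real (indicator {s l<..} t))))
  = (LINT t|lborel. complex_of_real (indicator {0..} t *\<^sub>R wall_density eps a t) +
    (\<Sum>l\<in>{1..m}. w l * complex_of_real (indicator {s l..} t *\<^sub>R wall_density eps a t)))"
  unfolding set_lebesgue_integral_def
 proof (rule integral_cong_AE)
  \<comment> \<open>The counts give open half-lines, \<open>wall_mass\<close> uses closed ones; they
    differ in finitely many points.\<close>
  have "AE t in lborel. \<forall>l\<in>{1..m}. t \<noteq> s l"
   by (intro AE_ball_countable[THEN iffD2] ballI AE_lborel_singleton) auto
  then show "AE t in lborel. indicator {0..} t *\<^sub>R (complex_of_real (wall_density eps a t) *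
     (1 + (\<Sum>l = 1..m. w l * complex_of_real (indicator {s l<..} t)))) =
    complex_of_real (indicator {0..} t *\<^sub>R wall_density eps a t) +
    (\<Sum>l\<in>{1..m}. w l * complex_of_real (indicator {s l..} t *\<^sub>R wall_density eps a t))"
  proof eventually_elim
   case (elim t)
   have "(\<Sum>l\<in>{1..m}. w l * complex_of_real (indicator {s l..} t *\<^sub>R wall_density eps a t)) =
    (\<Sum>l\<in>{1..m}. indicator {0..} t *\<^sub>R (complex_of_real (wall_density eps a t) * (w l * complex_of_real (indicator {s l<..} t))))"
   proof (intro sum.cong refl)
    fix l assume l: "l \<in> {1..m}"
    have "t \<noteq> s l" using elim l by auto
    then show "w l * complex_of_real (indicator {s l..} t *\<^sub>R wall_density eps a t) =
     indicator {0..} t *\<^sub>R (complex_of_real (wall_density eps a t) * (w l * complex_of_real (indicator {s l<..} t)))"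
     using assms(3)[OF l] by (auto simp: indicator_def)
   qed
   then show ?case
    by (simp add: scaleR_conv_of_real algebra_simps sum_distrib_left)
  qed
 qed auto
 also have "... = (LINT t|lborel. complex_of_real (indicator {0..} t *\<^sub>R wall_density eps a t)) +
   (\<Sum>l\<in>{1..m}. LINT t|lborel. w l * complex_of_real (indicator {s l..} t *\<^sub>R wall_density eps a t))"
  by (subst Bochner_Integration.integral_add)
   (intro int Bochner_Integration.integrable_sum integrable_mult_right Bochner_Integration.integral_sum
     arg_cong2[where f = "(+)"] refl)+
 also have "... = of_real (wall_mass eps a 0) + (\<Sum>l\<in>{1..m}. w l * of_real (wall_mass eps a (s l)))"
  unfolding mass[symmetric] by (intro arg_cong2[where f = "(+)"] sum.cong refl integral_mult_right_zero)
 finally show ?thesis .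
qed

text \<open>An exponential of a count is a product over the points, so the whole observable is a
  product of the radial function \<open>\<psi>\<close>, and numerator and normalisation are two
  instances of \<open>integral_vandermonde_radial\<close>. The products start at
  \<open>k = 0\<close>, hence the shift \<open>k + 1 + \<alpha>\<close>.\<close>

lemma mgf_eq_prod:
 fixes b \<alpha> \<rho> eps :: real and s :: "nat \<Rightarrow> real" and n m :: nat and u :: "nat \<Rightarrow> complex"
 assumes pos: "0 < b" "0 < \<rho>" "0 < eps" "-1 < \<alpha>" and X: "real n * \<rho> powr (2 * b) = 2 / eps\<^sup>2"
  and decr: "\<And>i j. 1 \<le> i \<Longrightarrow> i < j \<Longrightarrow> j \<le> m \<Longrightarrow> s j < s i"
  and s0: "\<And>l. l \<in> {1..m} \<Longrightarrow> 0 \<le> s l" and s1: "\<And>l. l \<in> {1..m} \<Longrightarrow> s l \<le> 1 / eps"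
 defines "a \<equiv> \<lambda>k::nat. (real k + 1 + \<alpha>) / b"
 shows "mgf m b \<alpha> \<rho> s n u = (\<Prod>k<n. 1 + (\<Sum>l\<in>{1..m}. omega m u l *
  of_real (wall_ratio eps (a k) (s l))))"
proof -
 have n: "n \<noteq> 0" using X pos by (intro notI) simp
 \<comment> \<open>The hypothesis fixes \<open>eps\<close> only through its square; positivity
   recovers the expression inside \<open>radius\<close>.\<close>
 have he: "eps = sqrt 2 / (\<rho> powr b * sqrt (real n))"
 proof -
  have "(eps * (\<rho> powr b * sqrt (real n)))\<^sup>2 = eps\<^sup>2 * (real n * \<rho> powr (2 * b))"
   by (simp add: power_mult_distrib power2_eq_square[of "\<rho> powr b"] powr_add[symmetric])
  also have "... = (sqrt 2)\<^sup>2" using pos unfolding X by simp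
  finally have "eps * (\<rho> powr b * sqrt (real n)) = sqrt 2"
   using pos by (intro power2_eq_imp_eq[of _ "sqrt 2"]) auto
  then show ?thesis using pos n by (simp add: field_simps)
 qed
 have rad: "cmod z < radius b \<rho> s n l \<longleftrightarrow> s l < wall_coord b \<rho> eps z" if "l \<in> {1..m}" for l z
  unfolding less_wall_coord_iff[OF pos(1-3) s1[OF that]] radius_def by (simp add: he)
 define \<psi> where "\<psi> = (\<lambda>t. 1 + (\<Sum>l\<in>{1..m}. omega m u l * complex_of_real (indicator {s l<..} t)))"
 have \<psi>: "\<psi> t = (\<Prod>j\<in>{1..m}. if s j < t then exp (u j) else 1)" for t
  unfolding \<psi>_def by (rule prod_step_eq_sum_omega[OF decr, symmetric])
 have [measurable]: "\<psi> \<in> borel_measurable borel" unfolding \<psi>_def by measurable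
 have bnd: "cmod (\<psi> t) \<le> 1 + (\<Sum>l\<in>{1..m}. cmod (omega m u l))" for t
  unfolding \<psi>_def
  by (intro order.trans[OF norm_triangle_ineq] add_mono order.trans[OF norm_sum] sum_mono)
   (auto simp: norm_mult indicator_def)
 define K where "K = (\<lambda>j::nat. pi * \<rho>\<^sup>2 * eps / b * (\<rho> powr (real (2 * j) + 2 * \<alpha>) * exp (- (2 / eps\<^sup>2))))"
 have K: "K j \<noteq> 0" for j using pos by (simp add: K_def)
 have a: "0 < a k" for k using pos by (simp add: a_def)
 have key: "(LINT z|PiM {..<n} (\<lambda>_. lborel).
   complex_of_real (\<Prod>k\<in>{..<n}. \<Prod>j\<in>{..<k}. (cmod (z k - z j))\<^sup>2) *
    (\<Prod>j\<in>{..<n}. complex_of_real (wQ b \<alpha> \<rho> n (z j)) * f (wall_coord b \<rho> eps (z j))))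
  = fact n * (\<Prod>j<n. of_real (K j) * (LBINT t:{0..}. of_real (wall_density eps (a j) t) * f t))"
  if [measurable]: "f \<in> borel_measurable borel" and B: "\<And>t. cmod (f t) \<le> B" for f B
 proof -
  have "(LINT z|PiM {..<n} (\<lambda>_. lborel).
   complex_of_real (\<Prod>k\<in>{..<n}. \<Prod>j\<in>{..<k}. (cmod (z k - z j))\<^sup>2) *
    (\<Prod>j\<in>{..<n}. complex_of_real (wQ b \<alpha> \<rho> n (z j)) * f (wall_coord b \<rho> eps (z j))))
   = fact n * (\<Prod>j<n. LINT z|lborel. of_real (cmod z ^ (2 * j)) *
      (complex_of_real (wQ b \<alpha> \<rho> n z) * f (wall_coord b \<rho> eps z)))"
   by (rule integral_vandermonde_radial[where w = "\<lambda>z. complex_of_real (wQ b \<alpha> \<rho> n z) * f (wall_coord b \<rho> eps z)"])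
    (measurable, simp add: wQ_def wall_coord_def norm_mult, rule integrable_radial_weight[OF pos X that(1) B])
  also have "... = fact n * (\<Prod>j<n. of_real (K j) * (LBINT t:{0..}. of_real (wall_density eps (a j) t) * f t))"
   by (subst integral_radial_weight[OF pos X _ B]) (auto simp: K_def a_def add_ac)
  finally show ?thesis .
 qed
 have num: "complex_of_real (jointW b \<alpha> \<rho> n z) *
   (\<Prod>j\<in>{1..m}. exp (u j * of_nat (countN n z (radius b \<rho> s n j))))
  = complex_of_real (\<Prod>k\<in>{..<n}. \<Prod>j\<in>{..<k}. (cmod (z k - z j))\<^sup>2) *
    (\<Prod>j\<in>{..<n}. complex_of_real (wQ b \<alpha> \<rho> n (z j)) * \<psi> (wall_coord b \<rho> eps (z j)))" for z
 proof -
  have "exp (u j * of_nat (countN n z (radius b \<rho> s n j))) =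
   (\<Prod>k\<in>{..<n}. if s j < wall_coord b \<rho> eps (z k) then exp (u j) else 1)" if j: "j \<in> {1..m}" for j
  proof -
   have "(\<Prod>k\<in>{..<n}. if s j < wall_coord b \<rho> eps (z k) then exp (u j) else 1) =
    exp (u j) ^ card {k\<in>{..<n}. s j < wall_coord b \<rho> eps (z k)}"
    by (simp add: prod.If_cases Int_def)
   then show ?thesis
    by (simp add: countN_def rad[OF j] exp_of_nat2_mult)
  qed
  then have "(\<Prod>j\<in>{1..m}. exp (u j * of_nat (countN n z (radius b \<rho> s n j)))) =
   (\<Prod>j\<in>{1..m}. \<Prod>k\<in>{..<n}. if s j < wall_coord b \<rho> eps (z k) then exp (u j) else 1)"
   by (intro prod.cong) auto
  also have "... = (\<Prod>k\<in>{..<n}. \<psi> (wall_coord b \<rho> eps (z k)))"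
   unfolding \<psi> by (rule prod.swap)
  finally show ?thesis
   by (simp add: jointW_def prod.distrib)
 qed
 have "complex_of_real (integral\<^sup>L (PiM {..<n} (\<lambda>_. lborel :: complex measure)) (jointW b \<alpha> \<rho> n)) =
  (LINT z|PiM {..<n} (\<lambda>_. lborel). complex_of_real (\<Prod>k\<in>{..<n}. \<Prod>j\<in>{..<k}. (cmod (z k - z j))\<^sup>2) *
    (\<Prod>j\<in>{..<n}. complex_of_real (wQ b \<alpha> \<rho> n (z j)) * 1))"
  by (subst integral_complex_of_real[symmetric]) (simp add: jointW_def)
 also have "... = fact n * (\<Prod>j<n. of_real (K j) * (LBINT t:{0..}. complex_of_real (wall_density eps (a j) t) * 1))"
  by (rule key[where f = "\<lambda>_. 1" and B = 1]) auto
 also have "... = fact n * (\<Prod>j<n. of_real (K j) * of_real (wall_mass eps (a j) 0))"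
  using LBINT_wall_density_step[OF pos(3) a, where m = 0] by simp
 finally have den: "complex_of_real (integral\<^sup>L (PiM {..<n} (\<lambda>_. lborel :: complex measure)) (jointW b \<alpha> \<rho> n))
  = fact n * (\<Prod>j<n. of_real (K j) * of_real (wall_mass eps (a j) 0))" .
 have G: "wall_mass eps (a j) 0 \<noteq> 0" for j
  using wall_mass_pos[OF pos(3) a, of 0 j] pos by simp
 have step: "(LBINT t:{0..}. of_real (wall_density eps (a j) t) * \<psi> t) =
   of_real (wall_mass eps (a j) 0) + (\<Sum>l\<in>{1..m}. omega m u l * of_real (wall_mass eps (a j) (s l)))" for j
  unfolding \<psi>_def by (rule LBINT_wall_density_step[OF pos(3) a s0])
 have "mgf m b \<alpha> \<rho> s n u = (fact n * (\<Prod>j<n. of_real (K j) *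
   (of_real (wall_mass eps (a j) 0) + (\<Sum>l\<in>{1..m}. omega m u l * of_real (wall_mass eps (a j) (s l))))))
  / (fact n * (\<Prod>j<n. of_real (K j) * of_real (wall_mass eps (a j) 0)))"
  unfolding mgf_def expect_def num den
  by (subst key[OF _ bnd]) (simp_all add: step)
 also have "... = (\<Prod>j<n. (of_real (wall_mass eps (a j) 0) + (\<Sum>l\<in>{1..m}. omega m u l * of_real (wall_mass eps (a j) (s l))))
  / of_real (wall_mass eps (a j) 0))"
  using K by (simp add: prod.distrib prod_dividef)
 also have "... = (\<Prod>k<n. 1 + (\<Sum>l\<in>{1..m}. omega m u l *
  of_real (wall_ratio eps (a k) (s l))))"
  using G by (intro prod.cong refl) (simp add: add_divide_distrib sum_divide_distrib)
 finally show ?thesis .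
qed

section \<open>Quotients of Gaussian tails\<close>

lemma power_le_exp:
 fixes c :: real
 assumes "0 < c"
 shows "\<exists>C>0. \<forall>y\<ge>0. (1 + y) ^ N \<le> C * exp (c * y)"
proof (cases "N = 0")
 case True
 then show ?thesis using assms by (intro exI[of _ 1]) auto
next
 case False
 \<comment> \<open>The entry \<open>1\<close> covers the constant term of \<open>1 + y\<close>, the
   entry \<open>N / c\<close> rescales \<open>y\<close> so that
   \<open>(1 + c * y / N) ^ N <= exp (c * y)\<close> applies.\<close>
 define d where "d = max 1 (real N / c)"
 have "(1 + y) ^ N \<le> d ^ N * exp (c * y)" if "0 \<le> y" for y
 proof -
  have "real N / c * (c * y / real N) = y" using False assms by simp
  moreover have "real N / c * (c * y / real N) \<le> d * (c * y / real N)"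
   using that assms by (intro mult_right_mono) (auto simp: d_def)
  ultimately have "1 + y \<le> d * (1 + c * y / real N)"
   by (simp add: d_def distrib_left)
  then have "(1 + y) ^ N \<le> (d * (1 + c * y / real N)) ^ N" using that by (intro power_mono) auto
  also have "... \<le> d ^ N * exp (c * y)"
   unfolding power_mult_distrib using False that assms
   by (intro mult_left_mono exp_ge_one_plus_x_over_n_power_n) (auto simp: d_def intro: order.trans[of _ 0])
  finally show ?thesis .
 qed
 then show ?thesis by (intro exI[of _ "d ^ N"]) (auto simp: d_def)
qed

lemma power_mult_gauss_le:
 fixes c k :: real
 assumes "0 < c"
 shows "\<exists>C>0. \<forall>x. (1 + abs x) ^ N * exp (- (c * x\<^sup>2)) \<le> C * exp (- (k * abs x))"
proof -
 obtain C :: real where C: "C > 0" "\<And>y. 0 \<le> y \<Longrightarrow> (1 + y) ^ N \<le> C * exp (1 * y)"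
  using power_le_exp[OF zero_less_one, of N] by metis
 have "(1 + abs x) ^ N * exp (- (c * x\<^sup>2)) \<le> C * exp ((k + 1)\<^sup>2 / (4 * c)) * exp (- (k * abs x))" for x
 proof -
  have "0 \<le> c * (abs x - (k + 1) / (2 * c))\<^sup>2" using assms by simp
  also have "... = c * x\<^sup>2 - (k + 1) * abs x + (k + 1)\<^sup>2 / (4 * c)"
   using assms by (simp add: field_simps power2_eq_square)
  finally have "exp (- (c * x\<^sup>2)) \<le> exp ((k + 1)\<^sup>2 / (4 * c) - (k + 1) * abs x)" by simp
  then have "(1 + abs x) ^ N * exp (- (c * x\<^sup>2)) \<le> (C * exp (1 * abs x)) * exp ((k + 1)\<^sup>2 / (4 * c) - (k + 1) * abs x)"
   by (intro mult_mono C) (use C(1) in auto)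
  also have "... = C * exp ((k + 1)\<^sup>2 / (4 * c)) * exp (- (k * abs x))"
   by (simp add: exp_add[symmetric] algebra_simps)
  finally show ?thesis .
 qed
 then show ?thesis using C(1) by (intro exI[of _ "C * exp ((k + 1)\<^sup>2 / (4 * c))"]) auto
qed

lemma integrable_exp_minus_abs: "0 < c \<Longrightarrow> integrable lborel (\<lambda>x::real. exp (- (c * abs x)))"
proof -
 assume c: "0 < c"
 have "(\<lambda>x. exp (- c * x)) integrable_on {0..}"
  using c by (rule integrable_on_exp_minus_to_infinity)
 then have "(\<lambda>x. exp (- c * x)) absolutely_integrable_on {0..}"
  by (intro nonnegative_absolutely_integrable_1) auto
 then have "set_integrable lborel {0..} (\<lambda>x. exp (- c * x))"
  by (simp add: set_integrable_def integrable_completion)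
 then have 1: "integrable lborel (\<lambda>x. indicator {0..} x * exp (- c * x))"
  by (simp add: set_integrable_def)
 then have "integrable lborel (\<lambda>x. indicator {0..} (0 + (-1) * x) * exp (- c * (0 + (-1) * x)))"
  by (intro lborel_integrable_real_affine) auto
 with 1 have "integrable lborel (\<lambda>x. indicator {0..} x * exp (- c * x) +
   indicator {0..} (0 + (-1) * x) * exp (- c * (0 + (-1) * x)))"
  by (rule Bochner_Integration.integrable_add)
 then show ?thesis
  by (rule Bochner_Integration.integrable_bound) (auto simp: indicator_def abs_if)
qed

lemma integrable_power_mult_gauss:
 assumes "0 < c"
 shows "integrable lborel (\<lambda>x::real. (1 + abs x) ^ N * exp (- (c * x\<^sup>2)))"
proof -
 obtain C where C: "C > 0" "\<And>x::real. (1 + abs x) ^ N * exp (- (c * x\<^sup>2)) \<le> C * exp (- (1 * abs x))"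
  using power_mult_gauss_le[OF assms, of N 1] by metis
 have "integrable lborel (\<lambda>x::real. C * exp (- (1 * abs x)))"
  by (intro integrable_mult_right integrable_exp_minus_abs) auto
 then show ?thesis
  by (rule Bochner_Integration.integrable_bound) (use C in auto)
qed

lemma set_integrable_power_mult_gauss:
 assumes "0 < c" "A \<in> sets borel"
 shows "set_integrable lborel A (\<lambda>x::real. (1 + abs x) ^ N * exp (- (c * x\<^sup>2)))"
 unfolding set_integrable_def
 using integrable_mult_indicator[OF _ integrable_power_mult_gauss[OF assms(1)], of A N] assms by simp

lemma set_integrable_gauss: "A \<in> sets borel \<Longrightarrow> set_integrable lborel A (\<lambda>x::real. exp (- x\<^sup>2))"
 using set_integrable_power_mult_gauss[of 1 A 0] by simp

text \<open>The function \<open>erfc\<close> without its normalisation, which cancels in every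
  quotient.\<close>

definition gauss_tail :: "real \<Rightarrow> real" where
 "gauss_tail t = (LBINT x:{t..}. exp (- x\<^sup>2))"

lemma erfc_gauss_tail: "erfc t = 2 / sqrt pi * gauss_tail t"
 by (simp add: erfc_def gauss_tail_def)

lemma gauss_tail_diff:
 assumes "c \<le> t"
 shows "gauss_tail t = gauss_tail c - integral {c..t} (\<lambda>x. exp (- x\<^sup>2))"
proof -
 have "{c..} = {c..t} \<union> {t..}" using assms by auto
 then have "gauss_tail c = (LBINT x:{c..t} \<union> {t..}. exp (- x\<^sup>2))" by (simp add: gauss_tail_def)
 also have "... = (LBINT x:{c..t}. exp (- x\<^sup>2)) + gauss_tail t"
  unfolding gauss_tail_def
 proof (rule set_integral_Un_AE)
  show "AE x in lborel. \<not> (x \<in> {c..t} \<and> x \<in> {t..})"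
   using AE_lborel_singleton[of t] by eventually_elim auto
 qed (auto intro: set_integrable_gauss)
 also have "(LBINT x:{c..t}. exp (- x\<^sup>2)) = integral {c..t} (\<lambda>x. exp (- x\<^sup>2))"
  by (intro set_borel_integral_eq_integral set_integrable_gauss) auto
 finally show ?thesis by simp
qed

lemma gauss_tail_has_real_derivative:
 "(gauss_tail has_real_derivative - exp (- t\<^sup>2)) (at t)"
proof -
 have "((\<lambda>u. integral {t-1..u} (\<lambda>x. exp (- x\<^sup>2))) has_vector_derivative exp (- t\<^sup>2)) (at t within {t-1..t+1})"
  by (rule integral_has_vector_derivative) (auto intro!: continuous_intros)
 then have "((\<lambda>u. integral {t-1..u} (\<lambda>x. exp (- x\<^sup>2))) has_real_derivative exp (- t\<^sup>2)) (at t)"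
  by (simp add: has_real_derivative_iff_has_vector_derivative at_within_Icc_at)
 then have "((\<lambda>u. gauss_tail (t-1) - integral {t-1..u} (\<lambda>x. exp (- x\<^sup>2))) has_real_derivative - exp (- t\<^sup>2)) (at t)"
  by (auto intro!: derivative_eq_intros)
 then show ?thesis
  by (rule DERIV_cong_ev[THEN iffD1, rotated 3, OF _ refl _ refl])
   (auto intro!: eventually_mono[OF eventually_gt_at_top] simp: eventually_nhds gauss_tail_diff[symmetric]
    intro: exI[of _ "{t-1<..}"])
qed

text \<open>On the interval of length \<open>1 / (1 + t)\<close> to the right of \<open>t\<close>
  the square grows by at most \<open>3\<close>. This replaces the Mills ratio: it makes
  \<open>exp (- y^2) / gauss_tail y\<close> grow at most linearly for \<open>y >= 0\<close>.\<close>

lemma gauss_tail_ge: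
 assumes "0 \<le> t"
 shows "exp (- t\<^sup>2 - 3) / (1 + t) \<le> gauss_tail t"
proof -
 have "(LBINT x:{t..t + 1/(1+t)}. exp (- t\<^sup>2 - 3)) \<le> (LBINT x:{t..}. exp (- x\<^sup>2))"
  unfolding set_lebesgue_integral_def
 proof (rule integral_mono)
  fix x
  show "indicator {t..t + 1/(1+t)} x *\<^sub>R exp (- t\<^sup>2 - 3) \<le> indicator {t..} x *\<^sub>R exp (- x\<^sup>2)"
  proof (cases "x \<in> {t..t + 1/(1+t)}")
   case True
   then have "x\<^sup>2 \<le> (t + 1 / (1 + t))\<^sup>2" using assms by (intro power_mono) auto
   also have "... = t\<^sup>2 + 2 * (t / (1 + t)) + (1 / (1 + t))\<^sup>2" by (simp add: power2_sum)
   also have "... \<le> t\<^sup>2 + 2 * 1 + 1\<^sup>2" using assms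
    by (intro add_mono mult_left_mono power_mono) (auto simp: field_simps)
   finally show ?thesis using True by (simp add: indicator_def)
  qed (auto simp: indicator_def)
 qed (use set_integrable_gauss[of "{t..}"] in \<open>auto simp: set_integrable_def emeasure_lborel_Icc_eq intro!: integrable_real_indicator\<close>)
 moreover have "(LBINT x:{t..t + 1/(1+t)}. exp (- t\<^sup>2 - 3)) = exp (- t\<^sup>2 - 3) / (1 + t)"
  using assms by (simp add: set_lebesgue_integral_def)
 ultimately show ?thesis by (simp add: gauss_tail_def)
qed

lemma gauss_tail_mono: "s \<le> t \<Longrightarrow> gauss_tail t \<le> gauss_tail s"
 by (rule DERIV_nonpos_imp_nonincreasing)
  (auto intro!: exI[of _ "- exp (- _\<^sup>2)"] gauss_tail_has_real_derivative)

lemma gauss_tail_pos: "0 < gauss_tail t"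
proof -
 have "0 < exp (- (max 0 t)\<^sup>2 - 3) / (1 + max 0 t)" by simp
 also have "... \<le> gauss_tail (max 0 t)" by (rule gauss_tail_ge) simp
 also have "... \<le> gauss_tail t" by (rule gauss_tail_mono) simp
 finally show ?thesis .
qed

lemma integral_shifted_gauss:
 "(LBINT t:{s..}. exp (- (y + t)\<^sup>2)) = gauss_tail (y + s)"
 unfolding gauss_tail_def set_lebesgue_integral_def
 by (subst lborel_integral_real_affine[of 1 _ y]) (auto intro!: Bochner_Integration.integral_cong simp: indicator_def)

text \<open>For \<open>x >= y\<close> one has \<open>(s + x)^2 >= x^2 + 2 * y * s\<close>;
  integrating over \<open>x\<close> gives an exponential gain relative to the tail itself.\<close>

lemma gauss_tail_add_le:
 assumes "0 \<le> y" "0 \<le> s"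
 shows "gauss_tail (y + s) \<le> exp (- 2 * y * s) * gauss_tail y"
proof -
 have int: "integrable lborel (\<lambda>x. indicator {y..} x *\<^sub>R exp (- x\<^sup>2))"
  using set_integrable_gauss[of "{y..}"] by (simp add: set_integrable_def)
 have "gauss_tail (s + y) = (LBINT x:{y..}. exp (- (s + x)\<^sup>2))"
  by (rule integral_shifted_gauss[symmetric])
 also have "... \<le> (LBINT x:{y..}. exp (- 2 * y * s) * exp (- x\<^sup>2))"
  unfolding set_lebesgue_integral_def
 proof (rule integral_mono')
  show "integrable lborel (\<lambda>x. indicator {y..} x *\<^sub>R (exp (- 2 * y * s) * exp (- x\<^sup>2)))"
   using integrable_mult_right[OF int, of "exp (- 2 * y * s)"] by (simp add: mult_ac)
  fix x
  show "indicator {y..} x *\<^sub>R exp (- (s + x)\<^sup>2) \<le> indicator {y..} x *\<^sub>R (exp (- 2 * y * s) * exp (- x\<^sup>2))"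
  proof (cases "y \<le> x")
   case True
   have "y * s \<le> x * s" using True assms by (intro mult_right_mono)
   then have "- (s + x)\<^sup>2 \<le> - 2 * y * s + - x\<^sup>2"
   proof -
    have "- (s + x)\<^sup>2 = - s\<^sup>2 - x\<^sup>2 - 2 * (x * s)" by (simp add: power2_sum)
    moreover have "- 2 * y * s = - 2 * (y * s)" by simp
    ultimately show ?thesis using \<open>y * s \<le> x * s\<close> zero_le_power2[of s] by linarith
   qed
   then show ?thesis using True by (simp add: exp_add[symmetric])
  qed auto
  show "0 \<le> indicator {y..} x *\<^sub>R (exp (- 2 * y * s) * exp (- x\<^sup>2))" by simp
 qed
 also have "... = exp (- 2 * y * s) * gauss_tail y" by (simp add: gauss_tail_def)
 finally show ?thesis by (simp add: add.commute)
qed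

lemma gauss_tail_diff_le:
 assumes "y \<le> 0" "0 \<le> s"
 shows "gauss_tail y - gauss_tail (y + s) \<le> s * exp (- y\<^sup>2 + 2 * abs y * s)"
proof -
 have "gauss_tail y - gauss_tail (y + s) = integral {y..y+s} (\<lambda>x. exp (- x\<^sup>2))"
  using gauss_tail_diff[of y "y + s"] assms by simp
 also have "... \<le> integral {y..y+s} (\<lambda>x. exp (- y\<^sup>2 + 2 * abs y * s))"
 proof (rule integral_le)
  show "(\<lambda>x. exp (- x\<^sup>2)) integrable_on {y..y + s}"
   by (intro integrable_continuous_interval continuous_intros)
  fix x assume x: "x \<in> {y..y + s}"
  then have "(-y) * (x - y) \<le> (-y) * s" using assms by (intro mult_left_mono) auto
  moreover have "0 \<le> (x - y)\<^sup>2" by simp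
  ultimately have "- x\<^sup>2 \<le> - y\<^sup>2 + 2 * abs y * s" using assms
   by (simp add: power2_eq_square algebra_simps)
  then show "exp (- x\<^sup>2) \<le> exp (- y\<^sup>2 + 2 * abs y * s)" by simp
 qed auto
 also have "... = s * exp (- y\<^sup>2 + 2 * abs y * s)" using assms by simp
 finally show ?thesis .
qed

text \<open>The moment is measured against the mass of the same tail, losing only a polynomial. For
  \<open>t >= 0\<close> the shift \<open>v = t + w\<close> factors the integrand into a part at
  \<open>t\<close> and an integrable part in \<open>w\<close>, and \<open>gauss_tail_ge\<close> is
  applied; for \<open>t < 0\<close> the mass is at least \<open>gauss_tail 0\<close>.\<close>

lemma gauss_moment_le:
 "\<exists>C>0. \<forall>t. (LBINT v:{t..}. (1 + abs v) ^ N * exp (- v\<^sup>2)) \<le> C * (1 + abs t) ^ (N + 1) * gauss_tail t"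
proof -
 define f where "f = (\<lambda>v::real. (1 + abs v) ^ N * exp (- v\<^sup>2))"
 have int: "integrable lborel f"
  unfolding f_def using integrable_power_mult_gauss[of 1 N] by simp
 have inti: "integrable lborel (\<lambda>v. indicator A v *\<^sub>R f v)" if "A \<in> sets borel" for A
  using int that by (intro integrable_mult_indicator) auto
 define I where "I = integral\<^sup>L lborel f"
 have f0: "0 \<le> f v" for v by (simp add: f_def)
 have le_I: "(LBINT v:A. f v) \<le> I" if "A \<in> sets borel" for A
  unfolding set_lebesgue_integral_def I_def
  using int by (rule integral_mono') (auto simp: f0 indicator_def)
 have I0: "0 \<le> I" unfolding I_def by (intro Bochner_Integration.integral_nonneg f0)
 define C where "C = (I + 1) * (exp 3 + 1 / gauss_tail 0)"
 have "(LBINT v:{t..}. f v) \<le> C * (1 + abs t) ^ (N + 1) * gauss_tail t" for t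
 proof (cases "0 \<le> t")
  case True
  have "(LBINT v:{t..}. f v) = (LBINT w:{0..}. f (t + w))"
   unfolding set_lebesgue_integral_def
   by (subst lborel_integral_real_affine[of 1 _ t]) (auto intro!: Bochner_Integration.integral_cong simp: indicator_def)
  also have "... \<le> (LBINT w:{0..}. (1 + t) ^ N * exp (- t\<^sup>2) * f w)"
   unfolding set_lebesgue_integral_def
  proof (rule integral_mono')
   show "integrable lborel (\<lambda>w. indicator {0..} w *\<^sub>R ((1 + t) ^ N * exp (- t\<^sup>2) * f w))"
    using integrable_mult_right[OF inti[of "{0..}"], of "(1 + t) ^ N * exp (- t\<^sup>2)"] by (simp add: mult_ac)
   fix w
   show "0 \<le> indicator {0..} w *\<^sub>R ((1 + t) ^ N * exp (- t\<^sup>2) * f w)" using f0 True by simp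
   show "indicator {0..} w *\<^sub>R f (t + w) \<le> indicator {0..} w *\<^sub>R ((1 + t) ^ N * exp (- t\<^sup>2) * f w)"
   proof (cases "0 \<le> w")
    case w: True
    have "(1 + abs (t + w)) ^ N \<le> ((1 + t) * (1 + abs w)) ^ N"
     using True w by (intro power_mono) (auto simp: algebra_simps)
    moreover have "- (t + w)\<^sup>2 \<le> - t\<^sup>2 + - w\<^sup>2" using True w by (simp add: power2_sum)
    then have "exp (- (t + w)\<^sup>2) \<le> exp (- t\<^sup>2) * exp (- w\<^sup>2)" by (simp only: exp_add[symmetric] exp_le_cancel_iff)
    ultimately have "f (t + w) \<le> ((1 + t) * (1 + abs w)) ^ N * (exp (- t\<^sup>2) * exp (- w\<^sup>2))"
     unfolding f_def using True by (intro mult_mono) auto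
    then show ?thesis using w by (simp add: f_def power_mult_distrib mult_ac)
   qed auto
  qed
  also have "... = (1 + t) ^ N * exp (- t\<^sup>2) * (LBINT w:{0..}. f w)" by simp
  also have "... \<le> (1 + t) ^ N * exp (- t\<^sup>2) * (I + 1)"
   using True le_I[of "{0..}"] by (intro mult_left_mono) auto
  also have "exp (- t\<^sup>2) = exp 3 * (1 + t) * (exp (- t\<^sup>2 - 3) / (1 + t))"
   using True by (simp add: exp_add[symmetric])
  then have "exp (- t\<^sup>2) \<le> exp 3 * (1 + t) * gauss_tail t"
   using gauss_tail_ge[OF True] True by (simp only:) (intro mult_left_mono, auto)
  then have "(1 + t) ^ N * exp (- t\<^sup>2) * (I + 1) \<le> (1 + t) ^ N * (exp 3 * (1 + t) * gauss_tail t) * (I + 1)"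
   using True I0 by (intro mult_right_mono mult_left_mono) auto
  also have "... = ((I + 1) * exp 3) * ((1 + abs t) ^ (N + 1) * gauss_tail t)" using True by (simp add: mult_ac)
  also have "... \<le> C * ((1 + abs t) ^ (N + 1) * gauss_tail t)"
   unfolding C_def using I0 gauss_tail_pos[of 0] gauss_tail_pos[of t]
   by (intro mult_right_mono mult_left_mono) auto
  finally show ?thesis by (simp add: mult.assoc)
 next
  case False
  have "(LBINT v:{t..}. f v) \<le> I + 1" using le_I[of "{t..}"] by simp
  also have "... = (I + 1) * (1 / gauss_tail 0) * (1 * gauss_tail 0)" using gauss_tail_pos[of 0] by simp
  also have "... \<le> C * ((1 + abs t) ^ (N + 1) * gauss_tail t)"
  proof (intro mult_mono)
   show "(I + 1) * (1 / gauss_tail 0) \<le> C" unfolding C_def using I0 by (intro mult_left_mono) auto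
   show "1 \<le> (1 + abs t) ^ (N + 1)" by (intro one_le_power) auto
   show "gauss_tail 0 \<le> gauss_tail t" using False by (intro gauss_tail_mono) auto
  qed (use I0 gauss_tail_pos[of 0] less_imp_le in \<open>auto simp: C_def\<close>)
  finally show ?thesis by (simp add: mult.assoc)
 qed
 moreover have "C > 0" unfolding C_def using I0 gauss_tail_pos[of 0] by (intro mult_pos_pos add_nonneg_pos add_pos_pos) auto
 ultimately show ?thesis unfolding f_def by blast
qed

lemma DERIV_gauss_tail [derivative_intros]:
 "(g has_real_derivative D) (at x) \<Longrightarrow>
 ((\<lambda>x. gauss_tail (g x)) has_real_derivative - exp (- (g x)\<^sup>2) * D) (at x)"
 by (rule DERIV_chain2[OF gauss_tail_has_real_derivative])

section \<open>The three basic quotients, their derivatives and their decay\<close>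

text \<open>\<open>gauss_q\<close> is minus the logarithmic derivative of \<open>gauss_tail\<close>,
  an inverse Mills ratio; \<open>gauss_R\<close> is the limit of the wall ratios, and
  \<open>gauss_p\<close> is the boundary term at \<open>s\<close> produced by integration by
  parts.\<close>

definition gauss_q :: "real \<Rightarrow> real" where
 "gauss_q y = exp (- y\<^sup>2) / gauss_tail y"
definition gauss_p :: "real \<Rightarrow> real \<Rightarrow> real" where
 "gauss_p s y = exp (- (y + s)\<^sup>2) / gauss_tail y"
definition gauss_R :: "real \<Rightarrow> real \<Rightarrow> real" where
 "gauss_R s y = gauss_tail (y + s) / gauss_tail y"

lemma DERIV_gauss_q: "(gauss_q has_real_derivative (gauss_q y * gauss_q y - 2 * y * gauss_q y)) (at y)"
 unfolding gauss_q_def using gauss_tail_pos[of y]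
 by (auto intro!: derivative_eq_intros simp: field_simps power2_eq_square)

lemma DERIV_gauss_p: "(gauss_p s has_real_derivative (gauss_q y - 2 * y - 2 * s) * gauss_p s y) (at y)"
 unfolding gauss_p_def gauss_q_def using gauss_tail_pos[of y]
 by (auto intro!: derivative_eq_intros simp: divide_simps) (simp add: algebra_simps power2_eq_square[of "gauss_tail y"])

lemma DERIV_gauss_R: "(gauss_R s has_real_derivative (gauss_q y * gauss_R s y - gauss_p s y)) (at y)"
 unfolding gauss_p_def gauss_q_def gauss_R_def using gauss_tail_pos[of y]
 by (auto intro!: derivative_eq_intros simp: field_simps power2_eq_square)

lemma gauss_q_pos: "0 < gauss_q y" by (simp add: gauss_q_def gauss_tail_pos)
lemma gauss_p_pos: "0 < gauss_p s y" by (simp add: gauss_p_def gauss_tail_pos)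
lemma gauss_R_pos: "0 < gauss_R s y" by (simp add: gauss_R_def gauss_tail_pos)
lemma gauss_R_le_1: "0 \<le> s \<Longrightarrow> gauss_R s y \<le> 1"
 by (simp add: gauss_R_def gauss_tail_pos gauss_tail_mono divide_le_eq)
lemma gauss_R_antimono: "s \<le> t \<Longrightarrow> gauss_R t y \<le> gauss_R s y"
 by (simp add: gauss_R_def gauss_tail_pos gauss_tail_mono divide_right_mono less_imp_le)

lemma gauss_q_le_pos: "0 \<le> y \<Longrightarrow> gauss_q y \<le> exp 3 * (1 + y)"
proof -
 assume y: "0 \<le> y"
 have "exp (- y\<^sup>2) = exp 3 * (1 + y) * (exp (- y\<^sup>2 - 3) / (1 + y))"
  using y by (simp add: exp_add[symmetric])
 also have "... \<le> exp 3 * (1 + y) * gauss_tail y"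
  using gauss_tail_ge[OF y] y by (intro mult_left_mono) auto
 finally show ?thesis by (simp add: gauss_q_def gauss_tail_pos divide_le_eq)
qed

lemma gauss_q_le_neg: "y \<le> 0 \<Longrightarrow> gauss_q y \<le> exp (- y\<^sup>2) / gauss_tail 0"
 unfolding gauss_q_def by (intro divide_left_mono gauss_tail_mono mult_pos_pos gauss_tail_pos) auto

lemma exp_minus_square_le: "exp (- y\<^sup>2 + 2 * k * abs y) \<le> exp ((k + c)\<^sup>2) * exp (- (2 * c * abs y))" for y k c :: real
proof -
 have "0 \<le> (abs y - (k + c))\<^sup>2" by simp
 also have "... = y\<^sup>2 - 2 * k * abs y - 2 * c * abs y + (k + c)\<^sup>2"
  by (simp add: power2_diff algebra_simps)
 finally show ?thesis by (simp add: exp_add[symmetric])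
qed

lemma gauss_q_bound: "\<exists>C\<ge>0. \<forall>y. gauss_q y \<le> C * (1 + abs y)"
proof (intro exI conjI allI)
 fix y
 show "gauss_q y \<le> (exp 3 + 1 / gauss_tail 0) * (1 + abs y)"
 proof (cases "0 \<le> y")
  case True
  have "exp 3 * (1 + abs y) \<le> (exp 3 + 1 / gauss_tail 0) * (1 + abs y)"
   using gauss_tail_pos[of 0] by (intro mult_right_mono) auto
  with gauss_q_le_pos[OF True] True show ?thesis by (metis abs_of_nonneg order.trans)
 next
  case False
  then have "gauss_q y \<le> exp (- y\<^sup>2) / gauss_tail 0" by (intro gauss_q_le_neg) auto
  also have "... \<le> 1 / gauss_tail 0" using gauss_tail_pos[of 0] by (intro divide_right_mono) auto
  also have "... = 1 / gauss_tail 0 * 1" by simp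
  also have "... \<le> (exp 3 + 1 / gauss_tail 0) * (1 + abs y)"
   using gauss_tail_pos[of 0] by (intro mult_mono) (auto simp: add_nonneg_nonneg less_imp_le)
  finally show ?thesis .
 qed
qed (use gauss_tail_pos[of 0] in \<open>simp add: add_nonneg_nonneg less_imp_le\<close>)

lemma gauss_R_decay_pos:
 assumes "0 < c" "c \<le> s" "0 \<le> y"
 shows "gauss_R s y \<le> exp (- (2 * c * abs y))"
proof -
 have "gauss_R s y \<le> exp (- 2 * y * s)"
  using gauss_tail_add_le[of y s] assms gauss_tail_pos[of y] by (simp add: gauss_R_def divide_le_eq)
 also have "... \<le> exp (- (2 * c * abs y))" using assms mult_left_mono[of c s y] by (simp add: mult_ac)
 finally show ?thesis .
qed

lemma gauss_R_decay_neg: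
 assumes "0 < c" "c \<le> s" "y \<le> 0"
 shows "1 - gauss_R s y \<le> (s / gauss_tail 0 * exp ((s + c)\<^sup>2)) * exp (- (2 * c * abs y))"
proof -
 have "1 - gauss_R s y = (gauss_tail y - gauss_tail (y + s)) / gauss_tail y"
  using gauss_tail_pos[of y] by (simp add: gauss_R_def field_simps)
 also have "... \<le> (s * exp (- y\<^sup>2 + 2 * abs y * s)) / gauss_tail 0"
  using assms gauss_tail_pos[of 0] by (intro frac_le gauss_tail_diff_le gauss_tail_mono) auto
 also have "... = s / gauss_tail 0 * exp (- y\<^sup>2 + 2 * s * abs y)" by (simp add: mult_ac)
 also have "... \<le> s / gauss_tail 0 * (exp ((s + c)\<^sup>2) * exp (- (2 * c * abs y)))"
  using assms gauss_tail_pos[of 0] by (intro mult_left_mono exp_minus_square_le) auto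
 finally show ?thesis by (simp add: mult_ac)
qed

text \<open>\<open>gauss_R\<close> decays on the right and tends to \<open>1\<close> on the left, so
  only the product with \<open>1 - gauss_R\<close> decays on both sides.\<close>

lemma gauss_R_var_bound:
 assumes "0 < c" "c \<le> s"
 shows "\<exists>C\<ge>0. \<forall>y. gauss_R s y * (1 - gauss_R s y) \<le> C * exp (- (2 * c * abs y))"
proof (intro exI conjI allI)
 define K where "K = s / gauss_tail 0 * exp ((s + c)\<^sup>2)"
 have K: "0 \<le> K" using assms gauss_tail_pos[of 0] by (simp add: K_def)
 then show "0 \<le> 1 + K" by simp
 fix y
 have R: "0 \<le> gauss_R s y" "gauss_R s y \<le> 1" using gauss_R_pos[of s y] gauss_R_le_1[of s y] assms by auto
 show "gauss_R s y * (1 - gauss_R s y) \<le> (1 + K) * exp (- (2 * c * abs y))"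
 proof (cases "0 \<le> y")
  case True
  have "gauss_R s y * (1 - gauss_R s y) \<le> gauss_R s y * 1" using R by (intro mult_left_mono) auto
  also have "... \<le> 1 * exp (- (2 * c * abs y))" using gauss_R_decay_pos[OF assms True] by simp
  also have "... \<le> (1 + K) * exp (- (2 * c * abs y))" using K by (intro mult_right_mono) auto
  finally show ?thesis .
 next
  case False
  have "gauss_R s y * (1 - gauss_R s y) \<le> 1 * (1 - gauss_R s y)" using R by (intro mult_right_mono) auto
  also have "... \<le> K * exp (- (2 * c * abs y))"
   using gauss_R_decay_neg[OF assms, of y] False by (simp add: K_def)
  also have "... \<le> (1 + K) * exp (- (2 * c * abs y))" using K by (intro mult_right_mono) auto
  finally show ?thesis .
 qed
qed

lemma gauss_p_bound:
 assumes "0 < c" "c \<le> s"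
 shows "\<exists>C\<ge>0. \<forall>y. gauss_p s y \<le> C * (1 + abs y) * exp (- (2 * c * abs y))"
proof (intro exI conjI allI)
 define K where "K = exp ((s + c)\<^sup>2) / gauss_tail 0"
 have K: "0 \<le> K" using gauss_tail_pos[of 0] by (simp add: K_def)
 then show "0 \<le> exp 3 + K" by simp
 fix y
 show "gauss_p s y \<le> (exp 3 + K) * (1 + abs y) * exp (- (2 * c * abs y))"
 proof (cases "0 \<le> y")
  case True
  have "gauss_p s y = exp (- 2 * y * s - s\<^sup>2) * gauss_q y"
   by (simp add: gauss_p_def gauss_q_def exp_add[symmetric] power2_sum algebra_simps)
  also have "... \<le> exp (- (2 * c * abs y)) * (exp 3 * (1 + y))"
  proof (intro mult_mono gauss_q_le_pos True)
   have "c * y \<le> s * y" using assms True by (intro mult_right_mono) auto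
   moreover have "- 2 * y * s = - 2 * (s * y)" "2 * c * abs y = 2 * (c * y)" using True by auto
   ultimately have "- 2 * y * s - s\<^sup>2 \<le> - (2 * c * abs y)" using zero_le_power2[of s] by linarith
   then show "exp (- 2 * y * s - s\<^sup>2) \<le> exp (- (2 * c * abs y))" by simp
  qed (use gauss_q_pos[of y] in auto)
  also have "... = exp 3 * ((1 + abs y) * exp (- (2 * c * abs y)))" using True by simp
  also have "... \<le> (exp 3 + K) * ((1 + abs y) * exp (- (2 * c * abs y)))"
   using K by (intro mult_right_mono) auto
  finally show ?thesis by (simp add: mult.assoc)
 next
  case False
  have "gauss_p s y \<le> exp (- (y + s)\<^sup>2) / gauss_tail 0" unfolding gauss_p_def
   using False by (intro divide_left_mono gauss_tail_mono mult_pos_pos gauss_tail_pos) auto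
  also have "- (y + s)\<^sup>2 \<le> - y\<^sup>2 + 2 * s * abs y" using False by (simp add: power2_sum)
  then have "exp (- (y + s)\<^sup>2) \<le> exp ((s + c)\<^sup>2) * exp (- (2 * c * abs y))"
   using exp_minus_square_le[of y s c] by (meson exp_le_cancel_iff order.trans)
  then have "exp (- (y + s)\<^sup>2) / gauss_tail 0 \<le> K * exp (- (2 * c * abs y))"
   using gauss_tail_pos[of 0] by (simp add: K_def divide_right_mono)
  also have "... \<le> (exp 3 + K) * (1 + abs y) * exp (- (2 * c * abs y))"
   using K mult_mono[of K "exp 3 + K" 1 "1 + abs y"] by (intro mult_right_mono) auto
  finally show ?thesis .
 qed
qed

lemma gauss_qR_bound:
 assumes "0 < c" "c \<le> s"
 shows "\<exists>C\<ge>0. \<forall>y. gauss_q y * gauss_R s y \<le> C * (1 + abs y) * exp (- (2 * c * abs y))"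
proof (intro exI conjI allI)
 define K where "K = exp (c\<^sup>2) / gauss_tail 0"
 have K: "0 \<le> K" using gauss_tail_pos[of 0] by (simp add: K_def)
 then show "0 \<le> exp 3 + K" by simp
 fix y
 have R: "0 \<le> gauss_R s y" "gauss_R s y \<le> 1" using gauss_R_pos[of s y] gauss_R_le_1[of s y] assms by auto
 show "gauss_q y * gauss_R s y \<le> (exp 3 + K) * (1 + abs y) * exp (- (2 * c * abs y))"
 proof (cases "0 \<le> y")
  case True
  have "gauss_q y * gauss_R s y \<le> (exp 3 * (1 + y)) * exp (- (2 * c * abs y))"
   using True R by (intro mult_mono gauss_q_le_pos gauss_R_decay_pos assms) auto
  also have "... = exp 3 * ((1 + abs y) * exp (- (2 * c * abs y)))" using True by simp
  also have "... \<le> (exp 3 + K) * ((1 + abs y) * exp (- (2 * c * abs y)))"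
   using K by (intro mult_right_mono) auto
  finally show ?thesis by (simp add: mult.assoc)
 next
  case False
  have "gauss_q y * gauss_R s y \<le> gauss_q y * 1" using R gauss_q_pos[of y] by (intro mult_left_mono) auto
  also have "... \<le> exp (- y\<^sup>2) / gauss_tail 0" using gauss_q_le_neg[of y] False by simp
  also have "... \<le> (exp (c\<^sup>2) * exp (- (2 * c * abs y))) / gauss_tail 0"
   using exp_minus_square_le[of y 0 c] gauss_tail_pos[of 0] by (intro divide_right_mono) auto
  also have "... = K * exp (- (2 * c * abs y))" by (simp add: K_def)
  also have "... \<le> (exp 3 + K) * (1 + abs y) * exp (- (2 * c * abs y))"
   using K mult_mono[of K "exp 3 + K" 1 "1 + abs y"] by (intro mult_right_mono) auto
  finally show ?thesis .
 qed
qed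

lemma vector_derivative_of_real_comp:
 "(f has_real_derivative D) (at x) \<Longrightarrow>
  ((\<lambda>x. complex_of_real (f x)) has_vector_derivative complex_of_real D) (at x)"
 by (rule has_vector_derivative_of_real)

section \<open>A differential algebra of expansion coefficients\<close>

text \<open>\<open>Om\<close> stands for all admissible vectors \<open>omega\<close>; quantifying
  over it makes every constant below uniform in \<open>u\<close>. \<open>Om_Re\<close> is stated for
  arbitrary increasing \<open>R\<close> with values in \<open>[0, 1]\<close>, so that it applies
  alike to the Gaussian quotients, to the exact wall ratios and to the constants \<open>0\<close>
  and \<open>1\<close>.\<close>

locale gauss_family =
 fixes m :: nat and s :: "nat \<Rightarrow> real" and \<sigma> B c0 :: real and Om :: "(nat \<Rightarrow> complex) set"
 assumes \<sigma>_pos: "0 < \<sigma>" and \<sigma>_le: "\<And>l. l \<in> {1..m} \<Longrightarrow> \<sigma> \<le> s l"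
  and s_decr: "\<And>i j. 1 \<le> i \<Longrightarrow> i < j \<Longrightarrow> j \<le> m \<Longrightarrow> s j < s i"
  and B_nonneg: "0 \<le> B" and Om_le: "\<And>w l. w \<in> Om \<Longrightarrow> l \<in> {1..m} \<Longrightarrow> cmod (w l) \<le> B"
  and c0_pos: "0 < c0"
  and Om_Re: "\<And>w R. w \<in> Om \<Longrightarrow> (\<And>l. l \<in> {1..m} \<Longrightarrow> 0 \<le> R l \<and> R l \<le> 1) \<Longrightarrow>
   (\<And>i j. 1 \<le> i \<Longrightarrow> i \<le> j \<Longrightarrow> j \<le> m \<Longrightarrow> R i \<le> R j) \<Longrightarrow>
   c0 \<le> Re (1 + (\<Sum>l\<in>{1..m}. w l * complex_of_real (R l)))"
begin

abbreviation decay :: "real \<Rightarrow> real" where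
 "decay y \<equiv> exp (- (\<sigma> * abs y))"

text \<open>This is \<open>g0\<close> of the statement, regarded as a function of
  \<open>omega\<close> instead of \<open>u\<close>.\<close>

definition gz :: "(nat \<Rightarrow> complex) \<Rightarrow> real \<Rightarrow> complex" where
 "gz w y = 1 + (\<Sum>l\<in>{1..m}. w l * of_real (gauss_R (s l) y))"

lemma s_pos: "l \<in> {1..m} \<Longrightarrow> 0 < s l"
 using \<sigma>_pos \<sigma>_le[of l] by linarith

lemma s_antimono: "1 \<le> i \<Longrightarrow> i \<le> j \<Longrightarrow> j \<le> m \<Longrightarrow> s j \<le> s i"
 using s_decr[of i j] by (cases "i = j") auto

lemma Re_gz: "w \<in> Om \<Longrightarrow> c0 \<le> Re (gz w y)"
 unfolding gz_def
proof (rule Om_Re)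
 show "0 \<le> gauss_R (s l) y \<and> gauss_R (s l) y \<le> 1" if "l \<in> {1..m}" for l
  using gauss_R_pos[of "s l" y] gauss_R_le_1[of "s l" y] s_pos[OF that] by auto
 show "gauss_R (s i) y \<le> gauss_R (s j) y" if "1 \<le> i" "i \<le> j" "j \<le> m" for i j
  using that by (intro gauss_R_antimono s_antimono)
qed

lemma norm_gz: "w \<in> Om \<Longrightarrow> c0 \<le> cmod (gz w y)"
 using Re_gz[of w y] complex_Re_le_cmod[of "gz w y"] by linarith

lemma gz_nz: "w \<in> Om \<Longrightarrow> gz w y \<noteq> 0"
 using norm_gz[of w y] c0_pos by auto

text \<open>\<open>Alg\<close> is the algebra of functions of \<open>y\<close> in which all expansion coefficients live,
 and \<open>Ideal\<close> is its ideal generated by \<open>p\<close> and \<open>q R\<close>. Since \<open>q' = q\<^sup>2 - 2 y q\<close>,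
 \<open>p' = (q - 2 y - 2 s) p\<close> and \<open>R' = q R - p\<close>, both are closed under differentiation;
 elements of the algebra grow polynomially, those of the ideal decay exponentially.\<close>

inductive Alg :: "((nat \<Rightarrow> complex) \<Rightarrow> real \<Rightarrow> complex) \<Rightarrow> bool" where
 Alg_const: "Alg (\<lambda>w y. c)"
| Alg_omega: "l \<in> {1..m} \<Longrightarrow> Alg (\<lambda>w y. w l)"
| Alg_id: "Alg (\<lambda>w y. of_real y)"
| Alg_q: "Alg (\<lambda>w y. of_real (gauss_q y))"
| Alg_p: "l \<in> {1..m} \<Longrightarrow> Alg (\<lambda>w y. of_real (gauss_p (s l) y))"
| Alg_R: "l \<in> {1..m} \<Longrightarrow> Alg (\<lambda>w y. of_real (gauss_R (s l) y))"
| Alg_inv: "Alg (\<lambda>w y. inverse (gz w y))"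
| Alg_add: "Alg f \<Longrightarrow> Alg g \<Longrightarrow> Alg (\<lambda>w y. f w y + g w y)"
| Alg_mult: "Alg f \<Longrightarrow> Alg g \<Longrightarrow> Alg (\<lambda>w y. f w y * g w y)"

inductive Ideal :: "((nat \<Rightarrow> complex) \<Rightarrow> real \<Rightarrow> complex) \<Rightarrow> bool" where
 Ideal_p: "l \<in> {1..m} \<Longrightarrow> Ideal (\<lambda>w y. of_real (gauss_p (s l) y))"
| Ideal_qR: "l \<in> {1..m} \<Longrightarrow> Ideal (\<lambda>w y. of_real (gauss_q y * gauss_R (s l) y))"
| Ideal_zero: "Ideal (\<lambda>w y. 0)"
| Ideal_add: "Ideal f \<Longrightarrow> Ideal g \<Longrightarrow> Ideal (\<lambda>w y. f w y + g w y)"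
| Ideal_mult: "Alg f \<Longrightarrow> Ideal g \<Longrightarrow> Ideal (\<lambda>w y. f w y * g w y)"

lemma Ideal_sum: "finite A \<Longrightarrow> (\<And>l. l \<in> A \<Longrightarrow> Ideal (f l)) \<Longrightarrow> Ideal (\<lambda>w y. \<Sum>l\<in>A. f l w y)"
 by (induction A rule: finite_induct) (auto intro: Ideal_zero Ideal_add)

lemma Ideal_imp_Alg: "Ideal f \<Longrightarrow> Alg f"
proof (induction rule: Ideal.induct)
 case (Ideal_qR l)
 then have "Alg (\<lambda>w y. of_real (gauss_q y) * of_real (gauss_R (s l) y))"
  by (intro Alg_mult Alg_q Alg_R)
 then show ?case by simp
qed (auto intro: Alg.intros)

lemma Alg_of_real_add: "Alg (\<lambda>w y. of_real (f y)) \<Longrightarrow> Alg (\<lambda>w y. of_real (g y)) \<Longrightarrow>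
  Alg (\<lambda>w y. of_real (f y + g y))"
 using Alg_add by simp

lemma Alg_of_real_mult: "Alg (\<lambda>w y. of_real (f y)) \<Longrightarrow> Alg (\<lambda>w y. of_real (g y)) \<Longrightarrow>
  Alg (\<lambda>w y. of_real (f y * g y))"
 using Alg_mult by simp

lemma Alg_of_real_minus: "Alg (\<lambda>w y. of_real (f y)) \<Longrightarrow> Alg (\<lambda>w y. of_real (- f y))"
 using Alg_mult[OF Alg_const[of "-1"], of "\<lambda>w y. of_real (f y)"] by simp

lemma Alg_of_real_diff: "Alg (\<lambda>w y. of_real (f y)) \<Longrightarrow> Alg (\<lambda>w y. of_real (g y)) \<Longrightarrow>
  Alg (\<lambda>w y. of_real (f y - g y))"
 using Alg_of_real_add[OF _ Alg_of_real_minus, of f g] by simp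

lemma Alg_of_real_const: "Alg (\<lambda>w y. of_real c)" by (rule Alg_const)

lemma Alg_of_real_power: "Alg (\<lambda>w y. of_real (f y)) \<Longrightarrow> Alg (\<lambda>w y. of_real (f y ^ n))"
 by (induction n) (auto intro: Alg_const[of 1] Alg_mult)

lemma Alg_of_real_divide: "Alg (\<lambda>w y. of_real (f y)) \<Longrightarrow> Alg (\<lambda>w y. of_real (f y / c))"
 using Alg_of_real_mult[OF _ Alg_of_real_const, of f "1 / c"] by simp

lemmas Alg_real_intros = Alg_of_real_add Alg_of_real_mult Alg_of_real_minus Alg_of_real_diff
 Alg_of_real_power Alg_of_real_divide Alg_id Alg_q Alg_p Alg_R Alg_of_real_const

definition dgz :: "(nat \<Rightarrow> complex) \<Rightarrow> real \<Rightarrow> complex" where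
 "dgz w y = (\<Sum>l\<in>{1..m}. w l * (of_real (gauss_q y * gauss_R (s l) y) + (-1) * of_real (gauss_p (s l) y)))"

lemma gz_has_vector_derivative: "(gz w has_vector_derivative dgz w y) (at y)"
proof -
 have "((\<lambda>y. 1 + (\<Sum>l\<in>{1..m}. w l * of_real (gauss_R (s l) y))) has_vector_derivative
  0 + (\<Sum>l\<in>{1..m}. w l * of_real (gauss_q y * gauss_R (s l) y - gauss_p (s l) y))) (at y)"
  by (intro has_vector_derivative_add has_vector_derivative_const has_vector_derivative_sum
    has_vector_derivative_mult_right vector_derivative_of_real_comp DERIV_gauss_R)
 then show ?thesis by (simp add: gz_def[abs_def] dgz_def)
qed

lemma Ideal_dgz: "Ideal dgz"
proof -
 have "Ideal (\<lambda>w y. \<Sum>l\<in>{1..m}. w l * (of_real (gauss_q y * gauss_R (s l) y) + (-1) * of_real (gauss_p (s l) y)))"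
  by (intro Ideal_sum finite_atLeastAtMost Ideal_mult Alg_omega Ideal_add Ideal_qR Ideal_p Alg_const) auto
 then show ?thesis by (simp add: dgz_def[abs_def])
qed

definition deriv_of :: "((nat \<Rightarrow> complex) \<Rightarrow> real \<Rightarrow> complex) \<Rightarrow> ((nat \<Rightarrow> complex) \<Rightarrow> real \<Rightarrow> complex) \<Rightarrow> bool" where
 "deriv_of f' f \<longleftrightarrow> (\<forall>w\<in>Om. \<forall>y. (f w has_vector_derivative f' w y) (at y))"

lemma Alg_derivative: "Alg f \<Longrightarrow> \<exists>f'. Alg f' \<and> deriv_of f' f"
proof (induction rule: Alg.induct)
 case (Alg_const c)
 show ?case by (intro exI[of _ "\<lambda>w y. 0"] conjI Alg.Alg_const) (auto simp: deriv_of_def)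
next
 case (Alg_omega l)
 show ?case by (intro exI[of _ "\<lambda>w y. 0"] conjI Alg.Alg_const) (auto simp: deriv_of_def)
next
 case Alg_id
 show ?case
  by (intro exI[of _ "\<lambda>w y. 1"] conjI Alg.Alg_const)
   (use vector_derivative_of_real_comp[OF DERIV_ident] in \<open>auto simp: deriv_of_def\<close>)
next
 case Alg_q
 have "Alg (\<lambda>w y. of_real (gauss_q y * gauss_q y - 2 * y * gauss_q y))"
  by (intro Alg_real_intros)
 then show ?case using vector_derivative_of_real_comp[OF DERIV_gauss_q] by (auto simp: deriv_of_def)
next
 case (Alg_p l)
 then have "Alg (\<lambda>w y. of_real ((gauss_q y - 2 * y - 2 * s l) * gauss_p (s l) y))"
  by (intro Alg_real_intros)
 then show ?case using vector_derivative_of_real_comp[OF DERIV_gauss_p] by (auto simp: deriv_of_def)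
next
 case (Alg_R l)
 then have "Alg (\<lambda>w y. of_real (gauss_q y * gauss_R (s l) y - gauss_p (s l) y))"
  by (intro Alg_real_intros)
 then show ?case using vector_derivative_of_real_comp[OF DERIV_gauss_R] by (auto simp: deriv_of_def)
next
 case Alg_inv
 have "Alg (\<lambda>w y. dgz w y * ((-1) * (inverse (gz w y) * inverse (gz w y))))"
  by (intro Alg_mult Alg.Alg_inv Alg.Alg_const Ideal_imp_Alg Ideal_dgz)
 moreover have "((\<lambda>y. inverse (gz w y)) has_vector_derivative
   dgz w y * ((-1) * (inverse (gz w y) * inverse (gz w y)))) (at y)" if "w \<in> Om" for w y
 proof -
  have "(inverse has_field_derivative - (inverse (gz w y) ^ Suc (Suc 0))) (at (gz w y))"
   by (rule DERIV_inverse) (rule gz_nz[OF that])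
  from field_vector_diff_chain_at[OF gz_has_vector_derivative this]
  show ?thesis by (simp add: o_def)
 qed
 ultimately show ?case unfolding deriv_of_def by blast
next
 case (Alg_add f g)
 then obtain f' g' where "Alg f'" "Alg g'" "deriv_of f' f" "deriv_of g' g" by blast
 then show ?case
  by (intro exI[of _ "\<lambda>w y. f' w y + g' w y"] conjI Alg.Alg_add)
   (auto simp: deriv_of_def intro: has_vector_derivative_add)
next
 case (Alg_mult f g)
 then obtain f' g' where "Alg f'" "Alg g'" "deriv_of f' f" "deriv_of g' g" by blast
 with Alg_mult show ?case
  by (intro exI[of _ "\<lambda>w y. f w y * g' w y + f' w y * g w y"] conjI Alg.Alg_add Alg.Alg_mult)
   (auto simp: deriv_of_def intro: has_vector_derivative_mult)
qed

lemma Ideal_derivative: "Ideal f \<Longrightarrow> \<exists>f'. Ideal f' \<and> deriv_of f' f"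
proof (induction rule: Ideal.induct)
 case (Ideal_p l)
 have "Ideal (\<lambda>w y. of_real (gauss_q y - 2 * y - 2 * s l) * of_real (gauss_p (s l) y))"
  by (intro Ideal_mult Alg_real_intros Ideal.Ideal_p Ideal_p)
 then show ?case using vector_derivative_of_real_comp[OF DERIV_gauss_p]
  by (intro exI[of _ "\<lambda>w y. of_real (gauss_q y - 2 * y - 2 * s l) * of_real (gauss_p (s l) y)"])
   (auto simp: deriv_of_def)
next
 case (Ideal_qR l)
 have "Ideal (\<lambda>w y. of_real (2 * gauss_q y - 2 * y) * of_real (gauss_q y * gauss_R (s l) y) +
   of_real (- gauss_q y) * of_real (gauss_p (s l) y))"
  by (intro Ideal_add Ideal_mult Alg_real_intros Ideal.Ideal_p Ideal.Ideal_qR Ideal_qR)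
 moreover have "((\<lambda>y. complex_of_real (gauss_q y * gauss_R (s l) y)) has_vector_derivative
  of_real (2 * gauss_q y - 2 * y) * of_real (gauss_q y * gauss_R (s l) y) +
   of_real (- gauss_q y) * of_real (gauss_p (s l) y)) (at y)" for y
  using vector_derivative_of_real_comp[OF DERIV_mult[OF DERIV_gauss_q DERIV_gauss_R], of "s l" y]
  by (simp add: algebra_simps)
 ultimately show ?case unfolding deriv_of_def by blast
next
 case Ideal_zero
 show ?case by (intro exI[of _ "\<lambda>w y. 0"] conjI Ideal.Ideal_zero) (auto simp: deriv_of_def)
next
 case (Ideal_add f g)
 then obtain f' g' where "Ideal f'" "Ideal g'" "deriv_of f' f" "deriv_of g' g" by blast
 then show ?case
  by (intro exI[of _ "\<lambda>w y. f' w y + g' w y"] conjI Ideal.Ideal_add)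
   (auto simp: deriv_of_def intro: has_vector_derivative_add)
next
 case (Ideal_mult f g)
 then obtain f' g' where "Alg f'" "Ideal g'" "deriv_of f' f" "deriv_of g' g"
  using Alg_derivative by blast
 with Ideal_mult show ?case
  by (intro exI[of _ "\<lambda>w y. f w y * g' w y + f' w y * g w y"] conjI Ideal.Ideal_add Ideal.Ideal_mult)
   (auto simp: deriv_of_def intro: has_vector_derivative_mult)
qed

lemma Alg_bound: "Alg f \<Longrightarrow> \<exists>C\<ge>0. \<exists>N. \<forall>w\<in>Om. \<forall>y. cmod (f w y) \<le> C * (1 + abs y) ^ N"
proof (induction rule: Alg.induct)
 case (Alg_const c)
 show ?case by (intro exI[of _ "cmod c"] conjI exI[of _ 0]) auto
next
 case (Alg_omega l)
 then show ?case using B_nonneg Om_le by (intro exI[of _ B] conjI exI[of _ 0]) auto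
next
 case Alg_id
 show ?case by (intro exI[of _ 1] conjI) (auto intro!: exI[of _ 1])
next
 case Alg_q
 obtain C where "C \<ge> 0" "\<And>y. gauss_q y \<le> C * (1 + abs y)" using gauss_q_bound by blast
 then show ?case using gauss_q_pos by (intro exI[of _ C] conjI exI[of _ 1]) (auto simp: abs_of_pos)
next
 case (Alg_p l)
 obtain C where C: "C \<ge> 0" "\<And>y. gauss_p (s l) y \<le> C * (1 + abs y) * exp (- (2 * \<sigma> * abs y))"
  using gauss_p_bound[OF \<sigma>_pos \<sigma>_le[OF Alg_p]] by blast
 have "C * (1 + abs y) * exp (- (2 * \<sigma> * abs y)) \<le> C * (1 + abs y) * 1" for y
  using C(1) \<sigma>_pos by (intro mult_left_mono) auto
 with C have "gauss_p (s l) y \<le> C * (1 + abs y)" for y by (metis mult_1_right order.trans)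
 with C(1) show ?case using gauss_p_pos by (intro exI[of _ C] conjI exI[of _ 1]) (auto simp: abs_of_pos)
next
 case (Alg_R l)
 have "abs (gauss_R (s l) y) \<le> 1" for y
  using gauss_R_pos[of "s l" y] gauss_R_le_1[of "s l" y] s_pos[OF Alg_R] by auto
 then show ?case by (intro exI[of _ 1] conjI exI[of _ 0]) auto
next
 case Alg_inv
 have "cmod (inverse (gz w y)) \<le> inverse c0" if "w \<in> Om" for w y
  using norm_gz[OF that, of y] c0_pos by (simp add: norm_inverse le_imp_inverse_le)
 then show ?case using c0_pos by (intro exI[of _ "inverse c0"] conjI exI[of _ 0]) auto
next
 case (Alg_add f g)
 then obtain C N D M where C: "C \<ge> 0" "\<And>w y. w \<in> Om \<Longrightarrow> cmod (f w y) \<le> C * (1 + abs y) ^ N"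
  and D: "D \<ge> 0" "\<And>w y. w \<in> Om \<Longrightarrow> cmod (g w y) \<le> D * (1 + abs y) ^ M" by metis
 have "cmod (f w y + g w y) \<le> (C + D) * (1 + abs y) ^ (N + M)" if "w \<in> Om" for w y
 proof -
  have "cmod (f w y + g w y) \<le> C * (1 + abs y) ^ N + D * (1 + abs y) ^ M"
   using C(2)[OF that, of y] D(2)[OF that, of y] norm_triangle_ineq[of "f w y" "g w y"] by linarith
  also have "... \<le> C * (1 + abs y) ^ (N + M) + D * (1 + abs y) ^ (N + M)"
   using C(1) D(1) by (intro add_mono mult_left_mono power_increasing) auto
  finally show ?thesis by (simp add: distrib_right)
 qed
 then show ?case using C(1) D(1) by (intro exI[of _ "C + D"] conjI) auto
next
 case (Alg_mult f g)
 then obtain C N D M where C: "C \<ge> 0" "\<And>w y. w \<in> Om \<Longrightarrow> cmod (f w y) \<le> C * (1 + abs y) ^ N"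
  and D: "D \<ge> 0" "\<And>w y. w \<in> Om \<Longrightarrow> cmod (g w y) \<le> D * (1 + abs y) ^ M" by metis
 have "cmod (f w y * g w y) \<le> (C * D) * (1 + abs y) ^ (N + M)" if "w \<in> Om" for w y
 proof -
  have "cmod (f w y * g w y) \<le> (C * (1 + abs y) ^ N) * (D * (1 + abs y) ^ M)"
   unfolding norm_mult using C D that by (intro mult_mono) auto
  then show ?thesis by (simp add: power_add mult_ac)
 qed
 then show ?case using C(1) D(1) by (intro exI[of _ "C * D"] conjI) auto
qed

lemma Ideal_bound_poly: "Ideal f \<Longrightarrow>
 \<exists>C\<ge>0. \<exists>N. \<forall>w\<in>Om. \<forall>y. cmod (f w y) \<le> C * (1 + abs y) ^ N * exp (- (2 * \<sigma> * abs y))"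
proof (induction rule: Ideal.induct)
 case (Ideal_p l)
 obtain C where "C \<ge> 0" "\<And>y. gauss_p (s l) y \<le> C * (1 + abs y) * exp (- (2 * \<sigma> * abs y))"
  using gauss_p_bound[OF \<sigma>_pos \<sigma>_le[OF Ideal_p]] by blast
 then show ?case using gauss_p_pos by (intro exI[of _ C] conjI exI[of _ 1]) (auto simp: abs_of_pos)
next
 case (Ideal_qR l)
 obtain C where "C \<ge> 0" "\<And>y. gauss_q y * gauss_R (s l) y \<le> C * (1 + abs y) * exp (- (2 * \<sigma> * abs y))"
  using gauss_qR_bound[OF \<sigma>_pos \<sigma>_le[OF Ideal_qR]] by blast
 then show ?case using gauss_q_pos gauss_R_pos
  by (intro exI[of _ C] conjI exI[of _ 1]) (auto simp: abs_of_pos norm_mult)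
next
 case Ideal_zero
 show ?case by (intro exI[of _ 0] conjI exI[of _ 0]) auto
next
 case (Ideal_add f g)
 then obtain C N D M where C: "C \<ge> 0" "\<And>w y. w \<in> Om \<Longrightarrow> cmod (f w y) \<le> C * (1 + abs y) ^ N * exp (- (2 * \<sigma> * abs y))"
  and D: "D \<ge> 0" "\<And>w y. w \<in> Om \<Longrightarrow> cmod (g w y) \<le> D * (1 + abs y) ^ M * exp (- (2 * \<sigma> * abs y))" by metis
 have "cmod (f w y + g w y) \<le> (C + D) * (1 + abs y) ^ (N + M) * exp (- (2 * \<sigma> * abs y))" if "w \<in> Om" for w y
 proof -
  have "cmod (f w y + g w y) \<le> (C * (1 + abs y) ^ N + D * (1 + abs y) ^ M) * exp (- (2 * \<sigma> * abs y))"
   using C(2)[OF that, of y] D(2)[OF that, of y] norm_triangle_ineq[of "f w y" "g w y"]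
   unfolding distrib_right by linarith
  also have "... \<le> (C * (1 + abs y) ^ (N + M) + D * (1 + abs y) ^ (N + M)) * exp (- (2 * \<sigma> * abs y))"
   using C(1) D(1) by (intro mult_right_mono add_mono mult_left_mono power_increasing) auto
  finally show ?thesis by (simp add: distrib_right)
 qed
 then show ?case using C(1) D(1) by (intro exI[of _ "C + D"] conjI) auto
next
 case (Ideal_mult f g)
 then obtain C N D M where C: "C \<ge> 0" "\<And>w y. w \<in> Om \<Longrightarrow> cmod (f w y) \<le> C * (1 + abs y) ^ N"
  and D: "D \<ge> 0" "\<And>w y. w \<in> Om \<Longrightarrow> cmod (g w y) \<le> D * (1 + abs y) ^ M * exp (- (2 * \<sigma> * abs y))"
  using Alg_bound by metis
 have "cmod (f w y * g w y) \<le> (C * D) * (1 + abs y) ^ (N + M) * exp (- (2 * \<sigma> * abs y))" if "w \<in> Om" for w y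
 proof -
  have "cmod (f w y * g w y) \<le> (C * (1 + abs y) ^ N) * (D * (1 + abs y) ^ M * exp (- (2 * \<sigma> * abs y)))"
   unfolding norm_mult using C D that by (intro mult_mono) auto
  then show ?thesis by (simp add: power_add mult_ac)
 qed
 then show ?case using C(1) D(1) by (intro exI[of _ "C * D"] conjI) auto
qed

text \<open>Half of the rate \<open>2 * \<sigma>\<close> is spent on absorbing the polynomial; this
  is why \<open>decay\<close> has the rate \<open>\<sigma>\<close>.\<close>

lemma poly_exp_decay:
 "\<exists>C>0. \<forall>y. (1 + abs y) ^ N * exp (- (2 * \<sigma> * abs y)) \<le> C * decay y"
proof -
 obtain C where C: "C > 0" "\<And>y. 0 \<le> y \<Longrightarrow> (1 + y) ^ N \<le> C * exp (\<sigma> * y)"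
  using power_le_exp[OF \<sigma>_pos, of N] by metis
 have "(1 + abs y) ^ N * exp (- (2 * \<sigma> * abs y)) \<le> C * decay y" for y
 proof -
  have "(1 + abs y) ^ N * exp (- (2 * \<sigma> * abs y)) \<le> C * exp (\<sigma> * abs y) * exp (- (2 * \<sigma> * abs y))"
   using C(2)[of "abs y"] by (intro mult_right_mono) auto
  also have "... = C * decay y" by (simp add: mult.assoc exp_add[symmetric])
  finally show ?thesis .
 qed
 with C(1) show ?thesis by blast
qed

end

section \<open>Expansion of the wall masses\<close>

text \<open>\<open>wall_P1\<close> and \<open>wall_P2'\<close> are the coefficients of
  \<open>eps\<close> and \<open>eps^2\<close> in the exponent after removal of
  \<open>- 2 * y * t - t^2\<close>; \<open>wall_P2\<close> is the coefficient of
  \<open>eps^2\<close> once the exponential is expanded, whence the half square.\<close>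

definition wall_P1 :: "real \<Rightarrow> real \<Rightarrow> real" where
 "wall_P1 y t = t - 2 * (y\<^sup>2 * t) - y * t\<^sup>2 - 2/3 * t ^ 3"

definition wall_P2' :: "real \<Rightarrow> real \<Rightarrow> real" where
 "wall_P2' y t = t\<^sup>2 / 2 - 2 * (y ^ 3 * t) - y\<^sup>2 * t\<^sup>2 - 2/3 * (y * t ^ 3) - t ^ 4 / 2"

definition wall_P2 :: "real \<Rightarrow> real \<Rightarrow> real" where
 "wall_P2 y t = (wall_P1 y t)\<^sup>2 / 2 + wall_P2' y t"

text \<open>The value \<open>y = 0\<close> is the critical exponent \<open>2 / eps^2\<close>; in
  general the maximum of the weight lies near \<open>t = - y\<close>.\<close>

definition wall_exponent :: "real \<Rightarrow> real \<Rightarrow> real" where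
 "wall_exponent eps y = 2 / (eps\<^sup>2 * (1 - eps * y))"

lemma ln_one_minus_taylor4:
 fixes x :: real
 assumes "0 \<le> x" "x \<le> 1/2"
 shows "abs (ln (1 - x) + (x + x\<^sup>2/2 + x^3/3 + x^4/4)) \<le> x ^ 5"
proof -
 define g where "g = (\<lambda>x::real. ln (1 - x) + (x + x\<^sup>2/2 + x^3/3 + x^4/4))"
 have dg: "(g has_real_derivative - (z ^ 4 / (1 - z))) (at z)" if "z < 1" for z
  unfolding g_def using that
  by (auto intro!: derivative_eq_intros simp: divide_simps) (simp add: algebra_simps power_numeral_reduce)
 have "g x \<le> g 0"
  using assms dg by (intro DERIV_nonpos_imp_nonincreasing[of 0 x]) (auto intro!: exI dg)
 moreover have "g 0 + 0 ^ 5 \<le> g x + x ^ 5"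
 proof (rule DERIV_nonneg_imp_nondecreasing[of 0 x "\<lambda>x. g x + x ^ 5"])
  fix z assume z: "0 \<le> z" "z \<le> x"
  \<comment> \<open>The bound \<open>1/5\<close> for \<open>1 - z\<close> is chosen so that the
    quotient is at most \<open>5 * z ^ 4\<close>, the derivative of the comparison function
    \<open>z ^ 5\<close>.\<close>
  have "z ^ 4 / (1 - z) \<le> z ^ 4 / (1 / 5)"
   using z assms by (intro divide_left_mono) auto
  then show "\<exists>w. ((\<lambda>x. g x + x ^ 5) has_real_derivative w) (at z) \<and> 0 \<le> w"
   using z assms by (intro exI[of _ "- (z ^ 4 / (1 - z)) + 5 * z ^ 4"] conjI)
    (auto intro!: derivative_eq_intros dg)
 qed (use assms in auto)
 ultimately show ?thesis using assms by (simp add: g_def)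
qed

lemma ln_one_minus_le:
 fixes x :: real
 assumes "0 \<le> x" "x < 1"
 shows "ln (1 - x) \<le> - x - x\<^sup>2 / 2"
proof -
 have "ln (1 - x) + x + x\<^sup>2/2 \<le> ln (1 - 0) + 0 + 0\<^sup>2/2"
 proof (rule DERIV_nonpos_imp_nonincreasing[of 0 x "\<lambda>x. ln (1 - x) + x + x\<^sup>2/2"])
  fix z assume z: "0 \<le> z" "z \<le> x"
  then have "((\<lambda>x. ln (1 - x) + x + x\<^sup>2/2) has_real_derivative - (z\<^sup>2 / (1 - z))) (at z)"
   using assms by (auto intro!: derivative_eq_intros simp: divide_simps) (simp add: algebra_simps power2_eq_square)
  then show "\<exists>w. ((\<lambda>x. ln (1 - x) + x + x\<^sup>2/2) has_real_derivative w) (at z) \<and> w \<le> 0"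
   using z assms by (intro exI conjI) auto
 qed (use assms in auto)
 then show ?thesis by simp
qed

text \<open>One scale \<open>W\<close> bounds both variables, so that all polynomial estimates below
  reduce to counting degrees.\<close>

lemma monom_le:
 fixes y t W :: real
 assumes "abs y \<le> W" "0 \<le> t" "t \<le> W" "1 \<le> W" "i + j \<le> k"
 shows "abs (y ^ i * t ^ j) \<le> W ^ k"
proof -
 have "abs (y ^ i * t ^ j) = abs y ^ i * t ^ j" using assms by (simp add: abs_mult power_abs)
 also have "... \<le> W ^ i * W ^ j" using assms by (intro mult_mono power_mono) auto
 also have "... \<le> W ^ k" using assms by (simp add: power_add[symmetric] power_increasing)
 finally show ?thesis .
qed

lemma wall_P1_le:
 assumes "abs y \<le> W" "0 \<le> t" "t \<le> W" "1 \<le> W"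
 shows "abs (wall_P1 y t) \<le> 5 * W ^ 3"
 using monom_le[OF assms, of 0 1 3] monom_le[OF assms, of 2 1 3] monom_le[OF assms, of 1 2 3]
  monom_le[OF assms, of 0 3 3] unfolding wall_P1_def
 by (simp only: power_0 power_one_right mult_1) linarith

lemma wall_P2'_le:
 assumes "abs y \<le> W" "0 \<le> t" "t \<le> W" "1 \<le> W"
 shows "abs (wall_P2' y t) \<le> 5 * W ^ 4"
 using monom_le[OF assms, of 0 2 4] monom_le[OF assms, of 3 1 4] monom_le[OF assms, of 2 2 4]
  monom_le[OF assms, of 1 3 4] monom_le[OF assms, of 0 4 4] unfolding wall_P2'_def
 by (simp only: power_0 power_one_right mult_1) linarith

lemma wall_P2_le:
 assumes "abs y \<le> W" "0 \<le> t" "t \<le> W" "1 \<le> W"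
 shows "abs (wall_P2 y t) \<le> 18 * W ^ 6"
proof -
 have "(wall_P1 y t)\<^sup>2 \<le> (5 * W ^ 3)\<^sup>2"
  unfolding abs_le_square_iff[symmetric] using wall_P1_le[OF assms] assms by simp
 also have "... = 25 * W ^ 6" by (simp add: power_mult_distrib power_mult[symmetric])
 finally have "(wall_P1 y t)\<^sup>2 / 2 \<le> 25 / 2 * W ^ 6" by simp
 moreover have "W ^ 4 \<le> W ^ 6" using assms by (intro power_increasing) auto
 ultimately show ?thesis
  using wall_P2'_le[OF assms] zero_le_power2[of "wall_P1 y t"] unfolding wall_P2_def by linarith
qed

text \<open>The exact exponent, recentred by its Gaussian part, agrees to third order in \<open>eps\<close>
 with \<open>eps P1 + eps\<^sup>2 P2'\<close>: expand both \<open>1 / (1 - eps y)\<close> and \<open>ln (1 - eps t)\<close>.\<close>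

lemma wall_exponent_expansion:
 fixes eps y t :: real
 defines "W \<equiv> 1 + abs y + t"
 assumes eps: "0 < eps" "eps \<le> 1/8" and y: "abs (eps * y) \<le> 1/8" and t: "0 \<le> t" and W: "eps * W ^ 3 \<le> 1"
 shows "eps * t \<le> 1/4"
  and "\<bar>((wall_exponent eps y - 1) * ln (1 - eps * t) + 2 * t / eps + 2 * y * t + t\<^sup>2)
     - (eps * wall_P1 y t + eps\<^sup>2 * wall_P2' y t)\<bar> \<le> 17 * (eps ^ 3 * W ^ 5)"
proof -
 have W1: "1 \<le> W" "abs y \<le> W" "t \<le> W" using t by (auto simp: W_def)
 have "(eps * t) ^ 3 \<le> (eps * W) ^ 3" using W1 t eps by (intro power_mono) auto
 also have "... = eps\<^sup>2 * (eps * W ^ 3)" by (simp add: power_mult_distrib power_numeral_reduce)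
 also have "... \<le> (1/8)\<^sup>2 * 1" using eps W W1 by (intro mult_mono power_mono) auto
 also have "... = (1/4 :: real) ^ 3" by (simp add: power_numeral_reduce)
 finally have "(eps * t) ^ 3 \<le> (1/4) ^ 3" .
 then show x4: "eps * t \<le> 1/4" using eps t by (simp add: power_mono_iff)
 define x where "x = eps * t"
 have x: "0 \<le> x" "x \<le> 1/4" using x4 eps t by (auto simp: x_def)
 define e where "e = eps * y"
 have e: "abs e \<le> 1/8" using y by (simp add: e_def)
 define L where "L = - (x + x\<^sup>2/2 + x^3/3 + x^4/4)"
 define lam where "lam = 1 / (1 - e)"
 define lam3 where "lam3 = 1 + e + e\<^sup>2 + e ^ 3"
 have lamd: "lam - lam3 = e ^ 4 / (1 - e)" unfolding lam_def lam3_def using e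
  by (simp add: field_simps) (simp add: power_numeral_reduce algebra_simps)
 have lam: "0 \<le> lam" "lam \<le> 2" using e unfolding lam_def by (auto simp: field_simps)
 have a: "wall_exponent eps y = 2 * lam / eps\<^sup>2" by (simp add: wall_exponent_def lam_def e_def)
 have eW: "eps * W \<le> 1"
 proof -
  have "eps * W \<le> eps * W ^ 3" using eps W1 power_increasing[of 1 3 W] by (intro mult_left_mono) auto
  with W show ?thesis by linarith
 qed
 have l5: "abs (ln (1 - x) - L) \<le> x ^ 5"
  using ln_one_minus_taylor4[of x] x by (simp add: L_def)
 \<comment> \<open>With both series truncated this is an exact identity: all terms of order below
   \<open>eps ^ 3\<close> cancel, which is what defines \<open>wall_P1\<close> and
   \<open>wall_P2'\<close>.\<close>
 have poly: "(2 * lam3 / eps\<^sup>2 - 1) * L + 2 * t / eps + 2 * y * t + t\<^sup>2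
   - (eps * wall_P1 y t + eps\<^sup>2 * wall_P2' y t)
  = eps ^ 3 * ((t ^ 3 / 3 - (y * t ^ 4 / 2 + 2/3 * (y\<^sup>2 * t ^ 3) + y ^ 3 * t\<^sup>2))
    + eps * (t ^ 4 / 4 - (y\<^sup>2 * t ^ 4 / 2 + 2/3 * (y ^ 3 * t ^ 3)))
    - eps\<^sup>2 * (y ^ 3 * t ^ 4 / 2))"
  unfolding lam3_def L_def x_def e_def wall_P1_def wall_P2'_def using eps
  by (simp add: field_simps power_mult_distrib) (simp add: power_numeral_reduce algebra_simps)
 note mo = monom_le[OF W1(2) t W1(3) W1(1)]
 have p1: "abs (t ^ 3 / 3 - (y * t ^ 4 / 2 + 2/3 * (y\<^sup>2 * t ^ 3) + y ^ 3 * t\<^sup>2)) \<le> 5/2 * W ^ 5"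
  using mo[of 0 3 5] mo[of 1 4 5] mo[of 2 3 5] mo[of 3 2 5]
  by (simp only: power_0 power_one_right mult_1) linarith
 have p2: "abs (eps * (t ^ 4 / 4 - (y\<^sup>2 * t ^ 4 / 2 + 2/3 * (y ^ 3 * t ^ 3)))) \<le> 3/2 * W ^ 5"
 proof -
  have "abs (t ^ 4 / 4 - (y\<^sup>2 * t ^ 4 / 2 + 2/3 * (y ^ 3 * t ^ 3))) \<le> 3/2 * W ^ 6"
   using mo[of 0 4 6] mo[of 2 4 6] mo[of 3 3 6]
   by (simp only: power_0 power_one_right mult_1) linarith
  then have "abs (eps * (t ^ 4 / 4 - (y\<^sup>2 * t ^ 4 / 2 + 2/3 * (y ^ 3 * t ^ 3)))) \<le> eps * (3/2 * W ^ 6)"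
   using eps by (simp add: abs_mult)
  also have "... = 3/2 * W ^ 5 * (eps * W)" by (simp add: power_numeral_reduce)
  also have "... \<le> 3/2 * W ^ 5 * 1" using eW W1 by (intro mult_left_mono) auto
  finally show ?thesis by simp
 qed
 have p3: "abs (eps\<^sup>2 * (y ^ 3 * t ^ 4 / 2)) \<le> 1/2 * W ^ 5"
 proof -
  have "abs (eps\<^sup>2 * (y ^ 3 * t ^ 4 / 2)) \<le> eps\<^sup>2 * (1/2 * W ^ 7)"
   using mo[of 3 4 7] by (simp add: abs_mult mult_left_mono)
  also have "... = 1/2 * W ^ 5 * (eps * W)\<^sup>2" by (simp add: power_numeral_reduce)
  also have "... \<le> 1/2 * W ^ 5 * 1" using eW W1 eps by (intro mult_left_mono power_le_one) auto
  finally show ?thesis by simp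
 qed
 have T1: "\<bar>(2 * lam3 / eps\<^sup>2 - 1) * L + 2 * t / eps + 2 * y * t + t\<^sup>2
   - (eps * wall_P1 y t + eps\<^sup>2 * wall_P2' y t)\<bar> \<le> eps ^ 3 * (5 * W ^ 5)"
 proof -
  have "0 \<le> W ^ 5" using W1 by simp
  then have "\<bar>t ^ 3 / 3 - (y * t ^ 4 / 2 + 2/3 * (y\<^sup>2 * t ^ 3) + y ^ 3 * t\<^sup>2)
    + eps * (t ^ 4 / 4 - (y\<^sup>2 * t ^ 4 / 2 + 2/3 * (y ^ 3 * t ^ 3)))
    - eps\<^sup>2 * (y ^ 3 * t ^ 4 / 2)\<bar> \<le> 5 * W ^ 5"
   using p1 p2 p3 by linarith
  then show ?thesis unfolding poly abs_mult using eps by (intro mult_mono) auto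
 qed
 have T2: "abs ((2 / eps\<^sup>2) * (lam - lam3) * L) \<le> 8 * (eps ^ 3 * W ^ 5)"
 proof -
  have "abs (lam - lam3) \<le> 2 * e ^ 4"
  proof -
   have "e ^ 4 / (1 - e) \<le> e ^ 4 / (1/2)" using e by (intro divide_left_mono) auto
   then show ?thesis unfolding lamd using e by (simp add: abs_of_nonneg)
  qed
  moreover have "abs L \<le> 2 * x"
  proof -
   have "x\<^sup>2 \<le> 1/4 * x" using mult_right_mono[of x "1/4" x] x by (simp add: power2_eq_square)
   moreover have "x ^ 3 \<le> x\<^sup>2" "x ^ 4 \<le> x\<^sup>2"
    using power_decreasing[of 2 3 x] power_decreasing[of 2 4 x] x by auto
   moreover have "0 \<le> x\<^sup>2" "0 \<le> x ^ 3" "0 \<le> x ^ 4" using x by auto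
   ultimately show ?thesis using x unfolding L_def by linarith
  qed
  ultimately have "abs ((2 / eps\<^sup>2) * (lam - lam3) * L) \<le> (2 / eps\<^sup>2) * (2 * e ^ 4) * (2 * x)"
   unfolding abs_mult by (intro mult_mono) auto
  also have "... = 8 * (eps ^ 3 * (y ^ 4 * t))" using eps
   by (simp add: e_def x_def field_simps power_numeral_reduce)
  also have "... \<le> 8 * (eps ^ 3 * W ^ 5)" using mo[of 4 1 5] eps by (intro mult_left_mono) auto
  finally show ?thesis .
 qed
 have T3: "abs ((2 * lam / eps\<^sup>2 - 1) * (ln (1 - x) - L)) \<le> 4 * (eps ^ 3 * W ^ 5)"
 proof -
  have "1 / 2 \<le> lam" using e unfolding lam_def by (auto simp: field_simps)
  moreover have "eps\<^sup>2 \<le> 1" using eps by (intro power_le_one) auto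
  ultimately have "1 \<le> 2 * lam / eps\<^sup>2" using eps by (simp add: field_simps)
  moreover have "2 * lam / eps\<^sup>2 \<le> 2 * 2 / eps\<^sup>2" using lam by (intro divide_right_mono) auto
  ultimately have "abs (2 * lam / eps\<^sup>2 - 1) \<le> 4 / eps\<^sup>2" by simp
  then have "abs ((2 * lam / eps\<^sup>2 - 1) * (ln (1 - x) - L)) \<le> 4 / eps\<^sup>2 * x ^ 5"
   unfolding abs_mult using l5 by (intro mult_mono) auto
  also have "... = 4 * (eps ^ 3 * t ^ 5)" using eps by (simp add: x_def field_simps power_numeral_reduce)
  also have "... \<le> 4 * (eps ^ 3 * W ^ 5)" using W1 t eps by (intro mult_left_mono power_mono) auto
  finally show ?thesis .
 qed
 \<comment> \<open>The error splits into the polynomial remainder, the tail of the geometric series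
   and the tail of the logarithm, with constants \<open>5 + 8 + 4 = 17\<close>.\<close>
 have "((wall_exponent eps y - 1) * ln (1 - eps * t) + 2 * t / eps + 2 * y * t + t\<^sup>2)
     - (eps * wall_P1 y t + eps\<^sup>2 * wall_P2' y t)
  = ((2 * lam3 / eps\<^sup>2 - 1) * L + 2 * t / eps + 2 * y * t + t\<^sup>2
   - (eps * wall_P1 y t + eps\<^sup>2 * wall_P2' y t))
   + (2 / eps\<^sup>2) * (lam - lam3) * L + (2 * lam / eps\<^sup>2 - 1) * (ln (1 - x) - L)"
  unfolding a x_def[symmetric] by (simp add: algebra_simps diff_divide_distrib)
 note split = this
 show "\<bar>((wall_exponent eps y - 1) * ln (1 - eps * t) + 2 * t / eps + 2 * y * t + t\<^sup>2)
     - (eps * wall_P1 y t + eps\<^sup>2 * wall_P2' y t)\<bar> \<le> 17 * (eps ^ 3 * W ^ 5)"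
 proof -
  have tri: "abs (x + y + z) \<le> a + b + c" if "abs x \<le> a" "abs y \<le> b" "abs z \<le> c" for x y z a b c :: real
   using that by linarith
  show ?thesis unfolding split by (rule order.trans[OF tri[OF T1 T2 T3]]) simp
 qed
qed

lemma exp_taylor3:
 fixes B :: real
 shows "abs (exp B - (1 + B + B\<^sup>2 / 2)) \<le> exp \<bar>B\<bar> * abs B ^ 3"
proof -
 obtain t where t: "abs t \<le> abs B" "exp B = (\<Sum>m<3. B ^ m / fact m) + exp t / fact 3 * B ^ 3"
  using Maclaurin_exp_le[of B 3] by auto
 have "exp B - (1 + B + B\<^sup>2 / 2) = exp t / 6 * B ^ 3"
  unfolding t(2) by (simp add: numeral_eq_Suc)
 then have "abs (exp B - (1 + B + B\<^sup>2 / 2)) = exp t / 6 * abs B ^ 3"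
  by (simp only: abs_mult power_abs) simp
 also have "... \<le> exp \<bar>B\<bar> * abs B ^ 3"
 proof (intro mult_right_mono)
  have "exp t \<le> exp \<bar>B\<bar>" using t(1) by simp
  then show "exp t / 6 \<le> exp \<bar>B\<bar>" using exp_gt_zero[of "abs B"] by linarith
 qed auto
 finally show ?thesis .
qed

text \<open>The effective small parameter is \<open>E = eps * W ^ 3\<close>, since each order in
  \<open>eps\<close> comes with at most three powers of \<open>W\<close>. For \<open>E <= 1\<close>
  the correction \<open>B\<close> to the exponent is bounded and the third order Taylor formula for
  \<open>exp\<close> applies.\<close>

lemma wall_density_expansion_near:
 fixes eps y t :: real
 defines "W \<equiv> 1 + abs y + t"
 assumes eps: "0 < eps" "eps \<le> 1/8" and y: "abs (eps * y) \<le> 1/8" and t: "0 \<le> t" and W: "eps * W ^ 3 \<le> 1"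
 shows "\<bar>exp (- y\<^sup>2) * wall_density eps (wall_exponent eps y) t
     - exp (- (y + t)\<^sup>2) * (1 + eps * wall_P1 y t + eps\<^sup>2 * wall_P2 y t)\<bar>
  \<le> (exp 27 * 27 ^ 3 + 400) * (eps ^ 3 * W ^ 9 * exp (- (y + t)\<^sup>2))"
proof -
 have W1: "1 \<le> W" "abs y \<le> W" "t \<le> W" using t by (auto simp: W_def)
 define p where "p = eps * wall_P1 y t"
 define p' where "p' = eps\<^sup>2 * wall_P2' y t"
 define B where "B = (wall_exponent eps y - 1) * ln (1 - eps * t) + 2 * t / eps + 2 * y * t + t\<^sup>2"
 define E where "E = eps * W ^ 3"
 have E: "0 \<le> E" "E \<le> 1" using eps W W1 by (auto simp: E_def)
 have E3: "E ^ 3 = eps ^ 3 * W ^ 9" by (simp add: E_def power_mult_distrib power_mult[symmetric])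
 have small: "eps * t \<le> 1/4" and Bp: "abs (B - (p + p')) \<le> 17 * (eps ^ 3 * W ^ 5)"
  using wall_exponent_expansion[OF eps y t W[unfolded W_def]] by (simp_all add: B_def p_def p'_def W_def)
 have pw: "W ^ i \<le> W ^ j" if "i \<le> j" for i j using that W1 by (intro power_increasing) auto
 have p: "abs p \<le> 5 * E"
  using wall_P1_le[OF W1(2) t W1(3,1)] eps by (simp add: p_def abs_mult E_def)
 have p': "abs p' \<le> 5 * (eps\<^sup>2 * W ^ 4)"
  using wall_P2'_le[OF W1(2) t W1(3,1)] eps by (simp add: p'_def abs_mult)
 have e2: "eps\<^sup>2 * W ^ 4 \<le> E\<^sup>2"
  using pw[of 4 6] eps by (simp add: E_def power_mult_distrib power_mult[symmetric])
 have e3: "eps ^ 3 * W ^ 5 \<le> E ^ 3"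
  using pw[of 5 9] eps by (simp add: E3)
 have E21: "E\<^sup>2 \<le> E" "E ^ 3 \<le> E" "E ^ 3 \<le> E\<^sup>2"
  using power_decreasing[of 1 2 E] power_decreasing[of 1 3 E] power_decreasing[of 2 3 E] E by auto
 have e32: "eps ^ 3 * W ^ 5 \<le> eps\<^sup>2 * W ^ 4"
 proof -
  have "eps * W \<le> 1"
  proof -
   have "eps * W \<le> eps * W ^ 3" using eps pw[of 1 3] by (intro mult_left_mono) auto
   with W show ?thesis by linarith
  qed
  then have "(eps\<^sup>2 * W ^ 4) * (eps * W) \<le> (eps\<^sup>2 * W ^ 4) * 1" by (intro mult_left_mono) auto
  then show ?thesis by (simp add: power_numeral_reduce mult_ac)
 qed
 \<comment> \<open>The constant is \<open>5 + 5 + 17\<close>, from \<open>p\<close>,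
   \<open>p'\<close> and the remainder of the exponent.\<close>
 have absB: "abs B \<le> 27 * E" using p p' Bp e2 e3 E21 by linarith
 then have absB1: "abs B \<le> 27" using E by linarith
 have r: "abs (exp B - (1 + B + B\<^sup>2 / 2)) \<le> exp 27 * 27 ^ 3 * E ^ 3"
 proof -
  have "exp \<bar>B\<bar> * abs B ^ 3 \<le> exp 27 * (27 * E) ^ 3"
   using absB absB1 by (intro mult_mono power_mono) auto
  with exp_taylor3[of B] show ?thesis by (simp add: power_mult_distrib)
 qed
 have sq: "abs (B\<^sup>2 / 2 - p\<^sup>2 / 2) \<le> 352 * E ^ 3"
 proof -
  have "abs (B - p) \<le> 22 * (eps\<^sup>2 * W ^ 4)" using Bp p' e32 by linarith
  moreover have "abs (B + p) \<le> 32 * E" using absB p by linarith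
  ultimately have "abs (B - p) * abs (B + p) \<le> (22 * (eps\<^sup>2 * W ^ 4)) * (32 * E)"
   using E by (intro mult_mono) auto
  also have "... \<le> (22 * E\<^sup>2) * (32 * E)" using e2 E by (intro mult_right_mono mult_left_mono) auto
  finally have "abs ((B - p) * (B + p)) \<le> 704 * E ^ 3" by (simp add: abs_mult power_numeral_reduce)
  moreover have "B\<^sup>2 / 2 - p\<^sup>2 / 2 = (B - p) * (B + p) / 2" by (simp add: power2_eq_square algebra_simps)
  ultimately show ?thesis by simp
 qed
 have "exp (- y\<^sup>2) * wall_density eps (wall_exponent eps y) t = exp (- (y + t)\<^sup>2) * exp B"
 proof -
  have pos: "0 < 1 - eps * t" using small by simp
  then have "wall_density eps (wall_exponent eps y) t = exp ((wall_exponent eps y - 1) * ln (1 - eps * t)) * exp (2 * t / eps)"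
   by (simp add: wall_density_def powr_def max_def)
  then show ?thesis
   by (simp add: exp_add[symmetric] B_def power2_sum algebra_simps)
 qed
 then have "exp (- y\<^sup>2) * wall_density eps (wall_exponent eps y) t
     - exp (- (y + t)\<^sup>2) * (1 + eps * wall_P1 y t + eps\<^sup>2 * wall_P2 y t)
  = exp (- (y + t)\<^sup>2) * (exp B - (1 + p + (p\<^sup>2 / 2 + p')))"
  by (simp add: p_def p'_def wall_P2_def algebra_simps power_mult_distrib)
 moreover have "abs (exp B - (1 + p + (p\<^sup>2 / 2 + p'))) \<le> (exp 27 * 27 ^ 3 + 400) * E ^ 3"
 proof -
  have "exp B - (1 + p + (p\<^sup>2 / 2 + p')) = (exp B - (1 + B + B\<^sup>2 / 2)) + (B\<^sup>2 / 2 - p\<^sup>2 / 2) + (B - (p + p'))"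
   by simp
  then have "abs (exp B - (1 + p + (p\<^sup>2 / 2 + p'))) \<le> exp 27 * 27 ^ 3 * E ^ 3 + 352 * E ^ 3 + 17 * E ^ 3"
   using r sq Bp e3 by linarith
  moreover have "(exp 27 * 27 ^ 3 + 400) * E ^ 3 = exp 27 * 27 ^ 3 * E ^ 3 + 400 * E ^ 3"
   by (rule distrib_right)
  ultimately show ?thesis using zero_le_power[OF E(1), of 3] by linarith
 qed
 ultimately show ?thesis
  by (simp add: abs_mult E3 mult_ac mult_left_mono)
qed

text \<open>Where \<open>eps * W ^ 3 >= 1\<close> nothing can be expanded, but \<open>t\<close> then
  dominates \<open>y\<close> and the density and its approximation are each small. The factor
  \<open>eps ^ 3 * W ^ 9\<close>, which is at least \<open>1\<close>, is inserted to give the bound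
  the shape of the near one.\<close>

lemma wall_density_expansion_far:
 fixes eps y t :: real
 defines "W \<equiv> 1 + abs y + t"
 assumes eps: "0 < eps" "eps \<le> 1/8" and y: "abs (eps * y) \<le> 1/8" and t: "0 \<le> t" and W: "1 \<le> eps * W ^ 3"
  and yW: "100 * (1 + abs y) \<le> W"
 shows "\<bar>exp (- y\<^sup>2) * wall_density eps (wall_exponent eps y) t
     - exp (- (y + t)\<^sup>2) * (1 + eps * wall_P1 y t + eps\<^sup>2 * wall_P2 y t)\<bar>
  \<le> 24 * (eps ^ 3 * W ^ 9 * exp (- (y + t)\<^sup>2)) + eps ^ 3 * W ^ 9 * (exp (- 2 * y\<^sup>2) * exp (- t\<^sup>2 / 4))"
proof -
 have W1: "1 \<le> W" "abs y \<le> W" "t \<le> W" using t by (auto simp: W_def)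
 define E where "E = eps * W ^ 3"
 have E: "1 \<le> E" using W by (auto simp: E_def)
 have E3: "E ^ 3 = eps ^ 3 * W ^ 9" by (simp add: E_def power_mult_distrib power_mult[symmetric])
 have E21: "E\<^sup>2 \<le> E ^ 3" "E \<le> E ^ 3" "1 \<le> E ^ 3"
  using power_increasing[of 2 3 E] power_increasing[of 1 3 E] power_increasing[of 0 3 E] E by auto
 have "abs (1 + eps * wall_P1 y t + eps\<^sup>2 * wall_P2 y t) \<le> 24 * E ^ 3"
 proof -
  have "abs (eps * wall_P1 y t) \<le> 5 * E"
   using wall_P1_le[OF W1(2) t W1(3,1)] eps by (simp add: abs_mult E_def)
  moreover have "abs (eps\<^sup>2 * wall_P2 y t) \<le> 18 * E\<^sup>2"
   using wall_P2_le[OF W1(2) t W1(3,1)] eps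
   by (simp add: abs_mult E_def power_mult_distrib power_mult[symmetric])
  ultimately show ?thesis using E21 by linarith
 qed
 then have 1: "abs (exp (- (y + t)\<^sup>2) * (1 + eps * wall_P1 y t + eps\<^sup>2 * wall_P2 y t)) \<le> 24 * (eps ^ 3 * W ^ 9 * exp (- (y + t)\<^sup>2))"
  by (simp add: abs_mult E3[symmetric] mult_ac mult_left_mono)
 have ty: "99 * (1 + abs y) \<le> t" using yW by (simp add: W_def)
 then have ty': "99 * abs y \<le> t" "99 \<le> t" by (auto simp: )
 have 2: "exp (- y\<^sup>2) * wall_density eps (wall_exponent eps y) t \<le> exp (- 2 * y\<^sup>2) * exp (- t\<^sup>2 / 4)"
 proof (cases "t < 1 / eps")
  case False
  then show ?thesis using eps by (simp add: wall_density_eq_0)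
 next
  case True
  then have x: "0 \<le> eps * t" "eps * t < 1" using eps t by (auto simp: field_simps)
  define lam where "lam = 1 / (1 - eps * y)"
  have lam: "8/9 \<le> lam" "lam \<le> 8/7" using y unfolding lam_def by (auto simp: field_simps)
  have a: "wall_exponent eps y = 2 * lam / eps\<^sup>2" by (simp add: wall_exponent_def lam_def)
  have "eps\<^sup>2 \<le> (1/8)\<^sup>2" using eps by (intro power_mono) auto
  then have eps2: "eps\<^sup>2 \<le> 1/64" by (simp add: power2_eq_square)
  have a1: "1 \<le> wall_exponent eps y" unfolding a using lam eps eps2 by (simp add: field_simps)
  have lamy: "2 / eps * (lam - 1) = 2 * y * lam" unfolding lam_def using eps y by (simp add: field_simps)
  have "(wall_exponent eps y - 1) * ln (1 - eps * t) + 2 * t / eps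
    \<le> (wall_exponent eps y - 1) * (- (eps * t) - (eps * t)\<^sup>2 / 2) + 2 * t / eps"
   using a1 ln_one_minus_le[OF x] by (intro add_right_mono mult_left_mono) auto
  also have "... = - (2 / eps * (lam - 1)) * t - lam * t\<^sup>2 + eps * t + eps\<^sup>2 * t\<^sup>2 / 2"
   unfolding a using eps by (simp add: field_simps power2_eq_square)
  also have "... = - (2 * y * lam) * t - lam * t\<^sup>2 + eps * t + eps\<^sup>2 * t\<^sup>2 / 2" unfolding lamy ..
  \<comment> \<open>The quadratic term \<open>- lam * t^2\<close> with \<open>lam >= 8/9\<close>
    dominates: by \<open>99 * abs y <= t\<close> the cross term is at most
    \<open>16/693 * t^2\<close>, and the two \<open>eps\<close> terms are at most
    \<open>1/8 * t^2\<close> and \<open>1/128 * t^2\<close>.\<close>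
  also have "... \<le> - (1/2) * t\<^sup>2"
  proof -
   have "- (2 * y * lam) * t \<le> abs (2 * y * lam) * t" using t by (intro mult_right_mono) auto
   also have "abs (2 * y * lam) * t \<le> (2 * (t/99) * (8/7)) * t"
    proof (intro mult_right_mono t)
     have "abs y * lam \<le> (t/99) * (8/7)" using lam ty' t by (intro mult_mono) auto
     moreover have "abs (2 * y * lam) = 2 * (abs y * lam)" using lam by (simp add: abs_mult)
     ultimately show "abs (2 * y * lam) \<le> 2 * (t/99) * (8/7)" by linarith
    qed
   finally have "- (2 * y * lam) * t \<le> 16/693 * t\<^sup>2" by (simp add: power2_eq_square)
   moreover have "8/9 * t\<^sup>2 \<le> lam * t\<^sup>2" using lam by (intro mult_right_mono) auto
   moreover have "eps * t \<le> 1/8 * t\<^sup>2"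
   proof -
    have "t \<le> t\<^sup>2" using ty' by (simp add: power2_eq_square)
    then show ?thesis using eps t by (intro mult_mono) auto
   qed
   moreover have "eps\<^sup>2 * t\<^sup>2 \<le> 1/64 * t\<^sup>2" using eps2 by (intro mult_right_mono) auto
   ultimately show ?thesis using zero_le_power2[of t] by linarith
  qed
  finally have ex: "(wall_exponent eps y - 1) * ln (1 - eps * t) + 2 * t / eps \<le> - (1/2) * t\<^sup>2" .
  have y2: "y\<^sup>2 \<le> t\<^sup>2 / 4"
  proof -
   have "\<bar>y\<bar>\<^sup>2 \<le> (t / 2)\<^sup>2" using ty' t by (intro power_mono) auto
   then show ?thesis by (simp add: power_divide)
  qed
  have "wall_density eps (wall_exponent eps y) t = exp ((wall_exponent eps y - 1) * ln (1 - eps * t) + 2 * t / eps)"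
   using x by (simp add: wall_density_def powr_def max_def exp_add)
  then have "exp (- y\<^sup>2) * wall_density eps (wall_exponent eps y) t \<le> exp (- y\<^sup>2) * exp (- (1/2) * t\<^sup>2)"
   using ex by (intro mult_left_mono) auto
  also have "... \<le> exp (- 2 * y\<^sup>2) * exp (- t\<^sup>2 / 4)"
   using y2 by (simp add: exp_add[symmetric])
  finally show ?thesis .
 qed
 also have "... \<le> E ^ 3 * (exp (- 2 * y\<^sup>2) * exp (- t\<^sup>2 / 4))"
  using mult_right_mono[OF E21(3), of "exp (- 2 * y\<^sup>2) * exp (- t\<^sup>2 / 4)"] by simp
 finally have 3: "exp (- y\<^sup>2) * wall_density eps (wall_exponent eps y) t \<le> eps ^ 3 * W ^ 9 * (exp (- 2 * y\<^sup>2) * exp (- t\<^sup>2 / 4))"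
  by (simp add: E3)
 have "0 \<le> exp (- y\<^sup>2) * wall_density eps (wall_exponent eps y) t" by (simp add: wall_density_nonneg)
 with 1 3 show ?thesis by linarith
qed

text \<open>The admissible range of \<open>y\<close>; the exponent 50 is generous, and makes every power of
 \<open>1 + abs y\<close> that occurs below negligible against \<open>1 / eps\<close>.\<close>

definition wall_range :: "real \<Rightarrow> real \<Rightarrow> bool" where
 "wall_range eps y \<longleftrightarrow> 0 < eps \<and> eps * (1 + abs y) ^ 50 \<le> 1 / 10 ^ 6"

lemma wall_range_le:
 assumes "wall_range eps y" "k \<le> 50"
 shows "eps * (1 + abs y) ^ k \<le> 1 / 10 ^ 6"
proof -
 have "eps * (1 + abs y) ^ k \<le> eps * (1 + abs y) ^ 50"
  using assms by (intro mult_left_mono power_increasing) (auto simp: wall_range_def)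
 then show ?thesis using assms(1) unfolding wall_range_def by linarith
qed

text \<open>The two regimes are complementary once \<open>eps * W ^ 3 > 1\<close> is known to imply
  \<open>100 * (1 + abs y) <= W\<close>; this is what the constant \<open>10 ^ 6\<close>, the cube
  of \<open>100\<close>, in \<open>wall_range\<close> is for.\<close>

lemma wall_density_expansion:
 fixes eps y t :: real
 defines "W \<equiv> 1 + abs y + t"
 assumes range: "wall_range eps y" and t: "0 \<le> t"
 shows "\<bar>exp (- y\<^sup>2) * wall_density eps (wall_exponent eps y) t
     - exp (- (y + t)\<^sup>2) * (1 + eps * wall_P1 y t + eps\<^sup>2 * wall_P2 y t)\<bar>
  \<le> (exp 27 * 27 ^ 3 + 400) * (eps ^ 3 * (W ^ 9 * exp (- (y + t)\<^sup>2) + W ^ 9 * (exp (- 2 * y\<^sup>2) * exp (- t\<^sup>2 / 4))))"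
proof -
 have eps: "0 < eps" using range by (simp add: wall_range_def)
 have eps1: "eps \<le> 1/8" using wall_range_le[OF range, of 0] by simp
 have "abs (eps * y) \<le> eps * (1 + abs y) ^ 1" using eps by (simp add: abs_mult)
 also have "... \<le> 1/8" using wall_range_le[OF range, of 1] by simp
 finally have y: "abs (eps * y) \<le> 1/8" .
 have W1: "1 \<le> W" using t by (auto simp: W_def)
 define c :: real where "c = exp 27 * 27 ^ 3 + 400"
 have c: "24 \<le> c" "1 \<le> c" unfolding c_def by (auto simp: add_increasing)
 have nn: "0 \<le> eps ^ 3 * (W ^ 9 * exp (- (y + t)\<^sup>2))" "0 \<le> eps ^ 3 * (W ^ 9 * (exp (- 2 * y\<^sup>2) * exp (- t\<^sup>2 / 4)))"
  using eps W1 by auto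
 show ?thesis
 proof (cases "eps * W ^ 3 \<le> 1")
  case True
  have "c * 0 \<le> c * (eps ^ 3 * (W ^ 9 * (exp (- 2 * y\<^sup>2) * exp (- t\<^sup>2 / 4))))"
   using nn c by (intro mult_left_mono) auto
  then show ?thesis
   using wall_density_expansion_near[OF eps eps1 y t True[unfolded W_def]]
   unfolding c_def[symmetric] W_def[symmetric] distrib_left by (simp only: mult.assoc)
 next
  case False
  have "100 * (1 + abs y) \<le> W"
  proof -
   have "eps * (100 * (1 + abs y)) ^ 3 = 10 ^ 6 * (eps * (1 + abs y) ^ 3)"
    unfolding power_mult_distrib by simp
   also have "... \<le> 1" using wall_range_le[OF range, of 3] by simp
   also have "... \<le> eps * W ^ 3" using False by simp
   finally have "(100 * (1 + abs y)) ^ 3 \<le> W ^ 3" using eps by simp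
   then show ?thesis using W1 by (simp add: power_mono_iff)
  qed
  then have "\<bar>exp (- y\<^sup>2) * wall_density eps (wall_exponent eps y) t
     - exp (- (y + t)\<^sup>2) * (1 + eps * wall_P1 y t + eps\<^sup>2 * wall_P2 y t)\<bar>
  \<le> 24 * (eps ^ 3 * (W ^ 9 * exp (- (y + t)\<^sup>2))) + 1 * (eps ^ 3 * (W ^ 9 * (exp (- 2 * y\<^sup>2) * exp (- t\<^sup>2 / 4))))"
   using wall_density_expansion_far[OF eps eps1 y t] False unfolding W_def by (simp add: mult.assoc)
  also have "... \<le> c * (eps ^ 3 * (W ^ 9 * exp (- (y + t)\<^sup>2))) + c * (eps ^ 3 * (W ^ 9 * (exp (- 2 * y\<^sup>2) * exp (- t\<^sup>2 / 4))))"
   using nn c by (intro add_mono mult_right_mono)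
  finally show ?thesis unfolding c_def[symmetric] by (simp add: distrib_left)
 qed
qed

section \<open>Integration of the correction terms\<close>

text \<open>These polynomials come from integrating by parts against
  \<open>exp (- (y + t)^2)\<close>: \<open>wall_c1\<close> and \<open>wall_c2\<close> multiply the
  remaining Gaussian tail, \<open>wall_Q1\<close> and \<open>wall_Q2\<close> the boundary term. The
  part \<open>wall_c1 * wall_Q1\<close> is split off from \<open>wall_Q2\<close> because it cancels
  in the quotient of masses, and \<open>wall_S2\<close> is what survives in
  \<open>g2\<close>.\<close>

definition wall_Q1 :: "real \<Rightarrow> real \<Rightarrow> real" where
 "wall_Q1 s y = - (5 * y\<^sup>2 + s * y + 2 * s\<^sup>2 - 1) / 6"
definition wall_c1 :: "real \<Rightarrow> real" where
 "wall_c1 y = (10 * y ^ 3 - 3 * y) / 6"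
definition wall_S2 :: "real \<Rightarrow> real \<Rightarrow> real" where
 "wall_S2 s y = (50 * y ^ 5 + 70 * y ^ 4 * s + y ^ 3 * (62 * s\<^sup>2 - 73) + y\<^sup>2 * s * (50 * s\<^sup>2 - 33)
  - y * (3 + 18 * s\<^sup>2 - 16 * s ^ 4) + s * (3 - 22 * s\<^sup>2 + 8 * s ^ 4)) / 72"
definition wall_c2 :: "real \<Rightarrow> real" where
 "wall_c2 y = 1/24 - y\<^sup>2 / 8 + 4/3 * y ^ 4 + 25/18 * y ^ 6"
definition wall_Q2 :: "real \<Rightarrow> real \<Rightarrow> real" where
 "wall_Q2 s y = wall_S2 s y + wall_c1 y * wall_Q1 s y"

lemma DERIV_wall_Q1:
 "((\<lambda>t. - (wall_Q1 t y * exp (- (y + t)\<^sup>2))) has_real_derivative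
  (wall_P1 y t - wall_c1 y) * exp (- (y + t)\<^sup>2)) (at t)"
 unfolding wall_Q1_def wall_P1_def wall_c1_def
 by (rule derivative_eq_intros refl | simp)+ (simp add: field_simps power2_eq_square power3_eq_cube)

lemma DERIV_wall_Q2:
 "((\<lambda>t. - (wall_Q2 t y * exp (- (y + t)\<^sup>2))) has_real_derivative
  (wall_P2 y t - wall_c2 y) * exp (- (y + t)\<^sup>2)) (at t)"
proof -
 define dQ where "dQ = (70 * y ^ 4 + 124 * y ^ 3 * t + y\<^sup>2 * (150 * t\<^sup>2 - 33)
  - y * (36 * t - 64 * t ^ 3) + (3 - 66 * t\<^sup>2 + 40 * t ^ 4)) / 72 + wall_c1 y * (- (y + 4 * t) / 6)"
 have "((\<lambda>t. wall_Q2 t y) has_real_derivative dQ) (at t)"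
  unfolding wall_Q2_def wall_S2_def wall_Q1_def dQ_def
  by (rule derivative_eq_intros refl | simp)+ (simp add: field_simps power_numeral_reduce)
 then have "((\<lambda>t. - (wall_Q2 t y * exp (- (y + t)\<^sup>2))) has_real_derivative
  (wall_Q2 t y * (2 * (y + t)) - dQ) * exp (- (y + t)\<^sup>2)) (at t)"
  by (auto intro!: derivative_eq_intros simp: algebra_simps)
 moreover have "wall_Q2 t y * (2 * (y + t)) - dQ = wall_P2 y t - wall_c2 y"
  unfolding wall_Q2_def wall_S2_def wall_Q1_def dQ_def wall_P2_def wall_P1_def wall_P2'_def wall_c1_def wall_c2_def
  by (simp add: field_simps) (simp add: algebra_simps power_numeral_reduce)
 ultimately show ?thesis by simp
qed

lemma wall_Q1_tendsto: "((\<lambda>t. - (wall_Q1 t y * exp (- (y + t)\<^sup>2))) \<longlongrightarrow> 0) at_top"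
 unfolding wall_Q1_def by real_asymp

lemma wall_Q2_tendsto: "((\<lambda>t. - (wall_Q2 t y * exp (- (y + t)\<^sup>2))) \<longlongrightarrow> 0) at_top"
 unfolding wall_Q2_def wall_S2_def wall_Q1_def by real_asymp

lemma LBINT_FTC_at_top:
 fixes f F :: "real \<Rightarrow> real"
 assumes int: "set_integrable lborel {s..} f"
  and der: "\<And>t. (F has_real_derivative f t) (at t)"
  and cont: "continuous_on UNIV f"
  and lim: "(F \<longlongrightarrow> 0) at_top"
 shows "(LBINT t:{s..}. f t) = - F s"
proof -
 have "((\<lambda>b. LBINT t:{s..b}. f t) \<longlongrightarrow> (LBINT t:{s..}. f t)) at_top"
  by (rule tendsto_set_lebesgue_integral_at_top[OF _ int]) auto
 moreover have "\<forall>\<^sub>F b in at_top. (LBINT t:{s..b}. f t) = F b - F s"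
  using eventually_ge_at_top[of s]
 proof eventually_elim
  case (elim b)
  show ?case unfolding set_lebesgue_integral_def
   by (rule integral_FTC_Icc)
    (use elim cont der in \<open>auto intro: continuous_on_subset has_vector_derivative_at_within
      simp: has_real_derivative_iff_has_vector_derivative\<close>)
 qed
 ultimately have "((\<lambda>b. F b - F s) \<longlongrightarrow> (LBINT t:{s..}. f t)) at_top"
  by (rule Lim_transform_eventually)
 moreover have "((\<lambda>b. F b - F s) \<longlongrightarrow> 0 - F s) at_top" by (intro tendsto_intros lim)
 ultimately show ?thesis using tendsto_unique trivial_limit_at_top_linorder by fastforce
qed

lemma W_le_shift: "0 \<le> t \<Longrightarrow> 1 + abs y + t \<le> 2 * (1 + abs y) * (1 + abs (y + t))" for y t :: real
proof -
 assume t: "0 \<le> t"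
 have "1 + abs y + t \<le> 1 + 2 * abs y + abs (y + t)" using t by linarith
 also have "... \<le> 1 + 2 * abs y + abs (y + t) + (1 + abs (y + t) + 2 * (abs y * abs (y + t)))" by simp
 also have "... = 2 * (1 + abs y) * (1 + abs (y + t))" by (simp add: algebra_simps)
 finally show ?thesis .
qed

section \<open>Integrated error bounds relative to the Gaussian masses\<close>

text \<open>The first summand majorises the expansion error and the approximation, the second one
  the exact density in the far region, where it has only been bounded by
  \<open>exp (- 2 * y^2 - t^2 / 4)\<close>.\<close>

definition wall_err :: "real \<Rightarrow> real \<Rightarrow> real" where
 "wall_err y t = (1 + abs y + t) ^ 9 * exp (- (y + t)\<^sup>2) + (1 + abs y + t) ^ 9 * (exp (- 2 * y\<^sup>2) * exp (- t\<^sup>2 / 4))"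

lemma wall_err_measurable [measurable]: "wall_err y \<in> borel_measurable borel"
 unfolding wall_err_def by measurable

lemma wall_err_nonneg: "0 \<le> t \<Longrightarrow> 0 \<le> wall_err y t"
 by (simp add: wall_err_def)

lemma wall_err_le: "0 \<le> t \<Longrightarrow> wall_err y t \<le>
  512 * (1 + abs y) ^ 9 * ((1 + abs (y + t)) ^ 9 * exp (- (y + t)\<^sup>2)) +
  (1 + abs y) ^ 9 * exp (- 2 * y\<^sup>2) * ((1 + abs t) ^ 9 * exp (- (1/4 * t\<^sup>2)))"
proof -
 assume t: "0 \<le> t"
 have "(1 + abs y + t) ^ 9 \<le> (2 * (1 + abs y) * (1 + abs (y + t))) ^ 9"
  using t W_le_shift by (intro power_mono) auto
 also have "... = 512 * (1 + abs y) ^ 9 * (1 + abs (y + t)) ^ 9" unfolding power_mult_distrib by simp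
 finally have 1: "(1 + abs y + t) ^ 9 * exp (- (y + t)\<^sup>2) \<le> 512 * (1 + abs y) ^ 9 * (1 + abs (y + t)) ^ 9 * exp (- (y + t)\<^sup>2)"
  by (intro mult_right_mono) auto
 have "(1 + abs y + t) ^ 9 \<le> ((1 + abs y) * (1 + abs t)) ^ 9"
  using t by (intro power_mono) (auto simp: algebra_simps)
 then have 2: "(1 + abs y + t) ^ 9 * (exp (- 2 * y\<^sup>2) * exp (- t\<^sup>2 / 4)) \<le>
   ((1 + abs y) ^ 9 * (1 + abs t) ^ 9) * (exp (- 2 * y\<^sup>2) * exp (- t\<^sup>2 / 4))"
  unfolding power_mult_distrib by (intro mult_right_mono) auto
 have e: "exp (- (1/4 * t\<^sup>2)) = exp (- t\<^sup>2 / 4)" by simp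
 show ?thesis unfolding wall_err_def e
  by (rule order.trans[OF add_mono[OF 1 2]]) (simp add: mult_ac)
qed

lemma integrable_shifted_gauss_power:
 "integrable lborel (\<lambda>t::real. (1 + abs (y + t)) ^ N * exp (- (y + t)\<^sup>2))"
 using lborel_integrable_real_affine[OF integrable_power_mult_gauss[OF zero_less_one, of N], of 1 y] by simp

text \<open>The error on \<open>[s, \<infinity>)\<close> is compared with the leading mass
  \<open>gauss_tail (y + s)\<close> of that half-line. The first summand of \<open>wall_err\<close>
  is a Gaussian moment; for the second, \<open>2 * y^2 >= (abs y + s)^2 - 2 * s^2\<close> and
  \<open>gauss_tail_ge\<close> bring in the tail.\<close>

lemma
 assumes s: "0 \<le> s"
 shows set_integrable_wall_err: "set_integrable lborel {s..} (wall_err y)"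
  and wall_err_tail_bound_ex: "\<exists>C>0. \<forall>y. (LBINT t:{s..}. wall_err y t) \<le> C * (1 + abs y) ^ 20 * gauss_tail (y + s)"
proof -
 define F where "F = (\<lambda>y t. (1 + abs (y + t)) ^ 9 * exp (- (y + t)\<^sup>2) :: real)"
 define G where "G = (\<lambda>t. (1 + abs t) ^ 9 * exp (- (1/4 * t\<^sup>2)) :: real)"
 have intF: "set_integrable lborel {s..} (F y)" for y
  unfolding set_integrable_def F_def
  by (intro integrable_mult_indicator integrable_shifted_gauss_power) auto
 have intG: "set_integrable lborel {s..} G"
  unfolding G_def by (intro set_integrable_power_mult_gauss) auto
 have intB: "set_integrable lborel {s..} (\<lambda>t. 512 * (1 + abs y) ^ 9 * F y t + (1 + abs y) ^ 9 * exp (- 2 * y\<^sup>2) * G t)" for y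
  by (intro set_integral_add set_integrable_mult_right intF intG)
 have le: "wall_err y t \<le> 512 * (1 + abs y) ^ 9 * F y t + (1 + abs y) ^ 9 * exp (- 2 * y\<^sup>2) * G t" if "t \<in> {s..}" for y t
  using wall_err_le[of t y] that s by (simp add: F_def G_def)
 show int: "set_integrable lborel {s..} (wall_err y)" for y
 proof (rule set_integrable_bound[OF intB])
  show "set_borel_measurable lborel {s..} (wall_err y)" unfolding set_borel_measurable_def by measurable
  show "AE t in lborel. t \<in> {s..} \<longrightarrow> norm (wall_err y t) \<le>
   norm (512 * (1 + abs y) ^ 9 * F y t + (1 + abs y) ^ 9 * exp (- 2 * y\<^sup>2) * G t)"
   using le wall_err_nonneg s by (intro AE_I2) (auto intro: order.trans[OF _ abs_ge_self])
 qed
 obtain C where C: "C > 0" "\<And>t. (LBINT v:{t..}. (1 + abs v) ^ 9 * exp (- v\<^sup>2)) \<le> C * (1 + abs t) ^ (9 + 1) * gauss_tail t"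
  using gauss_moment_le[of 9] by blast
 define I where "I = (LBINT t:{s..}. G t)"
 have I: "0 \<le> I" unfolding I_def set_lebesgue_integral_def G_def
  by (intro Bochner_Integration.integral_nonneg) (auto simp: indicator_def)
 define K where "K = 512 * C * (1 + s) ^ 10 + exp (2 * s\<^sup>2 + 3) * (1 + s) * I"
 have K: "K > 0" unfolding K_def using C(1) s I by (intro add_pos_nonneg) auto
 have "(LBINT t:{s..}. wall_err y t) \<le> K * (1 + abs y) ^ 20 * gauss_tail (y + s)" for y
 proof -
  have 1: "(LBINT t:{s..}. F y t) \<le> C * (1 + s) ^ 10 * ((1 + abs y) ^ 11 * gauss_tail (y + s))"
  proof -
   have "(LBINT t:{s..}. F y t) = (LBINT v:{y+s..}. (1 + abs v) ^ 9 * exp (- v\<^sup>2))"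
    unfolding set_lebesgue_integral_def F_def
    by (subst (2) lborel_integral_real_affine[of 1 _ y])
     (auto intro!: Bochner_Integration.integral_cong simp: indicator_def)
   also have "... \<le> C * (1 + abs (y + s)) ^ 10 * gauss_tail (y + s)" using C(2)[of "y + s"] by simp
   also have "1 + abs (y + s) \<le> (1 + s) * (1 + abs y)"
   proof -
    have "(1 + s) * (1 + abs y) = 1 + s + abs y + s * abs y" by (simp add: algebra_simps)
    then show ?thesis using s mult_nonneg_nonneg[OF s abs_ge_zero[of y]] by linarith
   qed
   then have "(1 + abs (y + s)) ^ 10 \<le> ((1 + s) * (1 + abs y)) ^ 10"
    by (intro power_mono) auto
   also have "... \<le> (1 + s) ^ 10 * (1 + abs y) ^ 11"
    unfolding power_mult_distrib using s by (intro mult_left_mono power_increasing) auto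
   finally show ?thesis using C(1) gauss_tail_pos[of "y + s"] by (simp add: mult_ac)
  qed
  have 2: "exp (- 2 * y\<^sup>2) \<le> exp (2 * s\<^sup>2 + 3) * (1 + s) * ((1 + abs y) ^ 11 * gauss_tail (y + s))"
  proof -
   have "- 2 * y\<^sup>2 \<le> (2 * s\<^sup>2 + 3) + (- (abs y + s)\<^sup>2 - 3)"
    using zero_le_power2[of "abs y - s"] by (simp add: power2_diff power2_sum)
   then have "exp (- 2 * y\<^sup>2) \<le> exp (2 * s\<^sup>2 + 3) * exp (- (abs y + s)\<^sup>2 - 3)"
    by (simp only: exp_add[symmetric] exp_le_cancel_iff)
   also have "... = exp (2 * s\<^sup>2 + 3) * (1 + (abs y + s)) * (exp (- (abs y + s)\<^sup>2 - 3) / (1 + (abs y + s)))"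
    using s by simp
   also have "... \<le> exp (2 * s\<^sup>2 + 3) * (1 + (abs y + s)) * gauss_tail (y + s)"
    using s order.trans[OF gauss_tail_ge gauss_tail_mono, of "abs y + s" "y + s"]
    by (intro mult_left_mono) auto
   also have "... \<le> exp (2 * s\<^sup>2 + 3) * ((1 + s) * (1 + abs y) ^ 11) * gauss_tail (y + s)"
   proof (intro mult_right_mono mult_left_mono)
    have "1 + (abs y + s) \<le> (1 + s) * (1 + abs y)" using s by (simp add: algebra_simps)
    also have "... \<le> (1 + s) * (1 + abs y) ^ 11"
     using s power_increasing[of 1 11 "1 + abs y"] by (intro mult_left_mono) auto
    finally show "1 + (abs y + s) \<le> (1 + s) * (1 + abs y) ^ 11" .
   qed (use gauss_tail_pos[of "y + s"] in auto)
   finally show ?thesis by (simp add: mult.assoc)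
  qed
  have "(LBINT t:{s..}. wall_err y t) \<le>
   (LBINT t:{s..}. 512 * (1 + abs y) ^ 9 * F y t + (1 + abs y) ^ 9 * exp (- 2 * y\<^sup>2) * G t)"
   by (rule set_integral_mono[OF int intB le])
  also have "... = 512 * (1 + abs y) ^ 9 * (LBINT t:{s..}. F y t) + (1 + abs y) ^ 9 * exp (- 2 * y\<^sup>2) * I"
   unfolding I_def by (subst set_integral_add) (auto intro!: set_integrable_mult_right intF intG)
  also have "... \<le> 512 * (1 + abs y) ^ 9 * (C * (1 + s) ^ 10 * ((1 + abs y) ^ 11 * gauss_tail (y + s)))
   + (1 + abs y) ^ 9 * (exp (2 * s\<^sup>2 + 3) * (1 + s) * ((1 + abs y) ^ 11 * gauss_tail (y + s))) * I"
   using I 1 2 by (intro add_mono mult_right_mono mult_left_mono) auto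
  also have "... = K * (((1 + abs y) ^ 9 * (1 + abs y) ^ 11) * gauss_tail (y + s))"
   unfolding K_def by (simp only: algebra_simps)
  also have "... = K * (1 + abs y) ^ 20 * gauss_tail (y + s)" by (simp add: power_add[symmetric])
  finally show ?thesis .
 qed
 then show "\<exists>C>0. \<forall>y. (LBINT t:{s..}. wall_err y t) \<le> C * (1 + abs y) ^ 20 * gauss_tail (y + s)"
  using K by blast
qed

lemma set_integrable_wall_err_Icc:
 assumes "0 \<le> s" shows "set_integrable lborel {0..s} (wall_err y)"
 by (rule set_integrable_subset[OF set_integrable_wall_err[of 0 y]]) (use assms in auto)

lemma LBINT_gauss_Icc: "0 \<le> s \<Longrightarrow> (LBINT t:{0..s}. exp (- (y + t)\<^sup>2)) = gauss_tail y - gauss_tail (y + s)"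
proof -
 assume s: "0 \<le> s"
 have "(LBINT t:{0..s}. exp (- (y + t)\<^sup>2)) = (- gauss_tail (y + s)) - (- gauss_tail (y + 0))"
  unfolding set_lebesgue_integral_def
 proof (rule integral_FTC_Icc[OF s])
  fix x
  have "((\<lambda>t. - gauss_tail (y + t)) has_real_derivative exp (- (y + x)\<^sup>2)) (at x)"
   by (auto intro!: derivative_eq_intros)
  then show "((\<lambda>t. - gauss_tail (y + t)) has_vector_derivative exp (- (y + x)\<^sup>2)) (at x within {0..s})"
   by (auto simp: has_real_derivative_iff_has_vector_derivative intro: has_vector_derivative_at_within)
 qed (auto intro!: continuous_intros)
 then show ?thesis by simp
qed

text \<open>The companion estimate on \<open>[0, s]\<close>. There the Gaussian mass itself becomes
  tiny for large \<open>abs y\<close>, so the comparison is made pointwise in \<open>t\<close>,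
  which is possible because \<open>t\<close> is bounded by \<open>s\<close>.\<close>

lemma wall_err_Icc_bound_ex:
 assumes s: "0 \<le> s"
 shows "\<exists>C>0. \<forall>y. (LBINT t:{0..s}. wall_err y t) \<le> C * (1 + abs y) ^ 20 * (gauss_tail y - gauss_tail (y + s))"
proof -
 define K where "K = (1 + s) ^ 9 * (1 + exp (2 * s\<^sup>2))"
 have K: "K > 0" unfolding K_def using s by (intro mult_pos_pos add_pos_pos) auto
 have "(LBINT t:{0..s}. wall_err y t) \<le> K * (1 + abs y) ^ 20 * (gauss_tail y - gauss_tail (y + s))" for y
 proof -
  have "(LBINT t:{0..s}. wall_err y t) \<le> (LBINT t:{0..s}. K * (1 + abs y) ^ 20 * exp (- (y + t)\<^sup>2))"
  proof (rule set_integral_mono[OF set_integrable_wall_err_Icc[OF s]])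
   show "set_integrable lborel {0..s} (\<lambda>t. K * (1 + abs y) ^ 20 * exp (- (y + t)\<^sup>2))"
    by (intro borel_integrable_atLeastAtMost' continuous_intros)
   fix t assume t: "t \<in> {0..s}"
   have W: "(1 + abs y + t) ^ 9 \<le> (1 + s) ^ 9 * (1 + abs y) ^ 20"
   proof -
    have "1 + abs y + t \<le> (1 + s) * (1 + abs y)"
    proof -
     have "(1 + s) * (1 + abs y) = 1 + s + abs y + s * abs y" by (simp add: algebra_simps)
     moreover have "t \<le> s" using t by simp
     ultimately show ?thesis using mult_nonneg_nonneg[OF s abs_ge_zero[of y]] by linarith
    qed
    then have "(1 + abs y + t) ^ 9 \<le> ((1 + s) * (1 + abs y)) ^ 9"
     using t by (intro power_mono) auto
    also have "... \<le> (1 + s) ^ 9 * (1 + abs y) ^ 20"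
     unfolding power_mult_distrib using s by (intro mult_left_mono power_increasing) auto
    finally show ?thesis .
   qed
   have "t\<^sup>2 \<le> s\<^sup>2" using t by (intro power_mono) auto
   then have "- 2 * y\<^sup>2 \<le> 2 * s\<^sup>2 + - (y + t)\<^sup>2"
    using zero_le_power2[of "y - t"] by (simp add: power2_diff power2_sum)
   then have "exp (- 2 * y\<^sup>2) \<le> exp (2 * s\<^sup>2) * exp (- (y + t)\<^sup>2)"
    by (simp only: exp_add[symmetric] exp_le_cancel_iff)
   moreover have "exp (- t\<^sup>2 / 4) \<le> 1" by simp
   ultimately have "exp (- 2 * y\<^sup>2) * exp (- t\<^sup>2 / 4) \<le> exp (2 * s\<^sup>2) * exp (- (y + t)\<^sup>2) * 1"
    by (intro mult_mono) auto
   then have "exp (- (y + t)\<^sup>2) + exp (- 2 * y\<^sup>2) * exp (- t\<^sup>2 / 4) \<le> (1 + exp (2 * s\<^sup>2)) * exp (- (y + t)\<^sup>2)"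
    by (simp add: algebra_simps)
   then have "(1 + abs y + t) ^ 9 * (exp (- (y + t)\<^sup>2) + exp (- 2 * y\<^sup>2) * exp (- t\<^sup>2 / 4)) \<le>
    ((1 + s) ^ 9 * (1 + abs y) ^ 20) * ((1 + exp (2 * s\<^sup>2)) * exp (- (y + t)\<^sup>2))"
    using W s by (intro mult_mono) auto
   then show "wall_err y t \<le> K * (1 + abs y) ^ 20 * exp (- (y + t)\<^sup>2)"
    unfolding wall_err_def K_def distrib_left[symmetric] by (simp only: mult_ac)
  qed
  also have "... = K * (1 + abs y) ^ 20 * (gauss_tail y - gauss_tail (y + s))"
   by (simp add: LBINT_gauss_Icc[OF s])
  finally show ?thesis .
 qed
 then show ?thesis using K by blast
qed

lemma set_integrable_wall_bounded:
 fixes f :: "real \<Rightarrow> real"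
 assumes "0 \<le> s" and [measurable]: "f \<in> borel_measurable borel" and "\<And>t. 0 \<le> t \<Longrightarrow> abs (f t) \<le> K * wall_err y t"
 shows "set_integrable lborel {s..} f"
proof (rule set_integrable_bound[of lborel _ "\<lambda>t. K * wall_err y t"])
 show "set_integrable lborel {s..} (\<lambda>t. K * wall_err y t)"
  using set_integrable_wall_err[OF assms(1)] by simp
 show "set_borel_measurable lborel {s..} f" unfolding set_borel_measurable_def by measurable
 show "AE t in lborel. t \<in> {s..} \<longrightarrow> norm (f t) \<le> norm (K * wall_err y t)"
  using assms by (intro AE_I2) (auto intro: order.trans[OF _ abs_ge_self])
qed

lemma LBINT_wall_bounded:
 fixes f :: "real \<Rightarrow> real"
 assumes "0 \<le> s" and meas: "f \<in> borel_measurable borel" and le: "\<And>t. 0 \<le> t \<Longrightarrow> abs (f t) \<le> K * wall_err y t"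
 shows "abs (LBINT t:{s..}. f t) \<le> K * (LBINT t:{s..}. wall_err y t)"
  and "abs (LBINT t:{0..s}. f t) \<le> K * (LBINT t:{0..s}. wall_err y t)"
proof -
 have gen: "abs (LBINT t:A. f t) \<le> K * (LBINT t:A. wall_err y t)"
  if A: "A \<in> sets borel" "A \<subseteq> {0..}" for A
 proof -
  have intf: "set_integrable lborel A f"
   using set_integrable_wall_bounded[OF order.refl meas le] by (rule set_integrable_subset) (use A in auto)
  have intw: "set_integrable lborel A (wall_err y)"
   using set_integrable_wall_err[OF order.refl] by (rule set_integrable_subset) (use A in auto)
  have "norm (LBINT t:A. f t) \<le> (LBINT t:A. norm (f t))"
   by (rule set_integral_norm_bound[OF intf])
  also have "... \<le> (LBINT t:A. K * wall_err y t)"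
   using A by (intro set_integral_mono set_integrable_norm intf set_integrable_mult_right intw) (auto intro!: le)
  finally show ?thesis by simp
 qed
 show "abs (LBINT t:{s..}. f t) \<le> K * (LBINT t:{s..}. wall_err y t)"
  using assms(1) by (intro gen) auto
 show "abs (LBINT t:{0..s}. f t) \<le> K * (LBINT t:{0..s}. wall_err y t)"
  by (intro gen) auto
qed

lemma wall_P_gauss_le:
 assumes "0 \<le> t"
 shows "abs (wall_P1 y t * exp (- (y + t)\<^sup>2)) \<le> 18 * wall_err y t"
  and "abs (wall_P2 y t * exp (- (y + t)\<^sup>2)) \<le> 18 * wall_err y t"
  and "abs (exp (- (y + t)\<^sup>2)) \<le> 18 * wall_err y t"
proof -
 define W where "W = 1 + abs y + t"
 have W1: "1 \<le> W" "abs y \<le> W" "t \<le> W" using assms by (auto simp: W_def)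
 have pw: "W ^ i \<le> W ^ j" if "i \<le> j" for i j using that W1 by (intro power_increasing) auto
 have key: "abs (c * exp (- (y + t)\<^sup>2)) \<le> 18 * wall_err y t" if "abs c \<le> 18 * W ^ 9" for c
 proof -
  have "abs (c * exp (- (y + t)\<^sup>2)) \<le> 18 * W ^ 9 * exp (- (y + t)\<^sup>2)"
   using that by (simp add: abs_mult mult_right_mono)
  moreover have "0 \<le> W ^ 9 * (exp (- 2 * y\<^sup>2) * exp (- t\<^sup>2 / 4))" using W1 by simp
  ultimately show ?thesis unfolding wall_err_def W_def[symmetric] by simp
 qed
 show "abs (wall_P1 y t * exp (- (y + t)\<^sup>2)) \<le> 18 * wall_err y t"
  using wall_P1_le[OF W1(2) assms W1(3,1)] pw[of 3 9] by (intro key) auto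
 show "abs (wall_P2 y t * exp (- (y + t)\<^sup>2)) \<le> 18 * wall_err y t"
  using wall_P2_le[OF W1(2) assms W1(3,1)] pw[of 6 9] by (intro key) auto
 show "abs (exp (- (y + t)\<^sup>2)) \<le> 18 * wall_err y t"
  using key[of 1] pw[of 0 9] by auto
qed

lemma wall_P_measurable [measurable]:
 "(\<lambda>t. wall_P1 y t) \<in> borel_measurable borel" "(\<lambda>t. wall_P2 y t) \<in> borel_measurable borel"
 unfolding wall_P1_def wall_P2_def wall_P2'_def by measurable

lemma
 assumes s: "0 \<le> s"
 shows LBINT_wall_P1: "(LBINT t:{s..}. wall_P1 y t * exp (- (y + t)\<^sup>2)) =
   wall_c1 y * gauss_tail (y + s) + wall_Q1 s y * exp (- (y + s)\<^sup>2)"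
  and LBINT_wall_P2: "(LBINT t:{s..}. wall_P2 y t * exp (- (y + t)\<^sup>2)) =
   wall_c2 y * gauss_tail (y + s) + wall_Q2 s y * exp (- (y + s)\<^sup>2)"
proof -
 have intg: "set_integrable lborel {s..} (\<lambda>t. exp (- (y + t)\<^sup>2))"
  by (rule set_integrable_wall_bounded[OF s _ wall_P_gauss_le(3)]) measurable
 have gen: "(LBINT t:{s..}. P t * exp (- (y + t)\<^sup>2)) = c * gauss_tail (y + s) + Q s * exp (- (y + s)\<^sup>2)"
  if int: "set_integrable lborel {s..} (\<lambda>t. P t * exp (- (y + t)\<^sup>2))"
   and der: "\<And>t. ((\<lambda>t. - (Q t * exp (- (y + t)\<^sup>2))) has_real_derivative (P t - c) * exp (- (y + t)\<^sup>2)) (at t)"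
   and cont: "continuous_on UNIV P" and lim: "((\<lambda>t. - (Q t * exp (- (y + t)\<^sup>2))) \<longlongrightarrow> 0) at_top"
  for P Q :: "real \<Rightarrow> real" and c
 proof -
  have "(LBINT t:{s..}. (P t - c) * exp (- (y + t)\<^sup>2)) = - (- (Q s * exp (- (y + s)\<^sup>2)))"
  proof (rule LBINT_FTC_at_top[OF _ der _ lim])
   show "set_integrable lborel {s..} (\<lambda>t. (P t - c) * exp (- (y + t)\<^sup>2))"
    unfolding left_diff_distrib by (intro set_integral_diff int set_integrable_mult_right intg)
  qed (intro continuous_intros cont)
  moreover have "(LBINT t:{s..}. (P t - c) * exp (- (y + t)\<^sup>2)) =
   (LBINT t:{s..}. P t * exp (- (y + t)\<^sup>2)) - c * gauss_tail (y + s)"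
   unfolding left_diff_distrib integral_shifted_gauss[symmetric]
   by (subst set_integral_diff) (auto intro!: int set_integrable_mult_right intg)
  ultimately show ?thesis by simp
 qed
 show "(LBINT t:{s..}. wall_P1 y t * exp (- (y + t)\<^sup>2)) =
   wall_c1 y * gauss_tail (y + s) + wall_Q1 s y * exp (- (y + s)\<^sup>2)"
  by (rule gen[OF _ DERIV_wall_Q1 _ wall_Q1_tendsto])
   (rule set_integrable_wall_bounded[OF s _ wall_P_gauss_le(1)], measurable,
    auto simp: wall_P1_def intro!: continuous_intros)
 show "(LBINT t:{s..}. wall_P2 y t * exp (- (y + t)\<^sup>2)) =
   wall_c2 y * gauss_tail (y + s) + wall_Q2 s y * exp (- (y + s)\<^sup>2)"
  by (rule gen[OF _ DERIV_wall_Q2 _ wall_Q2_tendsto])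
   (rule set_integrable_wall_bounded[OF s _ wall_P_gauss_le(2)], measurable,
    auto simp: wall_P1_def wall_P2_def wall_P2'_def intro!: continuous_intros)
qed

text \<open>The error is kept proportional to \<open>R (1 - R)\<close>, by expanding the masses of \<open>[s, \<infinity>)\<close> and of
 \<open>[0, s]\<close> separately, each with an error relative to its own Gaussian mass; this is what makes
 the expansion summable over both tails.\<close>

lemma ratio_expansion:
 fixes eps K x0 x1 x2 d0 d1 d2 px pd :: real
 assumes eps: "0 < eps" and K: "1 \<le> K" "eps * K \<le> 1/8"
  and x0: "0 \<le> x0" "0 \<le> d0" "x0 + d0 = 1"
  and x: "abs x1 \<le> K * x0" "abs x2 \<le> K * x0" and d: "abs d1 \<le> K * d0" "abs d2 \<le> K * d0"
  and p: "abs px \<le> eps ^ 3 * (K * x0)" "abs pd \<le> eps ^ 3 * (K * d0)"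
 defines "N \<equiv> x0 + eps * x1 + eps\<^sup>2 * x2 + px" and "M \<equiv> d0 + eps * d1 + eps\<^sup>2 * d2 + pd"
  and "r1 \<equiv> x1 - x0 * (x1 + d1)"
 defines "r2 \<equiv> x2 - x0 * (x2 + d2) - r1 * (x1 + d1)"
 shows "abs (N / (N + M) - (x0 + eps * r1 + eps\<^sup>2 * r2)) \<le> 40 * (eps ^ 3 * (K ^ 3 * (x0 * d0)))"
proof -
 define t1 where "t1 = x1 + d1"
 define t2 where "t2 = x2 + d2"
 define p' where "p' = px + pd"
 define v where "v = x0 * d0"
 have v: "0 \<le> v" using x0 by (simp add: v_def)
 have eK: "0 \<le> eps * K" using eps K by simp
 have K0: "K * x0 + K * d0 = K" using x0(3) by (metis distrib_left mult_1_right)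
 have t: "abs t1 \<le> K" "abs t2 \<le> K" using x d K0 unfolding t1_def t2_def by linarith+
 have p'b: "abs p' \<le> eps ^ 3 * K"
 proof -
  have "eps ^ 3 * (K * x0) + eps ^ 3 * (K * d0) = eps ^ 3 * K" by (metis distrib_left K0)
  then show ?thesis using p unfolding p'_def by linarith
 qed
 have d0x: "d0 = 1 - x0" using x0 by simp
 have r1: "r1 = x1 * d0 - x0 * d1" unfolding r1_def d0x by (simp add: algebra_simps)
 have r2: "r2 = (x2 * d0 - x0 * d2) - r1 * t1" unfolding r2_def t1_def d0x by (simp add: algebra_simps)
 \<comment> \<open>The source of the factor \<open>x0 * d0\<close>: in these antisymmetric
   combinations each summand contains one factor comparable to \<open>x0\<close> and one comparable
   to \<open>d0\<close>.\<close>
 have cross: "abs (a * d0 - x0 * b) \<le> 2 * (c * v)" if "abs a \<le> c * x0" "abs b \<le> c * d0" for a b c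
 proof -
  have "abs (a * d0) \<le> c * v" using mult_right_mono[OF that(1) x0(2)] x0 by (simp add: abs_mult v_def mult_ac)
  moreover have "abs (x0 * b) \<le> c * v" using mult_left_mono[OF that(2) x0(1)] x0 by (simp add: abs_mult v_def mult_ac)
  ultimately show ?thesis by linarith
 qed
 have r1b: "abs r1 \<le> 2 * (K * v)" unfolding r1 by (rule cross[OF x(1) d(1)])
 have KK: "K * v \<le> K\<^sup>2 * v" using K v power_increasing[of 1 2 K] by (intro mult_right_mono) auto
 have r2b: "abs r2 \<le> 4 * (K\<^sup>2 * v)"
 proof -
  have "abs (r1 * t1) \<le> 2 * (K * v) * K" unfolding abs_mult using r1b t v K by (intro mult_mono) auto
  moreover have "2 * (K * v) * K = 2 * (K\<^sup>2 * v)" by (simp add: power2_eq_square)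
  moreover have "abs (x2 * d0 - x0 * d2) \<le> 2 * (K * v)" by (rule cross[OF x(2) d(2)])
  ultimately show ?thesis unfolding r2 using KK by linarith
 qed
 have T: "N + M = 1 + eps * t1 + eps\<^sup>2 * t2 + p'"
  unfolding N_def M_def t1_def t2_def p'_def using x0(3) by (simp add: algebra_simps)
 have eps1: "eps \<le> 1/8"
 proof -
  have "eps * 1 \<le> eps * K" using K eps by (intro mult_left_mono) auto
  then show ?thesis using K by linarith
 qed
 have s1: "abs (eps * t1) \<le> 1/8"
 proof -
  have "abs (eps * t1) \<le> eps * K" using mult_left_mono[OF t(1), of eps] eps by (simp add: abs_mult)
  then show ?thesis using K by linarith
 qed
 have s2: "abs (eps\<^sup>2 * t2) \<le> 1/64"
 proof -
  have "abs (eps\<^sup>2 * t2) \<le> eps * (eps * K)" using t(2) eps by (simp add: abs_mult power2_eq_square)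
  also have "... \<le> 1/8 * (1/8)" using eps eps1 K by (intro mult_mono) auto
  finally show ?thesis by simp
 qed
 have s3: "abs p' \<le> 1/64"
 proof -
  have "eps ^ 3 * K = eps\<^sup>2 * (eps * K)" by (simp add: power_numeral_reduce)
  also have "... \<le> 1 * (1/8)" using eps eps1 K by (intro mult_mono power_le_one) auto
  finally have "eps ^ 3 * K \<le> 1/8" by simp
  moreover have "eps ^ 3 * K \<le> eps * (eps * K)"
   using eps eps1 K power_decreasing[of 2 3 eps] by (simp add: power2_eq_square mult_right_mono mult.assoc[symmetric])
  moreover have "eps * (eps * K) \<le> 1/8 * (1/8)" using eps eps1 K by (intro mult_mono) auto
  ultimately show ?thesis using p'b by linarith
 qed
 have T2: "1/2 \<le> N + M" unfolding T using s1 s2 s3 by linarith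
 \<comment> \<open>The remainder after cross-multiplication; \<open>r1\<close> and \<open>r2\<close>
   are the solutions for which the terms of order \<open>eps\<close> and \<open>eps^2\<close>
   disappear.\<close>
 define num where "num = N - (x0 + eps * r1 + eps\<^sup>2 * r2) * (N + M)"
 have num: "num = (px * d0 - x0 * pd) - eps ^ 3 * (r1 * t2 + r2 * t1) - eps ^ 3 * (eps * (r2 * t2)) - (eps * r1 + eps\<^sup>2 * r2) * p'"
  unfolding num_def T unfolding N_def r2_def r1_def t1_def t2_def p'_def d0x
  by (simp add: algebra_simps power2_eq_square power3_eq_cube)
 define Z where "Z = eps ^ 3 * (K ^ 3 * v)"
 have Kp: "K \<le> K ^ 3" "K\<^sup>2 \<le> K ^ 3" using K power_increasing[of 1 3 K] power_increasing[of 2 3 K] by auto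
 have Z0: "0 \<le> Z" unfolding Z_def using eps K v by simp
 have n1: "abs (px * d0 - x0 * pd) \<le> 2 * Z"
 proof -
  have "abs (px * d0 - x0 * pd) \<le> 2 * ((eps ^ 3 * K) * v)"
   by (rule cross) (use p in \<open>simp_all add: mult.assoc\<close>)
  also have "... \<le> 2 * Z" unfolding Z_def mult.assoc using eps v Kp by (intro mult_left_mono mult_right_mono) auto
  finally show ?thesis .
 qed
 have r1K: "abs r1 \<le> 2 * (K\<^sup>2 * v)" using r1b KK by linarith
 have rt: "abs (r1 * t2 + r2 * t1) \<le> 6 * (K ^ 3 * v)"
 proof -
  have "abs (r1 * t2) \<le> 2 * (K\<^sup>2 * v) * K" "abs (r2 * t1) \<le> 4 * (K\<^sup>2 * v) * K"
   unfolding abs_mult using r1K r2b t v K by (auto intro!: mult_mono)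
  moreover have "K\<^sup>2 * v * K = K ^ 3 * v" by (simp add: power_numeral_reduce)
  ultimately show ?thesis by linarith
 qed
 have n2: "abs (eps ^ 3 * (r1 * t2 + r2 * t1)) \<le> 6 * Z"
  using mult_left_mono[OF rt, of "eps ^ 3"] eps by (simp add: abs_mult Z_def)
 have n3: "abs (eps ^ 3 * (eps * (r2 * t2))) \<le> 4 * Z"
 proof -
  have "abs (r2 * t2) \<le> 4 * (K\<^sup>2 * v) * K" unfolding abs_mult using r2b t v K by (intro mult_mono) auto
  also have "... = 4 * (K ^ 3 * v)" by (simp add: power_numeral_reduce)
  finally have "abs (eps * (r2 * t2)) \<le> 1 * (4 * (K ^ 3 * v))"
   unfolding abs_mult[of eps] using eps eps1 by (intro mult_mono) auto
  then have "eps ^ 3 * abs (eps * (r2 * t2)) \<le> eps ^ 3 * (4 * (K ^ 3 * v))" using eps by (intro mult_left_mono) auto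
  then show ?thesis using eps by (simp add: abs_mult Z_def)
 qed
 have n4: "abs ((eps * r1 + eps\<^sup>2 * r2) * p') \<le> 6 * Z"
 proof -
  have "abs (eps * r1) \<le> 1 * (2 * (K\<^sup>2 * v))" unfolding abs_mult using eps eps1 r1K by (intro mult_mono) auto
  moreover have "abs (eps\<^sup>2 * r2) \<le> 1 * (4 * (K\<^sup>2 * v))"
   unfolding abs_mult using eps eps1 r2b by (intro mult_mono) (auto intro: power_le_one)
  ultimately have "abs (eps * r1 + eps\<^sup>2 * r2) \<le> 6 * (K\<^sup>2 * v)" by linarith
  then have "abs ((eps * r1 + eps\<^sup>2 * r2) * p') \<le> 6 * (K\<^sup>2 * v) * (eps ^ 3 * K)"
   unfolding abs_mult[of _ p'] using p'b v by (intro mult_mono) auto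
  also have "... = 6 * Z" by (simp add: Z_def power_numeral_reduce)
  finally show ?thesis .
 qed
 have "abs num \<le> 20 * Z" unfolding num using n1 n2 n3 n4 Z0 by linarith
 moreover have "N / (N + M) - (x0 + eps * r1 + eps\<^sup>2 * r2) = num / (N + M)"
  unfolding num_def using T2 by (simp add: field_simps)
 then have "abs (N / (N + M) - (x0 + eps * r1 + eps\<^sup>2 * r2)) = abs num / (N + M)" using T2 by simp
 moreover have "abs num / (N + M) \<le> (20 * Z) / (1/2)"
  using \<open>\<bar>num\<bar> \<le> 20 * Z\<close> T2 Z0 by (intro frac_le) auto
 ultimately show ?thesis by (simp add: Z_def v_def)
qed

text \<open>The first and second order coefficients of a wall ratio. Up to the factors
  \<open>sqrt 2\<close> and \<open>2\<close> they are the summands of \<open>g1\<close> and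
  \<open>g2\<close>.\<close>

definition wall_r1 :: "real \<Rightarrow> real \<Rightarrow> real" where
 "wall_r1 s y = wall_Q1 s y * gauss_p s y - wall_Q1 0 y * (gauss_q y * gauss_R s y)"

definition wall_r2 :: "real \<Rightarrow> real \<Rightarrow> real" where
 "wall_r2 s y = wall_S2 s y * gauss_p s y - wall_S2 0 y * (gauss_q y * gauss_R s y)
  - wall_Q1 0 y * gauss_q y * wall_r1 s y"

lemma LBINT_Icc_atLeast:
 fixes f :: "real \<Rightarrow> real"
 assumes "0 \<le> s" "set_integrable lborel {0..} f"
 shows "(LBINT t:{0..}. f t) = (LBINT t:{0..s}. f t) + (LBINT t:{s..}. f t)"
proof -
 have "{0..} = {0..s} \<union> {s..}" using assms by auto
 moreover have "(LBINT t:{0..s} \<union> {s..}. f t) = (LBINT t:{0..s}. f t) + (LBINT t:{s..}. f t)"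
 proof (rule set_integral_Un_AE)
  show "AE t in lborel. \<not> (t \<in> {0..s} \<and> t \<in> {s..})"
   using AE_lborel_singleton[of s] by eventually_elim auto
 qed (auto intro: set_integrable_subset[OF assms(2)] simp: assms(1))
 ultimately show ?thesis by simp
qed

text \<open>The loss \<open>(1 + abs y) ^ 20\<close> from the integrated errors still leaves a power
  of \<open>eps\<close>, so it stays small against any fixed constant as soon as \<open>eps\<close>
  is small, uniformly in the range of \<open>y\<close>.\<close>

lemma wall_range_sqrt:
 assumes "wall_range eps y"
 shows "eps * (1 + abs y) ^ 20 \<le> sqrt eps"
proof -
 have eps: "0 < eps" using assms by (simp add: wall_range_def)
 have "(eps * (1 + abs y) ^ 20)\<^sup>2 = eps * (eps * (1 + abs y) ^ 40)"
  by (simp add: power_mult_distrib power_mult[symmetric] power2_eq_square[of eps])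
 also have "... \<le> eps * 1" using wall_range_le[OF assms, of 40] eps by (intro mult_left_mono) auto
 finally show ?thesis by (intro real_le_rsqrt) simp
qed

text \<open>After multiplication by \<open>exp (- y^2)\<close> and division by
  \<open>gauss_tail y\<close>, the masses of \<open>[s, \<infinity>)\<close> and
  \<open>[0, s]\<close> have the leading parts \<open>gauss_R\<close> and
  \<open>1 - gauss_R\<close>, as \<open>ratio_expansion\<close> requires. Its \<open>K\<close> is of
  the form \<open>D * (1 + abs y) ^ 20\<close>, and the cube of it gives the power
  \<open>60\<close>.\<close>

lemma wall_ratio_expansion:
 assumes s: "0 \<le> s"
 shows "\<exists>C>0. \<exists>eps0>0. \<forall>eps y. eps < eps0 \<longrightarrow> wall_range eps y \<longrightarrow>
  \<bar>wall_ratio eps (wall_exponent eps y) s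
   - (gauss_R s y + eps * wall_r1 s y + eps\<^sup>2 * wall_r2 s y)\<bar>
  \<le> C * (eps ^ 3 * ((1 + abs y) ^ 60 * (gauss_R s y * (1 - gauss_R s y))))"
proof -
 obtain A where A: "A > 0" "\<And>y. (LBINT t:{s..}. wall_err y t) \<le> A * (1 + abs y) ^ 20 * gauss_tail (y + s)"
  using wall_err_tail_bound_ex[OF s] by metis
 obtain B where B: "B > 0" "\<And>y. (LBINT t:{0..s}. wall_err y t) \<le> B * (1 + abs y) ^ 20 * (gauss_tail y - gauss_tail (y + s))"
  using wall_err_Icc_bound_ex[OF s] by metis
 define c :: real where "c = exp 27 * 27 ^ 3 + 400"
 have c: "18 \<le> c" unfolding c_def by (auto simp: add_increasing)
 define D where "D = max 1 (c * (A + B))"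
 have "c * A \<le> c * (A + B)" "c * B \<le> c * (A + B)" using A(1) B(1) c by (auto intro!: mult_left_mono)
 then have D: "1 \<le> D" "c * A \<le> D" "c * B \<le> D" unfolding D_def by linarith+
 \<comment> \<open>Then \<open>sqrt eps <= 1 / (8 * D)\<close>, which turns
   \<open>wall_range_sqrt\<close> into \<open>eps * K <= 1/8\<close>.\<close>
 define eps0 where "eps0 = (1 / (8 * D))\<^sup>2"
 have "eps0 > 0" using D by (simp add: eps0_def)
 moreover have "\<bar>wall_ratio eps (wall_exponent eps y) s
   - (gauss_R s y + eps * wall_r1 s y + eps\<^sup>2 * wall_r2 s y)\<bar>
  \<le> (40 * D ^ 3) * (eps ^ 3 * ((1 + abs y) ^ 60 * (gauss_R s y * (1 - gauss_R s y))))"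
  if small: "eps < eps0" and range: "wall_range eps y" for eps y
 proof -
  have eps: "0 < eps" using range by (simp add: wall_range_def)
  define a where "a = wall_exponent eps y"
  have "abs (eps * y) \<le> eps * (1 + abs y) ^ 1" using eps by (simp add: abs_mult)
  also have "... \<le> 1/8" using wall_range_le[OF range, of 1] by simp
  finally have "0 < 1 - eps * y" by linarith
  then have a: "0 < a" using eps by (simp add: a_def wall_exponent_def)
  define g where "g = gauss_tail y"
  have g: "0 < g" by (simp add: g_def gauss_tail_pos)
  define K where "K = D * (1 + abs y) ^ 20"
  have pw: "1 \<le> (1 + abs y) ^ 20" by (intro one_le_power) auto
  have K: "1 \<le> K" unfolding K_def using D(1) pw by (metis mult_mono mult_1 order.trans zero_le_one)
  have eK: "eps * K \<le> 1/8"
  proof -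
   have "sqrt eps \<le> 1 / (8 * D)"
    using small D by (intro real_le_lsqrt) (auto simp: eps0_def)
   then have "eps * (1 + abs y) ^ 20 \<le> 1 / (8 * D)" using wall_range_sqrt[OF range] by linarith
   then have "D * (eps * (1 + abs y) ^ 20) \<le> D * (1 / (8 * D))" using D by (intro mult_left_mono) auto
   then show ?thesis using D by (simp add: K_def mult_ac)
  qed
  define x0 where "x0 = gauss_R s y"
  define d0 where "d0 = 1 - x0"
  have x0: "0 \<le> x0" "0 \<le> d0" "x0 + d0 = 1"
   using gauss_R_pos[of s y] gauss_R_le_1[OF s, of y] by (auto simp: x0_def d0_def)
  have xg: "gauss_tail (y + s) = x0 * g" using g by (simp add: x0_def gauss_R_def g_def)
  have dg: "gauss_tail y - gauss_tail (y + s) = d0 * g"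
   unfolding xg d0_def g_def[symmetric] by (simp add: algebra_simps)
  define I where "I = (\<lambda>S (f :: real \<Rightarrow> real). (LBINT t:S. f t) / g)"
  define e where "e = (\<lambda>t. exp (- (y + t)\<^sup>2))"
  \<comment> \<open>The remainder of the rescaled density, integrated like the three explicit
    terms.\<close>
  define h where "h = (\<lambda>t. exp (- y\<^sup>2) * wall_density eps a t - e t * (1 + eps * wall_P1 y t + eps\<^sup>2 * wall_P2 y t))"
  have em [measurable]: "e \<in> borel_measurable borel" unfolding e_def by measurable
  have hm [measurable]: "h \<in> borel_measurable borel" unfolding h_def by measurable
  have bnd: "abs (I {s..} f) \<le> k * (K * x0) \<and> abs (I {0..s} f) \<le> k * (K * d0)"
   if m: "f \<in> borel_measurable borel" and le: "\<And>t. 0 \<le> t \<Longrightarrow> abs (f t) \<le> (k * c) * wall_err y t" and k: "0 \<le> k" for f k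
  proof
   have kc: "0 \<le> k * c" using k c by simp
   have "abs (LBINT t:{s..}. f t) \<le> (k * c) * (A * (1 + abs y) ^ 20 * (x0 * g))"
    using LBINT_wall_bounded(1)[OF s m le] mult_left_mono[OF A(2)[of y, unfolded xg] kc] by linarith
   also have "... = k * ((c * A) * ((1 + abs y) ^ 20 * (x0 * g)))" by (simp add: mult_ac)
   also have "... \<le> k * (D * ((1 + abs y) ^ 20 * (x0 * g)))"
    using D k x0 g by (intro mult_left_mono mult_right_mono) auto
   finally show "abs (I {s..} f) \<le> k * (K * x0)"
    using g by (simp add: I_def K_def abs_divide divide_le_eq mult_ac)
   have "abs (LBINT t:{0..s}. f t) \<le> (k * c) * (B * (1 + abs y) ^ 20 * (d0 * g))"
    using LBINT_wall_bounded(2)[OF s m le] mult_left_mono[OF B(2)[of y, unfolded dg] kc] by linarith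
   also have "... = k * ((c * B) * ((1 + abs y) ^ 20 * (d0 * g)))" by (simp add: mult_ac)
   also have "... \<le> k * (D * ((1 + abs y) ^ 20 * (d0 * g)))"
    using D k x0 g by (intro mult_left_mono mult_right_mono) auto
   finally show "abs (I {0..s} f) \<le> k * (K * d0)"
    using g by (simp add: I_def K_def abs_divide divide_le_eq mult_ac)
  qed
  have ce: "18 * wall_err y t \<le> (1 * c) * wall_err y t" if "0 \<le> t" for t
   using c wall_err_nonneg[OF that] by (simp add: mult_right_mono)
  define f1 where "f1 = (\<lambda>t. wall_P1 y t * e t)"
  define f2 where "f2 = (\<lambda>t. wall_P2 y t * e t)"
  have f1m [measurable]: "f1 \<in> borel_measurable borel" unfolding f1_def by measurable
  have f2m [measurable]: "f2 \<in> borel_measurable borel" unfolding f2_def by measurable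
  have le1: "abs (f1 t) \<le> (1 * c) * wall_err y t" and le2: "abs (f2 t) \<le> (1 * c) * wall_err y t"
   and le0: "abs (e t) \<le> (1 * c) * wall_err y t" if "0 \<le> t" for t
   using wall_P_gauss_le[OF that, of y] ce[OF that] unfolding f1_def f2_def e_def by linarith+
  have leh: "abs (h t) \<le> (eps ^ 3 * c) * wall_err y t" if "0 \<le> t" for t
  proof -
   have "abs (h t) \<le> c * (eps ^ 3 * wall_err y t)"
    using wall_density_expansion[OF range that] unfolding h_def e_def a_def c_def wall_err_def .
   then show ?thesis by (simp add: mult_ac)
  qed
  have intS: "set_integrable lborel S f" if "f \<in> borel_measurable borel" "\<And>t. 0 \<le> t \<Longrightarrow> abs (f t) \<le> k * wall_err y t"
   "S \<in> sets borel" "S \<subseteq> {0..}" for f k S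
   using set_integrable_wall_bounded[OF order.refl that(1,2)] by (rule set_integrable_subset) (use that in auto)
  define N where "N = x0 + eps * I {s..} f1 + eps\<^sup>2 * I {s..} f2 + I {s..} h"
  define M where "M = d0 + eps * I {0..s} f1 + eps\<^sup>2 * I {0..s} f2 + I {0..s} h"
  have main: "\<bar>N / (N + M) - (x0 + eps * (I {s..} f1 - x0 * (I {s..} f1 + I {0..s} f1)) +
   eps\<^sup>2 * (I {s..} f2 - x0 * (I {s..} f2 + I {0..s} f2) -
    (I {s..} f1 - x0 * (I {s..} f1 + I {0..s} f1)) * (I {s..} f1 + I {0..s} f1)))\<bar>
   \<le> 40 * (eps ^ 3 * (K ^ 3 * (x0 * d0)))"
   unfolding N_def M_def
  proof (rule ratio_expansion[OF eps K eK x0])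
   show "abs (I {s..} f1) \<le> K * x0" "abs (I {0..s} f1) \<le> K * d0" using bnd[OF f1m le1] by auto
   show "abs (I {s..} f2) \<le> K * x0" "abs (I {0..s} f2) \<le> K * d0" using bnd[OF f2m le2] by auto
   show "abs (I {s..} h) \<le> eps ^ 3 * (K * x0)" "abs (I {0..s} h) \<le> eps ^ 3 * (K * d0)"
    using bnd[OF hm leh] eps by auto
  qed
  have split: "(LBINT t:S. exp (- y\<^sup>2) * wall_density eps a t) / g =
    I S e + eps * I S f1 + eps\<^sup>2 * I S f2 + I S h" if S: "S \<in> sets borel" "S \<subseteq> {0..}" for S
  proof -
   have "(LBINT t:S. exp (- y\<^sup>2) * wall_density eps a t) = (LBINT t:S. ((e t + eps * f1 t) + eps\<^sup>2 * f2 t) + h t)"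
    by (simp add: h_def f1_def f2_def algebra_simps)
   also have "... = (((LBINT t:S. e t) + eps * (LBINT t:S. f1 t)) + eps\<^sup>2 * (LBINT t:S. f2 t)) + (LBINT t:S. h t)"
    by (subst set_integral_add | intro set_integral_add set_integrable_mult_right intS[OF em le0 S] intS[OF f1m le1 S]
      intS[OF f2m le2 S] intS[OF hm leh S] | simp)+
   finally show ?thesis by (simp add: I_def add_divide_distrib)
  qed
  have Ie: "I {s..} e = x0" "I {0..s} e = d0"
   unfolding I_def e_def integral_shifted_gauss LBINT_gauss_Icc[OF s] dg unfolding xg using g by auto
  have N: "N = exp (- y\<^sup>2) * wall_mass eps a s / g"
   using split[of "{s..}"] s by (simp add: N_def Ie wall_mass_def)
  have NM: "N + M = exp (- y\<^sup>2) * wall_mass eps a 0 / g"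
  proof -
   have "wall_mass eps a 0 = (LBINT t:{0..s}. wall_density eps a t) + wall_mass eps a s"
    unfolding wall_mass_def by (rule LBINT_Icc_atLeast[OF s set_integrable_wall_density[OF eps a]])
   moreover have "M = exp (- y\<^sup>2) * (LBINT t:{0..s}. wall_density eps a t) / g"
    using split[of "{0..s}"] by (simp add: M_def Ie)
   ultimately show ?thesis unfolding N by (simp add: add_divide_distrib[symmetric] algebra_simps)
  qed
  have ratio: "N / (N + M) = wall_ratio eps a s" unfolding NM unfolding N using g by simp
  have p: "exp (- (y + s)\<^sup>2) / g = gauss_p s y" and q: "exp (- y\<^sup>2) / g = gauss_q y"
   by (simp_all add: gauss_p_def gauss_q_def g_def)
  have I1: "I {s..} f1 = wall_c1 y * x0 + wall_Q1 s y * gauss_p s y"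
   unfolding I_def f1_def e_def LBINT_wall_P1[OF s] xg p[symmetric] using g by (simp add: add_divide_distrib)
  have I2: "I {s..} f2 = wall_c2 y * x0 + wall_Q2 s y * gauss_p s y"
   unfolding I_def f2_def e_def LBINT_wall_P2[OF s] xg p[symmetric] using g by (simp add: add_divide_distrib)
  have T1: "I {s..} f1 + I {0..s} f1 = wall_c1 y + wall_Q1 0 y * gauss_q y"
   using LBINT_Icc_atLeast[OF s intS[OF f1m le1]] LBINT_wall_P1[OF order.refl, of y] g
   unfolding I_def f1_def e_def q[symmetric] by (simp add: add_divide_distrib[symmetric] g_def add.commute) (simp add: field_simps)
  have T2: "I {s..} f2 + I {0..s} f2 = wall_c2 y + wall_Q2 0 y * gauss_q y"
   using LBINT_Icc_atLeast[OF s intS[OF f2m le2]] LBINT_wall_P2[OF order.refl, of y] g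
   unfolding I_def f2_def e_def q[symmetric] by (simp add: add_divide_distrib[symmetric] g_def add.commute) (simp add: field_simps)
  have r1: "I {s..} f1 - x0 * (I {s..} f1 + I {0..s} f1) = wall_r1 s y"
   unfolding T1 unfolding I1 wall_r1_def x0_def by (simp add: algebra_simps)
  have r2: "I {s..} f2 - x0 * (I {s..} f2 + I {0..s} f2) - wall_r1 s y * (I {s..} f1 + I {0..s} f1) = wall_r2 s y"
   unfolding T1 T2 unfolding I2 wall_r2_def wall_Q2_def unfolding wall_r1_def x0_def by (simp add: algebra_simps)
  have "K ^ 3 = D ^ 3 * (1 + abs y) ^ 60" by (simp add: K_def power_mult_distrib power_mult[symmetric])
  then show ?thesis using main unfolding r1 r2 ratio
   by (simp add: a_def x0_def d0_def mult_ac)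
 qed
 moreover have "40 * D ^ 3 > 0" using D by simp
 ultimately show ?thesis by blast
qed

section \<open>Logarithms of the factors\<close>

text \<open>The half-plane \<open>c <= Re z\<close> is convex, avoids the branch cut, and on it the
  derivatives of \<open>Ln\<close> are bounded by powers of \<open>1 / c\<close>, so the complex
  Taylor theorem gives both estimates.\<close>

lemma
 fixes z w :: complex and c :: real
 assumes "0 < c" "c \<le> Re z" "c \<le> Re w"
 shows Ln_lipschitz: "cmod (Ln z - Ln w) \<le> cmod (z - w) / c"
  and Ln_taylor2: "cmod (Ln z - (Ln w + (z - w) / w - (z - w)\<^sup>2 / (2 * w\<^sup>2))) \<le> cmod (z - w) ^ 3 / c ^ 3"
proof -
 define S where "S = {z. c \<le> Re z}"
 have S: "convex S" "z \<in> S" "w \<in> S" using assms by (auto simp: S_def convex_halfspace_Re_ge)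
 have nz: "x \<noteq> 0" "x \<notin> \<real>\<^sub>\<le>\<^sub>0" "c \<le> cmod x" if "x \<in> S" for x
  using that assms complex_Re_le_cmod[of x] by (auto simp: S_def complex_nonpos_Reals_iff)
 define f :: "nat \<Rightarrow> complex \<Rightarrow> complex" where
  "f = (\<lambda>i. if i = 0 then Ln else if i = 1 then inverse else if i = 2 then (\<lambda>x. - (inverse x)\<^sup>2) else (\<lambda>x. 2 * (inverse x) ^ 3))"
 have f0: "(f 0 has_field_derivative f (Suc 0) x) (at x within S)" if "x \<in> S" for x
  using nz[OF that] by (auto simp: f_def inverse_eq_divide intro!: derivative_eq_intros)
 have f1: "(f 1 has_field_derivative f (Suc 1) x) (at x within S)" if "x \<in> S" for x
  using nz[OF that] by (auto simp: f_def power2_eq_square intro!: derivative_eq_intros)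
 have f2: "(f 2 has_field_derivative f (Suc 2) x) (at x within S)" if "x \<in> S" for x
  unfolding f_def using nz[OF that]
  by (auto simp: power2_eq_square power3_eq_cube intro!: derivative_eq_intros)
 have "cmod (f 0 z - (\<Sum>i\<le>0. f i w * (z - w) ^ i / fact i)) \<le> inverse c * cmod (z - w) ^ Suc 0 / fact 0"
 proof (rule complex_Taylor[OF S(1) _ _ S(3,2)])
  show "cmod (f (Suc 0) x) \<le> inverse c" if "x \<in> S" for x
   using nz[OF that] assms by (simp add: f_def norm_inverse le_imp_inverse_le)
 qed (use f0 in auto)
 then show "cmod (Ln z - Ln w) \<le> cmod (z - w) / c" by (simp add: f_def field_simps)
 have "cmod (f 0 z - (\<Sum>i\<le>2. f i w * (z - w) ^ i / fact i)) \<le> (2 / c ^ 3) * cmod (z - w) ^ Suc 2 / fact 2"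
 proof (rule complex_Taylor[OF S(1) _ _ S(3,2)])
  show "cmod (f (Suc 2) x) \<le> 2 / c ^ 3" if "x \<in> S" for x
  proof -
   have "inverse (cmod x) ^ 3 \<le> inverse c ^ 3"
    using nz[OF that] assms by (intro power_mono le_imp_inverse_le) auto
   then show ?thesis by (simp add: f_def norm_mult norm_power norm_inverse power_inverse norm_divide field_simps)
  qed
  show "(f i has_field_derivative f (Suc i) x) (at x within S)" if "x \<in> S" "i \<le> 2" for i x
  proof -
   have "i = 0 \<or> i = 1 \<or> i = 2" using that(2) by auto
   then show ?thesis using f0[OF that(1)] f1[OF that(1)] f2[OF that(1)] by blast
  qed
 qed
 moreover have eq: "(\<Sum>i\<le>2. f i w * (z - w) ^ i / fact i) = Ln w + (z - w) / w - (z - w)\<^sup>2 / (2 * w\<^sup>2)"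
  by (simp add: f_def numeral_2_eq_2 atMost_Suc field_simps)
 ultimately have "cmod (f 0 z - (Ln w + (z - w) / w - (z - w)\<^sup>2 / (2 * w\<^sup>2))) \<le> (2 / c ^ 3) * cmod (z - w) ^ Suc 2 / fact 2"
  by (simp only:)
 then show "cmod (Ln z - (Ln w + (z - w) / w - (z - w)\<^sup>2 / (2 * w\<^sup>2))) \<le> cmod (z - w) ^ 3 / c ^ 3"
  by (simp add: f_def)
qed

lemma norm_add_diff_le: "norm (x + y - z) \<le> norm x + norm y + norm z" for x y z :: "'a :: real_normed_vector"
 using norm_triangle_ineq4[of "x + y" z] norm_triangle_ineq[of x y] by linarith

lemma wall_mass_antimono:
 assumes "0 < eps" "0 < a" "s \<le> t"
 shows "wall_mass eps a t \<le> wall_mass eps a s"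
 unfolding wall_mass_def set_lebesgue_integral_def
proof (rule integral_mono)
 show "indicator {t..} x *\<^sub>R wall_density eps a x \<le> indicator {s..} x *\<^sub>R wall_density eps a x" for x
  using assms(3) by (auto simp: indicator_def wall_density_nonneg)
qed (use set_integrable_wall_density[OF assms(1,2)] in \<open>auto simp: set_integrable_def\<close>)

lemma wall_mass_nonneg: "0 \<le> wall_mass eps a s"
 unfolding wall_mass_def set_lebesgue_integral_def
 by (intro Bochner_Integration.integral_nonneg) (simp add: wall_density_nonneg)

context gauss_family
begin

definition gwall :: "real \<Rightarrow> (nat \<Rightarrow> complex) \<Rightarrow> real \<Rightarrow> complex" where
 "gwall eps w a = 1 + (\<Sum>l\<in>{1..m}. w l * of_real (wall_ratio eps a (s l)))"

lemma wall_ratio_bounds: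
 assumes "0 < eps" "0 < a" "0 \<le> r"
 shows "0 \<le> wall_ratio eps a r" "wall_ratio eps a r \<le> 1"
 using wall_mass_nonneg[of eps a r] wall_mass_antimono[OF assms] wall_mass_pos[OF assms(1,2), of 0] assms(1)
 by (auto simp: divide_le_eq)

lemma Re_gwall: "w \<in> Om \<Longrightarrow> 0 < eps \<Longrightarrow> 0 < a \<Longrightarrow> c0 \<le> Re (gwall eps w a)"
 unfolding gwall_def
proof (rule Om_Re)
 assume a: "0 < eps" "0 < a"
 show "0 \<le> wall_mass eps a (s l) / wall_mass eps a 0 \<and> wall_mass eps a (s l) / wall_mass eps a 0 \<le> 1"
  if "l \<in> {1..m}" for l
  using wall_ratio_bounds[OF a, of "s l"] s_pos[OF that] by auto
 show "wall_ratio eps a (s i) \<le> wall_ratio eps a (s j)"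
  if "1 \<le> i" "i \<le> j" "j \<le> m" for i j
  using that a by (intro divide_right_mono wall_mass_antimono s_antimono wall_mass_nonneg)
qed

text \<open>The coefficients of the logarithm in powers of \<open>eps\<close>, where
  \<open>H1\<close> and \<open>H2\<close> are \<open>h1 / sqrt 2\<close> and \<open>h2 / 2\<close>.
  \<open>Hinf\<close> is the limit of \<open>H0\<close> for \<open>y\<close> tending to minus
  infinity; it becomes the sum of the \<open>u j\<close> on the polydisc, so that \<open>H0c\<close>
  is the centred integrand of the statement.\<close>

definition H0 :: "(nat \<Rightarrow> complex) \<Rightarrow> real \<Rightarrow> complex" where
 "H0 w y = Ln (gz w y)"
definition S1 :: "(nat \<Rightarrow> complex) \<Rightarrow> real \<Rightarrow> complex" where
 "S1 w y = (\<Sum>l\<in>{1..m}. w l * of_real (wall_r1 (s l) y))"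
definition S2 :: "(nat \<Rightarrow> complex) \<Rightarrow> real \<Rightarrow> complex" where
 "S2 w y = (\<Sum>l\<in>{1..m}. w l * of_real (wall_r2 (s l) y))"
definition H1 :: "(nat \<Rightarrow> complex) \<Rightarrow> real \<Rightarrow> complex" where
 "H1 w y = inverse (gz w y) * S1 w y"
definition H2 :: "(nat \<Rightarrow> complex) \<Rightarrow> real \<Rightarrow> complex" where
 "H2 w y = inverse (gz w y) * S2 w y + (- 1/2) * (H1 w y * H1 w y)"
definition Hinf :: "(nat \<Rightarrow> complex) \<Rightarrow> complex" where
 "Hinf w = Ln (1 + (\<Sum>l\<in>{1..m}. w l))"
definition H0c :: "(nat \<Rightarrow> complex) \<Rightarrow> real \<Rightarrow> complex" where
 "H0c w y = H0 w y - (if y < 0 then Hinf w else 0)"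
definition dH0 :: "(nat \<Rightarrow> complex) \<Rightarrow> real \<Rightarrow> complex" where
 "dH0 w y = inverse (gz w y) * dgz w y"

lemma Ideal_r1: assumes "l \<in> {1..m}" shows "Ideal (\<lambda>w y. of_real (wall_r1 (s l) y))"
proof -
 have "Ideal (\<lambda>w y. of_real (wall_Q1 (s l) y) * of_real (gauss_p (s l) y) +
   of_real (- wall_Q1 0 y) * of_real (gauss_q y * gauss_R (s l) y))"
  unfolding wall_Q1_def by (intro Ideal_add Ideal_mult Ideal_p Ideal_qR assms Alg_real_intros)
 then show ?thesis by (simp add: wall_r1_def)
qed

lemma Ideal_r2: assumes "l \<in> {1..m}" shows "Ideal (\<lambda>w y. of_real (wall_r2 (s l) y))"
proof -
 have "Ideal (\<lambda>w y. of_real (wall_S2 (s l) y) * of_real (gauss_p (s l) y) +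
   of_real (- wall_S2 0 y) * of_real (gauss_q y * gauss_R (s l) y) +
   of_real (- (wall_Q1 0 y * gauss_q y)) * of_real (wall_r1 (s l) y))"
  unfolding wall_Q1_def wall_S2_def
  by (intro Ideal_add Ideal_mult Ideal_p Ideal_qR Ideal_r1 assms Alg_real_intros)
 then show ?thesis by (simp add: wall_r2_def)
qed

lemma Ideal_S1: "Ideal S1"
proof -
 have "Ideal (\<lambda>w y. \<Sum>l\<in>{1..m}. w l * of_real (wall_r1 (s l) y))"
  by (intro Ideal_sum finite_atLeastAtMost Ideal_mult Alg_omega Ideal_r1) auto
 then show ?thesis by (simp add: S1_def[abs_def])
qed

lemma Ideal_S2: "Ideal S2"
proof -
 have "Ideal (\<lambda>w y. \<Sum>l\<in>{1..m}. w l * of_real (wall_r2 (s l) y))"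
  by (intro Ideal_sum finite_atLeastAtMost Ideal_mult Alg_omega Ideal_r2) auto
 then show ?thesis by (simp add: S2_def[abs_def])
qed

lemma Ideal_H1: "Ideal H1"
 using Ideal_mult[OF Alg_inv Ideal_S1] by (simp add: H1_def[abs_def])

lemma Ideal_H2: "Ideal H2"
proof -
 have "Ideal (\<lambda>w y. inverse (gz w y) * S2 w y + (- 1/2) * (H1 w y * H1 w y))"
  by (intro Ideal_add Ideal_mult Alg_inv Ideal_S2 Alg_const Ideal_H1 Ideal_imp_Alg[OF Ideal_H1])
 then show ?thesis by (simp add: H2_def[abs_def])
qed

lemma Ideal_dH0: "Ideal dH0"
 using Ideal_mult[OF Alg_inv Ideal_dgz] by (simp add: dH0_def[abs_def])

lemma deriv_H0: "deriv_of dH0 H0"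
 unfolding deriv_of_def
proof (intro ballI allI)
 fix w y assume om: "w \<in> Om"
 have "gz w y \<notin> \<real>\<^sub>\<le>\<^sub>0" using Re_gz[OF om, of y] c0_pos by (auto simp: complex_nonpos_Reals_iff)
 then have "(Ln has_field_derivative inverse (gz w y)) (at (gz w y))" by (rule has_field_derivative_Ln)
 from field_vector_diff_chain_at[OF gz_has_vector_derivative this]
 show "(H0 w has_vector_derivative dH0 w y) (at y)"
  by (simp add: o_def H0_def[abs_def] dH0_def mult.commute)
qed

lemma Ideal_bound:
 assumes "Ideal f"
 shows "\<exists>C>0. \<forall>w\<in>Om. \<forall>y. cmod (f w y) \<le> C * decay y"
proof -
 obtain C N where C: "C \<ge> 0" "\<And>w y. w \<in> Om \<Longrightarrow> cmod (f w y) \<le> C * (1 + abs y) ^ N * exp (- (2 * \<sigma> * abs y))"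
  using Ideal_bound_poly[OF assms] by metis
 obtain D where D: "D > 0" "\<And>y. (1 + abs y) ^ N * exp (- (2 * \<sigma> * abs y)) \<le> D * decay y"
  using poly_exp_decay[of N] by metis
 have "cmod (f w y) \<le> ((C + 1) * D) * decay y" if "w \<in> Om" for w y
 proof -
  have "cmod (f w y) \<le> C * ((1 + abs y) ^ N * exp (- (2 * \<sigma> * abs y)))"
   using C(2)[OF that, of y] by (simp add: mult.assoc)
  also have "... \<le> (C + 1) * (D * decay y)"
   by (rule mult_mono) (use C(1) D in auto)
  finally show ?thesis by (simp add: mult.assoc)
 qed
 then show ?thesis using C(1) D(1) by (intro exI[of _ "(C + 1) * D"]) auto
qed

lemma Re_1_sum: "w \<in> Om \<Longrightarrow> c0 \<le> Re (1 + (\<Sum>l\<in>{1..m}. w l))"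
 using Om_Re[of w "\<lambda>_. 1"] by simp

text \<open>\<open>H0c\<close> is not in the ideal, so its decay is proved by hand:
  \<open>Ln\<close> is Lipschitz on the half-plane, and \<open>gz\<close> is exponentially close to
  \<open>1\<close> on the right and to \<open>1 + sum w\<close> on the left.\<close>

lemma H0c_bound: "\<exists>C>0. \<forall>w\<in>Om. \<forall>y. cmod (H0c w y) \<le> C * decay y"
proof -
 define D where "D = (\<Sum>l\<in>{1..m}. s l / gauss_tail 0 * exp ((s l + \<sigma>)\<^sup>2))"
 define C where "C = B * (m + D) / c0 + 1"
 have K: "0 \<le> s l / gauss_tail 0 * exp ((s l + \<sigma>)\<^sup>2)" if "l \<in> {1..m}" for l
  using s_pos[OF that] gauss_tail_pos[of 0] by auto
 have D: "0 \<le> D" unfolding D_def by (intro sum_nonneg K)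
 have C: "C > 0" unfolding C_def using B_nonneg D c0_pos by (intro add_nonneg_pos) auto
 have "cmod (H0c w y) \<le> C * decay y" if om: "w \<in> Om" for w y
 proof -
  define e where "e = exp (- (2 * \<sigma> * abs y))"
  have e: "0 \<le> e" by (simp add: e_def)
  have "cmod (H0c w y) \<le> B * (m + D) * e / c0"
  proof (cases "y < 0")
   case False
   have "cmod (H0c w y) = cmod (Ln (gz w y) - Ln 1)" using False by (simp add: H0c_def H0_def)
   also have "... \<le> cmod (gz w y - 1) / c0"
    using Om_Re[OF om, of "\<lambda>_. 0"] by (intro Ln_lipschitz c0_pos Re_gz om) auto
   also have "cmod (gz w y - 1) \<le> (\<Sum>l\<in>{1..m}. B * e)"
    unfolding gz_def add_diff_cancel_left'
   proof (intro order.trans[OF norm_sum] sum_mono)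
    fix l assume l: "l \<in> {1..m}"
    show "cmod (w l * of_real (gauss_R (s l) y)) \<le> B * e"
     unfolding norm_mult e_def using False gauss_R_pos[of "s l" y]
      gauss_R_decay_pos[OF \<sigma>_pos \<sigma>_le[OF l], of y] Om_le[OF om l] B_nonneg
     by (intro mult_mono) auto
   qed
   also have "... = B * m * e" by simp
   also have "... \<le> B * (m + D) * e" using B_nonneg D e by (intro mult_right_mono mult_left_mono) auto
   finally show ?thesis using c0_pos by (simp add: divide_right_mono)
  next
   case True
   have "cmod (H0c w y) = cmod (Ln (gz w y) - Ln (1 + (\<Sum>l\<in>{1..m}. w l)))"
    using True by (simp add: H0c_def H0_def Hinf_def)
   also have "... \<le> cmod (gz w y - (1 + (\<Sum>l\<in>{1..m}. w l))) / c0"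
    by (intro Ln_lipschitz c0_pos Re_gz om Re_1_sum)
   also have "gz w y - (1 + (\<Sum>l\<in>{1..m}. w l)) = (\<Sum>l\<in>{1..m}. w l * of_real (gauss_R (s l) y - 1))"
    unfolding gz_def by (simp add: sum_subtractf algebra_simps)
   also have "cmod \<dots> \<le> (\<Sum>l\<in>{1..m}. B * ((s l / gauss_tail 0 * exp ((s l + \<sigma>)\<^sup>2)) * e))"
   proof (intro order.trans[OF norm_sum] sum_mono)
    fix l assume l: "l \<in> {1..m}"
    have "cmod (of_real (gauss_R (s l) y - 1)) = 1 - gauss_R (s l) y"
     using gauss_R_le_1[of "s l" y] s_pos[OF l] unfolding norm_of_real by simp
    then show "cmod (w l * of_real (gauss_R (s l) y - 1)) \<le> B * ((s l / gauss_tail 0 * exp ((s l + \<sigma>)\<^sup>2)) * e)"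
     unfolding norm_mult e_def using True gauss_R_le_1[of "s l" y] s_pos[OF l]
      gauss_R_decay_neg[OF \<sigma>_pos \<sigma>_le[OF l], of y] Om_le[OF om l] B_nonneg
     by (intro mult_mono) auto
   qed
   also have "... = B * D * e" by (simp add: D_def sum_distrib_left sum_distrib_right mult_ac)
   also have "... \<le> B * (m + D) * e" using B_nonneg D e by (intro mult_right_mono mult_left_mono) auto
   finally show ?thesis using c0_pos by (simp add: divide_right_mono)
  qed
  also have "... \<le> C * e" unfolding C_def using e by (simp add: distrib_right)
  also have "... \<le> C * decay y"
   unfolding e_def using C \<sigma>_pos by (intro mult_left_mono) auto
  finally show ?thesis .
 qed
 then show ?thesis using C by blast
qed

lemma gwall_expansion:
 "\<exists>C>0. \<exists>eps0>0. \<forall>eps y. eps < eps0 \<longrightarrow> wall_range eps y \<longrightarrow> (\<forall>w\<in>Om.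
  cmod (gwall eps w (wall_exponent eps y) - (gz w y + eps * S1 w y + eps\<^sup>2 * S2 w y)) \<le> C * (eps ^ 3 * decay y))"
proof -
 have "\<forall>l\<in>{1..m}. \<exists>C eps0. C > 0 \<and> eps0 > 0 \<and> (\<forall>eps y. eps < eps0 \<longrightarrow> wall_range eps y \<longrightarrow>
  \<bar>wall_ratio eps (wall_exponent eps y) (s l)
   - (gauss_R (s l) y + eps * wall_r1 (s l) y + eps\<^sup>2 * wall_r2 (s l) y)\<bar>
  \<le> C * (eps ^ 3 * decay y))"
 proof
  fix l assume l: "l \<in> {1..m}"
  obtain C eps0 where C: "C > 0" "eps0 > 0" "\<And>eps y. eps < eps0 \<Longrightarrow> wall_range eps y \<Longrightarrow>
   \<bar>wall_ratio eps (wall_exponent eps y) (s l)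
   - (gauss_R (s l) y + eps * wall_r1 (s l) y + eps\<^sup>2 * wall_r2 (s l) y)\<bar>
   \<le> C * (eps ^ 3 * ((1 + abs y) ^ 60 * (gauss_R (s l) y * (1 - gauss_R (s l) y))))"
   using wall_ratio_expansion[OF less_imp_le[OF s_pos[OF l]]] by blast
  obtain D where D: "D \<ge> 0" "\<And>y. gauss_R (s l) y * (1 - gauss_R (s l) y) \<le> D * exp (- (2 * \<sigma> * abs y))"
   using gauss_R_var_bound[OF \<sigma>_pos \<sigma>_le[OF l]] by metis
  obtain E where E: "E > 0" "\<And>y. (1 + abs y) ^ 60 * exp (- (2 * \<sigma> * abs y)) \<le> E * decay y"
   using poly_exp_decay[of 60] by metis
  have "\<bar>wall_ratio eps (wall_exponent eps y) (s l)
   - (gauss_R (s l) y + eps * wall_r1 (s l) y + eps\<^sup>2 * wall_r2 (s l) y)\<bar>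
   \<le> (C * (D + 1) * E) * (eps ^ 3 * decay y)" if "eps < eps0" "wall_range eps y" for eps y
  proof -
   have eps: "0 < eps" using that(2) by (simp add: wall_range_def)
   have "(1 + abs y) ^ 60 * (gauss_R (s l) y * (1 - gauss_R (s l) y)) \<le> (1 + abs y) ^ 60 * (D * exp (- (2 * \<sigma> * abs y)))"
    using D(2)[of y] by (intro mult_left_mono) auto
   also have "... = D * ((1 + abs y) ^ 60 * exp (- (2 * \<sigma> * abs y)))" by simp
   also have "... \<le> (D + 1) * (E * decay y)"
    by (rule mult_mono) (use D(1) E in auto)
   finally have "C * (eps ^ 3 * ((1 + abs y) ^ 60 * (gauss_R (s l) y * (1 - gauss_R (s l) y)))) \<le>
    C * (eps ^ 3 * ((D + 1) * (E * decay y)))"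
    using C(1) eps by (intro mult_left_mono) auto
   with C(3)[OF that] show ?thesis by (simp add: mult_ac)
  qed
  moreover have "C * (D + 1) * E > 0" using C D E by auto
  ultimately show "\<exists>C eps0. C > 0 \<and> eps0 > 0 \<and> (\<forall>eps y. eps < eps0 \<longrightarrow> wall_range eps y \<longrightarrow>
  \<bar>wall_ratio eps (wall_exponent eps y) (s l)
   - (gauss_R (s l) y + eps * wall_r1 (s l) y + eps\<^sup>2 * wall_r2 (s l) y)\<bar>
  \<le> C * (eps ^ 3 * decay y))" using C(2) by blast
 qed
 then obtain C eps0 where C: "\<And>l. l \<in> {1..m} \<Longrightarrow> C l > 0" "\<And>l. l \<in> {1..m} \<Longrightarrow> eps0 l > (0::real)"
  "\<And>l eps y. l \<in> {1..m} \<Longrightarrow> eps < eps0 l \<Longrightarrow> wall_range eps y \<Longrightarrow>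
  \<bar>wall_ratio eps (wall_exponent eps y) (s l)
   - (gauss_R (s l) y + eps * wall_r1 (s l) y + eps\<^sup>2 * wall_r2 (s l) y)\<bar>
  \<le> C l * (eps ^ 3 * decay y)"
  by metis
 define e0 where "e0 = Min (insert 1 (eps0 ` {1..m}))"
 have e0: "e0 > 0" unfolding e0_def using C(2) by (subst Min_gr_iff) auto
 have e0l: "e0 \<le> eps0 l" if "l \<in> {1..m}" for l unfolding e0_def using that by (intro Min_le) auto
 define D where "D = B * (\<Sum>l\<in>{1..m}. C l) + 1"
 have D: "D > 0" unfolding D_def using B_nonneg C(1)
  by (intro add_nonneg_pos mult_nonneg_nonneg sum_nonneg) (auto intro: less_imp_le)
 have "cmod (gwall eps w (wall_exponent eps y) - (gz w y + eps * S1 w y + eps\<^sup>2 * S2 w y)) \<le> D * (eps ^ 3 * decay y)"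
  if "eps < e0" "wall_range eps y" "w \<in> Om" for eps y w
 proof -
  have eps: "0 < eps" using that(2) by (simp add: wall_range_def)
  have eq: "gwall eps w (wall_exponent eps y) - (gz w y + eps * S1 w y + eps\<^sup>2 * S2 w y) =
   (\<Sum>l\<in>{1..m}. w l * of_real (wall_mass eps (wall_exponent eps y) (s l) / wall_mass eps (wall_exponent eps y) 0
   - (gauss_R (s l) y + eps * wall_r1 (s l) y + eps\<^sup>2 * wall_r2 (s l) y)))"
   unfolding gwall_def gz_def S1_def S2_def
   by (simp add: sum_distrib_left sum.distrib sum_subtractf algebra_simps)
  have "cmod (gwall eps w (wall_exponent eps y) - (gz w y + eps * S1 w y + eps\<^sup>2 * S2 w y)) \<le> (\<Sum>l\<in>{1..m}. B * (C l * (eps ^ 3 * decay y)))"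
   unfolding eq
  proof (intro order.trans[OF norm_sum] sum_mono)
   fix l assume l: "l \<in> {1..m}"
   have "eps < eps0 l" using e0l[OF l] that by linarith
   from C(3)[OF l this that(2)] Om_le[OF that(3) l]
   show "cmod (w l * of_real (wall_mass eps (wall_exponent eps y) (s l) / wall_mass eps (wall_exponent eps y) 0
   - (gauss_R (s l) y + eps * wall_r1 (s l) y + eps\<^sup>2 * wall_r2 (s l) y))) \<le> B * (C l * (eps ^ 3 * decay y))"
    unfolding norm_mult norm_of_real using B_nonneg by (intro mult_mono) auto
  qed
  also have "... = (B * (\<Sum>l\<in>{1..m}. C l)) * (eps ^ 3 * decay y)"
   by (simp only: sum_distrib_left[symmetric] sum_distrib_right[symmetric] mult.assoc)
  also have "... \<le> D * (eps ^ 3 * decay y)" unfolding D_def using eps by (intro mult_right_mono) auto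
  finally show ?thesis by simp
 qed
 then show ?thesis using D e0 by blast
qed

text \<open>A second order expansion of \<open>Ln\<close> around \<open>gz\<close>, into which the
  expansion of the factor is inserted. The increment is of order \<open>eps * decay y\<close>, so
  powers of it keep one factor \<open>decay y\<close>.\<close>

lemma Ln_gwall_expansion:
 "\<exists>C>0. \<exists>eps0>0. \<forall>eps y. eps < eps0 \<longrightarrow> wall_range eps y \<longrightarrow> (\<forall>w\<in>Om.
  cmod (Ln (gwall eps w (wall_exponent eps y)) - (H0 w y + eps * H1 w y + eps\<^sup>2 * H2 w y)) \<le> C * (eps ^ 3 * decay y))"
proof -
 obtain A eps0 where A: "A > 0" "eps0 > 0" "\<And>eps y w. eps < eps0 \<Longrightarrow> wall_range eps y \<Longrightarrow> w \<in> Om \<Longrightarrow>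
  cmod (gwall eps w (wall_exponent eps y) - (gz w y + eps * S1 w y + eps\<^sup>2 * S2 w y)) \<le> A * (eps ^ 3 * decay y)"
  using gwall_expansion by blast
 obtain K1 where K1: "K1 > 0" "\<And>w y. w \<in> Om \<Longrightarrow> cmod (S1 w y) \<le> K1 * decay y"
  using Ideal_bound[OF Ideal_S1] by metis
 obtain K2 where K2: "K2 > 0" "\<And>w y. w \<in> Om \<Longrightarrow> cmod (S2 w y) \<le> K2 * decay y"
  using Ideal_bound[OF Ideal_S2] by metis
 define V where "V = K1 + K2 + A"
 have V: "V > 0" using A K1 K2 by (simp add: V_def)
 \<comment> \<open>The summands belong to the substitution in the linear term, the substitution in
   the quadratic term, and the cubic Taylor remainder.\<close>
 define C where "C = A / c0 + V * V / c0\<^sup>2 + V ^ 3 / c0 ^ 3"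
 have "C > 0" unfolding C_def using A(1) V c0_pos by (intro add_pos_pos divide_pos_pos) auto
 moreover have "cmod (Ln (gwall eps w (wall_exponent eps y)) - (H0 w y + eps * H1 w y + eps\<^sup>2 * H2 w y)) \<le> C * (eps ^ 3 * decay y)"
  if small: "eps < eps0" and range: "wall_range eps y" and om: "w \<in> Om" for eps y w
 proof -
  have eps: "0 < eps" using range by (simp add: wall_range_def)
  have eps1: "eps \<le> 1" using wall_range_le[OF range, of 0] by simp
  have "abs (eps * y) \<le> eps * (1 + abs y) ^ 1" using eps by (simp add: abs_mult)
  also have "... \<le> 1/8" using wall_range_le[OF range, of 1] by simp
  finally have "0 < 1 - eps * y" by linarith
  then have a: "0 < wall_exponent eps y" using eps by (simp add: wall_exponent_def)
  define \<delta> where "\<delta> = decay y"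
  have \<delta>: "0 < \<delta>" "\<delta> \<le> 1" using \<sigma>_pos by (auto simp: \<delta>_def)
  define g where "g = gz w y"
  define h where "h = gwall eps w (wall_exponent eps y)"
  define v where "v = h - g"
  define S where "S = S1 w y"
  define T where "T = S2 w y"
  have S: "cmod S \<le> K1 * \<delta>" and T: "cmod T \<le> K2 * \<delta>" using K1(2) K2(2) om by (auto simp: S_def T_def \<delta>_def)
  have g: "c0 \<le> cmod g" "g \<noteq> 0" using norm_gz[OF om, of y] gz_nz[OF om, of y] by (auto simp: g_def)
  have err: "cmod (v - (eps * S + eps\<^sup>2 * T)) \<le> A * (eps ^ 3 * \<delta>)"
   using A(3)[OF small range om] by (simp add: v_def h_def g_def S_def T_def \<delta>_def algebra_simps)
  have e32: "eps ^ 3 \<le> eps\<^sup>2" "eps\<^sup>2 \<le> eps" using power_decreasing[of 2 3 eps] power_decreasing[of 1 2 eps] eps eps1 by auto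
  have nT: "cmod (eps\<^sup>2 * T) \<le> K2 * (eps\<^sup>2 * \<delta>)" and nS: "cmod (eps * S) \<le> K1 * (eps * \<delta>)"
   using mult_left_mono[OF T, of "eps\<^sup>2"] mult_left_mono[OF S, of eps] eps by (auto simp: norm_mult norm_power mult_ac)
  have e3A: "A * (eps ^ 3 * \<delta>) \<le> A * (eps\<^sup>2 * \<delta>)" using e32 A \<delta> by (intro mult_left_mono mult_right_mono) auto
  have vS: "cmod (v - eps * S) \<le> (K2 + A) * (eps\<^sup>2 * \<delta>)"
  proof -
   have "v - eps * S = (v - (eps * S + eps\<^sup>2 * T)) + eps\<^sup>2 * T" by simp
   then have "cmod (v - eps * S) \<le> cmod (v - (eps * S + eps\<^sup>2 * T)) + cmod (eps\<^sup>2 * T)" by (metis norm_triangle_ineq)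
   with err nT e3A show ?thesis by (simp only: distrib_right)
  qed
  have e2: "(K2 + A) * (eps\<^sup>2 * \<delta>) \<le> (K2 + A) * (eps * \<delta>)"
   using e32 A K2 \<delta> by (intro mult_left_mono mult_right_mono) auto
  have v: "cmod v \<le> V * (eps * \<delta>)"
  proof -
   have "cmod v \<le> cmod (v - eps * S) + cmod (eps * S)" by (metis diff_add_cancel norm_triangle_ineq)
   with vS nS e2 show ?thesis unfolding V_def by (simp add: distrib_right)
  qed
  have vS': "cmod (v + eps * S) \<le> (2 * V) * (eps * \<delta>)"
  proof -
   have "K1 * (eps * \<delta>) \<le> V * (eps * \<delta>)" using A K2 eps \<delta> unfolding V_def by (intro mult_right_mono) auto
   with v nS norm_triangle_ineq[of v "eps * S"] show ?thesis by (simp add: mult.assoc)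
  qed
  have sq: "cmod (v\<^sup>2 - (eps * S)\<^sup>2) \<le> 2 * (V * V * (eps ^ 3 * \<delta>))"
  proof -
   have "v\<^sup>2 - (eps * S)\<^sup>2 = (v - eps * S) * (v + eps * S)" by (simp add: power2_eq_square algebra_simps)
   then have "cmod (v\<^sup>2 - (eps * S)\<^sup>2) \<le> (V * (eps\<^sup>2 * \<delta>)) * ((2 * V) * (eps * \<delta>))"
    unfolding norm_mult[symmetric]
   proof -
    have "(K2 + A) * (eps\<^sup>2 * \<delta>) \<le> V * (eps\<^sup>2 * \<delta>)" unfolding V_def using K1 \<delta> by (intro mult_right_mono) auto
    with vS have "cmod (v - eps * S) \<le> V * (eps\<^sup>2 * \<delta>)" by linarith
    then have "cmod ((v - eps * S) * (v + eps * S)) \<le> (V * (eps\<^sup>2 * \<delta>)) * ((2 * V) * (eps * \<delta>))"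
     unfolding norm_mult using vS' V \<delta> by (intro mult_mono) auto
    then show ?thesis using \<open>v\<^sup>2 - (eps * S)\<^sup>2 = (v - eps * S) * (v + eps * S)\<close> by simp
   qed
   also have "... = (2 * (V * V * (eps ^ 3 * \<delta>))) * \<delta>" by (simp add: power_numeral_reduce mult_ac)
   also have "... \<le> (2 * (V * V * (eps ^ 3 * \<delta>))) * 1" using \<delta> V eps by (intro mult_left_mono) auto
   finally show ?thesis by simp
  qed
  have cube: "cmod v ^ 3 \<le> V ^ 3 * (eps ^ 3 * \<delta>)"
  proof -
   have "cmod v ^ 3 \<le> (V * (eps * \<delta>)) ^ 3" using v by (intro power_mono) auto
   also have "... = V ^ 3 * (eps ^ 3 * \<delta> ^ 3)" by (simp add: power_mult_distrib)
   also have "... \<le> V ^ 3 * (eps ^ 3 * \<delta>)"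
    using power_decreasing[of 1 3 \<delta>] \<delta> V eps by (intro mult_left_mono) auto
   finally show ?thesis .
  qed
  have H: "H0 w y + eps * H1 w y + eps\<^sup>2 * H2 w y = Ln g + (eps * S + eps\<^sup>2 * T) / g - (eps * S)\<^sup>2 / (2 * g\<^sup>2)"
   unfolding H0_def H2_def H1_def g_def[symmetric] S_def[symmetric] T_def[symmetric] using g
   by (simp add: field_simps power2_eq_square)
  have "cmod (Ln h - (Ln g + v / g - v\<^sup>2 / (2 * g\<^sup>2))) \<le> cmod v ^ 3 / c0 ^ 3"
   unfolding v_def by (rule Ln_taylor2[OF c0_pos]) (auto simp: h_def g_def intro!: Re_gwall Re_gz om eps a)
  also have "... \<le> V ^ 3 * (eps ^ 3 * \<delta>) / c0 ^ 3" using cube c0_pos by (intro divide_right_mono) auto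
  finally have t1: "cmod (Ln h - (Ln g + v / g - v\<^sup>2 / (2 * g\<^sup>2))) \<le> V ^ 3 * (eps ^ 3 * \<delta>) / c0 ^ 3" .
  have t2: "cmod ((v - (eps * S + eps\<^sup>2 * T)) / g) \<le> A * (eps ^ 3 * \<delta>) / c0"
   unfolding norm_divide using err g c0_pos A(1) eps \<delta> by (intro frac_le) auto
  have t3: "cmod ((v\<^sup>2 - (eps * S)\<^sup>2) / (2 * g\<^sup>2)) \<le> 2 * (V * V * (eps ^ 3 * \<delta>)) / (2 * c0\<^sup>2)"
   unfolding norm_divide norm_mult norm_power using sq g c0_pos V eps \<delta>
   by (intro frac_le) (auto intro!: power_mono)
  have "Ln h - (H0 w y + eps * H1 w y + eps\<^sup>2 * H2 w y) =
   (Ln h - (Ln g + v / g - v\<^sup>2 / (2 * g\<^sup>2))) + (v - (eps * S + eps\<^sup>2 * T)) / g - (v\<^sup>2 - (eps * S)\<^sup>2) / (2 * g\<^sup>2)"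
   unfolding H by (simp add: diff_divide_distrib)
  then have "cmod (Ln h - (H0 w y + eps * H1 w y + eps\<^sup>2 * H2 w y)) \<le>
   cmod (Ln h - (Ln g + v / g - v\<^sup>2 / (2 * g\<^sup>2))) + cmod ((v - (eps * S + eps\<^sup>2 * T)) / g) + cmod ((v\<^sup>2 - (eps * S)\<^sup>2) / (2 * g\<^sup>2))"
   by (simp only: norm_add_diff_le)
  also have "... \<le> V ^ 3 * (eps ^ 3 * \<delta>) / c0 ^ 3 + A * (eps ^ 3 * \<delta>) / c0 + 2 * (V * V * (eps ^ 3 * \<delta>)) / (2 * c0\<^sup>2)"
   using t1 t2 t3 by linarith
  also have "... = C * (eps ^ 3 * \<delta>)" by (simp add: C_def distrib_right)
  finally show ?thesis by (simp add: h_def \<delta>_def)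
 qed
 ultimately show ?thesis using A(2) by blast
qed

end

section \<open>Summation by the midpoint rule\<close>

lemma norm_add_le2: "norm x \<le> a \<Longrightarrow> norm y \<le> b \<Longrightarrow> norm (x + y) \<le> a + b" for x y :: "'a :: real_normed_vector"
 by (rule norm_triangle_le) simp

lemma norm_diff_le2: "norm x \<le> a \<Longrightarrow> norm y \<le> b \<Longrightarrow> norm (x - y) \<le> a + b" for x y :: "'a :: real_normed_vector"
 by (rule norm_triangle_le_diff) simp

section \<open>The midpoint rule on one cell\<close>

lemma norm_le_of_vector_derivative:
 fixes g :: "real \<Rightarrow> complex"
 assumes "\<And>h. 0 \<le> h \<Longrightarrow> h \<le> d \<Longrightarrow> (g has_vector_derivative g' h) (at h)"
  and "\<And>h. 0 \<le> h \<Longrightarrow> h \<le> d \<Longrightarrow> norm (g' h) \<le> c" and "g 0 = 0" and "0 \<le> h" "h \<le> d"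
 shows "norm (g h) \<le> c * h"
proof -
 have "norm (g h - g 0) \<le> c * norm (h - 0)"
 proof (rule differentiable_bound[of "{0..d}" g "\<lambda>x u. u *\<^sub>R g' x"])
  show "(g has_derivative (\<lambda>u. u *\<^sub>R g' x)) (at x within {0..d})" if "x \<in> {0..d}" for x
   using assms(1)[of x] that by (auto simp: has_vector_derivative_def intro: has_derivative_at_withinI)
  show "onorm (\<lambda>u. u *\<^sub>R g' x) \<le> c" if "x \<in> {0..d}" for x
  proof (rule onorm_le)
   fix u :: real
   show "norm (u *\<^sub>R g' x) \<le> c * norm u"
    using mult_left_mono[OF assms(2)[of x] abs_ge_zero[of u]] that by (simp add: mult.commute)
  qed
 qed (use assms(4,5) in auto)
 then show ?thesis using assms by simp
qed

lemma has_vector_derivative_shift_plus: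
 "(A has_vector_derivative D) (at (j + h)) \<Longrightarrow> ((\<lambda>h. A (j + h)) has_vector_derivative D) (at h)" for h j :: real
proof -
 assume A: "(A has_vector_derivative D) (at (j + h))"
 have "((\<lambda>h. j + h) has_real_derivative 1) (at h)" by (auto intro!: derivative_eq_intros)
 then have "((\<lambda>h. j + h) has_vector_derivative 1) (at h)"
  by (simp only: has_real_derivative_iff_has_vector_derivative)
 from vector_diff_chain_at[OF this A] show ?thesis by (simp add: o_def)
qed

lemma has_vector_derivative_shift_minus:
 "(A has_vector_derivative D) (at (j - h)) \<Longrightarrow> ((\<lambda>h. A (j - h)) has_vector_derivative - D) (at h)" for h j :: real
proof -
 assume A: "(A has_vector_derivative D) (at (j - h))"
 have "((\<lambda>h. j - h) has_real_derivative -1) (at h)" by (auto intro!: derivative_eq_intros)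
 then have "((\<lambda>h. j - h) has_vector_derivative -1) (at h)"
  by (simp only: has_real_derivative_iff_has_vector_derivative)
 from vector_diff_chain_at[OF this A] show ?thesis by (simp add: o_def)
qed

lemma increment_le:
 fixes F F1 :: "real \<Rightarrow> complex"
 assumes F: "\<And>t. \<bar>t - j\<bar> \<le> 1/2 \<Longrightarrow> (F has_vector_derivative F1 t) (at t)"
  and T: "\<And>t. \<bar>t - j\<bar> \<le> 1/2 \<Longrightarrow> norm (F1 t) \<le> T" and h: "0 \<le> h" "h \<le> 1/2"
 shows "norm (F (j + h) - F j) \<le> T * h" "norm (F (j - h) - F j) \<le> T * h"
proof -
 have "norm ((\<lambda>h. F (j + h) - F j) h) \<le> T * h"
 proof (rule norm_le_of_vector_derivative[OF _ _ _ h])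
  fix h :: real assume h: "0 \<le> h" "h \<le> 1/2"
  then have *: "abs ((j + h) - j) \<le> 1/2" by simp
  show "((\<lambda>h. F (j + h) - F j) has_vector_derivative F1 (j + h) - 0) (at h)"
   by (rule has_vector_derivative_diff[OF has_vector_derivative_shift_plus[OF F[OF *]] has_vector_derivative_const])
  show "norm (F1 (j + h) - 0) \<le> T" using T[OF *] by simp
 qed simp
 then show "norm (F (j + h) - F j) \<le> T * h" by simp
 have "norm ((\<lambda>h. F (j - h) - F j) h) \<le> T * h"
 proof (rule norm_le_of_vector_derivative[OF _ _ _ h])
  fix h :: real assume h: "0 \<le> h" "h \<le> 1/2"
  then have *: "abs ((j - h) - j) \<le> 1/2" by simp
  show "((\<lambda>h. F (j - h) - F j) has_vector_derivative - F1 (j - h) - 0) (at h)"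
   by (rule has_vector_derivative_diff[OF has_vector_derivative_shift_minus[OF F[OF *]] has_vector_derivative_const])
  show "norm (- F1 (j - h) - 0) \<le> T" using T[OF *] by simp
 qed simp
 then show "norm (F (j - h) - F j) \<le> T * h" by simp
qed

text \<open>Three degrees of accuracy are provided, for \<open>H2\<close>, \<open>H1\<close> and
  \<open>H0\<close>. Each derivative in the index costs a factor of order \<open>eps\<close>, and
  the three functions already carry \<open>eps^2\<close>, \<open>eps\<close> and \<open>1\<close>,
  so every cell error becomes of order \<open>eps ^ 3\<close>. All three proofs differentiate the
  symmetric difference around the midpoint.\<close>

lemma midpoint_cell1:
 fixes A F F1 :: "real \<Rightarrow> complex"
 assumes A: "\<And>t. \<bar>t - j\<bar> \<le> 1/2 \<Longrightarrow> (A has_vector_derivative F t) (at t)"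
  and F: "\<And>t. \<bar>t - j\<bar> \<le> 1/2 \<Longrightarrow> (F has_vector_derivative F1 t) (at t)"
  and T: "\<And>t. \<bar>t - j\<bar> \<le> 1/2 \<Longrightarrow> norm (F1 t) \<le> T"
 shows "norm (A (j + 1/2) - A (j - 1/2) - F j) \<le> T"
proof -
 have Fp: "norm (F (j + h) - F j) \<le> T * h" and Fm: "norm (F (j - h) - F j) \<le> T * h" if "0 \<le> h" "h \<le> 1/2" for h
  using increment_le[OF F T that] by auto
 have T0: "0 \<le> T" using order.trans[OF norm_ge_zero T[of j]] by simp
 have "norm (A (j + 1/2) - A (j - 1/2) - (1/2) *\<^sub>R (2 * F j)) \<le> T * (1/2)"
 proof (rule norm_le_of_vector_derivative[of "1/2" "\<lambda>h. A (j + h) - A (j - h) - h *\<^sub>R (2 * F j)"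
    "\<lambda>h. F (j + h) - (- F (j - h)) - 1 *\<^sub>R (2 * F j)"])
  fix h :: real assume h: "0 \<le> h" "h \<le> 1/2"
  show "((\<lambda>h. A (j + h) - A (j - h) - h *\<^sub>R (2 * F j)) has_vector_derivative F (j + h) - (- F (j - h)) - 1 *\<^sub>R (2 * F j)) (at h)"
   using h by (intro has_vector_derivative_diff has_vector_derivative_shift_plus[of A _ j] has_vector_derivative_shift_minus[of A _ j] A)
    (auto intro!: derivative_eq_intros)
  have "F (j + h) - (- F (j - h)) - 1 *\<^sub>R (2 * F j) = (F (j + h) - F j) + (F (j - h) - F j)" by simp
  then have "norm (F (j + h) - (- F (j - h)) - 1 *\<^sub>R (2 * F j)) \<le> T * h + T * h"
   using Fp[OF h] Fm[OF h] by (simp only: norm_add_le2)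
  also have "... \<le> T" using mult_left_mono[OF h(2) T0] by simp
  finally show "norm (F (j + h) - (- F (j - h)) - 1 *\<^sub>R (2 * F j)) \<le> T" .
 qed auto
 then show ?thesis using T0 by simp
qed

lemma midpoint_cell2:
 fixes A F F1 F2 :: "real \<Rightarrow> complex"
 assumes A: "\<And>t. \<bar>t - j\<bar> \<le> 1/2 \<Longrightarrow> (A has_vector_derivative F t) (at t)"
  and F: "\<And>t. \<bar>t - j\<bar> \<le> 1/2 \<Longrightarrow> (F has_vector_derivative F1 t) (at t)"
  and F1: "\<And>t. \<bar>t - j\<bar> \<le> 1/2 \<Longrightarrow> (F1 has_vector_derivative F2 t) (at t)"
  and T: "\<And>t. \<bar>t - j\<bar> \<le> 1/2 \<Longrightarrow> norm (F2 t) \<le> T"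
 shows "norm (A (j + 1/2) - A (j - 1/2) - F j) \<le> T"
proof -
 have T0: "0 \<le> T" using order.trans[OF norm_ge_zero T[of j]] by simp
 have u: "norm (F1 (j + h) - F1 (j - h)) \<le> T" if h: "0 \<le> h" "h \<le> 1/2" for h
 proof -
  have "norm (F1 (j + h) - F1 (j - h)) \<le> (2 * T) * h"
  proof (rule norm_le_of_vector_derivative[of "1/2" _ "\<lambda>h. F2 (j + h) - (- F2 (j - h))"])
   fix h :: real assume h: "0 \<le> h" "h \<le> 1/2"
   show "((\<lambda>h. F1 (j + h) - F1 (j - h)) has_vector_derivative F2 (j + h) - (- F2 (j - h))) (at h)"
    using h by (intro has_vector_derivative_diff has_vector_derivative_shift_plus[of F1 _ j] has_vector_derivative_shift_minus[of F1 _ j] F1) auto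
   show "norm (F2 (j + h) - (- F2 (j - h))) \<le> 2 * T"
    using T[of "j + h"] T[of "j - h"] h norm_triangle_ineq[of "F2 (j + h)" "F2 (j - h)"] by simp
  qed (use h in auto)
  also have "... \<le> T" using mult_left_mono[OF h(2), of "2 * T"] T0 by simp
  finally show ?thesis .
 qed
 have e1: "norm (F (j + h) - (- F (j - h)) - 2 * F j) \<le> T" if h: "0 \<le> h" "h \<le> 1/2" for h
 proof -
  have "norm (F (j + h) - (- F (j - h)) - 2 * F j) \<le> T * h"
  proof (rule norm_le_of_vector_derivative[of "1/2" _ "\<lambda>h. F1 (j + h) - (- (- F1 (j - h))) - 0"])
   fix h :: real assume h: "0 \<le> h" "h \<le> 1/2"
   show "((\<lambda>h. F (j + h) - (- F (j - h)) - 2 * F j) has_vector_derivative F1 (j + h) - (- (- F1 (j - h))) - 0) (at h)"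
    using h by (intro has_vector_derivative_diff has_vector_derivative_minus has_vector_derivative_shift_plus[of F _ j]
      has_vector_derivative_shift_minus[of F _ j] F has_vector_derivative_const) auto
   show "norm (F1 (j + h) - (- (- F1 (j - h))) - 0) \<le> T" using u[OF h] by simp
  qed (use h in auto)
  also have "... \<le> T" using mult_left_mono[OF h(2) T0] T0 by simp
  finally show ?thesis .
 qed
 have "norm (A (j + 1/2) - A (j - 1/2) - (1/2) *\<^sub>R (2 * F j)) \<le> T * (1/2)"
 proof (rule norm_le_of_vector_derivative[of "1/2" "\<lambda>h. A (j + h) - A (j - h) - h *\<^sub>R (2 * F j)"
    "\<lambda>h. F (j + h) - (- F (j - h)) - 1 *\<^sub>R (2 * F j)"])
  fix h :: real assume h: "0 \<le> h" "h \<le> 1/2"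
  show "((\<lambda>h. A (j + h) - A (j - h) - h *\<^sub>R (2 * F j)) has_vector_derivative F (j + h) - (- F (j - h)) - 1 *\<^sub>R (2 * F j)) (at h)"
   using h by (intro has_vector_derivative_diff has_vector_derivative_shift_plus[of A _ j] has_vector_derivative_shift_minus[of A _ j] A)
    (auto intro!: derivative_eq_intros)
  show "norm (F (j + h) - (- F (j - h)) - 1 *\<^sub>R (2 * F j)) \<le> T" using e1[OF h] by simp
 qed auto
 then show ?thesis using T0 by simp
qed

text \<open>The second order term \<open>F2 j / 24\<close> of the midpoint rule is replaced by the
  increment of \<open>F1\<close> over the cell, at the price of a third derivative; such increments
  telescope when the cells are summed.\<close>

lemma midpoint_cell3:
 fixes A F F1 F2 F3 :: "real \<Rightarrow> complex"
 assumes A: "\<And>t. \<bar>t - j\<bar> \<le> 1/2 \<Longrightarrow> (A has_vector_derivative F t) (at t)"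
  and F: "\<And>t. \<bar>t - j\<bar> \<le> 1/2 \<Longrightarrow> (F has_vector_derivative F1 t) (at t)"
  and F1: "\<And>t. \<bar>t - j\<bar> \<le> 1/2 \<Longrightarrow> (F1 has_vector_derivative F2 t) (at t)"
  and F2: "\<And>t. \<bar>t - j\<bar> \<le> 1/2 \<Longrightarrow> (F2 has_vector_derivative F3 t) (at t)"
  and T: "\<And>t. \<bar>t - j\<bar> \<le> 1/2 \<Longrightarrow> norm (F3 t) \<le> T"
 shows "norm (A (j + 1/2) - A (j - 1/2) - F j - (1/24) *\<^sub>R (F1 (j + 1/2) - F1 (j - 1/2))) \<le> T"
proof -
 have T0: "0 \<le> T" using order.trans[OF norm_ge_zero T[of j]] by simp
 have Fp: "norm (F2 (j + h) - F2 j) \<le> T * h" and Fm: "norm (F2 (j - h) - F2 j) \<le> T * h" if "0 \<le> h" "h \<le> 1/2" for h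
  using increment_le[OF F2 T that] by auto
 have w: "norm (F1 (j + h) - F1 (j - h) - h *\<^sub>R (2 * F2 j)) \<le> T / 2" if h: "0 \<le> h" "h \<le> 1/2" for h
 proof -
  have "norm (F1 (j + h) - F1 (j - h) - h *\<^sub>R (2 * F2 j)) \<le> T * h"
  proof (rule norm_le_of_vector_derivative[of "1/2" _ "\<lambda>h. F2 (j + h) - (- F2 (j - h)) - 1 *\<^sub>R (2 * F2 j)"])
   fix h :: real assume h: "0 \<le> h" "h \<le> 1/2"
   show "((\<lambda>h. F1 (j + h) - F1 (j - h) - h *\<^sub>R (2 * F2 j)) has_vector_derivative F2 (j + h) - (- F2 (j - h)) - 1 *\<^sub>R (2 * F2 j)) (at h)"
    using h by (intro has_vector_derivative_diff has_vector_derivative_shift_plus[of F1 _ j] has_vector_derivative_shift_minus[of F1 _ j] F1)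
     (auto intro!: derivative_eq_intros)
   have "F2 (j + h) - (- F2 (j - h)) - 1 *\<^sub>R (2 * F2 j) = (F2 (j + h) - F2 j) + (F2 (j - h) - F2 j)" by simp
   then have "norm (F2 (j + h) - (- F2 (j - h)) - 1 *\<^sub>R (2 * F2 j)) \<le> T * h + T * h"
    using Fp[OF h] Fm[OF h] by (simp only: norm_add_le2)
   also have "... \<le> T" using mult_left_mono[OF h(2) T0] by simp
   finally show "norm (F2 (j + h) - (- F2 (j - h)) - 1 *\<^sub>R (2 * F2 j)) \<le> T" .
  qed (use h in auto)
  also have "... \<le> T / 2" using mult_left_mono[OF h(2) T0] by simp
  finally show ?thesis .
 qed
 have e1: "norm (F (j + h) - (- F (j - h)) - 2 * F j - (h\<^sup>2) *\<^sub>R F2 j) \<le> T / 4" if h: "0 \<le> h" "h \<le> 1/2" for h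
 proof -
  have "norm (F (j + h) - (- F (j - h)) - 2 * F j - (h\<^sup>2) *\<^sub>R F2 j) \<le> (T / 2) * h"
  proof (rule norm_le_of_vector_derivative[of "1/2" _ "\<lambda>h. F1 (j + h) - (- (- F1 (j - h))) - 0 - (2 * h) *\<^sub>R F2 j"])
   fix h :: real assume h: "0 \<le> h" "h \<le> 1/2"
   show "((\<lambda>h. F (j + h) - (- F (j - h)) - 2 * F j - (h\<^sup>2) *\<^sub>R F2 j) has_vector_derivative
     F1 (j + h) - (- (- F1 (j - h))) - 0 - (2 * h) *\<^sub>R F2 j) (at h)"
    using h by (intro has_vector_derivative_diff has_vector_derivative_minus has_vector_derivative_shift_plus[of F _ j]
      has_vector_derivative_shift_minus[of F _ j] F has_vector_derivative_const) (auto intro!: derivative_eq_intros)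
   show "norm (F1 (j + h) - (- (- F1 (j - h))) - 0 - (2 * h) *\<^sub>R F2 j) \<le> T / 2"
    using w[OF h] by (simp add: scaleR_conv_of_real mult_ac)
  qed (use h in auto)
  also have "... \<le> T / 4" using mult_left_mono[OF h(2), of "T / 2"] T0 by simp
  finally show ?thesis .
 qed
 have g: "norm (A (j + 1/2) - A (j - 1/2) - (1/2) *\<^sub>R (2 * F j) - ((1/2) ^ 3 / 3) *\<^sub>R F2 j) \<le> (T / 4) * (1/2)"
 proof (rule norm_le_of_vector_derivative[of "1/2" "\<lambda>h. A (j + h) - A (j - h) - h *\<^sub>R (2 * F j) - (h ^ 3 / 3) *\<^sub>R F2 j"
    "\<lambda>h. F (j + h) - (- F (j - h)) - 1 *\<^sub>R (2 * F j) - (h\<^sup>2) *\<^sub>R F2 j"])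
  fix h :: real assume h: "0 \<le> h" "h \<le> 1/2"
  show "((\<lambda>h. A (j + h) - A (j - h) - h *\<^sub>R (2 * F j) - (h ^ 3 / 3) *\<^sub>R F2 j) has_vector_derivative
    F (j + h) - (- F (j - h)) - 1 *\<^sub>R (2 * F j) - (h\<^sup>2) *\<^sub>R F2 j) (at h)"
   using h by (intro has_vector_derivative_diff has_vector_derivative_shift_plus[of A _ j] has_vector_derivative_shift_minus[of A _ j] A)
    (auto intro!: derivative_eq_intros)
  show "norm (F (j + h) - (- F (j - h)) - 1 *\<^sub>R (2 * F j) - (h\<^sup>2) *\<^sub>R F2 j) \<le> T / 4" using e1[OF h] by simp
 qed auto
 have wh: "norm (F1 (j + 1/2) - F1 (j - 1/2) - F2 j) \<le> T / 2" using w[of "1/2"] by simp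
 have "A (j + 1/2) - A (j - 1/2) - F j - (1/24) *\<^sub>R (F1 (j + 1/2) - F1 (j - 1/2)) =
  (A (j + 1/2) - A (j - 1/2) - (1/2) *\<^sub>R (2 * F j) - ((1/2) ^ 3 / 3) *\<^sub>R F2 j) - (1/24) *\<^sub>R (F1 (j + 1/2) - F1 (j - 1/2) - F2 j)"
  by (simp add: scaleR_conv_of_real power3_eq_cube algebra_simps)
 moreover have "norm ((1/24) *\<^sub>R (F1 (j + 1/2) - F1 (j - 1/2) - F2 j)) \<le> T / 48" using wh by simp
 ultimately have "norm (A (j + 1/2) - A (j - 1/2) - F j - (1/24) *\<^sub>R (F1 (j + 1/2) - F1 (j - 1/2))) \<le> (T / 4) * (1/2) + T / 48"
  using g by (simp only: norm_diff_le2)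
 then show ?thesis using T0 by simp
qed

section \<open>The change of variables from the index to \<open>y\<close>\<close>

text \<open>The solution \<open>y\<close> of
  \<open>wall_exponent eps y = (t + \<alpha>) / b\<close>. \<open>wall_t\<close> is its inverse, and
  \<open>wall_v\<close> is the derivative of \<open>y\<close> with respect to the index, written as
  a function of \<open>y\<close>.\<close>

definition wall_y :: "real \<Rightarrow> real \<Rightarrow> real \<Rightarrow> real \<Rightarrow> real" where
 "wall_y eps b \<alpha> t = 1 / eps - 2 * b / (eps ^ 3 * (t + \<alpha>))"

definition wall_t :: "real \<Rightarrow> real \<Rightarrow> real \<Rightarrow> real \<Rightarrow> real" where
 "wall_t eps b \<alpha> y = 2 * b / (eps\<^sup>2 * (1 - eps * y)) - \<alpha>"

definition wall_v :: "real \<Rightarrow> real \<Rightarrow> real \<Rightarrow> real" where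
 "wall_v eps b y = eps / (2 * b) * (1 - eps * y)\<^sup>2"

lemma one_minus_wall_y:
 "0 < eps \<Longrightarrow> - \<alpha> < t \<Longrightarrow> 1 - eps * wall_y eps b \<alpha> t = 2 * b / (eps\<^sup>2 * (t + \<alpha>))"
proof -
 assume a: "0 < eps" "- \<alpha> < t"
 define T where "T = t + \<alpha>"
 have "0 < T" using a by (simp add: T_def)
 then show ?thesis unfolding wall_y_def T_def[symmetric] using a
  by (simp add: field_simps power2_eq_square power3_eq_cube)
qed

lemma wall_exponent_wall_y:
 assumes "0 < eps" "0 < b" "- \<alpha> < t"
 shows "wall_exponent eps (wall_y eps b \<alpha> t) = (t + \<alpha>) / b"
 unfolding wall_exponent_def one_minus_wall_y[OF assms(1,3)] using assms by (simp add: field_simps)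

lemma wall_t_wall_y: "0 < eps \<Longrightarrow> 0 < b \<Longrightarrow> - \<alpha> < t \<Longrightarrow> wall_t eps b \<alpha> (wall_y eps b \<alpha> t) = t"
 unfolding wall_t_def by (subst one_minus_wall_y) auto

lemma DERIV_wall_y:
 assumes "0 < eps" "0 < b" "- \<alpha> < t"
 shows "(wall_y eps b \<alpha> has_real_derivative wall_v eps b (wall_y eps b \<alpha> t)) (at t)"
proof -
 define T where "T = t + \<alpha>"
 have "0 < T" using assms by (simp add: T_def)
 then have "wall_v eps b (wall_y eps b \<alpha> t) = 2 * b / (eps ^ 3 * (t + \<alpha>)\<^sup>2)"
  unfolding wall_v_def one_minus_wall_y[OF assms(1,3)] T_def[symmetric] using assms
  by (simp add: field_simps power2_eq_square power3_eq_cube)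
 moreover have "((\<lambda>t. 1 / eps - c * inverse (t + \<alpha>)) has_real_derivative c * (inverse T)\<^sup>2) (at t)" for c
  using \<open>0 < T\<close> unfolding T_def by (auto intro!: derivative_eq_intros simp: power2_eq_square)
 note this[of "2 * b / eps ^ 3"]
 moreover have "(\<lambda>t. 1 / eps - 2 * b / eps ^ 3 * inverse (t + \<alpha>)) = wall_y eps b \<alpha>"
  by (simp add: wall_y_def[abs_def] field_class.field_divide_inverse mult.assoc)
 moreover have "2 * b / eps ^ 3 * (inverse T)\<^sup>2 = 2 * b / (eps ^ 3 * (t + \<alpha>)\<^sup>2)"
  by (simp add: T_def divide_inverse power_inverse)
 ultimately show ?thesis by simp
qed

lemma wall_y_strict_mono:
 assumes "0 < eps" "0 < b" "- \<alpha> < t" "t < t'"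
 shows "wall_y eps b \<alpha> t < wall_y eps b \<alpha> t'"
proof -
 have "eps ^ 3 * (t + \<alpha>) < eps ^ 3 * (t' + \<alpha>)" using assms by (intro mult_strict_left_mono) auto
 then have "2 * b / (eps ^ 3 * (t' + \<alpha>)) < 2 * b / (eps ^ 3 * (t + \<alpha>))"
  using assms by (intro divide_strict_left_mono mult_pos_pos) auto
 then show ?thesis by (simp add: wall_y_def)
qed

lemma wall_y_mono:
 "0 < eps \<Longrightarrow> 0 < b \<Longrightarrow> - \<alpha> < t \<Longrightarrow> t \<le> t' \<Longrightarrow> wall_y eps b \<alpha> t \<le> wall_y eps b \<alpha> t'"
 using wall_y_strict_mono[of eps b \<alpha> t t'] by (cases "t = t'") auto

lemma wall_y_wall_t:
 assumes "0 < eps" "0 < b" "eps * y < 1"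
 shows "- \<alpha> < wall_t eps b \<alpha> y" "wall_y eps b \<alpha> (wall_t eps b \<alpha> y) = y"
proof -
 show "- \<alpha> < wall_t eps b \<alpha> y" using assms by (simp add: wall_t_def)
 have "2 * b / (eps ^ 3 * (wall_t eps b \<alpha> y + \<alpha>)) = (1 - eps * y) / eps"
  using assms by (simp add: wall_t_def field_simps power2_eq_square power3_eq_cube)
 then show "wall_y eps b \<alpha> (wall_t eps b \<alpha> y) = y"
  using assms unfolding wall_y_def by (simp add: field_simps)
qed

lemma wall_v_bounds:
 assumes "0 < eps" "0 < b" "abs (eps * y) \<le> 1/8"
 shows "eps / (4 * b) \<le> wall_v eps b y" "wall_v eps b y \<le> eps / b"
proof -
 have u: "1/2 \<le> (1 - eps * y)\<^sup>2" "(1 - eps * y)\<^sup>2 \<le> 2"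
 proof -
  have "(7/8)\<^sup>2 \<le> (1 - eps * y)\<^sup>2" "(1 - eps * y)\<^sup>2 \<le> (9/8)\<^sup>2"
   using assms(3) by (auto intro!: power_mono)
  then show "1/2 \<le> (1 - eps * y)\<^sup>2" "(1 - eps * y)\<^sup>2 \<le> 2" by (simp_all add: power2_eq_square)
 qed
 have "eps / (2 * b) * (1/2) \<le> wall_v eps b y"
  unfolding wall_v_def by (rule mult_left_mono) (use u assms in auto)
 moreover have "wall_v eps b y \<le> eps / (2 * b) * 2"
  unfolding wall_v_def by (rule mult_left_mono) (use u assms in auto)
 ultimately show "eps / (4 * b) \<le> wall_v eps b y" "wall_v eps b y \<le> eps / b" using assms by simp_all
qed

lemma DERIV_wall_v: "0 < b \<Longrightarrow> (wall_v eps b has_real_derivative - (eps\<^sup>2 / b * (1 - eps * y))) (at y)"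
 unfolding wall_v_def by (auto intro!: derivative_eq_intros simp: field_simps power2_eq_square)

text \<open>The majorant \<open>1 / (1 + y^2)\<close> is used for the cell errors because it changes
  by at most a fixed factor within a cell and because its sum is controlled by
  \<open>arctan\<close>.\<close>

lemma inverse_square_shift_le: "abs (x - z) \<le> 1 \<Longrightarrow> 1 / (1 + x\<^sup>2) \<le> 3 / (1 + z\<^sup>2)" for x z :: real
proof -
 assume a: "abs (x - z) \<le> 1"
 have "(x - z)\<^sup>2 \<le> 1" using a by (simp add: abs_square_le_1)
 then have 1: "x\<^sup>2 - 2 * (x * z) + z\<^sup>2 \<le> 1" by (simp add: power2_diff mult.assoc)
 have "4 * x\<^sup>2 - 4 * (x * z) + z\<^sup>2 = (2 * x - z)\<^sup>2" by (simp add: power2_diff power_mult_distrib)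
 then have 2: "0 \<le> 4 * x\<^sup>2 - 4 * (x * z) + z\<^sup>2" by (simp only: zero_le_power2)
 have "1 + c \<le> 3 * (1 + d)" if "d - 2 * w + c \<le> 1" "0 \<le> 4 * d - 4 * w + c" "0 \<le> d" for c d w :: real
 proof -
  have "2 * d - 4 * w + 2 * c \<le> 2" using that(1) by simp
  then have "c \<le> 2 + 2 * d" using that(2) by simp
  then show ?thesis using that(3) by simp
 qed
 from this[OF 1 2 zero_le_power2] have "1 + z\<^sup>2 \<le> 3 * (1 + x\<^sup>2)" .
 moreover have "0 < 1 + z\<^sup>2" "0 < 1 + x\<^sup>2" by (auto intro: add_pos_nonneg)
 ultimately show ?thesis by (simp add: divide_le_eq pos_le_divide_eq mult.commute)
qed

lemma comp_wall_y:
 fixes k k1 :: "real \<Rightarrow> complex"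
 assumes "0 < eps" "0 < b" "- \<alpha> < t" "(k has_vector_derivative k1 (wall_y eps b \<alpha> t)) (at (wall_y eps b \<alpha> t))"
 shows "((\<lambda>t. k (wall_y eps b \<alpha> t)) has_vector_derivative
  wall_v eps b (wall_y eps b \<alpha> t) *\<^sub>R k1 (wall_y eps b \<alpha> t)) (at t)"
 using vector_diff_chain_at[OF DERIV_wall_y[OF assms(1-3), unfolded has_real_derivative_iff_has_vector_derivative] assms(4)]
 by (simp add: o_def)

text \<open>A single cell of length one around the index \<open>j\<close>. The condition
  \<open>eps <= b\<close> keeps the derivative of \<open>wall_y\<close>, which is at most
  \<open>eps / b\<close>, below \<open>1\<close>, so \<open>y\<close> moves by at most one
  unit.\<close>

locale wall_cell =
 fixes eps b \<alpha> j :: real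
 assumes he: "0 < eps" "eps \<le> 1" "eps \<le> b"
  and dom: "\<And>t. \<bar>t - j\<bar> \<le> 1/2 \<Longrightarrow> - \<alpha> < t"
  and range: "\<And>t. \<bar>t - j\<bar> \<le> 1/2 \<Longrightarrow> abs (eps * wall_y eps b \<alpha> t) \<le> 1/8"
begin

abbreviation "Y \<equiv> wall_y eps b \<alpha>"
abbreviation "v \<equiv> wall_v eps b"

lemma b_pos: "0 < b" using he by linarith

lemma v_le: "abs (t - j) \<le> 1/2 \<Longrightarrow> 0 \<le> v (Y t) \<and> v (Y t) \<le> eps / b"
 using wall_v_bounds[OF he(1) b_pos range] he b_pos by (smt (verit) divide_nonneg_pos)

lemma Y_near: assumes "abs (t - j) \<le> 1/2" shows "abs (Y t - Y j) \<le> 1"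
proof -
 have t: "t \<in> {j-1/2..j+1/2}" using assms unfolding atLeastAtMost_iff abs_le_iff by linarith
 have "norm (Y t - Y j) \<le> 1 * norm (t - j)"
 proof (rule field_differentiable_bound[of "{j-1/2..j+1/2}" Y "\<lambda>t. v (Y t)"])
  fix z assume "z \<in> {j-1/2..j+1/2}"
  then have z: "abs (z - j) \<le> 1/2" unfolding atLeastAtMost_iff abs_le_iff by linarith
  show "(Y has_field_derivative v (Y z)) (at z within {j-1/2..j+1/2})"
   using DERIV_wall_y[OF he(1) b_pos dom[OF z]] by (rule has_field_derivative_at_within)
  have "eps / b \<le> 1" using he b_pos by simp
  then show "norm (v (Y z)) \<le> 1" using v_le[OF z] by simp
 qed (use t in auto)
 then show ?thesis using assms by simp
qed

lemma delta_le: "abs (t - j) \<le> 1/2 \<Longrightarrow> 0 \<le> C \<Longrightarrow> C * (1 / (1 + (Y t)\<^sup>2)) \<le> C * (3 / (1 + (Y j)\<^sup>2))"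
 by (intro mult_left_mono inverse_square_shift_le Y_near)

text \<open>By the mean value theorem for \<open>arctan\<close> along the cell, where the derivative
  of \<open>wall_y\<close> is at least \<open>eps / (4 * b)\<close> and the majorant varies by at
  most the factor \<open>3\<close>. Summed over the cells, the right-hand sides telescope to at most
  \<open>12 * b * pi\<close>.\<close>

lemma arctan_increment: "eps / (1 + (Y j)\<^sup>2) \<le> 12 * b * (arctan (Y (j + 1/2)) - arctan (Y (j - 1/2)))"
proof -
 have "\<exists>z. j - 1/2 < z \<and> z < j + 1/2 \<and> arctan (Y (j + 1/2)) - arctan (Y (j - 1/2)) =
   ((j + 1/2) - (j - 1/2)) * (v (Y z) / (1 + (Y z)\<^sup>2))"
 proof (rule MVT2)
  fix z assume "j - 1/2 \<le> z" "z \<le> j + 1/2"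
  then have z: "abs (z - j) \<le> 1/2" unfolding abs_le_iff by linarith
  show "((\<lambda>t. arctan (Y t)) has_real_derivative v (Y z) / (1 + (Y z)\<^sup>2)) (at z)"
   using DERIV_wall_y[OF he(1) b_pos dom[OF z]]
   by (auto intro!: derivative_eq_intros simp: divide_inverse)
 qed simp
 then obtain z where z': "j - 1/2 < z" "z < j + 1/2"
  and eq': "arctan (Y (j + 1/2)) - arctan (Y (j - 1/2)) = ((j + 1/2) - (j - 1/2)) * (v (Y z) / (1 + (Y z)\<^sup>2))"
  by blast
 have z: "abs (z - j) \<le> 1/2" using z' unfolding abs_le_iff by linarith
 have eq: "arctan (Y (j + 1/2)) - arctan (Y (j - 1/2)) = v (Y z) / (1 + (Y z)\<^sup>2)" using eq' by simp
 have "(eps / (4 * b)) * (1 / 3 * (1 / (1 + (Y j)\<^sup>2))) \<le> v (Y z) * (1 / (1 + (Y z)\<^sup>2))"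
 proof (intro mult_mono)
  have "abs (Y j - Y z) \<le> 1" using Y_near[OF z] by (simp add: abs_minus_commute)
  from inverse_square_shift_le[OF this] have "1 / (1 + (Y j)\<^sup>2) \<le> 3 * (1 / (1 + (Y z)\<^sup>2))" by simp
  then show "1 / 3 * (1 / (1 + (Y j)\<^sup>2)) \<le> 1 / (1 + (Y z)\<^sup>2)" by linarith
  show "eps / (4 * b) \<le> v (Y z)" by (rule wall_v_bounds[OF he(1) b_pos range[OF z]])
  show "0 \<le> v (Y z)" using v_le[OF z] by simp
  show "0 \<le> 1 / 3 * (1 / (1 + (Y j)\<^sup>2))" by simp
 qed
 then have "12 * b * ((eps / (4 * b)) * (1 / 3 * (1 / (1 + (Y j)\<^sup>2)))) \<le> 12 * b * (v (Y z) * (1 / (1 + (Y z)\<^sup>2)))"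
  using b_pos by (intro mult_left_mono) auto
 moreover have "12 * b * ((eps / (4 * b)) * (1 / 3 * q)) = eps * q" for q using b_pos by simp
 ultimately have "eps * (1 / (1 + (Y j)\<^sup>2)) \<le> 12 * b * (v (Y z) * (1 / (1 + (Y z)\<^sup>2)))" by (simp only:)
 then show ?thesis unfolding eq by simp
qed

lemma cell1:
 fixes A k k1 :: "real \<Rightarrow> complex"
 assumes A: "\<And>t. \<bar>t - j\<bar> \<le> 1/2 \<Longrightarrow> (A has_vector_derivative k (Y t)) (at t)"
  and k: "\<And>y. (k has_vector_derivative k1 y) (at y)"
  and C: "\<And>y. cmod (k1 y) \<le> C * (1 / (1 + y\<^sup>2))" "0 \<le> C"
 shows "cmod (A (j + 1/2) - A (j - 1/2) - k (Y j)) \<le> eps * (3 * C / b) * (1 / (1 + (Y j)\<^sup>2))"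
proof (rule midpoint_cell1[of j A "\<lambda>t. k (Y t)" "\<lambda>t. v (Y t) *\<^sub>R k1 (Y t)"])
 fix t assume t: "abs (t - j) \<le> 1/2"
 show "(A has_vector_derivative k (Y t)) (at t)" by (rule A[OF t])
 show "((\<lambda>t. k (Y t)) has_vector_derivative v (Y t) *\<^sub>R k1 (Y t)) (at t)"
  by (rule comp_wall_y[OF he(1) b_pos dom[OF t], of k k1]) (rule k)
 have "cmod (v (Y t) *\<^sub>R k1 (Y t)) = v (Y t) * cmod (k1 (Y t))" using v_le[OF t] by simp
 also have "... \<le> (eps / b) * (C * (3 / (1 + (Y j)\<^sup>2)))"
  using v_le[OF t] order.trans[OF C(1) delta_le[OF t C(2)]] he b_pos by (intro mult_mono) auto
 finally show "cmod (v (Y t) *\<^sub>R k1 (Y t)) \<le> eps * (3 * C / b) * (1 / (1 + (Y j)\<^sup>2))" by (simp add: mult_ac)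
qed

definition dv :: "real \<Rightarrow> real" where "dv y = - (eps\<^sup>2 / b * (1 - eps * y))"

lemma dv_le: "abs (t - j) \<le> 1/2 \<Longrightarrow> abs (dv (Y t)) \<le> 2 * eps\<^sup>2 / b"
proof -
 assume t: "abs (t - j) \<le> 1/2"
 have "abs (1 - eps * Y t) \<le> 2" using range[OF t] by linarith
 then have "eps\<^sup>2 / b * abs (1 - eps * Y t) \<le> eps\<^sup>2 / b * 2" using b_pos by (intro mult_left_mono) auto
 then show ?thesis using b_pos by (simp add: dv_def abs_mult)
qed

lemma vk_derivative:
 fixes k1 :: "real \<Rightarrow> complex"
 assumes "(k1 has_vector_derivative k2) (at y)"
 shows "((\<lambda>y. v y *\<^sub>R k1 y) has_vector_derivative dv y *\<^sub>R k1 y + v y *\<^sub>R k2) (at y)"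
 using has_vector_derivative_scaleR[OF DERIV_wall_v[OF b_pos] assms] by (simp add: dv_def add.commute)

lemma cell2:
 fixes A k k1 k2 :: "real \<Rightarrow> complex"
 assumes A: "\<And>t. \<bar>t - j\<bar> \<le> 1/2 \<Longrightarrow> (A has_vector_derivative k (Y t)) (at t)"
  and k: "\<And>y. (k has_vector_derivative k1 y) (at y)" and k1: "\<And>y. (k1 has_vector_derivative k2 y) (at y)"
  and C: "\<And>y. cmod (k1 y) \<le> C * (1 / (1 + y\<^sup>2))" "\<And>y. cmod (k2 y) \<le> C * (1 / (1 + y\<^sup>2))" "0 \<le> C"
 shows "cmod (A (j + 1/2) - A (j - 1/2) - k (Y j)) \<le> eps\<^sup>2 * (9 * C / b\<^sup>2) * (1 / (1 + (Y j)\<^sup>2))"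
proof (rule midpoint_cell2[of j A "\<lambda>t. k (Y t)" "\<lambda>t. v (Y t) *\<^sub>R k1 (Y t)"
   "\<lambda>t. v (Y t) *\<^sub>R (dv (Y t) *\<^sub>R k1 (Y t) + v (Y t) *\<^sub>R k2 (Y t))"])
 fix t assume t: "abs (t - j) \<le> 1/2"
 show "(A has_vector_derivative k (Y t)) (at t)" by (rule A[OF t])
 show "((\<lambda>t. k (Y t)) has_vector_derivative v (Y t) *\<^sub>R k1 (Y t)) (at t)"
  by (rule comp_wall_y[OF he(1) b_pos dom[OF t], of k k1]) (rule k)
 show "((\<lambda>t. v (Y t) *\<^sub>R k1 (Y t)) has_vector_derivative v (Y t) *\<^sub>R (dv (Y t) *\<^sub>R k1 (Y t) + v (Y t) *\<^sub>R k2 (Y t))) (at t)"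
  by (rule comp_wall_y[OF he(1) b_pos dom[OF t], of "\<lambda>y. v y *\<^sub>R k1 y" "\<lambda>y. dv y *\<^sub>R k1 y + v y *\<^sub>R k2 y"])
   (rule vk_derivative[OF k1])
 define r where "r = C * (3 / (1 + (Y j)\<^sup>2))"
 have r: "0 \<le> r" using C(3) by (simp add: r_def)
 have b1: "cmod (k1 (Y t)) \<le> r" "cmod (k2 (Y t)) \<le> r"
  unfolding r_def using order.trans[OF C(1) delta_le[OF t C(3)]] order.trans[OF C(2) delta_le[OF t C(3)]] by auto
 have eps2: "eps\<^sup>2 \<le> eps" using he by (simp add: power2_eq_square)
 have "eps\<^sup>2 / b \<le> eps / b" using eps2 b_pos by (intro divide_right_mono) auto
 have "cmod (dv (Y t) *\<^sub>R k1 (Y t) + v (Y t) *\<^sub>R k2 (Y t)) \<le> (2 * eps\<^sup>2 / b) * r + (eps / b) * r"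
  unfolding norm_scaleR
  by (rule order.trans[OF norm_triangle_ineq], unfold norm_scaleR)
   (use dv_le[OF t] v_le[OF t] b1 r b_pos he in \<open>intro add_mono mult_mono, auto\<close>)
 also have "... \<le> (2 * (eps / b)) * r + (eps / b) * r"
  using \<open>eps\<^sup>2 / b \<le> eps / b\<close> r by (intro add_right_mono mult_right_mono) auto
 finally have i: "cmod (dv (Y t) *\<^sub>R k1 (Y t) + v (Y t) *\<^sub>R k2 (Y t)) \<le> (3 * (eps / b)) * r" by simp
 have "cmod (v (Y t) *\<^sub>R (dv (Y t) *\<^sub>R k1 (Y t) + v (Y t) *\<^sub>R k2 (Y t))) \<le> (eps / b) * ((3 * (eps / b)) * r)"
  unfolding norm_scaleR using v_le[OF t] i he b_pos by (intro mult_mono) auto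
 then show "cmod (v (Y t) *\<^sub>R (dv (Y t) *\<^sub>R k1 (Y t) + v (Y t) *\<^sub>R k2 (Y t))) \<le> eps\<^sup>2 * (9 * C / b\<^sup>2) * (1 / (1 + (Y j)\<^sup>2))"
  by (simp add: r_def power2_eq_square mult_ac)
qed

lemma dvk_derivative:
 fixes k1 k2 k3 :: "real \<Rightarrow> complex"
 assumes "(k1 has_vector_derivative k2 y) (at y)" "(k2 has_vector_derivative k3 y) (at y)"
 shows "((\<lambda>y. v y *\<^sub>R (dv y *\<^sub>R k1 y + v y *\<^sub>R k2 y)) has_vector_derivative
  dv y *\<^sub>R (dv y *\<^sub>R k1 y + v y *\<^sub>R k2 y) +
  v y *\<^sub>R ((eps ^ 3 / b) *\<^sub>R k1 y + (2 * dv y) *\<^sub>R k2 y + v y *\<^sub>R k3 y)) (at y)"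
proof -
 have "(dv has_real_derivative eps ^ 3 / b) (at y)"
  unfolding dv_def using b_pos by (auto intro!: derivative_eq_intros simp: power2_eq_square power3_eq_cube)
 from has_vector_derivative_scaleR[OF this assms(1)] vk_derivative[OF assms(2)]
 have "((\<lambda>y. dv y *\<^sub>R k1 y + v y *\<^sub>R k2 y) has_vector_derivative
  (dv y *\<^sub>R k2 y + (eps ^ 3 / b) *\<^sub>R k1 y) + (dv y *\<^sub>R k2 y + v y *\<^sub>R k3 y)) (at y)"
  by (rule has_vector_derivative_add)
 from vk_derivative[OF this] show ?thesis
  by (simp add: scaleR_conv_of_real algebra_simps)
qed

lemma cell3:
 fixes A k k1 k2 k3 :: "real \<Rightarrow> complex"
 assumes A: "\<And>t. \<bar>t - j\<bar> \<le> 1/2 \<Longrightarrow> (A has_vector_derivative k (Y t)) (at t)"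
  and k: "\<And>y. (k has_vector_derivative k1 y) (at y)" and k1: "\<And>y. (k1 has_vector_derivative k2 y) (at y)"
  and k2: "\<And>y. (k2 has_vector_derivative k3 y) (at y)"
  and C: "\<And>y. cmod (k1 y) \<le> C * (1 / (1 + y\<^sup>2))" "\<And>y. cmod (k2 y) \<le> C * (1 / (1 + y\<^sup>2))"
   "\<And>y. cmod (k3 y) \<le> C * (1 / (1 + y\<^sup>2))" "0 \<le> C"
 shows "cmod (A (j + 1/2) - A (j - 1/2) - k (Y j) - (1/24) *\<^sub>R (v (Y (j + 1/2)) *\<^sub>R k1 (Y (j + 1/2)) - v (Y (j - 1/2)) *\<^sub>R k1 (Y (j - 1/2))))
  \<le> eps ^ 3 * ((18 * C + 18 * b * C) / b ^ 3 + 18 * C / b ^ 3) * (1 / (1 + (Y j)\<^sup>2))"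
proof (rule midpoint_cell3[of j A "\<lambda>t. k (Y t)" "\<lambda>t. v (Y t) *\<^sub>R k1 (Y t)"
   "\<lambda>t. v (Y t) *\<^sub>R (dv (Y t) *\<^sub>R k1 (Y t) + v (Y t) *\<^sub>R k2 (Y t))"
   "\<lambda>t. v (Y t) *\<^sub>R (dv (Y t) *\<^sub>R (dv (Y t) *\<^sub>R k1 (Y t) + v (Y t) *\<^sub>R k2 (Y t)) +
  v (Y t) *\<^sub>R ((eps ^ 3 / b) *\<^sub>R k1 (Y t) + (2 * dv (Y t)) *\<^sub>R k2 (Y t) + v (Y t) *\<^sub>R k3 (Y t)))"])
 fix t assume t: "abs (t - j) \<le> 1/2"
 show "(A has_vector_derivative k (Y t)) (at t)" by (rule A[OF t])
 show "((\<lambda>t. k (Y t)) has_vector_derivative v (Y t) *\<^sub>R k1 (Y t)) (at t)"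
  by (rule comp_wall_y[OF he(1) b_pos dom[OF t], of k k1]) (rule k)
 show "((\<lambda>t. v (Y t) *\<^sub>R k1 (Y t)) has_vector_derivative v (Y t) *\<^sub>R (dv (Y t) *\<^sub>R k1 (Y t) + v (Y t) *\<^sub>R k2 (Y t))) (at t)"
  by (rule comp_wall_y[OF he(1) b_pos dom[OF t], of "\<lambda>y. v y *\<^sub>R k1 y" "\<lambda>y. dv y *\<^sub>R k1 y + v y *\<^sub>R k2 y"])
   (rule vk_derivative[OF k1])
 show "((\<lambda>t. v (Y t) *\<^sub>R (dv (Y t) *\<^sub>R k1 (Y t) + v (Y t) *\<^sub>R k2 (Y t))) has_vector_derivative
  v (Y t) *\<^sub>R (dv (Y t) *\<^sub>R (dv (Y t) *\<^sub>R k1 (Y t) + v (Y t) *\<^sub>R k2 (Y t)) +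
  v (Y t) *\<^sub>R ((eps ^ 3 / b) *\<^sub>R k1 (Y t) + (2 * dv (Y t)) *\<^sub>R k2 (Y t) + v (Y t) *\<^sub>R k3 (Y t)))) (at t)"
  by (rule comp_wall_y[OF he(1) b_pos dom[OF t], of "\<lambda>y. v y *\<^sub>R (dv y *\<^sub>R k1 y + v y *\<^sub>R k2 y)"
     "\<lambda>y. dv y *\<^sub>R (dv y *\<^sub>R k1 y + v y *\<^sub>R k2 y) +
  v y *\<^sub>R ((eps ^ 3 / b) *\<^sub>R k1 y + (2 * dv y) *\<^sub>R k2 y + v y *\<^sub>R k3 y)"])
   (rule dvk_derivative[OF k1 k2])
 define e where "e = C * (3 / (1 + (Y j)\<^sup>2))"
 have e: "0 \<le> e" using C(4) by (simp add: e_def)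
 have b1: "cmod (k1 (Y t)) \<le> e" "cmod (k2 (Y t)) \<le> e" "cmod (k3 (Y t)) \<le> e"
  unfolding e_def using order.trans[OF C(1) delta_le[OF t C(4)]] order.trans[OF C(2) delta_le[OF t C(4)]]
   order.trans[OF C(3) delta_le[OF t C(4)]] by auto
 define z where "z = eps / b"
 have z: "0 \<le> z" using he b_pos by (simp add: z_def)
 have eps2: "eps\<^sup>2 \<le> eps" using he by (simp add: power2_eq_square)
 have eps3: "eps ^ 3 \<le> eps" using he power_decreasing[of 1 3 eps] by simp
 have zb: "eps\<^sup>2 / b = eps * z" "eps = b * z" using b_pos by (auto simp: z_def power2_eq_square)
 have dvz: "abs (dv (Y t)) \<le> 2 * (eps * z)" using dv_le[OF t] zb by simp
 have ez: "eps * z \<le> z" using he z mult_right_mono[of eps 1 z] by simp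
 have vz: "0 \<le> v (Y t)" "v (Y t) \<le> z" using v_le[OF t] by (auto simp: z_def)
 have tri: "cmod (x *\<^sub>R p) \<le> c * d" if "abs x \<le> c" "cmod p \<le> d" for x c d :: real and p
  using that mult_mono[of "abs x" c "cmod p" d] by (simp add: order.trans[OF abs_ge_zero])
 have i: "cmod (dv (Y t) *\<^sub>R k1 (Y t) + v (Y t) *\<^sub>R k2 (Y t)) \<le> 3 * (z * e)"
 proof -
  have "cmod (dv (Y t) *\<^sub>R k1 (Y t)) \<le> (2 * z) * e" using dvz ez by (intro tri b1) linarith
  moreover have "cmod (v (Y t) *\<^sub>R k2 (Y t)) \<le> z * e" using vz by (intro tri b1) auto
  ultimately have "cmod (dv (Y t) *\<^sub>R k1 (Y t) + v (Y t) *\<^sub>R k2 (Y t)) \<le> (2 * z) * e + z * e"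
   by (rule norm_add_le2)
  then show ?thesis by (simp add: mult_ac)
 qed
 have ii: "cmod (dv (Y t) *\<^sub>R (dv (Y t) *\<^sub>R k1 (Y t) + v (Y t) *\<^sub>R k2 (Y t))) \<le> (2 * (eps * z)) * (3 * (z * e))"
  by (rule tri[OF dvz i])
 have iii: "cmod ((eps ^ 3 / b) *\<^sub>R k1 (Y t) + (2 * dv (Y t)) *\<^sub>R k2 (Y t) + v (Y t) *\<^sub>R k3 (Y t)) \<le> 6 * (z * e)"
 proof -
  have "eps ^ 3 / b \<le> z" unfolding z_def using eps3 b_pos by (intro divide_right_mono) auto
  then have "cmod ((eps ^ 3 / b) *\<^sub>R k1 (Y t)) \<le> z * e" using he b_pos by (intro tri b1) simp
  moreover have "cmod ((2 * dv (Y t)) *\<^sub>R k2 (Y t)) \<le> (4 * z) * e"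
   using dvz ez by (intro tri b1) (simp add: abs_mult)
  moreover have "cmod (v (Y t) *\<^sub>R k3 (Y t)) \<le> z * e" using vz by (intro tri b1) auto
  ultimately have "cmod ((eps ^ 3 / b) *\<^sub>R k1 (Y t) + (2 * dv (Y t)) *\<^sub>R k2 (Y t) + v (Y t) *\<^sub>R k3 (Y t)) \<le> z * e + (4 * z) * e + z * e"
   by (intro norm_add_le2)
  then show ?thesis by (simp add: mult_ac)
 qed
 have "cmod (v (Y t) *\<^sub>R (dv (Y t) *\<^sub>R (dv (Y t) *\<^sub>R k1 (Y t) + v (Y t) *\<^sub>R k2 (Y t)) +
  v (Y t) *\<^sub>R ((eps ^ 3 / b) *\<^sub>R k1 (Y t) + (2 * dv (Y t)) *\<^sub>R k2 (Y t) + v (Y t) *\<^sub>R k3 (Y t))))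
  \<le> z * ((2 * (eps * z)) * (3 * (z * e)) + z * (6 * (z * e)))"
  using vz by (intro tri norm_add_le2 ii iii) auto
 also have "... = eps ^ 3 * ((6 * (eps * b\<^sup>2) / b\<^sup>2 / b ^ 3 * e) + 6 / b ^ 3 * e)"
  using b_pos unfolding z_def by (simp add: field_simps power2_eq_square power3_eq_cube)
 also have "... \<le> eps ^ 3 * (6 * (1 + b) / b ^ 3 * e + 6 / b ^ 3 * e)"
 proof (intro mult_left_mono add_right_mono mult_right_mono e)
  have "6 * (eps * b\<^sup>2) / b\<^sup>2 = 6 * eps" using b_pos by simp
  also have "... \<le> 6 * (1 + b)" using he b_pos by simp
  finally show "6 * (eps * b\<^sup>2) / b\<^sup>2 / b ^ 3 \<le> 6 * (1 + b) / b ^ 3"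
   using b_pos by (intro divide_right_mono) auto
 qed (use he in auto)
 also have "... = eps ^ 3 * ((18 * C + 18 * b * C) / b ^ 3 + 18 * C / b ^ 3) * (1 / (1 + (Y j)\<^sup>2))"
  unfolding e_def by (simp add: add_divide_distrib algebra_simps)
 finally show "cmod (v (Y t) *\<^sub>R (dv (Y t) *\<^sub>R (dv (Y t) *\<^sub>R k1 (Y t) + v (Y t) *\<^sub>R k2 (Y t)) +
  v (Y t) *\<^sub>R ((eps ^ 3 / b) *\<^sub>R k1 (Y t) + (2 * dv (Y t)) *\<^sub>R k2 (Y t) + v (Y t) *\<^sub>R k3 (Y t))))
  \<le> eps ^ 3 * ((18 * C + 18 * b * C) / b ^ 3 + 18 * C / b ^ 3) * (1 / (1 + (Y j)\<^sup>2))" .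
qed

end

context gauss_family
begin

lemma exp_decay_power:
 "\<exists>C>0. \<forall>y. (1 + abs y) ^ N * decay y \<le> C"
proof -
 obtain C where C: "C > 0" "\<And>y. 0 \<le> y \<Longrightarrow> (1 + y) ^ N \<le> C * exp (\<sigma> * y)"
  using power_le_exp[OF \<sigma>_pos, of N] by blast
 have "(1 + abs y) ^ N * decay y \<le> C" for y
 proof -
  have "(1 + abs y) ^ N * decay y \<le> C * exp (\<sigma> * abs y) * decay y"
   using C(2)[of "abs y"] by (intro mult_right_mono) auto
  then show ?thesis by (simp add: mult.assoc exp_add[symmetric])
 qed
 with C(1) show ?thesis by blast
qed

lemma Ideal_bound_sq:
 assumes "Ideal f"
 shows "\<exists>C\<ge>0. \<forall>w\<in>Om. \<forall>y. cmod (f w y) \<le> C * (1 / (1 + y\<^sup>2))"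
proof -
 obtain C where C: "C > 0" "\<And>w y. w \<in> Om \<Longrightarrow> cmod (f w y) \<le> C * decay y"
  using Ideal_bound[OF assms] by blast
 obtain D where D: "D > 0" "\<And>y. (1 + abs y) ^ 2 * decay y \<le> D"
  using exp_decay_power[of 2] by blast
 have "cmod (f w y) \<le> (C * D) * (1 / (1 + y\<^sup>2))" if "w \<in> Om" for w y
 proof -
  have "1 + y\<^sup>2 \<le> (1 + abs y)\<^sup>2" by (simp add: power2_sum)
  then have "(1 + y\<^sup>2) * decay y \<le> (1 + abs y)\<^sup>2 * decay y"
   by (intro mult_right_mono) auto
  with D(2)[of y] have "(1 + y\<^sup>2) * decay y \<le> D" by linarith
  moreover have "0 < 1 + y\<^sup>2" by (simp add: add_pos_nonneg)
  ultimately have "decay y \<le> D * (1 / (1 + y\<^sup>2))" by (simp add: pos_le_divide_eq mult.commute)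
  then have "C * decay y \<le> C * (D * (1 / (1 + y\<^sup>2)))" using C(1) by (intro mult_left_mono) auto
  with C(2)[OF that, of y] show ?thesis by (simp only: mult.assoc)
 qed
 then show ?thesis using C(1) D(1) by (intro exI[of _ "C * D"]) auto
qed

definition Hexp :: "real \<Rightarrow> (nat \<Rightarrow> complex) \<Rightarrow> real \<Rightarrow> complex" where
 "Hexp eps w y = H0 w y + of_real eps * H1 w y + (of_real eps)\<^sup>2 * H2 w y"

text \<open>Each cell contributes an error of order \<open>eps ^ 3 / (1 + y^2)\<close>, and
  telescoping \<open>arctan\<close> gives back one factor \<open>1 / eps\<close>. The functions
  \<open>A0\<close>, \<open>A1\<close>, \<open>A2\<close> are antiderivatives with respect to the
  index; the end terms of the midpoint correction are left explicit, to be removed later by the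
  decay of \<open>dH0\<close>.\<close>

lemma midpoint_sum:
 assumes b: "0 < b"
 shows "\<exists>C>0. \<forall>eps \<alpha> w A0 A1 A2. \<forall>p q :: nat. 0 < eps \<longrightarrow> eps \<le> 1 \<longrightarrow> eps \<le> b \<longrightarrow> w \<in> Om \<longrightarrow> p \<le> q \<longrightarrow>
  (\<forall>t. real p - 1/2 \<le> t \<longrightarrow> t \<le> real q + 1/2 \<longrightarrow> - \<alpha> < t \<and> abs (eps * wall_y eps b \<alpha> t) \<le> 1/8 \<and>
   (A0 has_vector_derivative H0 w (wall_y eps b \<alpha> t)) (at t) \<and>
   (A1 has_vector_derivative H1 w (wall_y eps b \<alpha> t)) (at t) \<and>
   (A2 has_vector_derivative H2 w (wall_y eps b \<alpha> t)) (at t)) \<longrightarrow>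
  cmod ((\<Sum>j=p..q. Hexp eps w (wall_y eps b \<alpha> (real j)))
   - ((A0 (real q + 1/2) + of_real eps * A1 (real q + 1/2) + (of_real eps)\<^sup>2 * A2 (real q + 1/2))
    - (A0 (real p - 1/2) + of_real eps * A1 (real p - 1/2) + (of_real eps)\<^sup>2 * A2 (real p - 1/2)))
   + (1/24) *\<^sub>R (wall_v eps b (wall_y eps b \<alpha> (real q + 1/2)) *\<^sub>R dH0 w (wall_y eps b \<alpha> (real q + 1/2))
    - wall_v eps b (wall_y eps b \<alpha> (real p - 1/2)) *\<^sub>R dH0 w (wall_y eps b \<alpha> (real p - 1/2))))
  \<le> C * eps\<^sup>2"
proof -
 obtain dH0' where d02: "Ideal dH0'" "deriv_of dH0' dH0" using Ideal_derivative[OF Ideal_dH0] by blast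
 obtain dH0'' where d03: "Ideal dH0''" "deriv_of dH0'' dH0'" using Ideal_derivative[OF d02(1)] by blast
 obtain dH1 where d11: "Ideal dH1" "deriv_of dH1 H1" using Ideal_derivative[OF Ideal_H1] by blast
 obtain dH1' where d12: "Ideal dH1'" "deriv_of dH1' dH1" using Ideal_derivative[OF d11(1)] by blast
 obtain dH2 where d21: "Ideal dH2" "deriv_of dH2 H2" using Ideal_derivative[OF Ideal_H2] by blast
 obtain C1 where C1: "C1 \<ge> 0" "\<And>w y. w \<in> Om \<Longrightarrow> cmod (dH0 w y) \<le> C1 * (1 / (1 + y\<^sup>2))" using Ideal_bound_sq[OF Ideal_dH0] by blast
 obtain C2 where C2: "C2 \<ge> 0" "\<And>w y. w \<in> Om \<Longrightarrow> cmod (dH0' w y) \<le> C2 * (1 / (1 + y\<^sup>2))" using Ideal_bound_sq[OF d02(1)] by blast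
 obtain C3 where C3: "C3 \<ge> 0" "\<And>w y. w \<in> Om \<Longrightarrow> cmod (dH0'' w y) \<le> C3 * (1 / (1 + y\<^sup>2))" using Ideal_bound_sq[OF d03(1)] by blast
 obtain C4 where C4: "C4 \<ge> 0" "\<And>w y. w \<in> Om \<Longrightarrow> cmod (dH1 w y) \<le> C4 * (1 / (1 + y\<^sup>2))" using Ideal_bound_sq[OF d11(1)] by blast
 obtain C5 where C5: "C5 \<ge> 0" "\<And>w y. w \<in> Om \<Longrightarrow> cmod (dH1' w y) \<le> C5 * (1 / (1 + y\<^sup>2))" using Ideal_bound_sq[OF d12(1)] by blast
 obtain C6 where C6: "C6 \<ge> 0" "\<And>w y. w \<in> Om \<Longrightarrow> cmod (dH2 w y) \<le> C6 * (1 / (1 + y\<^sup>2))" using Ideal_bound_sq[OF d21(1)] by blast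
 define K where "K = C1 + C2 + C3 + C4 + C5 + C6"
 have K0: "0 \<le> K" using C1 C2 C3 C4 C5 C6 by (simp add: K_def)
 have Kb: "c * (1 / (1 + y\<^sup>2)) \<le> K * (1 / (1 + y\<^sup>2))" if "c \<le> K" for c y :: real
  using that by (intro mult_right_mono) auto
 have le: "C1 \<le> K" "C2 \<le> K" "C3 \<le> K" "C4 \<le> K" "C5 \<le> K" "C6 \<le> K"
  using C1(1) C2(1) C3(1) C4(1) C5(1) C6(1) by (auto simp: K_def)
 define T3 where "T3 = (18 * K + 18 * b * K) / b ^ 3 + 18 * K / b ^ 3"
 define T where "T = T3 + 9 * K / b\<^sup>2 + 3 * K / b"
 have T0: "0 \<le> T" using K0 b by (simp add: T_def T3_def)
 define C where "C = T * (12 * b * pi) + 1"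
 have "C > 0" using T0 b by (simp add: C_def add_nonneg_pos)
 moreover have "cmod ((\<Sum>j=p..q. Hexp eps w (wall_y eps b \<alpha> (real j)))
   - ((A0 (real q + 1/2) + of_real eps * A1 (real q + 1/2) + (of_real eps)\<^sup>2 * A2 (real q + 1/2))
    - (A0 (real p - 1/2) + of_real eps * A1 (real p - 1/2) + (of_real eps)\<^sup>2 * A2 (real p - 1/2)))
   + (1/24) *\<^sub>R (wall_v eps b (wall_y eps b \<alpha> (real q + 1/2)) *\<^sub>R dH0 w (wall_y eps b \<alpha> (real q + 1/2))
    - wall_v eps b (wall_y eps b \<alpha> (real p - 1/2)) *\<^sub>R dH0 w (wall_y eps b \<alpha> (real p - 1/2))))
  \<le> C * eps\<^sup>2"
  if he: "0 < eps" "eps \<le> 1" "eps \<le> b" and om: "w \<in> Om" and pq: "p \<le> q"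
  and dom: "\<forall>t. real p - 1/2 \<le> t \<longrightarrow> t \<le> real q + 1/2 \<longrightarrow> - \<alpha> < t \<and> abs (eps * wall_y eps b \<alpha> t) \<le> 1/8 \<and>
   (A0 has_vector_derivative H0 w (wall_y eps b \<alpha> t)) (at t) \<and>
   (A1 has_vector_derivative H1 w (wall_y eps b \<alpha> t)) (at t) \<and>
   (A2 has_vector_derivative H2 w (wall_y eps b \<alpha> t)) (at t)"
  for eps \<alpha> w A0 A1 A2 and p q :: nat
 proof -
  define Y where "Y = wall_y eps b \<alpha>"
  define v where "v = wall_v eps b"
  \<comment> \<open>The correction \<open>F1 / 24\<close> is included in the antiderivative, so that
    one telescoping sum covers all contributions.\<close>
  define A where "A = (\<lambda>t. A0 t + of_real eps * A1 t + (of_real eps)\<^sup>2 * A2 t - (1/24) *\<^sub>R (v (Y t) *\<^sub>R dH0 w (Y t)))"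
  have cell: "cmod (A (real j + 1/2) - A (real j - 1/2) - Hexp eps w (Y (real j))) \<le>
    eps\<^sup>2 * T * (12 * b * (arctan (Y (real j + 1/2)) - arctan (Y (real j - 1/2))))" if j: "j \<in> {p..q}" for j
  proof -
   have rg: "real p - 1/2 \<le> t" "t \<le> real q + 1/2" if "abs (t - real j) \<le> 1/2" for t
    using that j unfolding abs_le_iff by auto
   have dA: "(A0 has_vector_derivative H0 w (wall_y eps b \<alpha> t)) (at t)"
    "(A1 has_vector_derivative H1 w (wall_y eps b \<alpha> t)) (at t)"
    "(A2 has_vector_derivative H2 w (wall_y eps b \<alpha> t)) (at t)" if "abs (t - real j) \<le> 1/2" for t
    using dom rg[OF that] by blast+
   interpret wall_cell eps b \<alpha> "real j"
    by unfold_locales (use he dom rg in auto)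
   define d where "d = 1 / (1 + (Y (real j))\<^sup>2)"
   have d0: "0 \<le> d" by (simp add: d_def)
   have c3: "cmod (A0 (real j + 1/2) - A0 (real j - 1/2) - H0 w (Y (real j)) - (1/24) *\<^sub>R (v (Y (real j + 1/2)) *\<^sub>R dH0 w (Y (real j + 1/2)) - v (Y (real j - 1/2)) *\<^sub>R dH0 w (Y (real j - 1/2))))
    \<le> eps ^ 3 * T3 * d"
    unfolding Y_def v_def d_def T3_def
    by (rule cell3[of A0 "H0 w" "dH0 w" "dH0' w" "dH0'' w"])
     (rule dA, assumption, use om deriv_H0 d02 d03 order.trans[OF C1(2)[OF om] Kb[OF le(1)]]
       order.trans[OF C2(2)[OF om] Kb[OF le(2)]] order.trans[OF C3(2)[OF om] Kb[OF le(3)]] K0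
      in \<open>auto simp: deriv_of_def\<close>)
   have c2: "cmod (A1 (real j + 1/2) - A1 (real j - 1/2) - H1 w (Y (real j))) \<le> eps\<^sup>2 * (9 * K / b\<^sup>2) * d"
    unfolding Y_def d_def
    by (rule cell2[of A1 "H1 w" "dH1 w" "dH1' w"])
     (rule dA, assumption, use om d11 d12 order.trans[OF C4(2)[OF om] Kb[OF le(4)]]
       order.trans[OF C5(2)[OF om] Kb[OF le(5)]] K0 in \<open>auto simp: deriv_of_def\<close>)
   have c1: "cmod (A2 (real j + 1/2) - A2 (real j - 1/2) - H2 w (Y (real j))) \<le> eps * (3 * K / b) * d"
    unfolding Y_def d_def
    by (rule cell1[of A2 "H2 w" "dH2 w"])
     (rule dA, assumption, use om d21 order.trans[OF C6(2)[OF om] Kb[OF le(6)]] K0 in \<open>auto simp: deriv_of_def\<close>)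
   have "A (real j + 1/2) - A (real j - 1/2) - Hexp eps w (Y (real j)) =
    (A0 (real j + 1/2) - A0 (real j - 1/2) - H0 w (Y (real j)) - (1/24) *\<^sub>R (v (Y (real j + 1/2)) *\<^sub>R dH0 w (Y (real j + 1/2)) - v (Y (real j - 1/2)) *\<^sub>R dH0 w (Y (real j - 1/2))))
    + of_real eps * (A1 (real j + 1/2) - A1 (real j - 1/2) - H1 w (Y (real j)))
    + (of_real eps)\<^sup>2 * (A2 (real j + 1/2) - A2 (real j - 1/2) - H2 w (Y (real j)))"
    unfolding A_def Hexp_def by (simp add: scaleR_conv_of_real algebra_simps)
   also have "cmod \<dots> \<le> eps ^ 3 * T3 * d + eps * (eps\<^sup>2 * (9 * K / b\<^sup>2) * d) + eps\<^sup>2 * (eps * (3 * K / b) * d)"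
   proof -
    have m: "cmod (of_real eps * x) \<le> eps * c" "cmod ((of_real eps)\<^sup>2 * x) \<le> eps\<^sup>2 * c" if "cmod x \<le> c" for x c
     using that he by (simp_all add: norm_mult norm_power mult_left_mono)
    show ?thesis by (intro norm_add_le2 c3 m(1)[OF c2] m(2)[OF c1])
   qed
   also have "... = eps\<^sup>2 * T * (eps * d)"
    by (simp add: T_def power2_eq_square power3_eq_cube algebra_simps)
   also have "... \<le> eps\<^sup>2 * T * (12 * b * (arctan (Y (real j + 1/2)) - arctan (Y (real j - 1/2))))"
    using arctan_increment T0 unfolding Y_def d_def by (intro mult_left_mono) auto
   finally show ?thesis .
  qed
  have tel: "(\<Sum>j=p..q. f (real j + 1/2) - f (real j - 1/2)) = f (real q + 1/2) - f (real p - 1/2)"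
   for f :: "real \<Rightarrow> 'z::ab_group_add"
  proof -
   have "(\<Sum>j=p..q. f (real (Suc j) - 1/2) - f (real j - 1/2)) = f (real (Suc q) - 1/2) - f (real p - 1/2)"
    by (rule sum_Suc_diff) (use pq in auto)
   moreover have "real (Suc j) - 1/2 = real j + 1/2" for j by simp
   ultimately show ?thesis by (simp only:)
  qed
  have "cmod ((\<Sum>j=p..q. Hexp eps w (Y (real j))) - (A (real q + 1/2) - A (real p - 1/2)))
   = cmod (\<Sum>j=p..q. - (A (real j + 1/2) - A (real j - 1/2) - Hexp eps w (Y (real j))))"
   unfolding tel[of A, symmetric] sum_subtractf[symmetric] by (simp add: algebra_simps)
  also have "... \<le> (\<Sum>j=p..q. eps\<^sup>2 * T * (12 * b * (arctan (Y (real j + 1/2)) - arctan (Y (real j - 1/2)))))"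
   by (rule order.trans[OF norm_sum], rule sum_mono) (use cell in \<open>simp only: norm_minus_cancel\<close>)
  also have "... = eps\<^sup>2 * T * (12 * b * (arctan (Y (real q + 1/2)) - arctan (Y (real p - 1/2))))"
   unfolding sum_distrib_left[symmetric] tel[of "\<lambda>t. arctan (Y t)"] ..
  also have "... \<le> eps\<^sup>2 * T * (12 * b * pi)"
   using arctan_ubound[of "Y (real q + 1/2)"] arctan_lbound[of "Y (real p - 1/2)"] T0 b
   by (intro mult_left_mono) auto
  also have "... \<le> C * eps\<^sup>2" by (simp add: C_def algebra_simps)
  finally have "cmod ((\<Sum>j=p..q. Hexp eps w (Y (real j))) - (A (real q + 1/2) - A (real p - 1/2))) \<le> C * eps\<^sup>2" .
  then show ?thesis unfolding A_def Y_def[symmetric] v_def[symmetric]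
   by (simp add: scaleR_conv_of_real algebra_simps)
 qed
 ultimately show ?thesis by blast
qed

end

section \<open>Comparison of the transformed integral with the limiting integrals\<close>

text \<open>The Jacobian of the change of variables, expanded to three different orders because it
  multiplies \<open>H0c\<close>, \<open>eps * H1\<close> and \<open>eps^2 * H2\<close>.\<close>

lemma inverse_square_taylor:
 fixes e :: real
 assumes "abs e \<le> 1/8"
 shows "abs (1 / (1 - e)\<^sup>2 - (1 + 2 * e + 3 * e\<^sup>2)) \<le> 6 * abs e ^ 3"
  and "abs (1 / (1 - e)\<^sup>2 - (1 + 2 * e)) \<le> 6 * abs e ^ 2"
  and "abs (1 / (1 - e)\<^sup>2 - 1) \<le> 6 * abs e"
proof -
 have e: "abs e \<le> 1/8" by fact
 have nz: "1 - e \<noteq> 0" using e by auto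
 have sq: "3/4 \<le> (1 - e)\<^sup>2"
 proof -
  have "(7/8)\<^sup>2 \<le> (1 - e)\<^sup>2" using e by (intro power_mono) auto
  then show ?thesis by (simp add: power2_eq_square)
 qed
 have "1 / (1 - e)\<^sup>2 - (1 + 2 * e + 3 * e\<^sup>2) = e ^ 3 * (4 - 3 * e) / (1 - e)\<^sup>2"
  using nz by (simp add: field_simps) (simp add: power_numeral_reduce algebra_simps)
 then have "abs (1 / (1 - e)\<^sup>2 - (1 + 2 * e + 3 * e\<^sup>2)) = abs e ^ 3 * abs (4 - 3 * e) / (1 - e)\<^sup>2"
  by (simp add: abs_mult power_abs)
 also have "... \<le> abs e ^ 3 * (9/2) / (3/4)"
  using sq e by (intro frac_le mult_left_mono) auto
 finally show 1: "abs (1 / (1 - e)\<^sup>2 - (1 + 2 * e + 3 * e\<^sup>2)) \<le> 6 * abs e ^ 3" by simp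
 have e2: "abs e ^ 3 \<le> 1/8 * \<bar>e\<bar>\<^sup>2" using mult_right_mono[OF e, of "\<bar>e\<bar>\<^sup>2"] by (simp add: power3_eq_cube power2_eq_square)
 have e1: "\<bar>e\<bar>\<^sup>2 \<le> 1/8 * abs e" using mult_right_mono[OF e, of "abs e"] by (simp add: power2_eq_square)
 have 2: "abs (1 / (1 - e)\<^sup>2 - (1 + 2 * e)) \<le> 4 * abs e ^ 2"
 proof -
  have "abs (3 * e\<^sup>2) = 3 * \<bar>e\<bar>\<^sup>2" by simp
  with 1 e2 show ?thesis by linarith
 qed
 then show "abs (1 / (1 - e)\<^sup>2 - (1 + 2 * e)) \<le> 6 * abs e ^ 2" using zero_le_power2[of "abs e"] by linarith
 show "abs (1 / (1 - e)\<^sup>2 - 1) \<le> 6 * abs e" using 2 e1 by linarith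
qed

context gauss_family
begin

lemma deriv_of_continuous: "deriv_of f' f \<Longrightarrow> w \<in> Om \<Longrightarrow> continuous_on A (f w)"
 unfolding deriv_of_def
 by (meson continuous_at_imp_continuous_on has_vector_derivative_continuous)

lemma H_continuous:
 assumes "w \<in> Om"
 shows "continuous_on A (H0 w)" "continuous_on A (H1 w)" "continuous_on A (H2 w)"
 using deriv_of_continuous[OF deriv_H0 assms] Ideal_derivative[OF Ideal_H1] Ideal_derivative[OF Ideal_H2]
  deriv_of_continuous[OF _ assms] by blast+

lemma H_measurable:
 assumes "w \<in> Om"
 shows "H0c w \<in> borel_measurable borel" "H1 w \<in> borel_measurable borel" "H2 w \<in> borel_measurable borel"
proof -
 have [measurable]: "H0 w \<in> borel_measurable borel"
  by (intro borel_measurable_continuous_onI H_continuous assms)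
 show "H0c w \<in> borel_measurable borel" unfolding H0c_def[abs_def] by measurable
 show "H1 w \<in> borel_measurable borel" "H2 w \<in> borel_measurable borel"
  by (intro borel_measurable_continuous_onI H_continuous assms)+
qed

lemma integrable_poly_decay: "integrable lborel (\<lambda>y. (1 + abs y) ^ N * decay y)"
proof -
 obtain C where C: "C > 0" "\<And>y. 0 \<le> y \<Longrightarrow> (1 + y) ^ N \<le> C * exp (\<sigma> / 2 * y)"
  using power_le_exp[of "\<sigma> / 2" N] \<sigma>_pos by auto
 have "integrable lborel (\<lambda>y. C * exp (- (\<sigma> / 2 * abs y)))"
  using \<sigma>_pos by (intro integrable_mult_right integrable_exp_minus_abs) auto
 then show ?thesis
 proof (rule Bochner_Integration.integrable_bound)
  show "AE y in lborel. norm ((1 + abs y) ^ N * decay y) \<le> norm (C * exp (- (\<sigma> / 2 * abs y)))"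
  proof (intro AE_I2)
   fix y :: real
   have "(1 + abs y) ^ N * decay y \<le> C * exp (\<sigma> / 2 * abs y) * decay y"
    using C(2)[of "abs y"] by (intro mult_right_mono) auto
   also have "... = C * exp (- (\<sigma> / 2 * abs y))" by (simp add: mult.assoc exp_add[symmetric])
   finally show "norm ((1 + abs y) ^ N * decay y) \<le> norm (C * exp (- (\<sigma> / 2 * abs y)))"
    using C(1) by simp
  qed
 qed auto
qed

lemma integrable_poly_mult:
 fixes f :: "real \<Rightarrow> complex"
 assumes [measurable]: "f \<in> borel_measurable borel" and "\<And>y. cmod (f y) \<le> C * decay y" and "0 \<le> C"
 shows "integrable lborel f" "integrable lborel (\<lambda>y. of_real y * f y)" "integrable lborel (\<lambda>y. of_real (y\<^sup>2) * f y)"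
proof -
 have gen: "integrable lborel (\<lambda>y. of_real (y ^ k) * f y)" for k
 proof (rule Bochner_Integration.integrable_bound)
  show "integrable lborel (\<lambda>y. C * ((1 + abs y) ^ k * decay y))"
   by (intro integrable_mult_right integrable_poly_decay)
  show "AE y in lborel. norm (of_real (y ^ k) * f y) \<le> norm (C * ((1 + abs y) ^ k * decay y))"
  proof (intro AE_I2)
   fix y :: real
   have "abs y ^ k * cmod (f y) \<le> (1 + abs y) ^ k * (C * decay y)"
    using assms(2)[of y] by (intro mult_mono power_mono) auto
   then show "norm (of_real (y ^ k) * f y) \<le> norm (C * ((1 + abs y) ^ k * decay y))"
    using assms(3) by (simp add: norm_mult power_abs mult_ac norm_power)
  qed
 qed measurable
 show "integrable lborel f" "integrable lborel (\<lambda>y. of_real y * f y)" "integrable lborel (\<lambda>y. of_real (y\<^sup>2) * f y)"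
  using gen[of 0] gen[of 1] gen[of 2] by simp_all
qed

text \<open>Up to constant factors these are the integrals in \<open>C2\<close>, \<open>C3\<close>
  and \<open>C4\<close>.\<close>

definition M1 :: "(nat \<Rightarrow> complex) \<Rightarrow> complex" where
 "M1 w = (LBINT y. H0c w y)"
definition M2 :: "(nat \<Rightarrow> complex) \<Rightarrow> complex" where
 "M2 w = (LBINT y. 2 * (of_real y * H0c w y) + H1 w y)"
definition M3 :: "(nat \<Rightarrow> complex) \<Rightarrow> complex" where
 "M3 w = (LBINT y. 3 * (of_real (y\<^sup>2) * H0c w y) + 2 * (of_real y * H1 w y) + H2 w y)"

abbreviation Msum :: "real \<Rightarrow> (nat \<Rightarrow> complex) \<Rightarrow> complex" where
 "Msum eps w \<equiv> M1 w + of_real eps * M2 w + (of_real eps)\<^sup>2 * M3 w"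

lemma H_bounds_ex: "\<exists>K>0. \<forall>w\<in>Om. \<forall>y. cmod (H0c w y) \<le> K * decay y \<and>
 cmod (H1 w y) \<le> K * decay y \<and> cmod (H2 w y) \<le> K * decay y"
proof -
 obtain A where A: "A > 0" "\<And>w y. w \<in> Om \<Longrightarrow> cmod (H0c w y) \<le> A * decay y" using H0c_bound by blast
 obtain B where B: "B > 0" "\<And>w y. w \<in> Om \<Longrightarrow> cmod (H1 w y) \<le> B * decay y" using Ideal_bound[OF Ideal_H1] by blast
 obtain C where C: "C > 0" "\<And>w y. w \<in> Om \<Longrightarrow> cmod (H2 w y) \<le> C * decay y" using Ideal_bound[OF Ideal_H2] by blast
 have le: "c * decay y \<le> (A + B + C) * decay y" if "c \<le> A + B + C" for c y
  using that by (intro mult_right_mono) auto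
 have "A \<le> A + B + C" "B \<le> A + B + C" "C \<le> A + B + C" using A(1) B(1) C(1) by auto
 then show ?thesis using A B C le by (intro exI[of _ "A + B + C"]) (meson add_pos_pos order.trans)
qed

lemma M_bounds_ex: "\<exists>K>0. \<forall>w\<in>Om. cmod (M1 w) \<le> K \<and> cmod (M2 w) \<le> K \<and> cmod (M3 w) \<le> K"
proof -
 obtain K where K: "K > 0" "\<And>w y. w \<in> Om \<Longrightarrow> cmod (H0c w y) \<le> K * decay y"
  "\<And>w y. w \<in> Om \<Longrightarrow> cmod (H1 w y) \<le> K * decay y" "\<And>w y. w \<in> Om \<Longrightarrow> cmod (H2 w y) \<le> K * decay y"
  using H_bounds_ex by blast
 define I where "I = (LBINT y. (6 * K) * ((1 + abs y) ^ 2 * decay y))"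
 have int: "integrable lborel (\<lambda>y. (6 * K) * ((1 + abs y) ^ 2 * decay y))"
  by (intro integrable_mult_right integrable_poly_decay)
 have gen: "cmod (LBINT y. f y) \<le> I" if "f \<in> borel_measurable borel" and le: "\<And>y. cmod (f y) \<le> (6 * K) * ((1 + abs y) ^ 2 * decay y)"
  for f :: "real \<Rightarrow> complex"
 proof -
  have "integrable lborel f"
   by (rule Bochner_Integration.integrable_bound[OF int]) (use that K(1) in \<open>auto intro!: AE_I2 order.trans[OF le] simp: abs_mult\<close>)
  then show ?thesis unfolding I_def
   by (intro order.trans[OF integral_norm_bound integral_mono[OF integrable_norm int le]])
 qed
 have bnd: "k * (K * decay y) \<le> (6 * K) * ((1 + abs y) ^ 2 * decay y)"
  if "k \<le> 6 * (1 + abs y)\<^sup>2" for k y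
  using mult_right_mono[OF that, of "K * decay y"] K(1) by (simp add: mult_ac)
 have u2: "(1 + abs y)\<^sup>2 = 1 + 2 * abs y + y\<^sup>2" for y :: real by (simp add: power2_sum)
 have nm: "cmod (of_real r * z) \<le> abs r * c" if "cmod z \<le> c" for r z c
  using that by (simp add: norm_mult mult_left_mono)
 have "cmod (M1 w) \<le> I + 1 \<and> cmod (M2 w) \<le> I + 1 \<and> cmod (M3 w) \<le> I + 1" if om: "w \<in> Om" for w
 proof -
  note [measurable] = H_measurable[OF om]
  define E where "E = (\<lambda>y. K * decay y)"
  have h: "cmod (H0c w y) \<le> E y" "cmod (H1 w y) \<le> E y" "cmod (H2 w y) \<le> E y" for y
   using K(2-4)[OF om] by (auto simp: E_def)
  have "cmod (M1 w) \<le> I" unfolding M1_def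
  proof (rule gen)
   show "cmod (H0c w y) \<le> (6 * K) * ((1 + abs y) ^ 2 * decay y)" for y
    using order.trans[OF h(1)[of y], unfolded E_def, OF bnd[of 1 y, simplified]] zero_le_power2[of y]
    by (simp add: u2)
  qed measurable
  moreover have "cmod (M2 w) \<le> I" unfolding M2_def
  proof (rule gen)
   show "cmod (2 * (of_real y * H0c w y) + H1 w y) \<le> (6 * K) * ((1 + abs y) ^ 2 * decay y)" for y
   proof -
    have "cmod (of_real (2 * y) * H0c w y + H1 w y) \<le> abs (2 * y) * E y + E y"
     by (intro norm_add_le2 nm h)
    also have "... = (2 * abs y + 1) * (K * decay y)" by (simp add: E_def abs_mult distrib_right)
    also have "... \<le> (6 * K) * ((1 + abs y) ^ 2 * decay y)"
     using zero_le_power2[of y] by (intro bnd) (simp add: u2)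
    finally show ?thesis by (simp add: mult.assoc)
   qed
  qed measurable
  moreover have "cmod (M3 w) \<le> I" unfolding M3_def
  proof (rule gen)
   show "cmod (3 * (of_real (y\<^sup>2) * H0c w y) + 2 * (of_real y * H1 w y) + H2 w y) \<le> (6 * K) * ((1 + abs y) ^ 2 * decay y)" for y
   proof -
    have "cmod (of_real (3 * y\<^sup>2) * H0c w y + of_real (2 * y) * H1 w y + H2 w y) \<le> abs (3 * y\<^sup>2) * E y + abs (2 * y) * E y + E y"
     by (intro norm_add_le2 nm h)
    also have "... = (3 * y\<^sup>2 + 2 * abs y + 1) * (K * decay y)" by (simp add: E_def abs_mult distrib_right)
    also have "... \<le> (6 * K) * ((1 + abs y) ^ 2 * decay y)"
     using zero_le_power2[of y] by (intro bnd) (simp add: u2)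
    finally show ?thesis by (simp add: mult.assoc)
   qed
  qed measurable
  ultimately show ?thesis by simp
 qed
 moreover have "0 \<le> I" unfolding I_def using K(1) by (intro Bochner_Integration.integral_nonneg) auto
 ultimately show ?thesis by (intro exI[of _ "I + 1"]) auto
qed

text \<open>Truncation of the range and expansion of the Jacobian are handled by one integrable
  pointwise bound. Inside \<open>[Ym, Yp]\<close> it is the Taylor remainder; outside, where only
  the limiting integrand is present, the required \<open>eps ^ 3\<close> is manufactured from the
  lower bound on \<open>eps * (1 + abs y) ^ 50\<close>.\<close>

lemma wall_integral_compare:
 assumes D: "0 \<le> D"
 shows "\<exists>C>0. \<forall>eps Ym Yp w. 0 < eps \<longrightarrow> eps \<le> 1 \<longrightarrow> w \<in> Om \<longrightarrow>
  (\<forall>y. Ym \<le> y \<longrightarrow> y \<le> Yp \<longrightarrow> abs (eps * y) \<le> 1/8) \<longrightarrow> (\<forall>y. y < Ym \<or> Yp < y \<longrightarrow> 1 \<le> D * (eps * (1 + abs y) ^ 50)) \<longrightarrow>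
  cmod ((LBINT y:{Ym..Yp}. (H0c w y + of_real eps * H1 w y + (of_real eps)\<^sup>2 * H2 w y) * of_real (1 / (1 - eps * y)\<^sup>2))
   - (Msum eps w)) \<le> C * eps ^ 3"
proof -
 obtain K where K: "K > 0" "\<And>w y. w \<in> Om \<Longrightarrow> cmod (H0c w y) \<le> K * decay y"
  "\<And>w y. w \<in> Om \<Longrightarrow> cmod (H1 w y) \<le> K * decay y" "\<And>w y. w \<in> Om \<Longrightarrow> cmod (H2 w y) \<le> K * decay y"
  using H_bounds_ex by blast
 \<comment> \<open>The constant \<open>18\<close> collects three terms with coefficient
   \<open>6\<close> each; the cube of \<open>D\<close> comes from the part outside the
   window.\<close>
 define L where "L = 18 * K * (1 + D ^ 3)"
 have L: "L > 0" using K(1) D by (simp add: L_def add_pos_nonneg)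
 define I where "I = (LBINT y. (1 + abs y) ^ 152 * decay y)"
 have I0: "0 \<le> I" unfolding I_def by (intro Bochner_Integration.integral_nonneg) auto
 have intI: "integrable lborel (\<lambda>y. (L * eps ^ 3) * ((1 + abs y) ^ 152 * decay y))" for eps
  by (intro integrable_mult_right integrable_poly_decay)
 have "cmod ((LBINT y:{Ym..Yp}. (H0c w y + of_real eps * H1 w y + (of_real eps)\<^sup>2 * H2 w y) * of_real (1 / (1 - eps * y)\<^sup>2))
   - (Msum eps w)) \<le> (L * (I + 1)) * eps ^ 3"
  if eps: "0 < eps" "eps \<le> 1" and om: "w \<in> Om" and ins: "\<forall>y. Ym \<le> y \<longrightarrow> y \<le> Yp \<longrightarrow> abs (eps * y) \<le> 1/8"
   and outs: "\<forall>y. y < Ym \<or> Yp < y \<longrightarrow> 1 \<le> D * (eps * (1 + abs y) ^ 50)" for eps Ym Yp w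
 proof -
  define a where "a = H0c w"
  define b where "b = H1 w"
  define c where "c = H2 w"
  note [measurable] = H_measurable[OF om, folded a_def b_def c_def]
  have K': "cmod (a y) \<le> K * decay y" "cmod (b y) \<le> K * decay y" "cmod (c y) \<le> K * decay y" for y
   using K(2-4)[OF om] by (auto simp: a_def b_def c_def)
  note ia = integrable_poly_mult[OF _ K'(1) less_imp_le[OF K(1)]] and ib = integrable_poly_mult[OF _ K'(2) less_imp_le[OF K(1)]]
   and ic = integrable_poly_mult[OF _ K'(3) less_imp_le[OF K(1)]]
  define G where "G = (\<lambda>y. (a y + of_real eps * b y + (of_real eps)\<^sup>2 * c y) * of_real (1 / (1 - eps * y)\<^sup>2))"
  define T where "T = (\<lambda>y. a y + of_real eps * (2 * (of_real y * a y) + b y) + (of_real eps)\<^sup>2 * (3 * (of_real (y\<^sup>2) * a y) + 2 * (of_real y * b y) + c y))"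
  have intT: "integrable lborel T" unfolding T_def
   by (intro Bochner_Integration.integrable_add integrable_mult_right ia ib ic) measurable
  have MT: "Msum eps w = integral\<^sup>L lborel T"
  proof -
   have i2: "integrable lborel (\<lambda>y. 2 * (of_real y * a y) + b y)"
    and i3: "integrable lborel (\<lambda>y. 3 * (of_real (y\<^sup>2) * a y) + 2 * (of_real y * b y) + c y)"
    by (intro Bochner_Integration.integrable_add integrable_mult_right ia ib ic; measurable)+
   have "integral\<^sup>L lborel T = (LBINT y. a y) + of_real eps * (LBINT y. 2 * (of_real y * a y) + b y)
     + (of_real eps)\<^sup>2 * (LBINT y. 3 * (of_real (y\<^sup>2) * a y) + 2 * (of_real y * b y) + c y)"
   proof -
    have i1: "integrable lborel a" by (rule ia(1)) measurable
    have j2: "integrable lborel (\<lambda>y. of_real eps * (2 * (of_real y * a y) + b y))"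
     by (intro integrable_mult_right i2)
    have j3: "integrable lborel (\<lambda>y. (of_real eps)\<^sup>2 * (3 * (of_real (y\<^sup>2) * a y) + 2 * (of_real y * b y) + c y))"
     by (intro integrable_mult_right i3)
    show ?thesis unfolding T_def
     by (simp only: Bochner_Integration.integral_add[OF Bochner_Integration.integrable_add[OF i1 j2] j3]
       Bochner_Integration.integral_add[OF i1 j2] integral_mult_right_zero)
   qed
   then show ?thesis by (simp add: M1_def M2_def M3_def a_def b_def c_def)
  qed
  have pt: "cmod (indicator {Ym..Yp} y *\<^sub>R G y - T y) \<le> (L * eps ^ 3) * ((1 + abs y) ^ 152 * decay y)" for y
  proof -
   define u where "u = 1 + abs y"
   have u: "1 \<le> u" "abs y \<le> u" by (auto simp: u_def)
   define E where "E = K * decay y"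
   have E: "0 \<le> E" using K(1) by (simp add: E_def)
   have abc: "cmod (a y) \<le> E" "cmod (b y) \<le> E" "cmod (c y) \<le> E" using K' by (auto simp: E_def)
   define e where "e = eps * y"
   have up: "u ^ i \<le> u ^ j" if "i \<le> j" for i j using that u by (intro power_increasing) auto
   have yp: "abs y ^ i \<le> u ^ i" for i using u by (intro power_mono) auto
   have key: "cmod (of_real r * z) \<le> k * E" if "abs r \<le> k" "cmod z \<le> E" for r k z
    using that E mult_mono[of "abs r" k "cmod z" E] by (simp add: norm_mult)
   show ?thesis
   proof (cases "Ym \<le> y \<and> y \<le> Yp")
    case True
    then have e8: "abs e \<le> 1/8" using ins by (simp add: e_def)
    define w2 where "w2 = 1 / (1 - e)\<^sup>2"
    have Gw: "G y = (a y + of_real eps * b y + (of_real eps)\<^sup>2 * c y) * of_real w2"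
     by (simp only: G_def w2_def e_def)
    have "indicator {Ym..Yp} y *\<^sub>R G y - T y = of_real (w2 - (1 + 2 * e + 3 * e\<^sup>2)) * a y
      + of_real (eps * (w2 - (1 + 2 * e))) * b y + of_real (eps\<^sup>2 * (w2 - 1)) * c y"
     using True by (simp add: Gw T_def e_def algebra_simps power_mult_distrib power2_eq_square)
    moreover have "abs (w2 - (1 + 2 * e + 3 * e\<^sup>2)) \<le> 6 * (eps ^ 3 * u ^ 3)"
    proof -
     have "abs e ^ 3 \<le> eps ^ 3 * u ^ 3" using yp[of 3] eps by (simp add: e_def abs_mult power_mult_distrib)
     then show ?thesis using inverse_square_taylor(1)[OF e8] unfolding w2_def by linarith
    qed
    moreover have "abs (eps * (w2 - (1 + 2 * e))) \<le> 6 * (eps ^ 3 * u ^ 3)"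
    proof -
     have "abs (w2 - (1 + 2 * e)) \<le> 6 * (eps\<^sup>2 * \<bar>y\<bar>\<^sup>2)" using inverse_square_taylor(2)[OF e8] eps
      unfolding w2_def e_def abs_mult power_mult_distrib by simp
     also have "... \<le> 6 * (eps\<^sup>2 * u ^ 3)" using order.trans[OF yp[of 2] up[of 2 3]] by (intro mult_left_mono) auto
     finally have "eps * abs (w2 - (1 + 2 * e)) \<le> eps * (6 * (eps\<^sup>2 * u ^ 3))" using eps by (intro mult_left_mono) auto
     then show ?thesis using eps by (simp add: abs_mult power3_eq_cube power2_eq_square mult_ac)
    qed
    moreover have "abs (eps\<^sup>2 * (w2 - 1)) \<le> 6 * (eps ^ 3 * u ^ 3)"
    proof -
     have "abs (w2 - 1) \<le> 6 * (eps * abs y)" using inverse_square_taylor(3)[OF e8] eps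
      unfolding w2_def e_def abs_mult by simp
     also have "... \<le> 6 * (eps * u ^ 3)" using order.trans[OF yp[of 1] up[of 1 3]] eps by (intro mult_left_mono) auto
     finally have "eps\<^sup>2 * abs (w2 - 1) \<le> eps\<^sup>2 * (6 * (eps * u ^ 3))" by (intro mult_left_mono) auto
     then show ?thesis using eps by (simp add: abs_mult power3_eq_cube power2_eq_square mult_ac)
    qed
    ultimately have "cmod (indicator {Ym..Yp} y *\<^sub>R G y - T y) \<le> 6 * (eps ^ 3 * u ^ 3) * E + 6 * (eps ^ 3 * u ^ 3) * E + 6 * (eps ^ 3 * u ^ 3) * E"
     by (simp only:) (intro norm_add_le2 key abc)
    also have "... = 18 * E * (eps ^ 3 * u ^ 3)" by simp
    also have "... \<le> 18 * E * (eps ^ 3 * u ^ 152)" using E eps up[of 3 152] by (intro mult_left_mono) auto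
    also have "... \<le> (1 + D ^ 3) * (18 * E * (eps ^ 3 * u ^ 152))"
    proof -
     have "0 \<le> D ^ 3 * (18 * E * (eps ^ 3 * u ^ 152))" using E eps u D by simp
     then show ?thesis by (simp add: distrib_right)
    qed
    finally show ?thesis unfolding L_def E_def u_def by (simp only: mult_ac)
   next
    case False
    then have "1 \<le> D * (eps * u ^ 50)" using outs by (auto simp: u_def)
    \<comment> \<open>Cubing yields \<open>eps ^ 3\<close> with the power \<open>150\<close>;
      together with the growth \<open>u ^ 2\<close> of the integrand this gives the exponent
      \<open>152\<close>.\<close>
    then have "1 ^ 3 \<le> (D * (eps * u ^ 50)) ^ 3" by (intro power_mono) auto
    then have big: "1 \<le> D ^ 3 * (eps ^ 3 * u ^ 150)" by (simp add: power_mult_distrib power_mult[symmetric])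
    have "indicator {Ym..Yp} y *\<^sub>R G y - T y = - (of_real (1 + 2 * e + 3 * e\<^sup>2) * a y
      + of_real (eps * (1 + 2 * e)) * b y + of_real (eps\<^sup>2) * c y)"
     using False by (simp add: G_def T_def e_def algebra_simps power_mult_distrib indicator_def power2_eq_square)
    moreover have ey: "abs e \<le> u" using eps u mult_mono[of eps 1 "abs y" u] by (simp add: e_def abs_mult)
    have e2: "e\<^sup>2 \<le> u\<^sup>2" using power_mono[OF ey, of 2] by simp
    have "abs (1 + 2 * e + 3 * e\<^sup>2) \<le> 6 * u ^ 2"
     using ey e2 up[of 0 2] up[of 1 2] zero_le_power2[of e] by (simp only: power_0 power_one_right) linarith
    moreover have "abs (eps * (1 + 2 * e)) \<le> 6 * u ^ 2"
    proof -
     have "abs (1 + 2 * e) \<le> 6 * u ^ 2" using ey up[of 0 2] up[of 1 2] by (simp only: power_0 power_one_right) linarith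
     then show ?thesis using eps mult_mono[of eps 1 "abs (1 + 2 * e)" "6 * u\<^sup>2"] by (simp add: abs_mult)
    qed
    moreover have "abs (eps\<^sup>2) \<le> 6 * u ^ 2"
     using eps power_le_one[of eps 2] up[of 0 2] by simp
    ultimately have "cmod (indicator {Ym..Yp} y *\<^sub>R G y - T y) \<le> 6 * u ^ 2 * E + 6 * u ^ 2 * E + 6 * u ^ 2 * E"
     by (simp only: norm_minus_cancel) (intro norm_add_le2 key abc)
    also have "... = 18 * E * u ^ 2 * 1" by simp
    also have "... \<le> 18 * E * u ^ 2 * (D ^ 3 * (eps ^ 3 * u ^ 150))" using E big u by (intro mult_left_mono) auto
    also have "... = D ^ 3 * (18 * E * (eps ^ 3 * (u ^ 2 * u ^ 150)))" by (simp only: mult_ac)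
    also have "u ^ 2 * u ^ 150 = u ^ 152" by (simp add: power_add[symmetric])
    also have "D ^ 3 * (18 * E * (eps ^ 3 * u ^ 152)) \<le> (1 + D ^ 3) * (18 * E * (eps ^ 3 * u ^ 152))"
     using E eps u by (intro mult_right_mono) auto
    finally show ?thesis unfolding L_def E_def u_def by (simp only: mult_ac)
   qed
  qed
  have Gm [measurable]: "G \<in> borel_measurable borel" unfolding G_def by measurable
  have Tm [measurable]: "T \<in> borel_measurable borel" unfolding T_def by measurable
  have intGT: "integrable lborel (\<lambda>y. indicator {Ym..Yp} y *\<^sub>R G y - T y)"
   by (rule Bochner_Integration.integrable_bound[OF intI[of eps]])
    (measurable, use pt L eps in \<open>auto intro!: AE_I2 order.trans[OF pt] simp: abs_mult\<close>)
  have "integrable lborel (\<lambda>y. (indicator {Ym..Yp} y *\<^sub>R G y - T y) + T y)"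
   using intGT intT by (rule Bochner_Integration.integrable_add)
  then have intG: "integrable lborel (\<lambda>y. indicator {Ym..Yp} y *\<^sub>R G y)" by simp
  have "(LBINT y:{Ym..Yp}. G y) - integral\<^sup>L lborel T = (LBINT y. indicator {Ym..Yp} y *\<^sub>R G y - T y)"
   unfolding set_lebesgue_integral_def by (rule Bochner_Integration.integral_diff[OF intG intT, symmetric])
  also have "cmod \<dots> \<le> (LBINT y. (L * eps ^ 3) * ((1 + abs y) ^ 152 * decay y))"
   by (rule order.trans[OF integral_norm_bound integral_mono[OF integrable_norm[OF intGT] intI pt]])
  also have "... = (L * eps ^ 3) * I" by (simp add: I_def)
  also have "... \<le> (L * (I + 1)) * eps ^ 3" using L eps by (simp add: algebra_simps)
  finally show ?thesis unfolding MT G_def a_def b_def c_def .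
 qed
 moreover have "L * (I + 1) > 0" using L I0 by simp
 ultimately show ?thesis by blast
qed

end

section \<open>Monotonicity in the exponent and the factors outside the window\<close>

lemma wall_density_ratio:
 assumes "0 < eps"
 shows "wall_density eps (a + d) t = wall_density eps a t * max 0 (1 - eps * t) powr d"
 unfolding wall_density_def by (simp add: powr_add[symmetric] algebra_simps)

text \<open>Raising the exponent by \<open>d\<close> multiplies the density by the decreasing
  function \<open>(1 - eps * t) powr d\<close>. Compared with its value \<open>c\<close> at
  \<open>s\<close>, this lowers the mass beyond \<open>s\<close> and raises the mass of
  \<open>[0, s]\<close>.\<close>

lemma wall_ratio_antimono:
 assumes eps: "0 < eps" and a: "0 < a" "a \<le> a'" and s: "0 \<le> s"
 shows "wall_ratio eps a' s \<le> wall_ratio eps a s"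
proof -
 define d where "d = a' - a"
 have a': "a' = a + d" "0 \<le> d" using a by (auto simp: d_def)
 define c where "c = max 0 (1 - eps * s) powr d"
 have c: "0 \<le> c" by (simp add: c_def)
 have int: "set_integrable lborel {r..} (wall_density eps x)" if "0 < x" for x r
  by (rule set_integrable_wall_density[OF eps that])
 have int0: "set_integrable lborel {0..s} (wall_density eps x)" if "0 < x" for x
  using int[OF that, of 0] by (rule set_integrable_subset) auto
 have up: "wall_mass eps a' s \<le> c * wall_mass eps a s"
  unfolding wall_mass_def set_integral_mult_right[symmetric]
 proof (rule set_integral_mono)
  fix t assume t: "t \<in> {s..}"
  have "max 0 (1 - eps * t) powr d \<le> c" unfolding c_def
   using mult_left_mono[of s t eps] t eps a'(2) by (intro powr_mono2 max.mono) auto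
  then show "wall_density eps a' t \<le> c * wall_density eps a t"
   unfolding a'(1) wall_density_ratio[OF eps] using wall_density_nonneg[of eps a t] mult_left_mono by (metis mult.commute)
 qed (use a in \<open>auto intro!: int\<close>)
 define D where "D = (\<lambda>x. LBINT t:{0..s}. wall_density eps x t)"
 have lo: "c * D a \<le> D a'"
  unfolding D_def set_integral_mult_right[symmetric]
 proof (rule set_integral_mono)
  fix t assume t: "t \<in> {0..s}"
  have "c \<le> max 0 (1 - eps * t) powr d" unfolding c_def
   using mult_left_mono[of t s eps] t eps a'(2) by (intro powr_mono2 max.mono) auto
  then show "c * wall_density eps a t \<le> wall_density eps a' t"
   unfolding a'(1) wall_density_ratio[OF eps] using wall_density_nonneg[of eps a t] mult_left_mono by (metis mult.commute)
 qed (use a in \<open>auto intro!: int0\<close>)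
 have split: "wall_mass eps x 0 = D x + wall_mass eps x s" if "0 < x" for x
  unfolding wall_mass_def D_def by (rule LBINT_Icc_atLeast[OF s int[OF that]])
 have D0: "0 \<le> D x" for x
  unfolding D_def set_lebesgue_integral_def
  by (intro Bochner_Integration.integral_nonneg) (simp add: wall_density_nonneg)
 have m0: "0 < wall_mass eps x 0" if "0 < x" for x using wall_mass_pos[OF eps that, of 0] eps by simp
 have "wall_mass eps a' s * D a \<le> (c * wall_mass eps a s) * D a" using up D0 by (intro mult_right_mono)
 also have "... = wall_mass eps a s * (c * D a)" by simp
 also have "... \<le> wall_mass eps a s * D a'" using lo wall_mass_nonneg by (intro mult_left_mono)
 finally have "wall_mass eps a' s * D a \<le> wall_mass eps a s * D a'" .
 then have "wall_mass eps a' s * wall_mass eps a 0 \<le> wall_mass eps a s * wall_mass eps a' 0"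
  using a split[of a] split[of a'] by (simp add: algebra_simps)
 then show ?thesis using m0[of a] m0[of a'] a by (simp add: frac_le_eq divide_simps)
qed

text \<open>A step of one unit in \<open>y\<close> is at least one step in the index. This leaves
  room for rounding to integers when the window is chosen.\<close>

lemma wall_t_increment:
 assumes "0 < eps" "eps \<le> b" "abs (eps * y) \<le> 1/8" "abs (eps * z) \<le> 1/8" "y \<le> z"
 shows "z - y \<le> wall_t eps b \<alpha> z - wall_t eps b \<alpha> y"
proof -
 define u where "u = 1 - eps * y"
 define w where "w = 1 - eps * z"
 have uw: "7/8 \<le> u" "u \<le> 9/8" "7/8 \<le> w" "w \<le> 9/8" using assms(3,4) by (auto simp: u_def w_def abs_le_iff)
 have uw2: "u * w \<le> 2" "0 < u * w" using mult_mono[OF uw(2) uw(4)] uw by auto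
 have "wall_t eps b \<alpha> z - wall_t eps b \<alpha> y = 2 * b / eps\<^sup>2 * (1 / w - 1 / u)"
  unfolding wall_t_def u_def[symmetric] w_def[symmetric] using uw assms by (simp add: field_simps)
 also have "1 / w - 1 / u = eps * (z - y) / (u * w)"
  using uw by (simp add: u_def w_def field_simps)
 also have "2 * b / eps\<^sup>2 * (eps * (z - y) / (u * w)) = (2 * b / eps) * (z - y) / (u * w)"
 proof -
  have "2 * b / e\<^sup>2 * (e * d / p) = (2 * b / e) * d / p" if "e \<noteq> 0" for e d p :: real
   using that by (cases "p = 0") (simp_all add: power2_eq_square)
  from this[of eps "z - y" "u * w"] show ?thesis using assms(1) by (metis less_irrefl)
 qed
 finally have eq: "wall_t eps b \<alpha> z - wall_t eps b \<alpha> y = (2 * b / eps) * (z - y) / (u * w)" .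
 have "1 \<le> b / eps" using assms by simp
 then have "2 \<le> 2 * b / eps" by simp
 then have "2 * (z - y) / 2 \<le> (2 * b / eps) * (z - y) / (u * w)"
  using uw2 assms by (intro frac_le mult_right_mono) auto
 then show ?thesis unfolding eq by simp
qed

lemma sum_wall_delta_le:
 assumes he: "0 < eps" "eps \<le> 1" "eps \<le> b" and pq: "p \<le> q"
  and dom: "\<And>t. real p - 1/2 \<le> t \<Longrightarrow> t \<le> real q + 1/2 \<Longrightarrow> - \<alpha> < t \<and> abs (eps * wall_y eps b \<alpha> t) \<le> 1/8"
 shows "(\<Sum>j=p..q. eps * (1 / (1 + (wall_y eps b \<alpha> (real j))\<^sup>2))) \<le> 12 * b * pi"
proof -
 define Y where "Y = wall_y eps b \<alpha>"
 define g where "g = (\<lambda>j::nat. arctan (Y (real j - 1/2)))"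
 have "eps * (1 / (1 + (Y (real j))\<^sup>2)) \<le> 12 * b * (g (Suc j) - g j)" if j: "j \<in> {p..q}" for j
 proof -
  have rg: "real p - 1/2 \<le> t" "t \<le> real q + 1/2" if "abs (t - real j) \<le> 1/2" for t
   using that j unfolding abs_le_iff by auto
  interpret wall_cell eps b \<alpha> "real j"
   by unfold_locales (use he dom rg in auto)
  have "real (Suc j) - 1/2 = real j + 1/2" by simp
  then show ?thesis using arctan_increment unfolding g_def Y_def by (simp only:) simp
 qed
 then have "(\<Sum>j=p..q. eps * (1 / (1 + (Y (real j))\<^sup>2))) \<le> (\<Sum>j=p..q. 12 * b * (g (Suc j) - g j))"
  by (rule sum_mono)
 also have "... = 12 * b * (g (Suc q) - g p)"
  unfolding sum_distrib_left[symmetric] using pq by (subst sum_Suc_diff) auto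
 also have "... \<le> 12 * b * pi"
  using arctan_ubound[of "Y (real (Suc q) - 1/2)"] arctan_lbound[of "Y (real p - 1/2)"] he
  unfolding g_def by (intro mult_left_mono) auto
 finally show ?thesis unfolding Y_def .
qed

text \<open>Integration by substitution: the chain rule produces \<open>wall_v\<close>, which
  cancels against the density \<open>2 * b / (eps * (1 - eps * y)^2)\<close>. The lower limit
  \<open>- L\<close> is only a common base point left of all relevant \<open>y\<close>.\<close>

lemma wall_antiderivative:
 fixes f :: "real \<Rightarrow> complex"
 assumes "0 < eps" "0 < b" "- \<alpha> < t" and f: "continuous_on UNIV f" and L: "eps * L < 1" "abs (wall_y eps b \<alpha> t) < L"
 shows "((\<lambda>t. of_real (2 * b / eps) * integral {-L..wall_y eps b \<alpha> t} (\<lambda>x. f x * of_real (1 / (1 - eps * x)\<^sup>2)))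
  has_vector_derivative f (wall_y eps b \<alpha> t)) (at t)"
proof -
 define Y where "Y = wall_y eps b \<alpha> t"
 define h where "h = (\<lambda>x. f x * of_real (1 / (1 - eps * x)\<^sup>2))"
 have nz: "1 - eps * x \<noteq> 0" if "x \<in> {-L..L}" for x
 proof -
  have "eps * x \<le> eps * L" using that assms(1) by (intro mult_left_mono) auto
  then show ?thesis using L by auto
 qed
 have "continuous_on {-L..L} h" unfolding h_def
  using nz by (intro continuous_intros continuous_on_subset[OF f]) auto
 moreover have "Y \<in> {-L..L}" using L(2) by (auto simp: Y_def abs_less_iff)
 ultimately have "((\<lambda>y. integral {-L..y} h) has_vector_derivative h Y) (at Y within {-L..L})"
  by (rule integral_has_vector_derivative)
 then have "((\<lambda>y. integral {-L..y} h) has_vector_derivative h Y) (at Y)"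
  using L(2) by (simp add: Y_def abs_less_iff at_within_Icc_at)
 then have "((\<lambda>y. of_real (2 * b / eps) * integral {-L..y} h) has_vector_derivative of_real (2 * b / eps) * h Y) (at Y)"
  by (rule has_vector_derivative_mult_right)
 from comp_wall_y[OF assms(1-3), of "\<lambda>y. of_real (2 * b / eps) * integral {-L..y} h" "\<lambda>y. of_real (2 * b / eps) * h y"] this
 have "((\<lambda>t. of_real (2 * b / eps) * integral {-L..wall_y eps b \<alpha> t} h) has_vector_derivative
   wall_v eps b Y *\<^sub>R (of_real (2 * b / eps) * h Y)) (at t)" unfolding Y_def by blast
 moreover have "wall_v eps b Y *\<^sub>R (of_real (2 * b / eps) * h Y) = f Y"
 proof -
  have "1 - eps * Y \<noteq> 0" using nz[of Y] L(2) by (auto simp: Y_def abs_less_iff)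
  then have one: "wall_v eps b Y * (2 * b / eps) * (1 / (1 - eps * Y)\<^sup>2) = 1"
   unfolding wall_v_def using assms by simp
  have "wall_v eps b Y *\<^sub>R (of_real (2 * b / eps) * h Y) = of_real (wall_v eps b Y * (2 * b / eps) * (1 / (1 - eps * Y)\<^sup>2)) * f Y"
   by (simp add: h_def scaleR_conv_of_real)
  then show ?thesis unfolding one by simp
 qed
 ultimately show ?thesis by (simp add: h_def Y_def)
qed

context gauss_family
begin

text \<open>The expansion remains valid at the ends of the admissible range, and there
  \<open>gauss_R\<close> or \<open>1 - gauss_R\<close> as well as all corrections are exponentially
  small. Monotonicity then spreads the bound to the indices outside the range.\<close>

lemma wall_ratio_tail:
 assumes l: "l \<in> {1..m}" and ne: "Om \<noteq> {}"
 shows "\<exists>C>0. \<exists>eps0>0. \<forall>eps y. eps < eps0 \<longrightarrow> wall_range eps y \<longrightarrow>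
  (y \<le> 0 \<longrightarrow> 1 - wall_ratio eps (wall_exponent eps y) (s l) \<le> C * decay y) \<and>
  (0 \<le> y \<longrightarrow> wall_mass eps (wall_exponent eps y) (s l) / wall_mass eps (wall_exponent eps y) 0 \<le> C * decay y)"
proof -
 obtain C eps0 where C: "C > 0" "eps0 > 0" "\<And>eps y. eps < eps0 \<Longrightarrow> wall_range eps y \<Longrightarrow>
   \<bar>wall_ratio eps (wall_exponent eps y) (s l)
   - (gauss_R (s l) y + eps * wall_r1 (s l) y + eps\<^sup>2 * wall_r2 (s l) y)\<bar>
   \<le> C * (eps ^ 3 * ((1 + abs y) ^ 60 * (gauss_R (s l) y * (1 - gauss_R (s l) y))))"
  using wall_ratio_expansion[OF less_imp_le[OF s_pos[OF l]]] by blast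
 obtain D where D: "D \<ge> 0" "\<And>y. gauss_R (s l) y * (1 - gauss_R (s l) y) \<le> D * exp (- (2 * \<sigma> * abs y))"
  using gauss_R_var_bound[OF \<sigma>_pos \<sigma>_le[OF l]] by blast
 obtain E where E: "E > 0" "\<And>y. (1 + abs y) ^ 60 * exp (- (2 * \<sigma> * abs y)) \<le> E * decay y"
  using poly_exp_decay[of 60] by blast
 obtain w where om: "w \<in> Om" using ne by blast
 obtain F1 where F1: "F1 > 0" "\<And>y. \<bar>wall_r1 (s l) y\<bar> \<le> F1 * decay y"
  using Ideal_bound[OF Ideal_r1[OF l]] om unfolding norm_of_real by blast
 obtain F2 where F2: "F2 > 0" "\<And>y. \<bar>wall_r2 (s l) y\<bar> \<le> F2 * decay y"
  using Ideal_bound[OF Ideal_r2[OF l]] om unfolding norm_of_real by blast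
 define G where "G = s l / gauss_tail 0 * exp ((s l + \<sigma>)\<^sup>2)"
 have G: "0 \<le> G" using s_pos[OF l] gauss_tail_pos[of 0] by (auto simp: G_def)
 define K where "K = C * (D * E) + F1 + F2 + G + 1"
 have "K > 0" unfolding K_def using mult_nonneg_nonneg[OF less_imp_le[OF C(1)] mult_nonneg_nonneg[OF D(1) less_imp_le[OF E(1)]]] F1(1) F2(1) G by linarith
 moreover have "(y \<le> 0 \<longrightarrow> 1 - wall_ratio eps (wall_exponent eps y) (s l) \<le> K * decay y) \<and>
  (0 \<le> y \<longrightarrow> wall_mass eps (wall_exponent eps y) (s l) / wall_mass eps (wall_exponent eps y) 0 \<le> K * decay y)"
  if small: "eps < eps0" and range: "wall_range eps y" for eps y
 proof -
  have eps: "0 < eps" using range by (simp add: wall_range_def)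
  have eps1: "eps \<le> 1" using wall_range_le[OF range, of 0] by simp
  define e where "e = decay y"
  have e: "0 < e" by (simp add: e_def)
  have ee: "exp (- (2 * \<sigma> * abs y)) \<le> e" using \<sigma>_pos by (simp add: e_def)
  define r where "r = wall_ratio eps (wall_exponent eps y) (s l)"
  define R where "R = gauss_R (s l) y"
  have err: "C * (eps ^ 3 * ((1 + abs y) ^ 60 * (R * (1 - R)))) \<le> C * (D * E) * e"
  proof -
   have "(1 + abs y) ^ 60 * (R * (1 - R)) \<le> (1 + abs y) ^ 60 * (D * exp (- (2 * \<sigma> * abs y)))"
    using D(2)[of y] by (intro mult_left_mono) (auto simp: R_def)
   also have "... = D * ((1 + abs y) ^ 60 * exp (- (2 * \<sigma> * abs y)))" by simp
   also have "... \<le> D * (E * e)" using D(1) E(2)[of y] by (intro mult_left_mono) (auto simp: e_def)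
   finally have 1: "(1 + abs y) ^ 60 * (R * (1 - R)) \<le> D * (E * e)" .
   have "eps ^ 3 * ((1 + abs y) ^ 60 * (R * (1 - R))) \<le> 1 * (D * (E * e))"
    by (rule mult_mono[OF power_le_one 1]) (use eps eps1 gauss_R_pos[of "s l" y] gauss_R_le_1[of "s l" y] s_pos[OF l] in \<open>auto simp: R_def\<close>)
   then show ?thesis using C(1) by (simp add: mult.assoc)
  qed
  have "abs (r - (R + eps * wall_r1 (s l) y + eps\<^sup>2 * wall_r2 (s l) y)) \<le> C * (D * E) * e"
   using C(3)[OF small range] err unfolding r_def R_def by linarith
  moreover have "abs (eps * wall_r1 (s l) y) \<le> F1 * e"
   using mult_mono[OF eps1 F1(2)[of y]] eps by (simp add: abs_mult e_def)
  moreover have "abs (eps\<^sup>2 * wall_r2 (s l) y) \<le> F2 * e"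
   using mult_mono[OF power_le_one[OF less_imp_le[OF eps] eps1, of 2] F2(2)[of y]] eps by (simp add: abs_mult e_def)
  ultimately have rR: "abs (r - R) \<le> C * (D * E) * e + F1 * e + F2 * e" by linarith
  have 1: "1 - R \<le> G * e" if "y \<le> 0"
  proof -
   have "1 - R \<le> G * exp (- (2 * \<sigma> * abs y))" unfolding R_def G_def by (rule gauss_R_decay_neg[OF \<sigma>_pos \<sigma>_le[OF l] that])
   also have "... \<le> G * e" using G ee by (intro mult_left_mono)
   finally show ?thesis .
  qed
  have 2: "R \<le> e" if "0 \<le> y"
   using gauss_R_decay_pos[OF \<sigma>_pos \<sigma>_le[OF l] that] ee unfolding R_def by linarith
  have Ke: "K * e = C * (D * E) * e + F1 * e + F2 * e + G * e + e" by (simp add: K_def distrib_right)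
  have "0 \<le> G * e" using G e by simp
  then show ?thesis unfolding r_def[symmetric] e_def[symmetric] Ke using rR 1 2 e by auto
 qed
 ultimately show ?thesis using C(2) by blast
qed

text \<open>The ratio for \<open>s 1\<close>, the largest shift, is the smallest and controls the
  distance of all ratios from \<open>1\<close>; the ratio for \<open>s m\<close> is the largest and
  controls their distance from \<open>0\<close>.\<close>

lemma Ln_gwall_tails:
 assumes m: "0 < m" and om: "w \<in> Om" and eps: "0 < eps" and a: "0 < a"
 shows "cmod (Ln (gwall eps w a) - Hinf w) \<le> B * m / c0 * (1 - wall_ratio eps a (s 1))"
  and "cmod (Ln (gwall eps w a)) \<le> B * m / c0 * (wall_ratio eps a (s m))"
proof -
 define r where "r = (\<lambda>l. wall_mass eps a (s l) / wall_mass eps a 0)"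
 have r: "0 \<le> r l" "r l \<le> 1" "r 1 \<le> r l" "r l \<le> r m" if "l \<in> {1..m}" for l
  using wall_ratio_bounds[OF eps a, of "s l"] s_pos[OF that] that s_antimono[of 1 l] s_antimono[of l m]
  unfolding r_def by (auto intro!: divide_right_mono wall_mass_antimono eps a wall_mass_nonneg)
 have g: "gwall eps w a = 1 + (\<Sum>l\<in>{1..m}. w l * of_real (r l))" by (simp add: gwall_def r_def)
 have "cmod (Ln (gwall eps w a) - Hinf w) \<le> cmod (gwall eps w a - (1 + (\<Sum>l\<in>{1..m}. w l))) / c0"
  unfolding Hinf_def by (intro Ln_lipschitz c0_pos Re_gwall om eps a Re_1_sum)
 also have "gwall eps w a - (1 + (\<Sum>l\<in>{1..m}. w l)) = (\<Sum>l\<in>{1..m}. w l * of_real (r l - 1))"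
  unfolding g by (simp add: sum_subtractf algebra_simps)
 also have "cmod (\<Sum>l\<in>{1..m}. w l * of_real (r l - 1)) \<le> (\<Sum>l\<in>{1..m}. B * (1 - r 1))"
 proof (intro order.trans[OF norm_sum] sum_mono)
  fix l assume l: "l \<in> {1..m}"
  show "cmod (w l * of_real (r l - 1)) \<le> B * (1 - r 1)"
   unfolding norm_mult norm_of_real using r[OF l] Om_le[OF om l] B_nonneg by (intro mult_mono) auto
 qed
 also have "... = B * m * (1 - r 1)" by simp
 finally show "cmod (Ln (gwall eps w a) - Hinf w) \<le> B * m / c0 * (1 - wall_ratio eps a (s 1))"
  using c0_pos by (simp add: r_def divide_right_mono)
 have "cmod (Ln (gwall eps w a) - Ln 1) \<le> cmod (gwall eps w a - 1) / c0"
  using Om_Re[OF om, of "\<lambda>_. 0"] by (intro Ln_lipschitz c0_pos Re_gwall om eps a) auto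
 also have "gwall eps w a - 1 = (\<Sum>l\<in>{1..m}. w l * of_real (r l))" unfolding g by simp
 also have "cmod (\<Sum>l\<in>{1..m}. w l * of_real (r l)) \<le> (\<Sum>l\<in>{1..m}. B * r m)"
 proof (intro order.trans[OF norm_sum] sum_mono)
  fix l assume l: "l \<in> {1..m}"
  show "cmod (w l * of_real (r l)) \<le> B * r m"
   unfolding norm_mult norm_of_real using r[OF l] Om_le[OF om l] B_nonneg by (intro mult_mono) auto
 qed
 also have "... = B * m * r m" by simp
 finally show "cmod (Ln (gwall eps w a)) \<le> B * m / c0 * (wall_ratio eps a (s m))"
  using c0_pos by (simp add: r_def divide_right_mono mult.commute)
qed

text \<open>The plateau \<open>Hinf\<close> on negative \<open>y\<close> is separated and integrated
  exactly with the antiderivative \<open>1 / (eps * (1 - eps * y))\<close>; the remaining integrand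
  decays on both sides.\<close>

lemma integral_Hexp_split:
 assumes eps: "0 < eps" and om: "w \<in> Om" and Y: "Ym < 0" "0 < Yp" and ins: "\<And>y. Ym \<le> y \<Longrightarrow> y \<le> Yp \<Longrightarrow> abs (eps * y) \<le> 1/8"
 shows "integral {Ym..Yp} (\<lambda>y. Hexp eps w y * of_real (1 / (1 - eps * y)\<^sup>2)) =
  (LBINT y:{Ym..Yp}. (H0c w y + of_real eps * H1 w y + (of_real eps)\<^sup>2 * H2 w y) * of_real (1 / (1 - eps * y)\<^sup>2))
  + Hinf w * of_real (1 / eps - 1 / (eps * (1 - eps * Ym)))"
proof -
 define W where "W = (\<lambda>y. 1 / (1 - eps * y)\<^sup>2)"
 have nz: "1 - eps * y \<noteq> 0" if "y \<in> {Ym..Yp}" for y using ins[of y] that by (auto simp: abs_le_iff)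
 have cW: "continuous_on {Ym..Yp} (\<lambda>y. complex_of_real (W y))" unfolding W_def
  using nz by (intro continuous_intros) auto
 have cH: "continuous_on {Ym..Yp} (\<lambda>y. Hexp eps w y * of_real (W y))"
  unfolding Hexp_def by (intro continuous_on_mult continuous_on_add continuous_on_const H_continuous om cW)
 have iH: "set_integrable lborel {Ym..Yp} (\<lambda>y. Hexp eps w y * of_real (W y))"
  by (rule borel_integrable_atLeastAtMost'[OF cH])
 have iW: "set_integrable lborel {Ym..<0} (\<lambda>y. Hinf w * of_real (W y))"
 proof (rule set_integrable_subset)
  show "set_integrable lborel {Ym..Yp} (\<lambda>y. Hinf w * of_real (W y))"
   by (intro borel_integrable_atLeastAtMost' continuous_on_mult continuous_on_const cW)
 qed (use Y in auto)
 have eq: "indicator {Ym..Yp} y *\<^sub>R ((H0c w y + of_real eps * H1 w y + (of_real eps)\<^sup>2 * H2 w y) * of_real (W y)) =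
  indicator {Ym..Yp} y *\<^sub>R (Hexp eps w y * of_real (W y)) - indicator {Ym..<0} y *\<^sub>R (Hinf w * of_real (W y))" for y
  using Y by (auto simp: Hexp_def H0c_def indicator_def algebra_simps)
 have "(LBINT y:{Ym..Yp}. (H0c w y + of_real eps * H1 w y + (of_real eps)\<^sup>2 * H2 w y) * of_real (W y)) =
  (LBINT y:{Ym..Yp}. Hexp eps w y * of_real (W y)) - (LBINT y:{Ym..<0}. Hinf w * of_real (W y))"
  unfolding set_lebesgue_integral_def eq
  by (rule Bochner_Integration.integral_diff) (use iH iW in \<open>simp_all add: set_integrable_def\<close>)
 moreover have "(LBINT y:{Ym..Yp}. Hexp eps w y * of_real (W y)) = integral {Ym..Yp} (\<lambda>y. Hexp eps w y * of_real (W y))"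
  by (rule set_borel_integral_eq_integral(2)[OF iH])
 moreover have "(LBINT y:{Ym..<0}. Hinf w * of_real (W y)) = Hinf w * of_real (1 / eps - 1 / (eps * (1 - eps * Ym)))"
 proof -
  have "(LBINT y:{Ym..<0}. W y) = (LBINT y:{Ym..0}. W y)"
   unfolding set_lebesgue_integral_def
  proof (rule integral_cong_AE)
   show "AE y in lborel. indicator {Ym..<0} y *\<^sub>R W y = indicator {Ym..0} y *\<^sub>R W y"
    using AE_lborel_singleton[of 0] by eventually_elim (auto simp: indicator_def)
  qed (auto simp: W_def)
  also have "... = 1 / (eps * (1 - eps * 0)) - 1 / (eps * (1 - eps * Ym))"
   unfolding set_lebesgue_integral_def
  proof (rule integral_FTC_Icc[of Ym 0 "\<lambda>y. 1 / (eps * (1 - eps * y))"])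
   fix y assume y: "Ym \<le> y" "y \<le> 0"
   have "1 - eps * y \<noteq> 0" using nz[of y] y Y by auto
   then have "((\<lambda>y. 1 / eps * inverse (1 - eps * y)) has_real_derivative 1 / eps * (- (inverse (1 - eps * y) * (- eps) * inverse (1 - eps * y)))) (at y)"
    by (intro DERIV_cmult DERIV_inverse') (auto intro!: derivative_eq_intros)
   moreover have "1 / eps * (- (i * (- eps) * i)) = i * i" for i using eps by simp
   ultimately have "((\<lambda>y. 1 / (eps * (1 - eps * y))) has_real_derivative W y) (at y)"
    by (simp only: W_def power2_eq_square divide_inverse inverse_mult_distrib mult_1)
   then show "((\<lambda>y. 1 / (eps * (1 - eps * y))) has_vector_derivative W y) (at y within {Ym..0})"
    unfolding has_real_derivative_iff_has_vector_derivative by (rule has_vector_derivative_at_within)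
  next
   show "continuous_on {Ym..0} W" unfolding W_def using nz Y by (intro continuous_intros) auto
  qed (use Y in auto)
  finally have "(LBINT y:{Ym..<0}. W y) = 1 / eps - 1 / (eps * (1 - eps * Ym))" by simp
  moreover have "(LBINT y:{Ym..<0}. complex_of_real (W y)) = of_real (LBINT y:{Ym..<0}. W y)"
   by (rule set_integral_complex_of_real)
  ultimately show ?thesis by (simp only: set_integral_mult_right)
 qed
 ultimately show ?thesis by (simp add: W_def)
qed

end

section \<open>Cutting off the boundary layer\<close>

text \<open>\<open>M\<close>, of order \<open>eps powr (- 1/50)\<close>, is the largest value
  allowed by \<open>wall_range\<close>; \<open>p\<close> and \<open>q\<close> are the first and last
  index of the window. The values \<open>M\<close>, \<open>M - 1\<close> and \<open>M - 2\<close>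
  leave a margin of one unit each: the cells stay within \<open>M\<close>, the discarded indices lie
  beyond \<open>M - 1\<close>, and the end points of the window reach at least
  \<open>M - 2\<close>.\<close>

definition wall_cutoff :: "real \<Rightarrow> real \<Rightarrow> real \<Rightarrow> real \<Rightarrow> nat \<Rightarrow> nat \<Rightarrow> bool" where
 "wall_cutoff eps b \<alpha> M p q \<longleftrightarrow> 0 < eps \<and> 10 \<le> M \<and> eps * (1 + M) ^ 50 = 1 / 10 ^ 6 \<and> 1 \<le> p \<and> p \<le> q \<and> eps \<le> b \<and> eps \<le> 1 \<and>
   (\<forall>t. real p - 1/2 \<le> t \<longrightarrow> t \<le> real q + 1/2 \<longrightarrow> - \<alpha> < t \<and> abs (wall_y eps b \<alpha> t) \<le> M) \<and>
   wall_y eps b \<alpha> (real p - 1/2) \<le> - (M - 2) \<and> M - 2 \<le> wall_y eps b \<alpha> (real q + 1/2) \<and>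
   (\<forall>t. t \<le> real p - 1 \<longrightarrow> (t + \<alpha>) / b \<le> wall_exponent eps (- (M - 1))) \<and>
   (\<forall>t. real q + 1 \<le> t \<longrightarrow> wall_exponent eps (M - 1) \<le> (t + \<alpha>) / b)"

lemma wall_cutoff_exists:
 assumes b: "0 < b" and \<theta>: "1 < \<theta>" and \<alpha>: "-1 < \<alpha>"
 shows "\<exists>eps1>0. \<forall>eps. \<forall>n::nat. 0 < eps \<longrightarrow> eps < eps1 \<longrightarrow> real n = \<theta> * (2 * b / eps\<^sup>2) \<longrightarrow>
  (\<exists>M. \<exists>p q :: nat. q \<le> n \<and> wall_cutoff eps b \<alpha> M p q)"
proof -
 \<comment> \<open>The first entry gives \<open>M >= 10\<close>, the next two the bounds
   \<open>eps <= 1\<close> and \<open>eps <= b\<close>, the two with \<open>\<theta>\<close> ensure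
   that the window ends before \<open>n\<close>, and the last that it starts after the index
   \<open>1\<close>.\<close>
 define eps1 where "eps1 = Min {1 / (10 ^ 6 * 11 ^ 50), 1, b, ((\<theta> - 1) / (\<theta> + 1))\<^sup>2, (\<theta> - 1) * b, b / (abs \<alpha> + 1)}"
 have pos: "eps1 > 0" using b \<theta> unfolding eps1_def by (subst Min_gr_iff) auto
 have le: "eps1 \<le> 1 / (10 ^ 6 * 11 ^ 50)" "eps1 \<le> 1" "eps1 \<le> b" "eps1 \<le> ((\<theta> - 1) / (\<theta> + 1))\<^sup>2" "eps1 \<le> (\<theta> - 1) * b"
  "eps1 \<le> b / (abs \<alpha> + 1)"
  unfolding eps1_def by (intro Min_le; simp)+
 have "\<exists>M. \<exists>p q :: nat. q \<le> n \<and> wall_cutoff eps b \<alpha> M p q"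
  if eps: "0 < eps" and small: "eps < eps1" and n: "real n = \<theta> * (2 * b / eps\<^sup>2)" for eps and n :: nat
 proof -
  have eb: "eps \<le> b" "eps \<le> 1" using small le by linarith+
  \<comment> \<open>The solution of \<open>eps * (1 + M) ^ 50 = 1 / 10 ^ 6\<close>.\<close>
  define M where "M = ((1 / 10 ^ 6) / eps) powr (1/50) - 1"
  have M50: "(1 + M) ^ 50 = (1 / 10 ^ 6) / eps"
  proof -
   have "(1 + M) ^ 50 = (1 + M) powr (real 50)" using eps by (subst powr_realpow) (auto simp: M_def)
   also have "... = (1 / 10 ^ 6) / eps" using eps by (simp add: M_def powr_powr)
   finally show ?thesis .
  qed
  have M: "10 \<le> M"
  proof (rule ccontr)
   assume "\<not> 10 \<le> M"
   then have "(1 + M) ^ 50 < 11 ^ 50" using eps by (intro power_strict_mono) (auto simp: M_def)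
   moreover have "11 ^ 50 \<le> (1 / 10 ^ 6) / eps"
   proof -
    have "eps * (10 ^ 6 * 11 ^ 50) \<le> 1" using small le(1) by (simp add: field_simps)
    then show ?thesis using eps by (simp add: field_simps)
   qed
   ultimately show False unfolding M50 by linarith
  qed
  have eM: "eps * (1 + M) ^ 50 = 1 / 10 ^ 6" using eps by (simp add: M50)
  have rM: "wall_range eps M" using eM M eps by (simp add: wall_range_def)
  have eM1: "eps * (1 + M) \<le> 1/8" using wall_range_le[OF rM, of 1] M by simp
  have ins: "abs (eps * y) \<le> 1/8" if "abs y \<le> M" for y
  proof -
   have "eps * abs y \<le> eps * (1 + M)" using that eps by (intro mult_left_mono) auto
   then have "eps * abs y \<le> 1/8" using eM1 by linarith
   then show ?thesis using eps by (simp add: abs_mult)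
  qed
  define T where "T = wall_t eps b \<alpha>"
  have inc: "z - y \<le> T z - T y" if "abs y \<le> M" "abs z \<le> M" "y \<le> z" for y z
   unfolding T_def by (rule wall_t_increment[OF eps eb(1) ins[OF that(1)] ins[OF that(2)] that(3)])
  have T_al: "- \<alpha> < T y" "wall_y eps b \<alpha> (T y) = y" if "abs y \<le> M" for y
   using wall_y_wall_t[OF eps b, of y \<alpha>] ins[OF that] by (auto simp: T_def abs_le_iff)
  have T1: "1 < T y" if "abs y \<le> M" for y
  proof -
   have "eps \<le> b / (abs \<alpha> + 1)" using small le(6) by linarith
   then have "eps * (abs \<alpha> + 1) \<le> b" by (simp add: field_simps)
   moreover have "eps\<^sup>2 \<le> eps" using eps eb(2) by (simp add: power2_eq_square mult_left_le)
   then have "eps\<^sup>2 * (abs \<alpha> + 1) \<le> eps * (abs \<alpha> + 1)" by (intro mult_right_mono) auto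
   ultimately have 1: "abs \<alpha> + 1 \<le> b / eps\<^sup>2" using eps by (simp add: field_simps)
   have u: "0 < 1 - eps * y" "1 - eps * y < 2" using ins[OF that] by (auto simp: abs_le_iff)
   have "eps\<^sup>2 * (1 - eps * y) < eps\<^sup>2 * 2" using u eps by (intro mult_strict_left_mono) auto
   then have "2 * b / (eps\<^sup>2 * 2) < 2 * b / (eps\<^sup>2 * (1 - eps * y))" using eps b u by (intro divide_strict_left_mono) auto
   then show ?thesis using 1 unfolding T_def wall_t_def by simp
  qed
  have aT: "(T y + \<alpha>) / b = wall_exponent eps y" for y
   using b by (simp add: T_def wall_t_def wall_exponent_def)
  \<comment> \<open>Rounding towards the inside of the range from \<open>- (M - 1)\<close> to
    \<open>M - 1\<close>; the half cells added at the ends still remain within \<open>M\<close> by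
    \<open>wall_t_increment\<close>.\<close>
  define p where "p = nat \<lceil>T (- (M - 1))\<rceil>"
  define q where "q = nat \<lfloor>T (M - 1)\<rfloor>"
  have T1p: "1 < T (- (M - 1))" "1 < T (M - 1)" using M by (auto intro!: T1)
  have p: "T (- (M - 1)) \<le> real p" "real p < T (- (M - 1)) + 1"
   using T1p(1) by (simp_all add: p_def) linarith
  have q: "real q \<le> T (M - 1)" "T (M - 1) < real q + 1"
   using T1p(2) by (simp_all add: q_def)
  have i1: "T (- M) + 1 \<le> T (- (M - 1))" using inc[of "-M" "-(M-1)"] M by simp
  have i2: "T (- (M - 1)) + 1 \<le> T (- (M - 2))" using inc[of "-(M-1)" "-(M-2)"] M by simp
  have i3: "T (- (M - 2)) \<le> T (M - 2)" using inc[of "-(M-2)" "M-2"] M by simp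
  have i4: "T (M - 2) + 1 \<le> T (M - 1)" using inc[of "M-2" "M-1"] M by simp
  have i5: "T (M - 1) + 1 \<le> T M" using inc[of "M-1" "M"] M by simp
  have p1: "1 \<le> p" using p T1p by linarith
  have pq: "p \<le> q" using p q i1 i2 i3 i4 by linarith
  have rng: "- \<alpha> < t \<and> abs (wall_y eps b \<alpha> t) \<le> M" if "real p - 1/2 \<le> t" "t \<le> real q + 1/2" for t
  proof -
   have lo: "T (- M) \<le> t" using that p i1 by linarith
   have hi: "t \<le> T M" using that q i5 by linarith
   have al: "- \<alpha> < T (- M)" "wall_y eps b \<alpha> (T (- M)) = - M" "wall_y eps b \<alpha> (T M) = M" using T_al[of "-M"] T_al[of M] M by auto
   have "- M \<le> wall_y eps b \<alpha> t" using wall_y_mono[OF eps b al(1) lo] al(2) by simp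
   moreover have "wall_y eps b \<alpha> t \<le> M" using wall_y_mono[OF eps b _ hi, of \<alpha>] al lo by simp
   ultimately show ?thesis using al(1) lo by auto
  qed
  have Yp: "wall_y eps b \<alpha> (real p - 1/2) \<le> - (M - 2)"
  proof -
   have "real p - 1/2 \<le> T (- (M - 2))" using p i2 by linarith
   then have "wall_y eps b \<alpha> (real p - 1/2) \<le> wall_y eps b \<alpha> (T (- (M - 2)))"
    using rng[of "real p - 1/2"] pq by (intro wall_y_mono eps b) auto
   then show ?thesis using T_al(2)[of "-(M-2)"] M by simp
  qed
  have Yq: "M - 2 \<le> wall_y eps b \<alpha> (real q + 1/2)"
  proof -
   have "T (M - 2) \<le> real q + 1/2" using q i4 by linarith
   then have "wall_y eps b \<alpha> (T (M - 2)) \<le> wall_y eps b \<alpha> (real q + 1/2)"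
    using T_al(1)[of "M-2"] M by (intro wall_y_mono eps b) auto
   then show ?thesis using T_al(2)[of "M-2"] M by simp
  qed
  have tl: "(t + \<alpha>) / b \<le> wall_exponent eps (- (M - 1))" if "t \<le> real p - 1" for t
   unfolding aT[symmetric] using that p b by (intro divide_right_mono) auto
  have tr: "wall_exponent eps (M - 1) \<le> (t + \<alpha>) / b" if "real q + 1 \<le> t" for t
   unfolding aT[symmetric] using that q b by (intro divide_right_mono) auto
  \<comment> \<open>Here \<open>\<theta> > 1\<close> is decisive: the right end exceeds the critical
    index by a relative amount of at most \<open>sqrt eps\<close>, up to a constant, whereas
    \<open>n\<close> exceeds it by the fixed factor \<open>\<theta>\<close>.\<close>
  have "T (M - 1) \<le> real n"
  proof -
   define x where "x = eps * (M - 1)"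
   have "x \<le> sqrt eps"
   proof -
    have "x \<le> eps * (1 + abs M) ^ 1" unfolding x_def using eps M by (intro mult_left_mono) auto
    also have "... \<le> eps * (1 + abs M) ^ 20" using eps by (intro mult_left_mono power_increasing) auto
    also have "... \<le> sqrt eps" by (rule wall_range_sqrt[OF rM])
    finally show ?thesis .
   qed
   also have "sqrt eps \<le> sqrt (((\<theta> - 1) / (\<theta> + 1))\<^sup>2)" using small le(4) by (intro real_sqrt_le_mono) linarith
   also have "... = (\<theta> - 1) / (\<theta> + 1)" using \<theta> by simp
   finally have x: "x * (\<theta> + 1) \<le> \<theta> - 1" using \<theta> by (simp add: field_simps)
   have x1: "0 < 1 - x" using ins[of "M - 1"] M by (auto simp: x_def abs_le_iff)
   have "1 / (1 - x) \<le> (1 + \<theta>) / 2" using x x1 by (simp add: field_simps)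
   then have 1: "(2 * b / eps\<^sup>2) * (1 / (1 - x)) \<le> (2 * b / eps\<^sup>2) * ((1 + \<theta>) / 2)" using b by (intro mult_left_mono) auto
   have "eps\<^sup>2 \<le> eps" using eps eb(2) by (simp add: power2_eq_square mult_left_le)
   then have "eps\<^sup>2 \<le> (\<theta> - 1) * b" using small le(5) by linarith
   then have 2: "1 \<le> (2 * b / eps\<^sup>2) * ((\<theta> - 1) / 2)" using eps by (simp add: field_simps)
   have "X * ((1 + \<theta>) / 2) + X * ((\<theta> - 1) / 2) = \<theta> * X" for X by (simp add: field_simps)
   then have "(2 * b / eps\<^sup>2) * ((1 + \<theta>) / 2) + (2 * b / eps\<^sup>2) * ((\<theta> - 1) / 2) = real n" unfolding n .
   moreover have "T (M - 1) = (2 * b / eps\<^sup>2) * (1 / (1 - x)) - \<alpha>" by (simp add: T_def wall_t_def x_def)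
   ultimately show ?thesis using 1 2 \<alpha> by linarith
  qed
  then have "q \<le> n" using q by linarith
  then show ?thesis
   using M eM p1 pq eb rng Yp Yq tl tr eps unfolding wall_cutoff_def by blast
 qed
 then show ?thesis using pos by blast
qed

context gauss_family
begin

text \<open>At distance \<open>M - 2\<close> one has \<open>1 + M <= 2 * (1 + abs y)\<close>, hence
  \<open>1 / eps\<close> is at most a constant times \<open>(1 + abs y) ^ 50\<close>, and
  exponential decay beats every power of it. The power \<open>eps ^ 5\<close> is enough for about
  \<open>1 / eps^2\<close> indices: it leaves \<open>eps ^ 3\<close>.\<close>

lemma exp_decay_cutoff:
 "\<exists>C>0. \<forall>eps M y. 0 < eps \<longrightarrow> 10 \<le> M \<longrightarrow> eps * (1 + M) ^ 50 = 1 / 10 ^ 6 \<longrightarrow> M - 2 \<le> abs y \<longrightarrow>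
  1 \<le> 10 ^ 6 * 2 ^ 50 * (eps * (1 + abs y) ^ 50) \<and> decay y \<le> C * eps ^ 5"
proof -
 obtain C where C: "C > 0" "\<And>y. (1 + abs y) ^ 250 * decay y \<le> C"
  using exp_decay_power[of 250] by blast
 define D :: real where "D = 10 ^ 6 * 2 ^ 50"
 have D: "0 < D" by (simp add: D_def)
 have "1 \<le> D * (eps * (1 + abs y) ^ 50) \<and> decay y \<le> (D ^ 5 * C) * eps ^ 5"
  if eps: "0 < eps" and M: "10 \<le> M" "eps * (1 + M) ^ 50 = 1 / 10 ^ 6" and y: "M - 2 \<le> abs y" for eps M y
 proof -
  define P where "P = (1 + abs y) ^ 50"
  define e where "e = decay y"
  have e: "0 < e" by (simp add: e_def)
  have "(1 + M) ^ 50 \<le> (2 * (1 + abs y)) ^ 50" using M y by (intro power_mono) auto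
  then have "eps * (1 + M) ^ 50 \<le> eps * (2 ^ 50 * P)" unfolding power_mult_distrib P_def using eps by (intro mult_left_mono) auto
  then have "10 ^ 6 * (eps * (1 + M) ^ 50) \<le> 10 ^ 6 * (eps * (2 ^ 50 * P))" by (rule mult_left_mono) simp
  then have 1: "1 \<le> D * (eps * P)" unfolding M(2) D_def by (simp add: mult_ac)
  have "e = 1 * e" by simp
  also have "... \<le> (D * (eps * P)) ^ 5 * e" using 1 e by (intro mult_right_mono one_le_power) auto
  also have "... = D ^ 5 * eps ^ 5 * ((1 + abs y) ^ 250 * e)"
   by (simp only: P_def power_mult_distrib power_mult[symmetric] mult_ac) simp
  also have "... \<le> D ^ 5 * eps ^ 5 * C" using C(2)[of y] D eps unfolding e_def by (intro mult_left_mono) auto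
  finally show ?thesis using 1 unfolding e_def P_def by (simp only: mult_ac)
 qed
 then show ?thesis using C(1) D unfolding D_def by (intro exI[of _ "(10 ^ 6 * 2 ^ 50) ^ 5 * C"]) auto
qed

text \<open>The midpoint sum becomes an integral in \<open>y\<close>, its end terms being negligible
  by \<open>exp_decay_cutoff\<close>. The plateau contributes \<open>Hinf\<close> times the length
  of the index interval from \<open>p - 1/2\<close> to the critical index.\<close>

lemma middle_sum:
 assumes b: "0 < b"
 shows "\<exists>C>0. \<forall>eps \<alpha> w M. \<forall>p q :: nat. w \<in> Om \<longrightarrow> wall_cutoff eps b \<alpha> M p q \<longrightarrow>
  cmod ((\<Sum>j=p..q. Hexp eps w (wall_y eps b \<alpha> (real j)))
   - (Hinf w * of_real (2 * b / eps\<^sup>2 - (real p - 1/2 + \<alpha>))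
    + of_real (2 * b / eps) * (Msum eps w))) \<le> C * eps\<^sup>2"
proof -
 obtain K1 where K1: "K1 > 0" "\<And>eps \<alpha> w A0 A1 A2 (p::nat) (q::nat). 0 < eps \<Longrightarrow> eps \<le> 1 \<Longrightarrow> eps \<le> b \<Longrightarrow> w \<in> Om \<Longrightarrow> p \<le> q \<Longrightarrow>
  (\<forall>t. real p - 1/2 \<le> t \<longrightarrow> t \<le> real q + 1/2 \<longrightarrow> - \<alpha> < t \<and> abs (eps * wall_y eps b \<alpha> t) \<le> 1/8 \<and>
   (A0 has_vector_derivative H0 w (wall_y eps b \<alpha> t)) (at t) \<and>
   (A1 has_vector_derivative H1 w (wall_y eps b \<alpha> t)) (at t) \<and>
   (A2 has_vector_derivative H2 w (wall_y eps b \<alpha> t)) (at t)) \<Longrightarrow>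
  cmod ((\<Sum>j=p..q. Hexp eps w (wall_y eps b \<alpha> (real j)))
   - ((A0 (real q + 1/2) + of_real eps * A1 (real q + 1/2) + (of_real eps)\<^sup>2 * A2 (real q + 1/2))
    - (A0 (real p - 1/2) + of_real eps * A1 (real p - 1/2) + (of_real eps)\<^sup>2 * A2 (real p - 1/2)))
   + (1/24) *\<^sub>R (wall_v eps b (wall_y eps b \<alpha> (real q + 1/2)) *\<^sub>R dH0 w (wall_y eps b \<alpha> (real q + 1/2))
    - wall_v eps b (wall_y eps b \<alpha> (real p - 1/2)) *\<^sub>R dH0 w (wall_y eps b \<alpha> (real p - 1/2))))
  \<le> K1 * eps\<^sup>2"
  using midpoint_sum[OF b] by (elim exE conjE) metis
 have D0: "0 \<le> (10 ^ 6 * 2 ^ 50 :: real)" by simp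
 obtain K2 where K2: "K2 > 0" "\<And>eps Ym Yp w. 0 < eps \<Longrightarrow> eps \<le> 1 \<Longrightarrow> w \<in> Om \<Longrightarrow>
  (\<forall>y. Ym \<le> y \<longrightarrow> y \<le> Yp \<longrightarrow> abs (eps * y) \<le> 1/8) \<Longrightarrow> (\<forall>y. y < Ym \<or> Yp < y \<longrightarrow> 1 \<le> 10 ^ 6 * 2 ^ 50 * (eps * (1 + abs y) ^ 50)) \<Longrightarrow>
  cmod ((LBINT y:{Ym..Yp}. (H0c w y + of_real eps * H1 w y + (of_real eps)\<^sup>2 * H2 w y) * of_real (1 / (1 - eps * y)\<^sup>2))
   - (Msum eps w)) \<le> K2 * eps ^ 3"
  using wall_integral_compare[OF D0] by (elim exE conjE, intro that) (assumption, blast)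
 obtain K3 where K3: "K3 > 0" "\<And>eps M y. 0 < eps \<Longrightarrow> 10 \<le> M \<Longrightarrow> eps * (1 + M) ^ 50 = 1 / 10 ^ 6 \<Longrightarrow> M - 2 \<le> abs y \<Longrightarrow>
  1 \<le> 10 ^ 6 * 2 ^ 50 * (eps * (1 + abs y) ^ 50) \<and> decay y \<le> K3 * eps ^ 5"
  using exp_decay_cutoff by metis
 obtain K4 where K4: "K4 > 0" "\<And>w y. w \<in> Om \<Longrightarrow> cmod (dH0 w y) \<le> K4 * decay y"
  using Ideal_bound[OF Ideal_dH0] by metis
 define F where "F = K4 * K3 / b"
 have F: "F > 0" unfolding F_def using K4(1) K3(1) b by simp
 define C where "C = K1 + 2 * b * K2 + 2 * F"
 have C: "C > 0" unfolding C_def using K1(1) K2(1) F b by (intro add_pos_pos mult_pos_pos) auto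
 have "cmod ((\<Sum>j=p..q. Hexp eps w (wall_y eps b \<alpha> (real j)))
   - (Hinf w * of_real (2 * b / eps\<^sup>2 - (real p - 1/2 + \<alpha>))
    + of_real (2 * b / eps) * (Msum eps w))) \<le> C * eps\<^sup>2"
  if om: "w \<in> Om" and cut: "wall_cutoff eps b \<alpha> M p q" for eps \<alpha> w M and p q :: nat
 proof -
  have eps: "0 < eps" "eps \<le> 1" "eps \<le> b" and pq: "p \<le> q" and M: "10 \<le> M" "eps * (1 + M) ^ 50 = 1 / 10 ^ 6"
   and rng: "\<And>t. real p - 1/2 \<le> t \<Longrightarrow> t \<le> real q + 1/2 \<Longrightarrow> - \<alpha> < t \<and> abs (wall_y eps b \<alpha> t) \<le> M"
   and Ym: "wall_y eps b \<alpha> (real p - 1/2) \<le> - (M - 2)" and Yp: "M - 2 \<le> wall_y eps b \<alpha> (real q + 1/2)"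
   using cut unfolding wall_cutoff_def by blast+
  define tp where "tp = real p - 1/2"
  define tq where "tq = real q + 1/2"
  define Y where "Y = wall_y eps b \<alpha>"
  have rM: "wall_range eps M" using M eps by (simp add: wall_range_def)
  have eM: "eps * (1 + M) \<le> 1/8" using wall_range_le[OF rM, of 1] M by simp
  have ins: "abs (eps * y) \<le> 1/8" if "abs y \<le> M + 1" for y
  proof -
   have "eps * abs y \<le> eps * (1 + M)" using that eps by (intro mult_left_mono) auto
   then have "eps * abs y \<le> 1/8" using eM by linarith
   then show ?thesis using eps by (simp add: abs_mult)
  qed
  have tpq: "tp \<le> tq" "real p - 1/2 \<le> tp" "tp \<le> real q + 1/2" "real p - 1/2 \<le> tq" "tq \<le> real q + 1/2" using pq by (auto simp: tp_def tq_def)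
  have YM: "abs (Y tp) \<le> M" "abs (Y tq) \<le> M" "- \<alpha> < tp" using rng[OF tpq(2,3)] rng[OF tpq(4,5)] by (auto simp: Y_def)
  have Ytp: "Y tp \<le> - (M - 2)" "M - 2 \<le> Y tq" using Ym Yp by (simp_all add: Y_def tp_def tq_def)
  define Lc where "Lc = M + 1"
  define W where "W = (\<lambda>y. complex_of_real (1 / (1 - eps * y)\<^sup>2))"
  define Ai where "Ai = (\<lambda>f t. of_real (2 * b / eps) * integral {-Lc..Y t} (\<lambda>x. f x * W x))"
  have eL: "eps * Lc < 1" using eM by (simp add: Lc_def add.commute)
  have Ader: "(Ai f has_vector_derivative f (Y t)) (at t)" if "continuous_on UNIV f" "real p - 1/2 \<le> t" "t \<le> real q + 1/2" for f t
   unfolding Ai_def Y_def W_def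
   by (rule wall_antiderivative[OF eps(1) b _ that(1) eL]) (use rng[OF that(2,3)] in \<open>auto simp: Lc_def\<close>)
  define A where "A = (\<lambda>t. Ai (H0 w) t + of_real eps * Ai (H1 w) t + (of_real eps)\<^sup>2 * Ai (H2 w) t)"
  define bd where "bd = (1/24) *\<^sub>R (wall_v eps b (Y tq) *\<^sub>R dH0 w (Y tq) - wall_v eps b (Y tp) *\<^sub>R dH0 w (Y tp))"
  define S where "S = (\<Sum>j=p..q. Hexp eps w (wall_y eps b \<alpha> (real j)))"
  have e1: "cmod (S - (A tq - A tp) + bd) \<le> K1 * eps\<^sup>2"
   unfolding S_def A_def bd_def Y_def tq_def tp_def
  proof (rule K1(2)[OF eps om pq], intro allI impI)
   fix t assume t: "real p - 1/2 \<le> t" "t \<le> real q + 1/2"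
   show "- \<alpha> < t \<and> abs (eps * wall_y eps b \<alpha> t) \<le> 1/8 \<and>
   (Ai (H0 w) has_vector_derivative H0 w (wall_y eps b \<alpha> t)) (at t) \<and>
   (Ai (H1 w) has_vector_derivative H1 w (wall_y eps b \<alpha> t)) (at t) \<and>
   (Ai (H2 w) has_vector_derivative H2 w (wall_y eps b \<alpha> t)) (at t)"
    using rng[OF t] ins[of "wall_y eps b \<alpha> t"] Ader[OF H_continuous(1)[OF om] t] Ader[OF H_continuous(2)[OF om] t]
     Ader[OF H_continuous(3)[OF om] t] unfolding Y_def by auto
  qed
  have vb: "cmod (wall_v eps b y *\<^sub>R dH0 w y) \<le> F * eps\<^sup>2" if y: "abs y \<le> M" "M - 2 \<le> abs y" for y
  proof -
   have v: "0 \<le> wall_v eps b y" "wall_v eps b y \<le> eps / b" using wall_v_bounds[OF eps(1) b ins, of y] y eps b by (auto simp: wall_v_def)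
   have "cmod (dH0 w y) \<le> K4 * (K3 * eps ^ 5)" using K4(2)[OF om, of y] K3(2)[OF eps(1) M y(2)] K4(1)
    by (meson mult_left_mono less_imp_le order.trans)
   also have "... \<le> K4 * (K3 * eps ^ 1)" using K4(1) K3(1) eps by (intro mult_left_mono power_decreasing) auto
   finally have d: "cmod (dH0 w y) \<le> K4 * (K3 * eps)" by simp
   have "cmod (wall_v eps b y *\<^sub>R dH0 w y) = wall_v eps b y * cmod (dH0 w y)" using v by simp
   also have "... \<le> eps / b * (K4 * (K3 * eps))" using v d eps b by (intro mult_mono) auto
   finally show ?thesis by (simp add: F_def power2_eq_square mult_ac)
  qed
  have e2: "cmod bd \<le> 2 * F * eps\<^sup>2"
  proof -
   have "cmod bd \<le> 1 * cmod (wall_v eps b (Y tq) *\<^sub>R dH0 w (Y tq) - wall_v eps b (Y tp) *\<^sub>R dH0 w (Y tp))"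
    unfolding bd_def norm_scaleR by (intro mult_right_mono) auto
   also have "... \<le> 1 * (F * eps\<^sup>2 + F * eps\<^sup>2)"
    using vb[of "Y tq"] vb[of "Y tp"] YM Ytp M by (intro mult_left_mono norm_diff_le2) auto
   finally show ?thesis by (simp add: mult.assoc)
  qed
  define J where "J = (\<lambda>f. integral {Y tp..Y tq} (\<lambda>x. f x * W x))"
  have nzW: "1 - eps * x \<noteq> 0" if "x \<in> {-Lc..Y tq}" for x
   using ins[of x] that YM by (auto simp: Lc_def abs_le_iff)
  have fW: "(\<lambda>x. f x * W x) integrable_on {-Lc..Y tq}" if "continuous_on UNIV f" for f :: "real \<Rightarrow> complex"
   unfolding W_def using nzW
   by (intro integrable_continuous_interval continuous_intros continuous_on_subset[OF that]) auto
  have AJ: "Ai f tq - Ai f tp = of_real (2 * b / eps) * J f" if "continuous_on UNIV f" for f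
  proof -
   have "integral {-Lc..Y tp} (\<lambda>x. f x * W x) + J f = integral {-Lc..Y tq} (\<lambda>x. f x * W x)"
    unfolding J_def using Ytp YM M by (intro Henstock_Kurzweil_Integration.integral_combine fW that) (auto simp: Lc_def)
   then have "integral {-Lc..Y tq} (\<lambda>x. f x * W x) - integral {-Lc..Y tp} (\<lambda>x. f x * W x) = J f"
    by (metis add_diff_cancel_left')
   then show ?thesis unfolding Ai_def right_diff_distrib[symmetric] by (rule arg_cong)
  qed
  have Jsum: "J (Hexp eps w) = J (H0 w) + of_real eps * J (H1 w) + (of_real eps)\<^sup>2 * J (H2 w)"
  proof -
   have i: "(\<lambda>x. f x * W x) integrable_on {Y tp..Y tq}" if "continuous_on UNIV f" for f :: "real \<Rightarrow> complex"
    using Ytp YM M by (intro integrable_on_subinterval[OF fW[OF that]]) (auto simp: Lc_def)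
   note i012 = i[OF H_continuous(1)[OF om]] i[OF H_continuous(2)[OF om]] i[OF H_continuous(3)[OF om]]
   have "J (Hexp eps w) = integral {Y tp..Y tq} (\<lambda>x. H0 w x * W x + of_real eps * (H1 w x * W x) + (of_real eps)\<^sup>2 * (H2 w x * W x))"
    unfolding J_def Hexp_def by (intro arg_cong2[where f = integral] refl ext) (simp add: distrib_right mult.assoc)
   also have "... = J (H0 w) + of_real eps * J (H1 w) + (of_real eps)\<^sup>2 * J (H2 w)"
    unfolding J_def using i012 by (intro integral_unique has_integral_add has_integral_mult_right integrable_integral)
   finally show ?thesis .
  qed
  have "A tq - A tp = (Ai (H0 w) tq - Ai (H0 w) tp) + of_real eps * (Ai (H1 w) tq - Ai (H1 w) tp)
    + (of_real eps)\<^sup>2 * (Ai (H2 w) tq - Ai (H2 w) tp)"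
   unfolding A_def by (simp only: right_diff_distrib) simp
  also have "... = of_real (2 * b / eps) * J (Hexp eps w)"
   unfolding AJ[OF H_continuous(1)[OF om]] AJ[OF H_continuous(2)[OF om]] AJ[OF H_continuous(3)[OF om]] Jsum
   by (simp only: distrib_left mult_ac)
  finally have AA: "A tq - A tp = of_real (2 * b / eps) * J (Hexp eps w)" .
  have inY: "abs (eps * y) \<le> 1/8" if "Y tp \<le> y" "y \<le> Y tq" for y
   using YM that by (intro ins) auto
  define I where "I = (LBINT y:{Y tp..Y tq}. (H0c w y + of_real eps * H1 w y + (of_real eps)\<^sup>2 * H2 w y) * of_real (1 / (1 - eps * y)\<^sup>2))"
  have Jsplit: "J (Hexp eps w) = I + Hinf w * of_real (1 / eps - 1 / (eps * (1 - eps * Y tp)))"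
   unfolding J_def W_def I_def using Ytp M by (intro integral_Hexp_split eps om inY) auto
  define Ms where "Ms = Msum eps w"
  have e3: "cmod (I - Ms) \<le> K2 * eps ^ 3"
   unfolding I_def Ms_def
  proof (rule K2(2)[OF eps(1,2) om]; intro allI impI)
   fix y assume "y < Y tp \<or> Y tq < y"
   then have "M - 2 \<le> abs y" using Ytp by auto
   then show "1 \<le> 10 ^ 6 * 2 ^ 50 * (eps * (1 + abs y) ^ 50)" using K3(2)[OF eps(1) M] by blast
  qed (use inY in blast)
  \<comment> \<open>\<open>wall_t\<close> evaluated at the left end point of the window returns the
    index \<open>p - 1/2\<close>.\<close>
  have coef: "2 * b / eps * (1 / eps - 1 / (eps * (1 - eps * Y tp))) = 2 * b / eps\<^sup>2 - (real p - 1/2 + \<alpha>)"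
  proof -
   have "2 * b / (eps\<^sup>2 * (1 - eps * Y tp)) = tp + \<alpha>"
    using wall_t_wall_y[OF eps(1) b YM(3)] unfolding wall_t_def Y_def by linarith
   then show ?thesis by (simp add: right_diff_distrib power2_eq_square tp_def mult.assoc)
  qed
  have e4: "cmod (of_real (2 * b / eps) * (I - Ms)) \<le> 2 * b * K2 * eps\<^sup>2"
  proof -
   have "cmod (of_real (2 * b / eps) * (I - Ms)) = 2 * b / eps * cmod (I - Ms)"
    unfolding norm_mult norm_of_real using eps b by simp
   also have "... \<le> 2 * b / eps * (K2 * eps ^ 3)" using e3 eps b by (intro mult_left_mono) auto
   also have "... = 2 * b * K2 * eps\<^sup>2" using eps by (simp add: power2_eq_square power3_eq_cube)
   finally show ?thesis .
  qed
  have alg: "S' - (h * (c * w2) + c * N) = ((S' - c * (I' + h * w2) + d) + c * (I' - N)) - d" for S' h c w2 N I' d :: complex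
   by (simp add: algebra_simps)
  have "S - (Hinf w * of_real (2 * b / eps\<^sup>2 - (real p - 1/2 + \<alpha>)) + of_real (2 * b / eps) * Ms)
   = ((S - (A tq - A tp) + bd) + of_real (2 * b / eps) * (I - Ms)) - bd"
   unfolding AA Jsplit coef[symmetric] of_real_mult by (rule alg)
  moreover have "cmod (((S - (A tq - A tp) + bd) + of_real (2 * b / eps) * (I - Ms)) - bd)
    \<le> (K1 * eps\<^sup>2 + 2 * b * K2 * eps\<^sup>2) + 2 * F * eps\<^sup>2"
   by (rule norm_diff_le2[OF norm_add_le2[OF e1 e4] e2])
  ultimately show ?thesis unfolding S_def[symmetric] Ms_def[symmetric] C_def distrib_right by (simp only:)
 qed
 then show ?thesis using C by blast
qed

text \<open>For indices beyond the window the exponent lies beyond the one belonging to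
  \<open>y = - (M - 1)\<close> or \<open>y = M - 1\<close>. Monotonicity of the ratios in the
  exponent transfers the exponentially small bounds from these two points.\<close>

lemma tail_sums:
 assumes b: "0 < b" and \<alpha>: "-1 < \<alpha>" and m: "0 < m" and ne: "Om \<noteq> {}"
 shows "\<exists>C>0. \<exists>eps0>0. \<forall>eps w M. \<forall>p q n :: nat. eps < eps0 \<longrightarrow> w \<in> Om \<longrightarrow> wall_cutoff eps b \<alpha> M p q \<longrightarrow>
  cmod ((\<Sum>j=1..<p. Ln (gwall eps w ((real j + \<alpha>) / b))) - Hinf w * of_real (real p - 1)) \<le> C * eps ^ 5 * real p \<and>
  cmod (\<Sum>j=q+1..n. Ln (gwall eps w ((real j + \<alpha>) / b))) \<le> C * eps ^ 5 * real n"
proof -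
 have m1: "1 \<in> {1..m}" "m \<in> {1..m}" using m by auto
 obtain A epsA where A: "A > 0" "epsA > 0" "\<And>eps y. eps < epsA \<Longrightarrow> wall_range eps y \<Longrightarrow> y \<le> 0 \<Longrightarrow>
  1 - wall_ratio eps (wall_exponent eps y) (s 1) \<le> A * decay y"
  using wall_ratio_tail[OF m1(1) ne] by metis
 obtain E epsE where E: "E > 0" "epsE > 0" "\<And>eps y. eps < epsE \<Longrightarrow> wall_range eps y \<Longrightarrow> 0 \<le> y \<Longrightarrow>
  wall_ratio eps (wall_exponent eps y) (s m) \<le> E * decay y"
  using wall_ratio_tail[OF m1(2) ne] by metis
 obtain K3 where K3: "K3 > 0" "\<And>eps M y. 0 < eps \<Longrightarrow> 10 \<le> M \<Longrightarrow> eps * (1 + M) ^ 50 = 1 / 10 ^ 6 \<Longrightarrow> M - 2 \<le> abs y \<Longrightarrow>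
  decay y \<le> K3 * eps ^ 5"
  using exp_decay_cutoff by metis
 define F where "F = B * m / c0"
 have F: "0 \<le> F" using B_nonneg c0_pos by (simp add: F_def)
 define G where "G = F * ((A + E) * K3) + 1"
 have G: "G > 0" using F A(1) E(1) K3(1) by (auto simp: G_def intro!: add_nonneg_pos)
 have "cmod ((\<Sum>j=1..<p. Ln (gwall eps w ((real j + \<alpha>) / b))) - Hinf w * of_real (real p - 1)) \<le> G * eps ^ 5 * real p \<and>
  cmod (\<Sum>j=q+1..n. Ln (gwall eps w ((real j + \<alpha>) / b))) \<le> G * eps ^ 5 * real n"
  if small: "eps < min epsA epsE" and om: "w \<in> Om" and cut: "wall_cutoff eps b \<alpha> M p q" for eps w M and p q n :: nat
 proof -
  have eps: "0 < eps" and p: "1 \<le> p" and M: "10 \<le> M" "eps * (1 + M) ^ 50 = 1 / 10 ^ 6"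
   and tl: "\<And>t. t \<le> real p - 1 \<Longrightarrow> (t + \<alpha>) / b \<le> wall_exponent eps (- (M - 1))"
   and tr: "\<And>t. real q + 1 \<le> t \<Longrightarrow> wall_exponent eps (M - 1) \<le> (t + \<alpha>) / b"
   using cut unfolding wall_cutoff_def by blast+
  have ran: "wall_range eps y" if "abs y = M - 1" for y
  proof -
   have "eps * (1 + abs y) ^ 50 \<le> eps * (1 + M) ^ 50" unfolding that using eps M(1) by (intro mult_left_mono power_mono) auto
   then show ?thesis using M(2) eps by (simp add: wall_range_def)
  qed
  have r: "wall_range eps (- (M - 1))" "wall_range eps (M - 1)" using ran M(1) by auto
  have dec: "exp (- (\<sigma> * abs (- (M - 1)))) \<le> K3 * eps ^ 5" "exp (- (\<sigma> * abs (M - 1))) \<le> K3 * eps ^ 5"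
   using K3(2)[OF eps M, of "- (M - 1)"] K3(2)[OF eps M, of "M - 1"] M by auto
  have we: "0 < wall_exponent eps (M - 1)"
  proof -
   have "eps * (1 + abs (M - 1)) ^ 1 \<le> 1/2" using wall_range_le[OF r(2), of 1] by simp
   then have "eps * M \<le> 1/2" using M(1) by simp
   then have "eps * (M - 1) < 1" using eps by (simp add: right_diff_distrib)
   then show ?thesis using eps by (simp add: wall_exponent_def)
  qed
  have aj: "0 < (real j + \<alpha>) / b" if "1 \<le> j" for j using that \<alpha> b by auto
  have 1: "cmod (Ln (gwall eps w ((real j + \<alpha>) / b)) - Hinf w) \<le> G * eps ^ 5" if j: "j \<in> {1..<p}" for j
  proof -
   have "wall_mass eps (wall_exponent eps (- (M - 1))) (s 1) / wall_mass eps (wall_exponent eps (- (M - 1))) 0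
    \<le> wall_ratio eps ((real j + \<alpha>) / b) (s 1)"
    using j by (intro wall_ratio_antimono eps aj tl less_imp_le[OF s_pos[OF m1(1)]]) auto
   moreover have "1 - wall_mass eps (wall_exponent eps (- (M - 1))) (s 1) / wall_mass eps (wall_exponent eps (- (M - 1))) 0 \<le> A * exp (- (\<sigma> * abs (- (M - 1))))"
    by (rule A(3)) (use small r M in auto)
   moreover have "A * exp (- (\<sigma> * abs (- (M - 1)))) \<le> A * (K3 * eps ^ 5)" using dec A(1) by (intro mult_left_mono) auto
   ultimately have "1 - wall_ratio eps ((real j + \<alpha>) / b) (s 1) \<le> A * (K3 * eps ^ 5)" by linarith
   also have "... \<le> (A + E) * K3 * eps ^ 5" using E(1) K3(1) eps by (simp add: algebra_simps)
   finally have "F * (1 - wall_ratio eps ((real j + \<alpha>) / b) (s 1)) \<le> F * ((A + E) * K3 * eps ^ 5)"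
    using F by (rule mult_left_mono)
   also have "... \<le> G * eps ^ 5" using eps by (simp add: G_def distrib_right mult.assoc)
   finally show ?thesis using Ln_gwall_tails(1)[OF m om eps aj[of j]] j unfolding F_def by auto
  qed
  have 2: "cmod (Ln (gwall eps w ((real j + \<alpha>) / b))) \<le> G * eps ^ 5" if j: "j \<in> {q+1..n}" for j
  proof -
   have "wall_mass eps ((real j + \<alpha>) / b) (s m) / wall_mass eps ((real j + \<alpha>) / b) 0
    \<le> wall_ratio eps (wall_exponent eps (M - 1)) (s m)"
    using j by (intro wall_ratio_antimono eps we tr less_imp_le[OF s_pos[OF m1(2)]]) auto
   moreover have "wall_ratio eps (wall_exponent eps (M - 1)) (s m) \<le> E * exp (- (\<sigma> * abs (M - 1)))"
    by (rule E(3)) (use small r M in auto)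
   moreover have "E * exp (- (\<sigma> * abs (M - 1))) \<le> E * (K3 * eps ^ 5)" using dec E(1) by (intro mult_left_mono) auto
   ultimately have "wall_ratio eps ((real j + \<alpha>) / b) (s m) \<le> E * (K3 * eps ^ 5)" by linarith
   also have "... \<le> (A + E) * K3 * eps ^ 5" using A(1) K3(1) eps by (simp add: algebra_simps)
   finally have "F * (wall_ratio eps ((real j + \<alpha>) / b) (s m)) \<le> F * ((A + E) * K3 * eps ^ 5)"
    using F by (rule mult_left_mono)
   also have "... \<le> G * eps ^ 5" using eps by (simp add: G_def distrib_right mult.assoc)
   finally show ?thesis using Ln_gwall_tails(2)[OF m om eps aj[of j]] j unfolding F_def by auto
  qed
  have "(\<Sum>j=1..<p. Ln (gwall eps w ((real j + \<alpha>) / b))) - Hinf w * of_real (real p - 1)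
    = (\<Sum>j=1..<p. Ln (gwall eps w ((real j + \<alpha>) / b)) - Hinf w)"
   using p by (simp add: sum_subtractf of_nat_diff mult.commute)
  moreover have "cmod (\<Sum>j=1..<p. Ln (gwall eps w ((real j + \<alpha>) / b)) - Hinf w) \<le> (\<Sum>j=1..<p. G * eps ^ 5)"
   using 1 by (rule sum_norm_le)
  moreover have "(\<Sum>j=1..<p. G * eps ^ 5) \<le> G * eps ^ 5 * real p"
   using G eps by (auto simp: mult.commute intro!: mult_right_mono)
  moreover have "cmod (\<Sum>j=q+1..n. Ln (gwall eps w ((real j + \<alpha>) / b))) \<le> (\<Sum>j=q+1..n. G * eps ^ 5)"
   using 2 by (rule sum_norm_le)
  moreover have "(\<Sum>j=q+1..n. G * eps ^ 5) \<le> G * eps ^ 5 * real n"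
   using G eps by (auto simp: mult.commute intro!: mult_right_mono)
  ultimately show ?thesis by (simp only:) auto
 qed
 moreover have "0 < min epsA epsE" using A(2) E(2) by simp
 ultimately show ?thesis using G by blast
qed

lemma middle_Ln_sum:
 assumes b: "0 < b"
 shows "\<exists>C>0. \<exists>eps0>0. \<forall>eps \<alpha> w M. \<forall>p q :: nat. eps < eps0 \<longrightarrow> w \<in> Om \<longrightarrow> wall_cutoff eps b \<alpha> M p q \<longrightarrow>
  cmod ((\<Sum>j=p..q. Ln (gwall eps w ((real j + \<alpha>) / b))) - (\<Sum>j=p..q. Hexp eps w (wall_y eps b \<alpha> (real j)))) \<le> C * eps\<^sup>2"
proof -
 obtain A eps0 where A: "A > 0" "eps0 > 0" "\<And>eps y w. eps < eps0 \<Longrightarrow> wall_range eps y \<Longrightarrow> w \<in> Om \<Longrightarrow>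
  cmod (Ln (gwall eps w (wall_exponent eps y)) - (H0 w y + eps * H1 w y + eps\<^sup>2 * H2 w y)) \<le> A * (eps ^ 3 * decay y)"
  using Ln_gwall_expansion by blast
 obtain D where D: "D > 0" "\<And>y. (1 + abs y) ^ 2 * decay y \<le> D"
  using exp_decay_power[of 2] by blast
 define C where "C = A * D * (12 * b * pi)"
 have C: "C > 0" using A D b by (simp add: C_def)
 have "cmod ((\<Sum>j=p..q. Ln (gwall eps w ((real j + \<alpha>) / b))) - (\<Sum>j=p..q. Hexp eps w (wall_y eps b \<alpha> (real j)))) \<le> C * eps\<^sup>2"
  if small: "eps < eps0" and om: "w \<in> Om" and cut: "wall_cutoff eps b \<alpha> M p q" for eps \<alpha> w M and p q :: nat
 proof -
  have eps: "0 < eps" "eps < eps0" "eps \<le> 1" "eps \<le> b" and pq: "p \<le> q" and M: "10 \<le> M" "eps * (1 + M) ^ 50 = 1 / 10 ^ 6"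
   and rng: "\<And>t. real p - 1/2 \<le> t \<Longrightarrow> t \<le> real q + 1/2 \<Longrightarrow> - \<alpha> < t \<and> abs (wall_y eps b \<alpha> t) \<le> M"
   using cut small unfolding wall_cutoff_def by blast+
  have ran: "wall_range eps y" if "abs y \<le> M" for y
  proof -
   have "eps * (1 + abs y) ^ 50 \<le> eps * (1 + M) ^ 50" using that eps by (intro mult_left_mono power_mono) auto
   then show ?thesis using M(2) eps by (simp add: wall_range_def)
  qed
  have dom: "- \<alpha> < t \<and> abs (eps * wall_y eps b \<alpha> t) \<le> 1/8" if "real p - 1/2 \<le> t" "t \<le> real q + 1/2" for t
  proof -
   have "eps * (1 + abs (wall_y eps b \<alpha> t)) ^ 1 \<le> 1 / 10 ^ 6" using rng[OF that] by (intro wall_range_le ran) auto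
   then have "eps * abs (wall_y eps b \<alpha> t) \<le> 1/8" using eps by (simp add: distrib_left)
   then show ?thesis using rng[OF that] eps by (simp add: abs_mult)
  qed
  have "cmod (Ln (gwall eps w ((real j + \<alpha>) / b)) - Hexp eps w (wall_y eps b \<alpha> (real j)))
    \<le> A * D * eps\<^sup>2 * (eps * (1 / (1 + (wall_y eps b \<alpha> (real j))\<^sup>2)))" if j: "j \<in> {p..q}" for j
  proof -
   define y where "y = wall_y eps b \<alpha> (real j)"
   have jr: "- \<alpha> < real j" "abs y \<le> M" using rng[of "real j"] j by (auto simp: y_def)
   have ex: "(real j + \<alpha>) / b = wall_exponent eps y" unfolding y_def by (rule wall_exponent_wall_y[symmetric, OF eps(1) b jr(1)])
   have "decay y \<le> D * (1 / (1 + y\<^sup>2))"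
   proof -
    have "(1 + y\<^sup>2) * decay y \<le> (1 + abs y)\<^sup>2 * decay y"
     by (intro mult_right_mono) (auto simp: power2_sum)
    also have "... \<le> D" by (rule D(2))
    finally have *: "(1 + y\<^sup>2) * decay y \<le> D" .
    have "0 < 1 + y\<^sup>2" by (simp add: add_pos_nonneg)
    then show ?thesis using * by (simp add: field_simps)
   qed
   then have "A * (eps ^ 3 * decay y) \<le> A * (eps ^ 3 * (D * (1 / (1 + y\<^sup>2))))" using A(1) eps by (intro mult_left_mono) auto
   also have "... = A * D * eps\<^sup>2 * (eps * (1 / (1 + y\<^sup>2)))" by (simp only: power3_eq_cube power2_eq_square mult_ac)
   finally show ?thesis using A(3)[OF eps(2) ran[OF jr(2)] om]
    unfolding ex y_def[symmetric] Hexp_def of_real_power by (rule order.trans[rotated])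
  qed
  then have "cmod (\<Sum>j=p..q. Ln (gwall eps w ((real j + \<alpha>) / b)) - Hexp eps w (wall_y eps b \<alpha> (real j)))
   \<le> (\<Sum>j=p..q. A * D * eps\<^sup>2 * (eps * (1 / (1 + (wall_y eps b \<alpha> (real j))\<^sup>2))))" by (rule sum_norm_le)
  also have "... = A * D * eps\<^sup>2 * (\<Sum>j=p..q. eps * (1 / (1 + (wall_y eps b \<alpha> (real j))\<^sup>2)))" by (rule sum_distrib_left[symmetric])
  also have "... \<le> A * D * eps\<^sup>2 * (12 * b * pi)"
   using sum_wall_delta_le[OF eps(1,3,4) pq dom] A(1) D(1) by (intro mult_left_mono) auto
  also have "... = C * eps\<^sup>2" by (simp add: C_def)
  finally show ?thesis unfolding sum_subtractf .
 qed
 then show ?thesis using C A(2) by blast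
qed

text \<open>The choice of the window drops out: the \<open>p - 1\<close> plateau factors on the left
  and the plateau part of the middle sum add up to
  \<open>2 * b / eps^2 - \<alpha> - 1/2\<close>.\<close>

lemma sum_Ln_gwall:
 assumes b: "0 < b" and \<theta>: "1 < \<theta>" and \<alpha>: "-1 < \<alpha>" and m: "0 < m" and ne: "Om \<noteq> {}"
 shows "\<exists>C>0. \<exists>eps0>0. \<forall>eps w. \<forall>n::nat. 0 < eps \<longrightarrow> eps < eps0 \<longrightarrow> w \<in> Om \<longrightarrow> real n = \<theta> * (2 * b / eps\<^sup>2) \<longrightarrow>
  cmod ((\<Sum>j=1..n. Ln (gwall eps w ((real j + \<alpha>) / b)))
   - (Hinf w * of_real (2 * b / eps\<^sup>2 - \<alpha> - 1/2)
    + of_real (2 * b / eps) * (Msum eps w))) \<le> C * eps\<^sup>2"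
proof -
 obtain eps1 where eps1: "eps1 > 0" "\<forall>eps. \<forall>n::nat. 0 < eps \<longrightarrow> eps < eps1 \<longrightarrow> real n = \<theta> * (2 * b / eps\<^sup>2) \<longrightarrow>
  (\<exists>M. \<exists>p q :: nat. q \<le> n \<and> wall_cutoff eps b \<alpha> M p q)"
  using wall_cutoff_exists[OF b \<theta> \<alpha>] by (elim exE conjE) (rule that; assumption)
 from tail_sums[OF b \<alpha> m ne]
 obtain T epsT where T: "T > 0" "epsT > 0" "\<forall>eps w M. \<forall>p q n :: nat. eps < epsT \<longrightarrow> w \<in> Om \<longrightarrow> wall_cutoff eps b \<alpha> M p q \<longrightarrow>
  cmod ((\<Sum>j=1..<p. Ln (gwall eps w ((real j + \<alpha>) / b))) - Hinf w * of_real (real p - 1)) \<le> T * eps ^ 5 * real p \<and>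
  cmod (\<Sum>j=q+1..n. Ln (gwall eps w ((real j + \<alpha>) / b))) \<le> T * eps ^ 5 * real n"
  by (elim exE conjE) (rule that; assumption)
 from middle_Ln_sum[OF b]
 obtain P epsP where P: "P > 0" "epsP > 0" "\<forall>eps \<alpha> w M. \<forall>p q :: nat. eps < epsP \<longrightarrow> w \<in> Om \<longrightarrow> wall_cutoff eps b \<alpha> M p q \<longrightarrow>
  cmod ((\<Sum>j=p..q. Ln (gwall eps w ((real j + \<alpha>) / b))) - (\<Sum>j=p..q. Hexp eps w (wall_y eps b \<alpha> (real j)))) \<le> P * eps\<^sup>2"
  by (elim exE conjE) (rule that; assumption)
 from middle_sum[OF b]
 obtain Q where Q: "Q > 0" "\<forall>eps \<alpha> w M. \<forall>p q :: nat. w \<in> Om \<longrightarrow> wall_cutoff eps b \<alpha> M p q \<longrightarrow>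
  cmod ((\<Sum>j=p..q. Hexp eps w (wall_y eps b \<alpha> (real j)))
   - (Hinf w * of_real (2 * b / eps\<^sup>2 - (real p - 1/2 + \<alpha>))
    + of_real (2 * b / eps) * (Msum eps w))) \<le> Q * eps\<^sup>2"
  by (elim exE conjE) (rule that; assumption)
 define V where "V = 2 * (T * (\<theta> * (2 * b)))"
 have V: "V > 0" using T(1) \<theta> b by (simp add: V_def)
 have "cmod ((\<Sum>j=1..n. Ln (gwall eps w ((real j + \<alpha>) / b)))
   - (Hinf w * of_real (2 * b / eps\<^sup>2 - \<alpha> - 1/2)
    + of_real (2 * b / eps) * (Msum eps w))) \<le> (V + P + Q) * eps\<^sup>2"
  if eps: "0 < eps" and small: "eps < min eps1 (min epsT epsP)" and om: "w \<in> Om" and n: "real n = \<theta> * (2 * b / eps\<^sup>2)" for eps w and n :: nat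
 proof -
  have sm: "eps < eps1" "eps < epsT" "eps < epsP" using small by auto
  obtain M and p q :: nat where qn: "q \<le> n" and cut: "wall_cutoff eps b \<alpha> M p q"
   using eps1(2)[THEN spec[of _ eps], THEN spec[of _ n], THEN mp, THEN mp, THEN mp, OF eps sm(1) n] by (elim exE conjE) (rule that)
  have p1: "1 \<le> p" and pq: "p \<le> q" and eb: "eps \<le> b" "eps \<le> 1" using cut unfolding wall_cutoff_def by blast+
  define L where "L = (\<lambda>j. Ln (gwall eps w ((real j + \<alpha>) / b)))"
  define Z where "Z = of_real (2 * b / eps) * (Msum eps w)"
  define X where "X = (\<Sum>j=p..q. Hexp eps w (wall_y eps b \<alpha> (real j)))"
  have "sum L {1..n} = sum L {1..<p} + sum L {p..q} + sum L {q+1..n}"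
  proof -
   have "{1..n} = {1..<p} \<union> {p..q} \<union> {q+1..n}" using p1 pq qn by auto
   then have "sum L {1..n} = sum L ({1..<p} \<union> {p..q} \<union> {q+1..n})" by simp
   also have "... = sum L ({1..<p} \<union> {p..q}) + sum L {q+1..n}" using pq by (intro sum.union_disjoint) auto
   also have "sum L ({1..<p} \<union> {p..q}) = sum L {1..<p} + sum L {p..q}" by (intro sum.union_disjoint) auto
   finally show ?thesis .
  qed
  then have eq: "sum L {1..n} - (Hinf w * of_real (2 * b / eps\<^sup>2 - \<alpha> - 1/2) + Z)
   = (sum L {1..<p} - Hinf w * of_real (real p - 1)) + sum L {q+1..n} + (sum L {p..q} - X)
    + (X - (Hinf w * of_real (2 * b / eps\<^sup>2 - (real p - 1/2 + \<alpha>)) + Z))"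
  proof -
   have "2 * b / eps\<^sup>2 - \<alpha> - 1/2 = (real p - 1) + (2 * b / eps\<^sup>2 - (real p - 1/2 + \<alpha>))" by simp
   then have "Hinf w * of_real (2 * b / eps\<^sup>2 - \<alpha> - 1/2) = Hinf w * of_real (real p - 1) + Hinf w * of_real (2 * b / eps\<^sup>2 - (real p - 1/2 + \<alpha>))"
    by (simp only: of_real_add distrib_left)
   then show ?thesis using \<open>sum L {1..n} = _\<close> by (simp only: algebra_simps)
  qed
  have nle: "T * eps ^ 5 * real n \<le> T * (\<theta> * (2 * b)) * eps\<^sup>2"
  proof -
   have "T * eps ^ 5 * real n = T * (\<theta> * (2 * b)) * eps ^ 3"
    unfolding n using eps by (simp add: field_simps power2_eq_square power3_eq_cube power_numeral_reduce)
   also have "... \<le> T * (\<theta> * (2 * b)) * eps\<^sup>2"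
    using eps eb T(1) \<theta> b by (intro mult_left_mono power_decreasing) auto
   finally show ?thesis .
  qed
  have "T * eps ^ 5 * real p \<le> T * eps ^ 5 * real n" using pq qn T(1) eps by (intro mult_left_mono) auto
  then have e12: "cmod (sum L {1..<p} - Hinf w * of_real (real p - 1)) \<le> T * (\<theta> * (2 * b)) * eps\<^sup>2" "cmod (sum L {q+1..n}) \<le> T * (\<theta> * (2 * b)) * eps\<^sup>2"
   using T(3)[rule_format, OF sm(2) om cut, of n] nle unfolding L_def by linarith+
  have e3: "cmod (sum L {p..q} - X) \<le> P * eps\<^sup>2"
   unfolding L_def X_def by (rule P(3)[rule_format, OF sm(3) om cut])
  have e4: "cmod (X - (Hinf w * of_real (2 * b / eps\<^sup>2 - (real p - 1/2 + \<alpha>)) + Z)) \<le> Q * eps\<^sup>2"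
   unfolding X_def Z_def by (rule Q(2)[rule_format, OF om cut])
  have "cmod (sum L {1..n} - (Hinf w * of_real (2 * b / eps\<^sup>2 - \<alpha> - 1/2) + Z))
   \<le> ((T * (\<theta> * (2 * b)) * eps\<^sup>2 + T * (\<theta> * (2 * b)) * eps\<^sup>2) + P * eps\<^sup>2) + Q * eps\<^sup>2"
   unfolding eq by (rule norm_add_le2[OF norm_add_le2[OF norm_add_le2[OF e12] e3] e4])
  also have "... = (V + P + Q) * eps\<^sup>2" by (simp add: V_def algebra_simps)
  finally show ?thesis unfolding L_def Z_def .
 qed
 moreover have "0 < min eps1 (min epsT epsP)" using eps1(1) T(2) P(2) by simp
 moreover have "V + P + Q > 0" using V P(1) Q(1) by simp
 ultimately show ?thesis by blast
qed

end

section \<open>Identification of the coefficients\<close>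

text \<open>Summation by parts. For tail exponentials the boundary value \<open>E (Suc m)\<close> is
  \<open>1\<close>, which produces the summand \<open>1 - R m\<close> in
  \<open>one_plus_sum_omega\<close>.\<close>

lemma abel_omega_sum:
 fixes E :: "nat \<Rightarrow> 'a::comm_ring_1"
 shows "(\<Sum>l\<in>{1..m}. (E l - E (Suc l)) * R l) = (\<Sum>l\<in>{1..m}. E l * (R l - (if l = 1 then 0 else R (l - 1)))) - (if m = 0 then 0 else E (Suc m) * R m)"
proof (induction m)
 case (Suc m)
 then show ?case by (cases "m = 0") (simp_all add: algebra_simps)
qed simp

lemma telescope_steps:
 fixes R :: "nat \<Rightarrow> 'a::ab_group_add"
 shows "(\<Sum>l\<in>{1..m}. R l - (if l = 1 then 0 else R (l - 1))) = (if m = 0 then 0 else R m)"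
proof (induction m)
 case (Suc m)
 then show ?case by (cases "m = 0") simp_all
qed simp

definition tail_exp :: "nat \<Rightarrow> (nat \<Rightarrow> complex) \<Rightarrow> nat \<Rightarrow> complex" where
 "tail_exp m u l = exp (\<Sum>j\<in>{l..m}. u j)"

lemma omega_tail_exp: "omega m u l = tail_exp m u l - tail_exp m u (Suc l)"
 by (simp add: omega_def tail_exp_def)

text \<open>For increasing \<open>R\<close> with values in \<open>[0, 1]\<close> this displays a
  factor as a convex combination of \<open>1\<close> and the tail exponentials.\<close>

lemma one_plus_sum_omega:
 assumes "0 < m"
 shows "1 + (\<Sum>l\<in>{1..m}. omega m u l * R l)
  = 1 - R m + (\<Sum>l\<in>{1..m}. tail_exp m u l * (R l - (if l = 1 then 0 else R (l - 1))))"
 unfolding omega_tail_exp abel_omega_sum using assms by (simp add: tail_exp_def)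

lemma one_plus_sum_omega_eq_exp: "1 + (\<Sum>l\<in>{1..m}. omega m u l) = exp (Usum m u)"
proof (cases "m = 0")
 case False
 have "(\<Sum>l\<in>{1..m}. omega m u l) = - (\<Sum>l\<in>{1..m}. tail_exp m u (Suc l) - tail_exp m u l)"
  by (simp add: omega_tail_exp sum_negf[symmetric])
 also have "... = - (tail_exp m u (Suc m) - tail_exp m u 1)"
  using False by (subst sum_Suc_diff) auto
 finally show ?thesis by (simp add: tail_exp_def Usum_def)
qed (simp add: Usum_def)

definition polydisc :: "nat \<Rightarrow> (nat \<Rightarrow> real) \<Rightarrow> real \<Rightarrow> (nat \<Rightarrow> complex) set" where
 "polydisc m x \<delta> = {u. \<forall>j\<in>{1..m}. u j \<in> ball (complex_of_real (x j)) \<delta>}"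

text \<open>The centre is real and at most \<open>m\<close> coordinates are added, each off by less
  than \<open>1 / m\<close>; this dictates the radius.\<close>

lemma polydisc_tail_sum:
 assumes m: "0 < m" and u: "u \<in> polydisc m x (1 / real m)" and l: "1 \<le> l"
 shows "abs (Im (\<Sum>j\<in>{l..m}. u j)) \<le> 1" "abs (Re (\<Sum>j\<in>{l..m}. u j)) \<le> (\<Sum>j\<in>{1..m}. \<bar>x j\<bar>) + 1"
proof -
 have d: "cmod (u j - of_real (x j)) \<le> 1 / m" if "j \<in> {1..m}" for j
  using u that by (auto simp: polydisc_def dist_norm norm_minus_commute less_imp_le)
 have "cmod (\<Sum>j\<in>{l..m}. u j - of_real (x j)) \<le> (\<Sum>j\<in>{l..m}. 1 / real m)"
  using d l by (intro sum_norm_le) auto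
 also have "... \<le> (\<Sum>j\<in>{1..m}. 1 / real m)" using l by (intro sum_mono2) auto
 also have "... = 1" using m by simp
 finally have D: "cmod ((\<Sum>j\<in>{l..m}. u j) - of_real (\<Sum>j\<in>{l..m}. x j)) \<le> 1" by (simp add: sum_subtractf)
 show "abs (Im (\<Sum>j\<in>{l..m}. u j)) \<le> 1"
  using abs_Im_le_cmod[of "(\<Sum>j\<in>{l..m}. u j) - of_real (\<Sum>j\<in>{l..m}. x j)"] D by simp
 have "abs (Re (\<Sum>j\<in>{l..m}. u j) - (\<Sum>j\<in>{l..m}. x j)) \<le> 1"
  using abs_Re_le_cmod[of "(\<Sum>j\<in>{l..m}. u j) - of_real (\<Sum>j\<in>{l..m}. x j)"] D by simp
 moreover have "abs (\<Sum>j\<in>{l..m}. x j) \<le> (\<Sum>j\<in>{l..m}. \<bar>x j\<bar>)" by (rule sum_abs)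
 moreover have "(\<Sum>j\<in>{l..m}. \<bar>x j\<bar>) \<le> (\<Sum>j\<in>{1..m}. \<bar>x j\<bar>)" using l by (intro sum_mono2) auto
 ultimately show "abs (Re (\<Sum>j\<in>{l..m}. u j)) \<le> (\<Sum>j\<in>{1..m}. \<bar>x j\<bar>) + 1" by linarith
qed

definition tail_bound :: "nat \<Rightarrow> (nat \<Rightarrow> real) \<Rightarrow> real" where
 "tail_bound m x = exp ((\<Sum>j\<in>{1..m}. \<bar>x j\<bar>) + 1)"

lemma cos_one_pos: "0 < cos (1::real)"
 by (rule cos_gt_zero) (use pi_gt3 in auto)

lemma polydisc_tail_exp:
 assumes "0 < m" "u \<in> polydisc m x (1 / real m)" "1 \<le> l"
 shows "cmod (tail_exp m u l) \<le> tail_bound m x" "cos 1 / tail_bound m x \<le> Re (tail_exp m u l)"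
proof -
 define S where "S = (\<Sum>j\<in>{l..m}. u j)"
 have S: "abs (Im S) \<le> 1" "abs (Re S) \<le> (\<Sum>j\<in>{1..m}. \<bar>x j\<bar>) + 1" using polydisc_tail_sum[OF assms] by (simp_all add: S_def)
 show "cmod (tail_exp m u l) \<le> tail_bound m x"
  using S(2) by (simp add: tail_exp_def S_def[symmetric] tail_bound_def)
 have "cos 1 \<le> cos \<bar>Im S\<bar>" using S(1) pi_gt3 by (intro cos_monotone_0_pi_le) auto
 moreover have "1 / tail_bound m x \<le> exp (Re S)" using S(2) by (simp add: tail_bound_def exp_minus[symmetric] divide_inverse)
 ultimately have "(1 / tail_bound m x) * cos 1 \<le> exp (Re S) * cos (Im S)"
  using cos_one_pos by (intro mult_mono) (auto simp: tail_bound_def)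
 then show "cos 1 / tail_bound m x \<le> Re (tail_exp m u l)"
  by (simp add: tail_exp_def S_def[symmetric] Re_exp)
qed

lemma Usum_eq_Ln:
 assumes "0 < m" "u \<in> polydisc m x (1 / real m)"
 shows "Ln (1 + (\<Sum>l\<in>{1..m}. omega m u l)) = Usum m u"
 unfolding one_plus_sum_omega_eq_exp
 using polydisc_tail_sum(1)[OF assms, of 1] pi_gt3 by (intro Ln_exp) (auto simp: Usum_def abs_le_iff)

text \<open>A convex combination of numbers with real part at least \<open>c\<close> has real part
  at least \<open>c\<close>. Here \<open>c\<close> is \<open>cos 1 / tail_bound m x\<close>, which
  is positive because the arguments are at most \<open>1 < pi / 2\<close>, and the combination is
  that of \<open>one_plus_sum_omega\<close>. The bound \<open>2 * tail_bound m x\<close> holds as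
  \<open>omega\<close> is a difference of two tail exponentials.\<close>

lemma gauss_family_polydisc:
 assumes m: "0 < m" and decr: "\<And>i j. 1 \<le> i \<Longrightarrow> i < j \<Longrightarrow> j \<le> m \<Longrightarrow> s j < s i" and sm: "0 < s m"
 shows "gauss_family m s (s m) (2 * tail_bound m x) (cos 1 / tail_bound m x) (omega m ` polydisc m x (1 / real m))"
proof
 have tb: "1 \<le> tail_bound m x" unfolding tail_bound_def by (simp add: sum_nonneg add_nonneg_nonneg)
 show "0 < s m" by (rule sm)
 show "s m \<le> s l" if "l \<in> {1..m}" for l using decr[of l m] that by (cases "l = m") auto
 show "s j < s i" if "1 \<le> i" "i < j" "j \<le> m" for i j by (rule decr[OF that])
 show "0 \<le> 2 * tail_bound m x" using tb by simp
 show "0 < cos 1 / tail_bound m x" using tb cos_one_pos by simp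
 show "cmod (w l) \<le> 2 * tail_bound m x" if w: "w \<in> omega m ` polydisc m x (1 / real m)" and l: "l \<in> {1..m}" for w l
 proof -
  obtain u where u: "u \<in> polydisc m x (1 / real m)" "w = omega m u" using w by blast
  show ?thesis unfolding u(2) omega_tail_exp
   using norm_triangle_ineq4[of "tail_exp m u l" "tail_exp m u (Suc l)"] polydisc_tail_exp(1)[OF m u(1), of l] polydisc_tail_exp(1)[OF m u(1), of "Suc l"] l by auto
 qed
 show "cos 1 / tail_bound m x \<le> Re (1 + (\<Sum>l\<in>{1..m}. w l * complex_of_real (R l)))"
  if w: "w \<in> omega m ` polydisc m x (1 / real m)" and R: "\<And>l. l \<in> {1..m} \<Longrightarrow> 0 \<le> R l \<and> R l \<le> 1"
   and mono: "\<And>i j. 1 \<le> i \<Longrightarrow> i \<le> j \<Longrightarrow> j \<le> m \<Longrightarrow> R i \<le> R j" for w R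
 proof -
  obtain u where u: "u \<in> polydisc m x (1 / real m)" "w = omega m u" using w by blast
  define c where "c = cos 1 / tail_bound m x"
  have c1: "c \<le> 1" using tb order.trans[OF cos_le_one[of 1] tb] by (simp add: c_def divide_le_eq)
  define dR where "dR = (\<lambda>l. R l - (if l = 1 then 0 else R (l - 1)))"
  have dR: "0 \<le> dR l" if "l \<in> {1..m}" for l using R[OF that] mono[of "l - 1" l] that by (auto simp: dR_def)
  have cdR: "complex_of_real (R l) - (if l = 1 then 0 else complex_of_real (R (l - 1))) = of_real (dR l)" for l
   by (simp add: dR_def)
  have "Re (1 + (\<Sum>l\<in>{1..m}. w l * complex_of_real (R l))) = 1 - R m + (\<Sum>l\<in>{1..m}. Re (tail_exp m u l) * dR l)"
   unfolding u(2) one_plus_sum_omega[OF m] cdR by simp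
  moreover have "(\<Sum>l\<in>{1..m}. c * dR l) \<le> (\<Sum>l\<in>{1..m}. Re (tail_exp m u l) * dR l)"
   using polydisc_tail_exp(2)[OF m u(1)] dR by (intro sum_mono mult_right_mono) (auto simp: c_def)
  moreover have "(\<Sum>l\<in>{1..m}. c * dR l) = c * R m"
   unfolding sum_distrib_left[symmetric] dR_def telescope_steps using m by simp
  moreover have "0 \<le> (1 - c) * (1 - R m)" using c1 R[of m] m by (intro mult_nonneg_nonneg) auto
  ultimately show ?thesis unfolding c_def[symmetric] by (simp add: algebra_simps)
 qed
qed

section \<open>Matching the explicit formulas of the statement\<close>

lemma erfc_ratios:
 "erfc (y + r) / erfc y = gauss_R r y"
 "exp (- y\<^sup>2) / erfc y = sqrt pi / 2 * gauss_q y"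
 "exp (- (y + r)\<^sup>2) / erfc y = sqrt pi / 2 * gauss_p r y"
 by (simp_all add: erfc_gauss_tail gauss_R_def gauss_q_def gauss_p_def)

lemma g1_summand:
 "sqrt 2 / (3 * sqrt pi) * ((5 * y\<^sup>2 - 1) * (exp (- y\<^sup>2) / erfc y) * (erfc (y + r) / erfc y)
   - (5 * y\<^sup>2 + r * y + 2 * r\<^sup>2 - 1) * (exp (- (y + r)\<^sup>2) / erfc y)) = sqrt 2 * wall_r1 r y"
proof -
 define p where "p = sqrt pi"
 have p: "p \<noteq> 0" by (simp add: p_def)
 show ?thesis unfolding erfc_ratios wall_r1_def wall_Q1_def p_def[symmetric] using p
  by (simp add: field_simps)
qed

text \<open>The four terms correspond one by one to \<open>wall_S2\<close> at the shift
  \<open>r\<close>, the product of the two boundary terms, \<open>wall_S2\<close> at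
  \<open>0\<close>, and the square of \<open>wall_Q1\<close> at \<open>0\<close>.\<close>

lemma g2_summand:
 "1 / (18 * sqrt pi) *
    (50 * y ^ 5 + 70 * y ^ 4 * r + y ^ 3 * (62 * r\<^sup>2 - 73)
    + y\<^sup>2 * r * (50 * r\<^sup>2 - 33) - y * (3 + 18 * r\<^sup>2 - 16 * r ^ 4)
    + r * (3 - 22 * r\<^sup>2 + 8 * r ^ 4))
    * (exp (- (y + r)\<^sup>2) / erfc y)
   + 2 * (1 - 5 * y\<^sup>2) * (5 * y\<^sup>2 + y * r - 1 + 2 * r\<^sup>2) / (9 * pi)
    * (exp (- y\<^sup>2) / erfc y) * (exp (- (y + r)\<^sup>2) / erfc y)
   + y * (3 + 73 * y\<^sup>2 - 50 * y ^ 4) / (18 * sqrt pi)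
    * (exp (- y\<^sup>2) / erfc y) * (erfc (y + r) / erfc y)
   + 2 * (1 - 5 * y\<^sup>2)\<^sup>2 / (9 * pi)
    * (exp (- y\<^sup>2) / erfc y)\<^sup>2 * (erfc (y + r) / erfc y) = 2 * wall_r2 r y"
proof -
 define p where "p = sqrt pi"
 have p: "p \<noteq> 0" and pi: "pi = p * p" by (simp_all add: p_def)
 define q where "q = gauss_q y"
 define P where "P = gauss_p r y"
 define R where "R = gauss_R r y"
 define A where "A = 50 * y ^ 5 + 70 * y ^ 4 * r + y ^ 3 * (62 * r\<^sup>2 - 73)
    + y\<^sup>2 * r * (50 * r\<^sup>2 - 33) - y * (3 + 18 * r\<^sup>2 - 16 * r ^ 4)
    + r * (3 - 22 * r\<^sup>2 + 8 * r ^ 4)"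
 have S0: "wall_S2 0 y = - (y * (3 + 73 * y\<^sup>2 - 50 * y ^ 4)) / 72" unfolding wall_S2_def
  by (simp add: algebra_simps power2_eq_square power3_eq_cube power_numeral_reduce)
 have Sr: "wall_S2 r y = A / 72" by (simp only: wall_S2_def A_def)
 have 1: "1 / (18 * p) * A * (p / 2 * P) = 2 * (A / 72 * P)" using p by simp
 have 2: "2 * (1 - 5 * y\<^sup>2) * (5 * y\<^sup>2 + y * r - 1 + 2 * r\<^sup>2) / (9 * (p * p)) * (p / 2 * q) * (p / 2 * P)
  = - 2 * (wall_Q1 0 y * q * (wall_Q1 r y * P))"
  using p unfolding wall_Q1_def by (simp add: field_simps)
 have 3: "y * (3 + 73 * y\<^sup>2 - 50 * y ^ 4) / (18 * p) * (p / 2 * q) * R = - 2 * (wall_S2 0 y * (q * R))"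
  using p unfolding S0 by simp
 have 4: "2 * (1 - 5 * y\<^sup>2)\<^sup>2 / (9 * (p * p)) * (p / 2 * q)\<^sup>2 * R = 2 * (wall_Q1 0 y * q * (wall_Q1 0 y * (q * R)))"
  using p unfolding wall_Q1_def by (simp add: field_simps power2_eq_square)
 show ?thesis
  unfolding erfc_ratios A_def[symmetric] p_def[symmetric] q_def[symmetric] P_def[symmetric] R_def[symmetric]
  unfolding pi 1 2 3 4 wall_r2_def wall_r1_def Sr q_def[symmetric] P_def[symmetric] R_def[symmetric]
  by (simp add: algebra_simps)
qed

context gauss_family
begin

lemma g_eq: "g0 m s u y = gz (omega m u) y" "g1 m s u y = of_real (sqrt 2) * S1 (omega m u) y"
 "g2 m s u y = 2 * S2 (omega m u) y"
proof -
 show "g0 m s u y = gz (omega m u) y" unfolding g0_def gz_def erfc_ratios by simp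
 show "g1 m s u y = of_real (sqrt 2) * S1 (omega m u) y"
  unfolding g1_def S1_def g1_summand sum_distrib_left of_real_mult by (intro sum.cong refl mult.left_commute)
 show "g2 m s u y = 2 * S2 (omega m u) y"
  unfolding g2_def S2_def g2_summand sum_distrib_left of_real_mult by (intro sum.cong refl) simp
qed

lemma h_eq: "h0 m s u y = H0 (omega m u) y" "h1 m s u y = of_real (sqrt 2) * H1 (omega m u) y"
 "h2 m s u y = 2 * H2 (omega m u) y"
proof -
 have sq: "complex_of_real (sqrt 2) * complex_of_real (sqrt 2) = 2"
  unfolding of_real_mult[symmetric] by simp
 show "h0 m s u y = H0 (omega m u) y" by (simp add: h0_def H0_def g_eq)
 show h1: "h1 m s u y = of_real (sqrt 2) * H1 (omega m u) y" by (simp add: h1_def H1_def g_eq divide_inverse mult_ac)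
 have q: "g1 m s u y / g0 m s u y = of_real (sqrt 2) * H1 (omega m u) y" using h1 by (simp only: h1_def)
 have sq2: "(of_real (sqrt 2) * h)\<^sup>2 = 2 * (h * h)" for h :: complex
  unfolding sq[symmetric] power2_eq_square by (simp only: mult_ac)
 have "h2 m s u y = 2 * S2 (omega m u) y / gz (omega m u) y - 2 * (H1 (omega m u) y * H1 (omega m u) y) / 2"
  unfolding h2_def q sq2 unfolding g_eq ..
 then show "h2 m s u y = 2 * H2 (omega m u) y"
  unfolding H2_def divide_inverse[of _ "gz (omega m u) y"] by (simp add: algebra_simps)
qed

lemma C_eq:
 assumes U: "Hinf (omega m u) = Usum m u"
 shows "C2 m b \<rho> s u = of_real (sqrt 2 * b * \<rho> powr b) * M1 (omega m u)"
  and "C3 m b \<alpha> s u = - of_real (1 / 2 + \<alpha>) * Usum m u + of_real b * (2 * M2 (omega m u))"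
  and "C4 m b \<rho> s u = of_real (b * \<rho> powr (- b)) * (of_real (2 * sqrt 2) * M3 (omega m u))"
proof -
 have h0c: "h0c m s u y = H0c (omega m u) y" for y by (simp add: h0c_def H0c_def h_eq U)
 have sq: "complex_of_real (sqrt 2) * complex_of_real (sqrt 2) = 2"
  unfolding of_real_mult[symmetric] by simp
 show "C2 m b \<rho> s u = of_real (sqrt 2 * b * \<rho> powr b) * M1 (omega m u)"
  unfolding C2_def h0c M1_def ..
 have eq3: "4 * of_real y * h0c m s u y + of_real (sqrt 2) * h1 m s u y = 2 * (2 * (of_real y * H0c (omega m u) y) + H1 (omega m u) y)" for y
  unfolding h0c h_eq mult.assoc[symmetric] sq by (simp add: algebra_simps)
 show "C3 m b \<alpha> s u = - of_real (1 / 2 + \<alpha>) * Usum m u + of_real b * (2 * M2 (omega m u))"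
  unfolding C3_def M2_def eq3 integral_mult_right_zero ..
 have eq4: "of_real (6 * sqrt 2 * y\<^sup>2) * h0c m s u y + 4 * of_real y * h1 m s u y + of_real (sqrt 2) * h2 m s u y
    = of_real (2 * sqrt 2) * (3 * (of_real (y\<^sup>2) * H0c (omega m u) y) + 2 * (of_real y * H1 (omega m u) y) + H2 (omega m u) y)" for y
  unfolding h0c h_eq by (simp add: algebra_simps)
 show "C4 m b \<rho> s u = of_real (b * \<rho> powr (- b)) * (of_real (2 * sqrt 2) * M3 (omega m u))"
  unfolding C4_def M3_def eq4 integral_mult_right_zero ..
qed

text \<open>A translation of scales: \<open>2 * b / eps^2\<close>, \<open>2 * b / eps\<close>,
  \<open>2 * b\<close> and \<open>2 * b * eps\<close> are the coefficients of the orders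
  \<open>n\<close>, \<open>sqrt n\<close>, \<open>1\<close> and \<open>1 / sqrt n\<close>. The part
  \<open>- \<alpha> - 1/2\<close> of the plateau count joins the constant term.\<close>

lemma mainterm_eq:
 assumes U: "Hinf (omega m u) = Usum m u" and pos: "0 < \<rho>" "0 < n"
  and he: "eps = sqrt 2 / (\<rho> powr b * sqrt (real n))"
 shows "mainterm m b \<alpha> \<rho> s n u = Hinf (omega m u) * of_real (2 * b / eps\<^sup>2 - \<alpha> - 1/2)
  + of_real (2 * b / eps) * (M1 (omega m u) + of_real eps * M2 (omega m u) + (of_real eps)\<^sup>2 * M3 (omega m u))"
proof -
 define k where "k = \<rho> powr b"
 define r where "r = sqrt (real n)"
 have k: "0 < k" "\<rho> powr (2 * b) = k * k" "\<rho> powr (- b) = 1 / k"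
  using pos by (simp_all add: k_def powr_add[symmetric] powr_minus divide_inverse)
 have r: "0 < r" "real n = r * r" using pos by (simp_all add: r_def)
 have e: "eps = sqrt 2 / (k * r)" by (simp add: he k_def r_def)
 have e1: "2 * b / eps\<^sup>2 = b * (k * k) * (r * r)" "2 * b / eps = sqrt 2 * b * k * r" "2 * b / eps * eps = 2 * b"
  "2 * b / eps * eps\<^sup>2 = b * (1 / k) * (2 * sqrt 2) / r"
 proof -
  define w where "w = sqrt (2::real)"
  have w: "w * w = 2" "0 < w" by (simp_all add: w_def)
  have ew: "eps = w / (k * r)" "eps\<^sup>2 = 2 / (k * k * (r * r))" unfolding e w(1)[symmetric] by (simp_all add: w_def power2_eq_square)
  have e0: "eps \<noteq> 0" using ew(1) w k r by simp
  show "2 * b / eps\<^sup>2 = b * (k * k) * (r * r)" unfolding ew(2) by simp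
  have i: "2 / w = w" using w by (simp add: divide_eq_eq)
  have "2 * b / eps = b * (k * r) * (2 / w)" unfolding ew(1) by simp
  then show 1: "2 * b / eps = sqrt 2 * b * k * r" unfolding i by (simp add: w_def)
  show "2 * b / eps * eps = 2 * b" using e0 by simp
  have "2 * b / eps * eps\<^sup>2 = 2 * b * eps" using e0 by (simp add: power2_eq_square)
  then show "2 * b / eps * eps\<^sup>2 = b * (1 / k) * (2 * sqrt 2) / r" unfolding ew(1) w_def by simp
 qed
 have C1: "C1 m b \<rho> u * of_nat n = Usum m u * of_real (2 * b / eps\<^sup>2)"
 proof -
  have "(of_nat n :: complex) = of_real (r * r)" using r(2) by (metis of_real_of_nat_eq)
  then show ?thesis unfolding C1_def e1 k(2) by simp
 qed
 have C2: "C2 m b \<rho> s u * of_real (sqrt (real n)) = of_real (2 * b / eps) * M1 (omega m u)"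
  unfolding C_eq(1)[OF U] e1 k_def[symmetric] r_def[symmetric] by simp
 have C3: "C3 m b \<alpha> s u = - Usum m u * of_real (\<alpha> + 1/2) + of_real (2 * b / eps) * (of_real eps * M2 (omega m u))"
 proof -
  note C_eq(2)[OF U, of b \<alpha>]
  moreover have "of_real (2 * b / eps) * (of_real eps * M2 (omega m u)) = of_real (2 * b) * M2 (omega m u)"
   unfolding mult.assoc[symmetric] of_real_mult[symmetric] e1(3) ..
  ultimately show ?thesis by (simp only:) (simp add: algebra_simps)
 qed
 have C4: "C4 m b \<rho> s u / of_real (sqrt (real n)) = of_real (2 * b / eps) * ((of_real eps)\<^sup>2 * M3 (omega m u))"
 proof -
  have "C4 m b \<rho> s u / of_real (sqrt (real n)) = of_real (b * (1 / k) * (2 * sqrt 2) / r) * M3 (omega m u)"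
   unfolding r_def[symmetric] C_eq(3)[OF U] k(3) by simp
  moreover have "of_real (2 * b / eps) * ((of_real eps)\<^sup>2 * M3 (omega m u)) = of_real (b * (1 / k) * (2 * sqrt 2) / r) * M3 (omega m u)"
   unfolding mult.assoc[symmetric] of_real_power[symmetric] of_real_mult[symmetric] e1(4) ..
  ultimately show ?thesis by (simp only:)
 qed
 have al: "a * c1 + c2 + (- a * c3 + c4) + c5 = a * (c1 - c3) + (c2 + c4 + c5)" for a c1 c2 c3 c4 c5 :: complex
  by (simp add: algebra_simps)
 have ge: "2 * b / eps\<^sup>2 - \<alpha> - 1/2 = 2 * b / eps\<^sup>2 - (\<alpha> + 1/2)" by simp
 show ?thesis unfolding mainterm_def C1 C2 C3 C4 U ge distrib_left[of "of_real (2 * b / eps)"] of_real_diff[of "2 * b / eps\<^sup>2"] by (rule al)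
qed

end

section \<open>The expansion on a polydisc in terms of \<open>n\<close> and \<open>u\<close>\<close>

definition wall_eps :: "real \<Rightarrow> real \<Rightarrow> nat \<Rightarrow> real" where
 "wall_eps b \<rho> n = sqrt 2 / (\<rho> powr b * sqrt (real n))"

definition layer_factor :: "nat \<Rightarrow> real \<Rightarrow> real \<Rightarrow> real \<Rightarrow> (nat \<Rightarrow> real) \<Rightarrow> nat \<Rightarrow> nat \<Rightarrow> (nat \<Rightarrow> complex) \<Rightarrow> complex" where
 "layer_factor m b \<alpha> \<rho> s n j u = 1 + (\<Sum>l\<in>{1..m}. omega m u l *
  of_real (wall_ratio (wall_eps b \<rho> n) ((real j + \<alpha>) / b) (s l)))"

lemma wall_eps_facts:
 assumes "0 < \<rho>" "0 < n"
 shows "0 < wall_eps b \<rho> n" "(wall_eps b \<rho> n)\<^sup>2 = 2 / (\<rho> powr (2 * b) * real n)"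
  "real n * \<rho> powr (2 * b) = 2 / (wall_eps b \<rho> n)\<^sup>2"
proof -
 show "0 < wall_eps b \<rho> n" using assms by (simp add: wall_eps_def)
 have "\<rho> powr (2 * b) = \<rho> powr b * \<rho> powr b" by (simp add: powr_add[symmetric])
 then show e2: "(wall_eps b \<rho> n)\<^sup>2 = 2 / (\<rho> powr (2 * b) * real n)"
  using assms by (simp add: wall_eps_def power_divide power_mult_distrib power2_eq_square[of "\<rho> powr b"])
 show "real n * \<rho> powr (2 * b) = 2 / (wall_eps b \<rho> n)\<^sup>2" unfolding e2 using assms by simp
qed

lemma wall_eps_tendsto:
 assumes "0 < \<rho>" "0 < e"
 shows "\<exists>N0>0. \<forall>n\<ge>N0. wall_eps b \<rho> n < e"
proof -
 define T where "T = sqrt 2 / (\<rho> powr b * e)"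
 define N0 where "N0 = nat \<lceil>T\<^sup>2\<rceil> + 1"
 have "wall_eps b \<rho> n < e" if n: "N0 \<le> n" for n
 proof -
  have "T\<^sup>2 < real n" using n by (simp add: N0_def) linarith
  then have "T < sqrt (real n)" using real_less_rsqrt by blast
  moreover have "0 < sqrt (real n)" using n by (simp add: N0_def)
  ultimately show ?thesis using assms by (simp add: T_def wall_eps_def field_simps)
 qed
 then show ?thesis by (intro exI[of _ N0]) (auto simp: N0_def)
qed

text \<open>Everything the final argument needs. The product formula holds for all \<open>u\<close>,
  the other parts on the polydisc; the bounds on \<open>C3\<close> and \<open>C4\<close> serve to
  separate the orders of \<open>n\<close> when the coefficients are shown to be holomorphic.\<close>

lemma polydisc_expansion:
 fixes m :: nat and b \<alpha> \<rho> :: real and s x :: "nat \<Rightarrow> real"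
 assumes m: "0 < m" and b: "0 < b" and rho: "0 < \<rho>" "\<rho> < b powr (- 1 / (2 * b))"
  and decr: "\<And>i j. 1 \<le> i \<Longrightarrow> i < j \<Longrightarrow> j \<le> m \<Longrightarrow> s j < s i" and sm: "0 < s m" and \<alpha>: "-1 < \<alpha>"
 shows "\<exists>K>0. \<exists>N0>0. (\<forall>n\<ge>N0. \<forall>u\<in>polydisc m x (1 / real m).
   cmod ((\<Sum>j=1..n. Ln (layer_factor m b \<alpha> \<rho> s n j u)) - mainterm m b \<alpha> \<rho> s n u) \<le> K / real n) \<and>
  (\<forall>n\<ge>N0. \<forall>u. mgf m b \<alpha> \<rho> s n u = (\<Prod>j=1..n. layer_factor m b \<alpha> \<rho> s n j u)) \<and>
  (\<forall>n\<ge>N0. \<forall>u\<in>polydisc m x (1 / real m). \<forall>j\<in>{1..n}. 0 < Re (layer_factor m b \<alpha> \<rho> s n j u)) \<and>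
  (\<forall>u\<in>polydisc m x (1 / real m). cmod (C3 m b \<alpha> s u) \<le> K \<and> cmod (C4 m b \<rho> s u) \<le> K)"
proof -
 interpret gauss_family m s "s m" "2 * tail_bound m x" "cos 1 / tail_bound m x" "omega m ` polydisc m x (1 / real m)"
  by (rule gauss_family_polydisc) (use m decr sm in auto)
 define P where "P = polydisc m x (1 / real m)"
 have ne: "omega m ` P \<noteq> {}"
 proof -
  have "(\<lambda>j. of_real (x j)) \<in> P" using m by (simp add: P_def polydisc_def)
  then show ?thesis by blast
 qed
 \<comment> \<open>The ratio of \<open>n\<close> to the critical index; the hypothesis on
   \<open>\<rho>\<close> is equivalent to \<open>\<theta> > 1\<close>.\<close>
 define \<theta> where "\<theta> = 1 / (b * \<rho> powr (2 * b))"
 have "\<rho> powr (2 * b) < (b powr (- 1 / (2 * b))) powr (2 * b)" using rho b by (intro powr_less_mono2) auto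
 also have "... = 1 / b"
 proof -
  have "- 1 / (2 * b) * (2 * b) = - 1" using b by simp
  then show ?thesis unfolding powr_powr using powr_neg_one[OF b] by simp
 qed
 finally have "b * \<rho> powr (2 * b) < 1" using b by (simp add: field_simps)
 then have \<theta>: "1 < \<theta>" using b rho by (simp add: \<theta>_def)
 obtain C eps0 where C: "C > 0" "eps0 > 0" "\<forall>eps w. \<forall>n::nat. 0 < eps \<longrightarrow> eps < eps0 \<longrightarrow> w \<in> omega m ` P \<longrightarrow> real n = \<theta> * (2 * b / eps\<^sup>2) \<longrightarrow>
  cmod ((\<Sum>j=1..n. Ln (gwall eps w ((real j + \<alpha>) / b)))
   - (Hinf w * of_real (2 * b / eps\<^sup>2 - \<alpha> - 1/2)
    + of_real (2 * b / eps) * (Msum eps w))) \<le> C * eps\<^sup>2"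
  using sum_Ln_gwall[OF b \<theta> \<alpha> m ne[unfolded P_def]] unfolding P_def[symmetric] by (elim exE conjE) (rule that; assumption)
 obtain KM where KM: "KM > 0" "\<forall>w\<in>omega m ` P. cmod (M1 w) \<le> KM \<and> cmod (M2 w) \<le> KM \<and> cmod (M3 w) \<le> KM"
  using M_bounds_ex unfolding P_def[symmetric] by blast
 have U: "Hinf (omega m u) = Usum m u" if "u \<in> P" for u
  using Usum_eq_Ln[OF m that[unfolded P_def]] by (simp add: Hinf_def)
 \<comment> \<open>The bound by \<open>1 / s 1\<close>, with \<open>s 1\<close> the largest shift,
   keeps every \<open>s l\<close> below \<open>1 / eps\<close>, so that the radii have a nonnegative
   base under the power.\<close>
 define e where "e = min eps0 (1 / s 1)"
 have s1: "0 < s 1" by (rule s_pos) (use m in auto)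
 have "0 < e" using C(2) s1 by (simp add: e_def)
 then obtain N0 where N0: "0 < N0" "\<forall>n\<ge>N0. wall_eps b \<rho> n < e" using wall_eps_tendsto[OF rho(1)] by metis
 define UB where "UB = (\<Sum>j\<in>{1..m}. \<bar>x j\<bar> + 1)"
 have UB: "cmod (Usum m u) \<le> UB" if u: "u \<in> P" for u
  unfolding Usum_def UB_def
 proof (rule sum_norm_le)
  fix j assume j: "j \<in> {1..m}"
  have "cmod (u j - of_real (x j)) < 1 / m" using u j by (auto simp: P_def polydisc_def dist_norm norm_minus_commute)
  also have "... \<le> 1" using m by simp
  finally show "cmod (u j) \<le> abs (x j) + 1" using norm_triangle_ineq2[of "u j" "of_real (x j)"] by simp
 qed
 have UB0: "0 \<le> UB" by (simp add: UB_def sum_nonneg)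
 define K1 where "K1 = C * (2 / \<rho> powr (2 * b))"
 define K3 where "K3 = abs (1 / 2 + \<alpha>) * UB + b * (2 * KM)"
 define K4 where "K4 = b * \<rho> powr (- b) * (2 * sqrt 2 * KM)"
 have K: "0 < K1" "0 \<le> K3" "0 \<le> K4" using C KM UB0 b rho by (auto simp: K1_def K3_def K4_def)
 have gw: "layer_factor m b \<alpha> \<rho> s n j u = gwall (wall_eps b \<rho> n) (omega m u) ((real j + \<alpha>) / b)" for n j u
  by (simp add: layer_factor_def gwall_def)
 have 1: "cmod ((\<Sum>j=1..n. Ln (layer_factor m b \<alpha> \<rho> s n j u)) - mainterm m b \<alpha> \<rho> s n u) \<le> (K1 + K3 + K4) / real n"
  if n: "N0 \<le> n" and u: "u \<in> P" for n u
 proof -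
  have n0: "0 < n" using n N0 by simp
  note E = wall_eps_facts[OF rho(1) n0, of b]
  have small: "wall_eps b \<rho> n < eps0" using N0(2) n by (auto simp: e_def)
  have nth: "real n = \<theta> * (2 * b / (wall_eps b \<rho> n)\<^sup>2)" unfolding E(2) \<theta>_def using b rho n0 by simp
  have "cmod ((\<Sum>j=1..n. Ln (layer_factor m b \<alpha> \<rho> s n j u)) - mainterm m b \<alpha> \<rho> s n u) \<le> C * (wall_eps b \<rho> n)\<^sup>2"
   unfolding gw mainterm_eq[OF U[OF u] rho(1) n0 wall_eps_def]
   by (rule C(3)[THEN spec[of _ "wall_eps b \<rho> n"], THEN spec[of _ "omega m u"], THEN spec[of _ n], THEN mp, THEN mp, THEN mp, THEN mp, OF E(1) small imageI[OF u] nth])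
  also have "... = K1 / real n" unfolding E(2) K1_def by simp
  also have "... \<le> (K1 + K3 + K4) / real n" using K by (intro divide_right_mono) auto
  finally show ?thesis .
 qed
 have 2: "mgf m b \<alpha> \<rho> s n u = (\<Prod>j=1..n. layer_factor m b \<alpha> \<rho> s n j u)" if n: "N0 \<le> n" for n u
 proof -
  have n0: "0 < n" using n N0 by simp
  note E = wall_eps_facts[OF rho(1) n0, of b]
  have small: "s l \<le> 1 / wall_eps b \<rho> n" if "l \<in> {1..m}" for l
  proof -
   have "s l \<le> s 1" using s_antimono[of 1 l] that by auto
   moreover have "wall_eps b \<rho> n < 1 / s 1" using N0(2) n by (auto simp: e_def)
   then have "s 1 \<le> 1 / wall_eps b \<rho> n" using E(1) s1 by (simp add: field_simps)
   ultimately show ?thesis by linarith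
  qed
  have "mgf m b \<alpha> \<rho> s n u = (\<Prod>k<n. layer_factor m b \<alpha> \<rho> s n (Suc k) u)"
   unfolding layer_factor_def
   by (subst mgf_eq_prod[where s = s and m = m, OF b rho(1) E(1) \<alpha> E(3) decr _ small]) (auto intro: less_imp_le[OF s_pos] simp: add.commute)
  also have "... = (\<Prod>j=1..n. layer_factor m b \<alpha> \<rho> s n j u)"
   using prod.atLeast1_atMost_eq[of "\<lambda>j. layer_factor m b \<alpha> \<rho> s n j u" n] by simp
  finally show ?thesis .
 qed
 have 3: "0 < Re (layer_factor m b \<alpha> \<rho> s n j u)" if n: "N0 \<le> n" and u: "u \<in> P" and j: "j \<in> {1..n}" for n u j
 proof -
  have "0 < (real j + \<alpha>) / b" using j \<alpha> b by auto
  then have "cos 1 / tail_bound m x \<le> Re (layer_factor m b \<alpha> \<rho> s n j u)"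
   unfolding gw using n N0 u by (intro Re_gwall wall_eps_facts(1) rho) (auto simp: P_def)
  then show ?thesis using c0_pos by linarith
 qed
 have 4: "cmod (C3 m b \<alpha> s u) \<le> K3" "cmod (C4 m b \<rho> s u) \<le> K4" if u: "u \<in> P" for u
 proof -
  have M: "cmod (M2 (omega m u)) \<le> KM" "cmod (M3 (omega m u)) \<le> KM" using KM(2) u by auto
  have "cmod (C3 m b \<alpha> s u) \<le> cmod (- of_real (1 / 2 + \<alpha>) * Usum m u) + cmod (of_real b * (2 * M2 (omega m u)))"
   unfolding C_eq(2)[OF U[OF u]] by (rule norm_triangle_ineq)
  also have "cmod (- of_real (1 / 2 + \<alpha>) * Usum m u) = abs (1 / 2 + \<alpha>) * cmod (Usum m u)"
   unfolding norm_mult norm_minus_cancel norm_of_real ..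
  also have "... \<le> abs (1 / 2 + \<alpha>) * UB" using UB[OF u] by (intro mult_left_mono) auto
  also have "cmod (of_real b * (2 * M2 (omega m u))) \<le> b * (2 * KM)"
   unfolding norm_mult norm_of_real using M b by auto
  finally show "cmod (C3 m b \<alpha> s u) \<le> K3" unfolding K3_def by simp
  have "cmod (C4 m b \<rho> s u) = b * \<rho> powr (- b) * (2 * sqrt 2 * cmod (M3 (omega m u)))"
   unfolding C_eq(3)[OF U[OF u]] norm_mult norm_of_real using b by simp
  also have "... \<le> K4" unfolding K4_def using M b by (intro mult_left_mono) auto
  finally show "cmod (C4 m b \<rho> s u) \<le> K4" .
 qed
 have le: "K3 \<le> K1 + K3 + K4" "K4 \<le> K1 + K3 + K4" using K by auto
 show ?thesis unfolding P_def[symmetric]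
  using 1 2 3 order.trans[OF 4(1) le(1)] order.trans[OF 4(2) le(2)] K N0(1)
  by (intro exI[of _ "K1 + K3 + K4"] exI[of _ N0] conjI) auto
qed

section \<open>Separately holomorphic functions\<close>

lemma deriv_bound_ball:
 assumes f: "f holomorphic_on ball w r" and K: "\<And>z. z \<in> ball w r \<Longrightarrow> cmod (f z) \<le> K" and r: "0 < r" and x: "x \<in> ball w (r / 2)"
 shows "cmod ((deriv ^^ k) f x) \<le> fact k * K / (r / 2 * (1 / 2)) ^ k"
proof (rule Cauchy_inequality)
 have sub: "cball x (r / 2 * (1 / 2)) \<subseteq> ball w r"
 proof
  fix z assume "z \<in> cball x (r / 2 * (1 / 2))"
  then show "z \<in> ball w r" using x r dist_triangle[of w z x] by auto
 qed
 show "f holomorphic_on ball x (r / 2 * (1 / 2))" using f sub ball_subset_cball by (meson holomorphic_on_subset order.trans)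
 show "continuous_on (cball x (r / 2 * (1 / 2))) f" using f sub holomorphic_on_imp_continuous_on continuous_on_subset by blast
 show "cmod (f z) \<le> K" if "cmod (x - z) = r / 2 * (1 / 2)" for z
  by (rule K) (use sub that in \<open>auto simp: dist_norm\<close>)
qed (use r in auto)

text \<open>The error is linear in \<open>h\<close> with a constant depending only on
  \<open>K\<close> and \<open>r\<close>, so difference quotients converge uniformly in all remaining
  variables.\<close>

lemma difference_quotient_bound:
 assumes f: "f holomorphic_on ball w r" and K: "\<And>z. z \<in> ball w r \<Longrightarrow> cmod (f z) \<le> K" and r: "0 < r"
  and h: "h \<noteq> 0" "cmod h < r / 2"
 shows "cmod ((f (w + h) - f w) / h - deriv f w) \<le> 32 * K / r\<^sup>2 * cmod h"
proof -
 \<comment> \<open>Cauchy's bound for the second derivative on a circle of radius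
   \<open>r / 4\<close>: \<open>2 * K / (r / 4)^2\<close>.\<close>
 define B where "B = 32 * K / r\<^sup>2"
 have "cmod ((deriv ^^ 0) f (w + h) - (\<Sum>i\<le>1. (deriv ^^ i) f w * (w + h - w) ^ i / fact i)) \<le> B * cmod (w + h - w) ^ Suc 1 / fact 1"
 proof (rule complex_Taylor[where S = "ball w (r / 2)" and f = "\<lambda>i. (deriv ^^ i) f"])
  fix i x assume "x \<in> ball w (r / 2)"
  then have "x \<in> ball w r" using r by auto
  then have "((deriv ^^ i) f has_field_derivative (deriv ^^ Suc i) f x) (at x)"
   by (intro has_field_derivative_higher_deriv[OF f]) auto
  then show "((deriv ^^ i) f has_field_derivative (deriv ^^ Suc i) f x) (at x within ball w (r / 2))"
   by (rule DERIV_subset) simp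
 next
  fix x assume "x \<in> ball w (r / 2)"
  from deriv_bound_ball[OF f K r this, of 2] show "cmod ((deriv ^^ Suc 1) f x) \<le> B"
   by (simp add: B_def power_divide eval_nat_numeral)
 qed (use h r in \<open>auto simp: dist_norm\<close>)
 then have 1: "cmod (f (w + h) - (f w + deriv f w * h)) \<le> B * cmod h * cmod h"
  by (simp add: power2_eq_square)
 have "(f (w + h) - f w) / h - deriv f w = (f (w + h) - (f w + deriv f w * h)) / h"
  using h(1) by (simp add: field_simps)
 then have "cmod ((f (w + h) - f w) / h - deriv f w) = cmod (f (w + h) - (f w + deriv f w * h)) / cmod h"
  by (simp add: norm_divide)
 also have "... \<le> B * cmod h" using 1 h(1) by (simp add: divide_le_eq)
 finally show ?thesis unfolding B_def .
qed

lemma polydisc_upd: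
 assumes "u \<in> polydisc m x \<delta>" "z \<in> ball (of_real (x i)) \<delta>"
 shows "u(i := z) \<in> polydisc m x \<delta>"
 using assms by (auto simp: polydisc_def)

lemma polydisc_mono: "\<delta>' \<le> \<delta> \<Longrightarrow> polydisc m x \<delta>' \<subseteq> polydisc m x \<delta>"
 by (force simp: polydisc_def)

text \<open>Holomorphy on each one-variable slice is all that Cauchy's estimates, applied one
  variable at a time, require.\<close>

definition sep_holomorphic :: "nat \<Rightarrow> (nat \<Rightarrow> real) \<Rightarrow> real \<Rightarrow> ((nat \<Rightarrow> complex) \<Rightarrow> complex) \<Rightarrow> bool" where
 "sep_holomorphic m x \<delta> G \<longleftrightarrow> (\<forall>u\<in>polydisc m x \<delta>. \<forall>i\<in>{1..m}. (\<lambda>z. G (u(i := z))) holomorphic_on ball (of_real (x i)) \<delta>)"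

lemma sep_holomorphicI:
 "(\<And>u i. u \<in> polydisc m x \<delta> \<Longrightarrow> i \<in> {1..m} \<Longrightarrow> (\<lambda>z. G (u(i := z))) holomorphic_on ball (of_real (x i)) \<delta>) \<Longrightarrow> sep_holomorphic m x \<delta> G"
 by (simp add: sep_holomorphic_def)

lemma sep_holomorphicD:
 "sep_holomorphic m x \<delta> G \<Longrightarrow> u \<in> polydisc m x \<delta> \<Longrightarrow> i \<in> {1..m} \<Longrightarrow> (\<lambda>z. G (u(i := z))) holomorphic_on ball (of_real (x i)) \<delta>"
 by (simp add: sep_holomorphic_def)

lemma sep_holomorphic_mono:
 assumes "sep_holomorphic m x \<delta> G" "\<delta>' \<le> \<delta>"
 shows "sep_holomorphic m x \<delta>' G"
proof (rule sep_holomorphicI)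
 fix u i assume "u \<in> polydisc m x \<delta>'" "i \<in> {1..m}"
 then have "(\<lambda>z. G (u(i := z))) holomorphic_on ball (of_real (x i)) \<delta>"
  using polydisc_mono[OF assms(2), of m x] by (intro sep_holomorphicD[OF assms(1)]) auto
 then show "(\<lambda>z. G (u(i := z))) holomorphic_on ball (of_real (x i)) \<delta>'"
  by (rule holomorphic_on_subset) (use assms(2) in auto)
qed

lemma sep_holomorphic_add: "sep_holomorphic m x \<delta> F \<Longrightarrow> sep_holomorphic m x \<delta> G \<Longrightarrow> sep_holomorphic m x \<delta> (\<lambda>u. F u + G u)"
 and sep_holomorphic_diff: "sep_holomorphic m x \<delta> F \<Longrightarrow> sep_holomorphic m x \<delta> G \<Longrightarrow> sep_holomorphic m x \<delta> (\<lambda>u. F u - G u)"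
 and sep_holomorphic_mult: "sep_holomorphic m x \<delta> F \<Longrightarrow> sep_holomorphic m x \<delta> G \<Longrightarrow> sep_holomorphic m x \<delta> (\<lambda>u. F u * G u)"
 and sep_holomorphic_exp: "sep_holomorphic m x \<delta> F \<Longrightarrow> sep_holomorphic m x \<delta> (\<lambda>u. exp (F u))"
 and sep_holomorphic_const: "sep_holomorphic m x \<delta> (\<lambda>u. c)"
 unfolding sep_holomorphic_def by (auto intro!: holomorphic_intros)

lemma sep_holomorphic_sum:
 "(\<And>a. a \<in> A \<Longrightarrow> sep_holomorphic m x \<delta> (F a)) \<Longrightarrow> sep_holomorphic m x \<delta> (\<lambda>u. \<Sum>a\<in>A. F a u)"
 unfolding sep_holomorphic_def by (auto intro!: holomorphic_intros)

lemma sep_holomorphic_coord: "sep_holomorphic m x \<delta> (\<lambda>u. u j)"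
proof (rule sep_holomorphicI)
 fix u i
 show "(\<lambda>z. (u(i := z)) j) holomorphic_on ball (complex_of_real (x i)) \<delta>"
  by (cases "j = i") (auto intro!: holomorphic_intros)
qed

lemma sep_holomorphic_Ln:
 assumes "sep_holomorphic m x \<delta> F" "\<And>u. u \<in> polydisc m x \<delta> \<Longrightarrow> 0 < Re (F u)"
 shows "sep_holomorphic m x \<delta> (\<lambda>u. Ln (F u))"
proof (rule sep_holomorphicI, rule holomorphic_on_Ln')
 fix u i z assume "u \<in> polydisc m x \<delta>" "i \<in> {1..m}" "z \<in> ball (complex_of_real (x i)) \<delta>"
 then have "0 < Re (F (u(i := z)))" by (intro assms(2) polydisc_upd)
 then show "F (u(i := z)) \<notin> \<real>\<^sub>\<le>\<^sub>0" by (auto simp: complex_nonpos_Reals_iff)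
qed (rule sep_holomorphicD[OF assms(1)])

lemma sep_holomorphic_limit:
 assumes f: "\<And>n. n \<ge> N \<Longrightarrow> sep_holomorphic m x \<delta> (f n)"
  and c: "\<And>n u. n \<ge> N \<Longrightarrow> u \<in> polydisc m x \<delta> \<Longrightarrow> cmod (f n u - g u) \<le> c n" "c \<longlonglongrightarrow> 0"
 shows "sep_holomorphic m x \<delta> g"
proof (rule sep_holomorphicI)
 fix u i assume u: "u \<in> polydisc m x \<delta>" and i: "i \<in> {1..m}"
 define S where "S = ball (complex_of_real (x i)) \<delta>"
 show "(\<lambda>z. g (u(i := z))) holomorphic_on S"
 proof (rule holomorphic_uniform_sequence[where f = "\<lambda>n z. f (n + N) (u(i := z))"])
  show "(\<lambda>z. f (n + N) (u(i := z))) holomorphic_on S" for n unfolding S_def by (intro sep_holomorphicD[OF f] u i) simp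
  fix z assume "z \<in> S"
  moreover have "open S" by (simp add: S_def)
  ultimately obtain d where d: "d > 0" "cball z d \<subseteq> S" by (meson open_contains_cball)
  have "uniform_limit (cball z d) (\<lambda>n z. f (n + N) (u(i := z))) (\<lambda>z. g (u(i := z))) sequentially"
  proof (rule uniform_limitI)
   fix e :: real assume "0 < e"
   moreover have "(\<lambda>n. c (n + N)) \<longlonglongrightarrow> 0" by (rule LIMSEQ_ignore_initial_segment[OF c(2)])
   ultimately have "\<forall>\<^sub>F n in sequentially. c (n + N) < e" using order_tendstoD(2) by fastforce
   then show "\<forall>\<^sub>F n in sequentially. \<forall>z\<in>cball z d. dist (f (n + N) (u(i := z))) (g (u(i := z))) < e"
   proof eventually_elim
    case (elim n)
    show ?case
    proof
     fix w assume "w \<in> cball z d"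
     then have "u(i := w) \<in> polydisc m x \<delta>" using u d(2) by (intro polydisc_upd) (auto simp: S_def)
     then have "cmod (f (n + N) (u(i := w)) - g (u(i := w))) \<le> c (n + N)" by (intro c(1)) simp
     then show "dist (f (n + N) (u(i := w))) (g (u(i := w))) < e" using elim by (simp add: dist_norm)
    qed
   qed
  qed
  then show "\<exists>d>0. cball z d \<subseteq> S \<and> uniform_limit (cball z d) (\<lambda>n z. f (n + N) (u(i := z))) (\<lambda>z. g (u(i := z))) sequentially"
   using d by blast
 qed (simp add: S_def)
qed

definition cpartial :: "nat \<Rightarrow> ((nat \<Rightarrow> complex) \<Rightarrow> complex) \<Rightarrow> (nat \<Rightarrow> complex) \<Rightarrow> complex" where
 "cpartial j G u = deriv (\<lambda>z. G (u(j := z))) (u j)"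

lemma slice_facts:
 assumes G: "sep_holomorphic m x \<delta> G" and K: "\<And>u. u \<in> polydisc m x \<delta> \<Longrightarrow> cmod (G u) \<le> K"
  and d: "\<delta>' < \<delta>" and u: "u \<in> polydisc m x \<delta>'" and j: "j \<in> {1..m}"
 shows "(\<lambda>z. G (u(j := z))) holomorphic_on ball (u j) (\<delta> - \<delta>')"
  and "\<And>z. z \<in> ball (u j) (\<delta> - \<delta>') \<Longrightarrow> cmod (G (u(j := z))) \<le> K"
  and "\<And>z. z \<in> ball (u j) (\<delta> - \<delta>') \<Longrightarrow> u(j := z) \<in> polydisc m x \<delta>"
proof -
 have uj: "dist (of_real (x j)) (u j) < \<delta>'" using u j by (auto simp: polydisc_def)
 have sub: "ball (u j) (\<delta> - \<delta>') \<subseteq> ball (of_real (x j)) \<delta>"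
 proof
  fix z assume "z \<in> ball (u j) (\<delta> - \<delta>')"
  then show "z \<in> ball (of_real (x j)) \<delta>" using uj dist_triangle[of "of_real (x j)" z "u j"] by auto
 qed
 have u': "u \<in> polydisc m x \<delta>" using u d polydisc_mono[of \<delta>' \<delta>] by auto
 show "(\<lambda>z. G (u(j := z))) holomorphic_on ball (u j) (\<delta> - \<delta>')"
  using holomorphic_on_subset[OF sep_holomorphicD[OF G u' j] sub] .
 show in_disc: "u(j := z) \<in> polydisc m x \<delta>" if "z \<in> ball (u j) (\<delta> - \<delta>')" for z
  using that sub by (intro polydisc_upd u') auto
 show "cmod (G (u(j := z))) \<le> K" if "z \<in> ball (u j) (\<delta> - \<delta>')" for z
  by (intro K in_disc that)
qed

lemma cpartial_bound:
 assumes G: "sep_holomorphic m x \<delta> G" and K: "\<And>u. u \<in> polydisc m x \<delta> \<Longrightarrow> cmod (G u) \<le> K"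
  and d: "\<delta>' < \<delta>" and u: "u \<in> polydisc m x \<delta>'" and j: "j \<in> {1..m}"
 shows "cmod (cpartial j G u) \<le> 4 / (\<delta> - \<delta>') * K"
 using deriv_bound_ball[OF slice_facts(1,2)[OF assms], where k = 1 and x = "u j"] d unfolding cpartial_def by (simp add: mult.commute)

text \<open>Holomorphy of the derivative in the variables other than \<open>j\<close> is not visible
  from the slice in \<open>j\<close>; it is inherited from the difference quotients, which are
  separately holomorphic and converge uniformly on the smaller polydisc.\<close>

lemma sep_holomorphic_cpartial:
 assumes G: "sep_holomorphic m x \<delta> G" and K: "\<And>u. u \<in> polydisc m x \<delta> \<Longrightarrow> cmod (G u) \<le> K"
  and d: "\<delta>' < \<delta>" and j: "j \<in> {1..m}"
 shows "sep_holomorphic m x \<delta>' (cpartial j G)"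
proof -
 define r where "r = \<delta> - \<delta>'"
 have r: "0 < r" using d by (simp add: r_def)
 define h where "h = (\<lambda>n::nat. r / (4 * (real n + 1)))"
 have h: "0 < h n" "h n < r / 2" for n
 proof -
  show "0 < h n" using r by (simp add: h_def)
  have "h n \<le> r / 4" unfolding h_def using r by (intro divide_left_mono) auto
  then show "h n < r / 2" using r by linarith
 qed
 define Q where "Q = (\<lambda>n u. (G (u(j := u j + of_real (h n))) - G u) / of_real (h n))"
 show ?thesis
 proof (rule sep_holomorphic_limit[where N = 0 and f = Q])
  fix n u assume u: "u \<in> polydisc m x \<delta>'"
  note sl = slice_facts[OF G K d u j, folded r_def]
  have "cmod ((G (u(j := u j + of_real (h n))) - G (u(j := u j))) / of_real (h n) - deriv (\<lambda>z. G (u(j := z))) (u j))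
   \<le> 32 * K / r\<^sup>2 * cmod (of_real (h n))"
   by (rule difference_quotient_bound[OF sl(1,2) r]) (use h[of n] in auto)
  then show "cmod (Q n u - cpartial j G u) \<le> 32 * K / r\<^sup>2 * h n"
   using h(1)[of n] by (simp add: Q_def cpartial_def)
 next
  have "h \<longlonglongrightarrow> 0" unfolding h_def by real_asymp
  then show "(\<lambda>n. 32 * K / r\<^sup>2 * h n) \<longlonglongrightarrow> 0" by (rule tendsto_mult_right_zero)
 next
  fix n :: nat
  have shift: "sep_holomorphic m x \<delta>' (\<lambda>u. G (u(j := u j + of_real (h n))))"
  proof (rule sep_holomorphicI)
   fix u i assume u: "u \<in> polydisc m x \<delta>'" and i: "i \<in> {1..m}"
   have hb: "u j + of_real (h n) \<in> ball (u j) (\<delta> - \<delta>')" for u :: "nat \<Rightarrow> complex"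
    using h[of n] r by (simp add: dist_norm r_def[symmetric])
   show "(\<lambda>z. G ((u(i := z))(j := (u(i := z)) j + of_real (h n)))) holomorphic_on ball (of_real (x i)) \<delta>'"
   proof (cases "i = j")
    case True
    have "(\<lambda>z. G (u(j := z))) holomorphic_on ball (of_real (x j)) \<delta>"
     using u d polydisc_mono[of \<delta>' \<delta>] by (intro sep_holomorphicD[OF G] j) auto
    moreover have "(\<lambda>z. z + of_real (h n)) holomorphic_on ball (of_real (x j)) \<delta>'" by (intro holomorphic_intros)
    moreover have "z + of_real (h n) \<in> ball (of_real (x j)) \<delta>" if "z \<in> ball (of_real (x j)) \<delta>'" for z :: complex
    proof -
     have "dist z (z + of_real (h n)) = h n" using h(1)[of n] by (simp add: dist_norm)
     then show ?thesis using that h[of n] r dist_triangle[of "of_real (x j)" "z + of_real (h n)" z] by (auto simp: r_def)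
    qed
    ultimately have "((\<lambda>z. G (u(j := z))) \<circ> (\<lambda>z. z + of_real (h n))) holomorphic_on ball (of_real (x j)) \<delta>'"
     by (intro holomorphic_on_compose_gen) auto
    then show ?thesis using True by (simp add: o_def)
   next
    case False
    have "u(j := u j + of_real (h n)) \<in> polydisc m x \<delta>" by (rule slice_facts(3)[OF G K d u j hb[of u]])
    moreover have "ball (complex_of_real (x i)) \<delta>' \<subseteq> ball (of_real (x i)) \<delta>" using d by auto
    ultimately have "(\<lambda>z. G ((u(j := u j + of_real (h n)))(i := z))) holomorphic_on ball (of_real (x i)) \<delta>'"
     by (intro holomorphic_on_subset[OF sep_holomorphicD[OF G _ i]])
    then show ?thesis using False by (simp add: fun_upd_twist)
   qed
  qed
  have "sep_holomorphic m x \<delta>' (\<lambda>u. (G (u(j := u j + of_real (h n))) - G u) * of_real (1 / h n))"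
   using d by (intro sep_holomorphic_mult sep_holomorphic_diff shift sep_holomorphic_const sep_holomorphic_mono[OF G]) auto
  then show "sep_holomorphic m x \<delta>' (Q n)" unfolding Q_def by (simp add: divide_inverse)
 qed
qed

text \<open>Cauchy's estimate is applied once per entry of \<open>js\<close>, each time on a
  slightly smaller polydisc. The constant \<open>C\<close> is chosen before \<open>G\<close>,
  \<open>K\<close> and \<open>F\<close>, because these will depend on \<open>n\<close>.
  \<open>F\<close> is only compared with \<open>G\<close> at real points, which suffices as
  \<open>mpartial\<close> takes derivatives along the real axes.\<close>

lemma mpartial_bound:
 assumes "set js \<subseteq> {1..m}" "0 < \<delta>'" "\<delta>' < \<delta>"
 shows "\<exists>C\<ge>0. \<forall>G K F. sep_holomorphic m x \<delta> G \<longrightarrow> (\<forall>u\<in>polydisc m x \<delta>. cmod (G u) \<le> K) \<longrightarrow>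
  (\<forall>w. (\<lambda>j. complex_of_real (w j)) \<in> polydisc m x \<delta> \<longrightarrow> F w = G (\<lambda>j. complex_of_real (w j))) \<longrightarrow>
  (\<exists>G'. sep_holomorphic m x \<delta>' G' \<and> (\<forall>u\<in>polydisc m x \<delta>'. cmod (G' u) \<le> C * K) \<and>
   (\<forall>w. (\<lambda>j. complex_of_real (w j)) \<in> polydisc m x \<delta>' \<longrightarrow> mpartial F js w = G' (\<lambda>j. complex_of_real (w j))))"
 using assms
proof (induction js arbitrary: \<delta>')
 case Nil
 show ?case
 proof (intro exI[of _ 1] conjI allI impI)
  fix G K F
  assume a: "sep_holomorphic m x \<delta> G" "\<forall>u\<in>polydisc m x \<delta>. cmod (G u) \<le> K"
   "\<forall>w. (\<lambda>j. complex_of_real (w j)) \<in> polydisc m x \<delta> \<longrightarrow> F w = G (\<lambda>j. complex_of_real (w j))"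
  have sub: "polydisc m x \<delta>' \<subseteq> polydisc m x \<delta>" using Nil by (intro polydisc_mono) simp
  show "\<exists>G'. sep_holomorphic m x \<delta>' G' \<and> (\<forall>u\<in>polydisc m x \<delta>'. cmod (G' u) \<le> 1 * K) \<and>
   (\<forall>w. (\<lambda>j. complex_of_real (w j)) \<in> polydisc m x \<delta>' \<longrightarrow> mpartial F [] w = G' (\<lambda>j. complex_of_real (w j)))"
   using sep_holomorphic_mono[OF a(1), of \<delta>'] a(2,3) sub Nil by (intro exI[of _ G]) auto
 qed simp
next
 case (Cons j js)
 \<comment> \<open>The induction hypothesis is used with the halfway radius, which leaves room for
   one more Cauchy estimate.\<close>
 define \<delta>2 where "\<delta>2 = (\<delta>' + \<delta>) / 2"
 have d2: "0 < \<delta>2" "\<delta>2 < \<delta>" "\<delta>' < \<delta>2" using Cons.prems by (auto simp: \<delta>2_def)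
 have j: "j \<in> {1..m}" using Cons.prems by auto
 obtain C where C: "C \<ge> 0" "\<forall>G K F. sep_holomorphic m x \<delta> G \<longrightarrow> (\<forall>u\<in>polydisc m x \<delta>. cmod (G u) \<le> K) \<longrightarrow>
  (\<forall>w. (\<lambda>j. complex_of_real (w j)) \<in> polydisc m x \<delta> \<longrightarrow> F w = G (\<lambda>j. complex_of_real (w j))) \<longrightarrow>
  (\<exists>G'. sep_holomorphic m x \<delta>2 G' \<and> (\<forall>u\<in>polydisc m x \<delta>2. cmod (G' u) \<le> C * K) \<and>
   (\<forall>w. (\<lambda>j. complex_of_real (w j)) \<in> polydisc m x \<delta>2 \<longrightarrow> mpartial F js w = G' (\<lambda>j. complex_of_real (w j))))"
  using Cons.IH[OF _ d2(1,2)] Cons.prems by auto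
 show ?case
 proof (intro exI[of _ "4 / (\<delta>2 - \<delta>') * C"] conjI allI impI)
  show "0 \<le> 4 / (\<delta>2 - \<delta>') * C" using d2 C(1) by simp
  fix G K F
  assume a: "sep_holomorphic m x \<delta> G" "\<forall>u\<in>polydisc m x \<delta>. cmod (G u) \<le> K"
   "\<forall>w. (\<lambda>j. complex_of_real (w j)) \<in> polydisc m x \<delta> \<longrightarrow> F w = G (\<lambda>j. complex_of_real (w j))"
  obtain G' where G': "sep_holomorphic m x \<delta>2 G'" "\<forall>u\<in>polydisc m x \<delta>2. cmod (G' u) \<le> C * K"
   "\<forall>w. (\<lambda>j. complex_of_real (w j)) \<in> polydisc m x \<delta>2 \<longrightarrow> mpartial F js w = G' (\<lambda>j. complex_of_real (w j))"
   using C(2) a by blast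
  have 1: "sep_holomorphic m x \<delta>' (cpartial j G')"
   using G'(2) by (intro sep_holomorphic_cpartial[OF G'(1) _ d2(3) j]) blast
  have 2: "cmod (cpartial j G' u) \<le> 4 / (\<delta>2 - \<delta>') * C * K" if "u \<in> polydisc m x \<delta>'" for u
   using cpartial_bound[OF G'(1) _ d2(3) that j, of "C * K"] G'(2) by (simp add: mult.assoc)
  have 3: "mpartial F (j # js) w = cpartial j G' (\<lambda>j. complex_of_real (w j))"
   if w: "(\<lambda>j. complex_of_real (w j)) \<in> polydisc m x \<delta>'" for w
  proof -
   define u where "u = (\<lambda>j. complex_of_real (w j))"
   define g where "g = (\<lambda>z. G' (u(j := z)))"
   define S where "S = ball (complex_of_real (x j)) \<delta>2"
   have u: "u \<in> polydisc m x \<delta>2" using w polydisc_mono[of \<delta>' \<delta>2] d2 by (auto simp: u_def)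
   have uj: "complex_of_real (w j) \<in> S" using u j by (auto simp: polydisc_def u_def S_def)
   have "(g has_field_derivative deriv g (of_real (w j))) (at (of_real (w j)))"
    using sep_holomorphicD[OF G'(1) u j] uj unfolding g_def S_def by (intro holomorphic_derivI[of _ S]) (auto simp: S_def)
   then have d: "((\<lambda>t. g (of_real t)) has_vector_derivative deriv g (of_real (w j))) (at (w j))"
    by (rule has_vector_derivative_real_field)
   have eq: "mpartial F js (w(j := t)) = g (of_real t)" if t: "complex_of_real t \<in> S" for t
   proof -
    have e: "(\<lambda>i. complex_of_real ((w(j := t)) i)) = u(j := of_real t)" by (auto simp: u_def)
    have "u(j := of_real t) \<in> polydisc m x \<delta>2" using t by (intro polydisc_upd u) (simp add: S_def)
    then show ?thesis using G'(3)[rule_format, of "w(j := t)"] unfolding e g_def by blast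
   qed
   have "((\<lambda>t. mpartial F js (w(j := t))) has_vector_derivative deriv g (of_real (w j))) (at (w j))"
   proof (rule has_vector_derivative_transform_within_open[OF d])
    show "open (complex_of_real -` S)" by (intro open_vimage continuous_intros) (auto simp: S_def)
   qed (use uj eq in auto)
   then show ?thesis unfolding mpartial.simps cpartial_def u_def[symmetric] g_def
    by (simp add: vector_derivative_at u_def)
  qed
  show "\<exists>G'. sep_holomorphic m x \<delta>' G' \<and> (\<forall>u\<in>polydisc m x \<delta>'. cmod (G' u) \<le> 4 / (\<delta>2 - \<delta>') * C * K) \<and>
   (\<forall>w. (\<lambda>j. complex_of_real (w j)) \<in> polydisc m x \<delta>' \<longrightarrow> mpartial F (j # js) w = G' (\<lambda>j. complex_of_real (w j)))"
   using 1 2 3 by blast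
 qed
qed

lemma sep_holomorphic_omega: "sep_holomorphic m x \<delta> (\<lambda>u. omega m' u l)"
 unfolding omega_def by (intro sep_holomorphic_diff sep_holomorphic_exp sep_holomorphic_sum sep_holomorphic_coord)

lemma sep_holomorphic_layer_factor: "sep_holomorphic m x \<delta> (layer_factor m' b \<alpha> \<rho> s n j)"
 unfolding layer_factor_def[abs_def]
 by (intro sep_holomorphic_add sep_holomorphic_const sep_holomorphic_sum sep_holomorphic_mult sep_holomorphic_omega)

lemma norm_add3_le: "cmod a \<le> A \<Longrightarrow> cmod b \<le> B \<Longrightarrow> cmod c \<le> C \<Longrightarrow> cmod (a + b + c) \<le> A + B + C"
 by (rule norm_add_le2[OF norm_add_le2])

text \<open>The coefficients are recovered one after the other as locally uniform limits of holomorphic functions,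
 so no differentiation under the integral sign is needed.\<close>

lemma sep_holomorphic_mainterm:
 assumes S: "\<And>n. n \<ge> N \<Longrightarrow> sep_holomorphic m x \<delta> (S n)" and N: "0 < N"
  and err: "\<And>n u. n \<ge> N \<Longrightarrow> u \<in> polydisc m x \<delta> \<Longrightarrow> cmod (S n u - mainterm m b \<alpha> \<rho> s n u) \<le> K / real n"
  and C34: "\<And>u. u \<in> polydisc m x \<delta> \<Longrightarrow> cmod (C3 m b \<alpha> s u) \<le> K \<and> cmod (C4 m b \<rho> s u) \<le> K"
 shows "sep_holomorphic m x \<delta> (mainterm m b \<alpha> \<rho> s n)"
proof -
 define r where "r = (\<lambda>n::nat. sqrt (real n))"
 have r: "0 < r n" "r n * r n = real n" if "N \<le> n" for n using that N by (auto simp: r_def)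
 define A where "A = C1 m b \<rho>"
 define B where "B = C2 m b \<rho> s"
 define C where "C = C3 m b \<alpha> s"
 define D where "D = C4 m b \<rho> s"
 have mt: "mainterm m b \<alpha> \<rho> s n u = A u * of_nat n + B u * of_real (r n) + C u + D u / of_real (r n)" for n u
  by (simp add: mainterm_def A_def B_def C_def D_def r_def)
 have hA: "sep_holomorphic m x \<delta> A" unfolding A_def C1_def[abs_def] Usum_def
  by (intro sep_holomorphic_mult sep_holomorphic_const sep_holomorphic_sum sep_holomorphic_coord)
 have divr: "cmod (z / of_real (r n)) \<le> c / r n" if "cmod z \<le> c" "N \<le> n" for z c n
  using that r(1)[of n] by (simp add: norm_divide divide_right_mono)
 define E where "E = (\<lambda>n u. S n u - mainterm m b \<alpha> \<rho> s n u)"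
 have E: "cmod (E n u) \<le> K / real n" if "N \<le> n" "u \<in> polydisc m x \<delta>" for n u using err[OF that] by (simp add: E_def)
 have hB: "sep_holomorphic m x \<delta> B"
 proof (rule sep_holomorphic_limit[where f = "\<lambda>n u. (S n u - A u * of_nat n) * (1 / of_real (r n))" and N = N])
  show "sep_holomorphic m x \<delta> (\<lambda>u. (S n u - A u * of_nat n) * (1 / of_real (r n)))" if "N \<le> n" for n
   by (intro sep_holomorphic_mult sep_holomorphic_diff sep_holomorphic_const hA S that)
  show "cmod ((S n u - A u * of_nat n) * (1 / of_real (r n)) - B u) \<le> (K + K / r n + K / real n) / r n"
   if n: "N \<le> n" and u: "u \<in> polydisc m x \<delta>" for n u
  proof -
   have "(S n u - A u * of_nat n) * (1 / of_real (r n)) - B u = (C u + D u / of_real (r n) + E n u) / of_real (r n)"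
    using r(1)[OF n] by (simp add: E_def mt field_simps)
   then show ?thesis using C34[OF u] E[OF n u] by (simp only:) (intro divr norm_add3_le n; simp add: C_def D_def)
  qed
  show "(\<lambda>n. (K + K / r n + K / real n) / r n) \<longlonglongrightarrow> 0" unfolding r_def by real_asymp
 qed
 have hC: "sep_holomorphic m x \<delta> C"
 proof (rule sep_holomorphic_limit[where f = "\<lambda>n u. S n u - A u * of_nat n - B u * of_real (r n)" and N = N])
  show "sep_holomorphic m x \<delta> (\<lambda>u. S n u - A u * of_nat n - B u * of_real (r n))" if "N \<le> n" for n
   by (intro sep_holomorphic_mult sep_holomorphic_diff sep_holomorphic_const hA hB S that)
  show "cmod (S n u - A u * of_nat n - B u * of_real (r n) - C u) \<le> K / r n + K / real n"
   if n: "N \<le> n" and u: "u \<in> polydisc m x \<delta>" for n u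
  proof -
   have "S n u - A u * of_nat n - B u * of_real (r n) - C u = D u / of_real (r n) + E n u"
    by (simp add: E_def mt)
   then show ?thesis using C34[OF u] E[OF n u] by (simp only:) (intro divr norm_add_le2 n; simp add: D_def)
  qed
  show "(\<lambda>n. K / r n + K / real n) \<longlonglongrightarrow> 0" unfolding r_def by real_asymp
 qed
 have hD: "sep_holomorphic m x \<delta> D"
 proof (rule sep_holomorphic_limit[where f = "\<lambda>n u. (S n u - A u * of_nat n - B u * of_real (r n) - C u) * of_real (r n)" and N = N])
  show "sep_holomorphic m x \<delta> (\<lambda>u. (S n u - A u * of_nat n - B u * of_real (r n) - C u) * of_real (r n))" if "N \<le> n" for n
   by (intro sep_holomorphic_mult sep_holomorphic_diff sep_holomorphic_const hA hB hC S that)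
  show "cmod ((S n u - A u * of_nat n - B u * of_real (r n) - C u) * of_real (r n) - D u) \<le> K / real n * r n"
   if n: "N \<le> n" and u: "u \<in> polydisc m x \<delta>" for n u
  proof -
   have "(S n u - A u * of_nat n - B u * of_real (r n) - C u) * of_real (r n) - D u = E n u * of_real (r n)"
    using r(1)[OF n] by (simp add: E_def mt field_simps)
   then show ?thesis using mult_right_mono[OF E[OF n u], of "r n"] r(1)[OF n] by (simp add: norm_mult)
  qed
  show "(\<lambda>n. K / real n * r n) \<longlonglongrightarrow> 0" unfolding r_def by real_asymp
 qed
 have "sep_holomorphic m x \<delta> (\<lambda>u. A u * of_nat n + B u * of_real (r n) + C u + D u * (1 / of_real (r n)))"
  by (intro sep_holomorphic_add sep_holomorphic_mult sep_holomorphic_const hA hB hC hD)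
 then show ?thesis by (simp add: mt[abs_def])
qed

section \<open>Real parameters and the final assembly\<close>

lemma omega_of_real_in_Reals: "omega m (\<lambda>j. complex_of_real (w j)) l \<in> \<real>"
 unfolding omega_def by (intro Reals_diff) (auto simp flip: of_real_sum exp_of_real)

text \<open>For positive real factors no multiple of \<open>2 * pi * \<i>\<close> can appear, so the
  principal logarithm of the product is the sum of the logarithms.\<close>

lemma Ln_prod_pos_real:
 assumes "\<And>j. j \<in> A \<Longrightarrow> f j \<in> \<real> \<and> 0 < Re (f j)" "finite A"
 shows "Ln (\<Prod>j\<in>A. f j) = (\<Sum>j\<in>A. Ln (f j))"
proof -
 have f: "f j = of_real (Re (f j))" if "j \<in> A" for j using assms(1)[OF that] by simp
 have "Ln (\<Prod>j\<in>A. f j) = Ln (\<Prod>j\<in>A. of_real (Re (f j)))" using f by (metis (no_types, lifting) prod.cong)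
 also have "... = of_real (ln (\<Prod>j\<in>A. Re (f j)))"
  unfolding of_real_prod[symmetric] using assms by (intro Ln_of_real prod_pos) auto
 also have "... = (\<Sum>j\<in>A. of_real (ln (Re (f j))))"
  using assms by (subst ln_prod) (auto dest: assms(1))
 also have "... = (\<Sum>j\<in>A. Ln (f j))"
  using assms(1) f by (intro sum.cong refl) (metis Ln_of_real)
 finally show ?thesis .
qed

lemma set_multi_index: "set (multi_index m k) \<subseteq> {1..m}"
 by (auto simp: multi_index_def)

text \<open>From \<open>n >= 3\<close> one gets \<open>n >= exp 1\<close>, hence
  \<open>ln n >= 1\<close>; this converts the error \<open>K / n\<close> into the stated
  form.\<close>

lemma ln_power_ge_1:
 assumes "3 \<le> n" "0 \<le> K"
 shows "K / real n \<le> K * (ln (real n)) ^ 4 / real n"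
proof -
 have "exp 1 \<le> real n" using exp_le assms(1) by linarith
 then have "1 \<le> ln (real n)" using assms(1) by (subst ln_ge_iff) auto
 then have "1 \<le> (ln (real n)) ^ 4" by (rule one_le_power)
 then have "K * 1 \<le> K * (ln (real n)) ^ 4" using assms(2) by (rule mult_left_mono)
 then show ?thesis by (simp add: divide_right_mono)
qed

theorem theorem1p5:
  fixes m :: nat and b \<alpha> \<rho> :: real and s x :: "nat \<Rightarrow> real"
  assumes m_pos: "m > 0"
    and b_pos: "b > 0"
    and rho_pos: "0 < \<rho>" and rho_lt: "\<rho> < b powr (- 1 / (2 * b))"
    and s_decr: "\<And>i j. 1 \<le> i \<Longrightarrow> i < j \<Longrightarrow> j \<le> m \<Longrightarrow> s j < s i"
    and s_pos: "s m > 0"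
    and alpha_gt: "\<alpha> > -1"
  shows
    "(\<exists>\<delta>>0. \<exists>K N0. \<forall>n\<ge>N0. \<forall>u :: nat \<Rightarrow> complex.
        (\<forall>j\<in>{1..m}. u j \<in> ball (complex_of_real (x j)) \<delta>) \<longrightarrow>
        (\<exists>e. cmod e \<le> K * (ln (real n)) ^ 4 / real n \<and>
             mgf m b \<alpha> \<rho> s n u = exp (mainterm m b \<alpha> \<rho> s n u + e)))
     \<and>
     (\<forall>k :: nat \<Rightarrow> nat. \<forall>v :: nat \<Rightarrow> real.
        \<exists>K N0. \<forall>n\<ge>N0.
          cmod (mpartial
                  (\<lambda>w. Ln (mgf m b \<alpha> \<rho> s n (\<lambda>j. complex_of_real (w j)))
                       - mainterm m b \<alpha> \<rho> s n (\<lambda>j. complex_of_real (w j)))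
                  (multi_index m k) v)
            \<le> K * (ln (real n)) ^ 4 / real n)"
proof (intro conjI allI)
 \<comment> \<open>A logarithm of the moment generating function that is holomorphic on the
   polydisc; for complex \<open>u\<close> it need not be the principal one.\<close>
 define L where "L = (\<lambda>n u. \<Sum>j=1..n. Ln (layer_factor m b \<alpha> \<rho> s n j u))"
 have expansion: "\<exists>K>0. \<exists>N0>0. (\<forall>n\<ge>N0. \<forall>u\<in>polydisc m x (1 / real m). cmod (L n u - mainterm m b \<alpha> \<rho> s n u) \<le> K / real n) \<and>
  (\<forall>n\<ge>N0. \<forall>u. mgf m b \<alpha> \<rho> s n u = (\<Prod>j=1..n. layer_factor m b \<alpha> \<rho> s n j u)) \<and>
  (\<forall>n\<ge>N0. \<forall>u\<in>polydisc m x (1 / real m). \<forall>j\<in>{1..n}. 0 < Re (layer_factor m b \<alpha> \<rho> s n j u)) \<and>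
  (\<forall>u\<in>polydisc m x (1 / real m). cmod (C3 m b \<alpha> s u) \<le> K \<and> cmod (C4 m b \<rho> s u) \<le> K)" for x
  unfolding L_def by (rule polydisc_expansion) (use assms in auto)
 show "\<exists>\<delta>>0. \<exists>K N0. \<forall>n\<ge>N0. \<forall>u :: nat \<Rightarrow> complex.
    (\<forall>j\<in>{1..m}. u j \<in> ball (complex_of_real (x j)) \<delta>) \<longrightarrow>
    (\<exists>e. cmod e \<le> K * (ln (real n)) ^ 4 / real n \<and>
      mgf m b \<alpha> \<rho> s n u = exp (mainterm m b \<alpha> \<rho> s n u + e))"
 proof -
  obtain K N0 where K: "0 < K" "0 < N0"
   "\<forall>n\<ge>N0. \<forall>u\<in>polydisc m x (1 / real m). cmod (L n u - mainterm m b \<alpha> \<rho> s n u) \<le> K / real n"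
   "\<forall>n\<ge>N0. \<forall>u. mgf m b \<alpha> \<rho> s n u = (\<Prod>j=1..n. layer_factor m b \<alpha> \<rho> s n j u)"
   "\<forall>n\<ge>N0. \<forall>u\<in>polydisc m x (1 / real m). \<forall>j\<in>{1..n}. 0 < Re (layer_factor m b \<alpha> \<rho> s n j u)"
   using expansion[of x] by (elim exE conjE) (rule that; assumption)
  show ?thesis
  proof (rule exI[of _ "1 / real m"], intro conjI exI[of _ K] exI[of _ "max N0 3"] allI impI)
   show "0 < 1 / real m" using m_pos by simp
   fix n u assume n: "max N0 3 \<le> n" and "\<forall>j\<in>{1..m}. u j \<in> ball (complex_of_real (x j)) (1 / real m)"
   then have u: "u \<in> polydisc m x (1 / real m)" by (simp add: polydisc_def)
   define e where "e = L n u - mainterm m b \<alpha> \<rho> s n u"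
   have "cmod e \<le> K / real n" using K(3) n u by (simp add: e_def)
   also have "... \<le> K * (ln (real n)) ^ 4 / real n" using n K(1) by (intro ln_power_ge_1) auto
   finally have e: "cmod e \<le> K * (ln (real n)) ^ 4 / real n" .
   have "exp (Ln (layer_factor m b \<alpha> \<rho> s n j u)) = layer_factor m b \<alpha> \<rho> s n j u" if "j \<in> {1..n}" for j
   proof -
    have "0 < Re (layer_factor m b \<alpha> \<rho> s n j u)" using K(5) n u that by simp
    then show ?thesis by (intro exp_Ln) auto
   qed
   then have "exp (L n u) = mgf m b \<alpha> \<rho> s n u" using K(4) n by (simp add: L_def exp_sum)
   then show "\<exists>e. cmod e \<le> K * (ln (real n)) ^ 4 / real n \<and> mgf m b \<alpha> \<rho> s n u = exp (mainterm m b \<alpha> \<rho> s n u + e)"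
    using e by (intro exI[of _ e]) (simp add: e_def)
  qed
 qed
 fix k :: "nat \<Rightarrow> nat" and v :: "nat \<Rightarrow> real"
 \<comment> \<open>For the derivatives the polydisc is centred at the point \<open>v\<close> itself,
   so the constants may depend on \<open>v\<close>.\<close>
 define \<delta> where "\<delta> = 1 / real m"
 have \<delta>: "0 < \<delta>" using m_pos by (simp add: \<delta>_def)
 obtain K N0 where K: "0 < K" "0 < N0"
   "\<forall>n\<ge>N0. \<forall>u\<in>polydisc m v \<delta>. cmod (L n u - mainterm m b \<alpha> \<rho> s n u) \<le> K / real n"
   "\<forall>n\<ge>N0. \<forall>u. mgf m b \<alpha> \<rho> s n u = (\<Prod>j=1..n. layer_factor m b \<alpha> \<rho> s n j u)"
   "\<forall>n\<ge>N0. \<forall>u\<in>polydisc m v \<delta>. \<forall>j\<in>{1..n}. 0 < Re (layer_factor m b \<alpha> \<rho> s n j u)"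
   "\<forall>u\<in>polydisc m v \<delta>. cmod (C3 m b \<alpha> s u) \<le> K \<and> cmod (C4 m b \<rho> s u) \<le> K"
   using expansion[of v] unfolding \<delta>_def[symmetric] by (elim exE conjE) (rule that; assumption)
 have hL: "sep_holomorphic m v \<delta> (L n)" if "N0 \<le> n" for n
  unfolding L_def using K(5) that by (intro sep_holomorphic_sum sep_holomorphic_Ln sep_holomorphic_layer_factor) auto
 have hM: "sep_holomorphic m v \<delta> (mainterm m b \<alpha> \<rho> s n)" for n
  by (rule sep_holomorphic_mainterm[OF hL K(2)]) (use K in auto)
 have d2: "0 < \<delta> / 2" "\<delta> / 2 < \<delta>" using \<delta> by simp_all
 obtain C where C: "C \<ge> 0" "\<forall>G K F. sep_holomorphic m v \<delta> G \<longrightarrow> (\<forall>u\<in>polydisc m v \<delta>. cmod (G u) \<le> K) \<longrightarrow>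
  (\<forall>w. (\<lambda>j. complex_of_real (w j)) \<in> polydisc m v \<delta> \<longrightarrow> F w = G (\<lambda>j. complex_of_real (w j))) \<longrightarrow>
  (\<exists>G'. sep_holomorphic m v (\<delta> / 2) G' \<and> (\<forall>u\<in>polydisc m v (\<delta> / 2). cmod (G' u) \<le> C * K) \<and>
   (\<forall>w. (\<lambda>j. complex_of_real (w j)) \<in> polydisc m v (\<delta> / 2) \<longrightarrow> mpartial F (multi_index m k) w = G' (\<lambda>j. complex_of_real (w j))))"
  using mpartial_bound[OF set_multi_index[of m k] d2, of v] by (elim exE conjE) (rule that; assumption)
 show "\<exists>K N0. \<forall>n\<ge>N0. cmod (mpartial
         (\<lambda>w. Ln (mgf m b \<alpha> \<rho> s n (\<lambda>j. complex_of_real (w j)))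
           - mainterm m b \<alpha> \<rho> s n (\<lambda>j. complex_of_real (w j)))
         (multi_index m k) v) \<le> K * (ln (real n)) ^ 4 / real n"
 proof (intro exI[of _ "C * K"] exI[of _ "max N0 3"] allI impI)
  fix n assume n: "max N0 3 \<le> n"
  define G where "G = (\<lambda>u. L n u - mainterm m b \<alpha> \<rho> s n u)"
  define F where "F = (\<lambda>w. Ln (mgf m b \<alpha> \<rho> s n (\<lambda>j. complex_of_real (w j)))
           - mainterm m b \<alpha> \<rho> s n (\<lambda>j. complex_of_real (w j)))"
  have "sep_holomorphic m v \<delta> G" unfolding G_def using n by (intro sep_holomorphic_diff hL hM) simp
  moreover have "\<forall>u\<in>polydisc m v \<delta>. cmod (G u) \<le> K / real n" using K(3) n by (simp add: G_def)
  moreover have "\<forall>w. (\<lambda>j. complex_of_real (w j)) \<in> polydisc m v \<delta> \<longrightarrow> F w = G (\<lambda>j. complex_of_real (w j))"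
  proof (intro allI impI)
   fix w assume w: "(\<lambda>j. complex_of_real (w j)) \<in> polydisc m v \<delta>"
   \<comment> \<open>At real points all factors are real and positive, so the principal logarithm in
     the statement is \<open>L n\<close> there.\<close>
   have "Ln (mgf m b \<alpha> \<rho> s n (\<lambda>j. complex_of_real (w j))) = L n (\<lambda>j. complex_of_real (w j))"
   proof -
    have "layer_factor m b \<alpha> \<rho> s n j (\<lambda>j. complex_of_real (w j)) \<in> \<real>" for j
     unfolding layer_factor_def by (intro Reals_add Reals_1 sum_in_Reals Reals_mult omega_of_real_in_Reals Reals_of_real)
    then have "Ln (\<Prod>j=1..n. layer_factor m b \<alpha> \<rho> s n j (\<lambda>j. complex_of_real (w j))) = L n (\<lambda>j. complex_of_real (w j))"
     unfolding L_def using K(5) n w by (intro Ln_prod_pos_real) auto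
    then show ?thesis using K(4) n by simp
   qed
   then show "F w = G (\<lambda>j. complex_of_real (w j))" by (simp add: F_def G_def)
  qed
  ultimately obtain G' where G': "\<forall>u\<in>polydisc m v (\<delta> / 2). cmod (G' u) \<le> C * (K / real n)"
   "\<forall>w. (\<lambda>j. complex_of_real (w j)) \<in> polydisc m v (\<delta> / 2) \<longrightarrow> mpartial F (multi_index m k) w = G' (\<lambda>j. complex_of_real (w j))"
   using C(2) by blast
  have "(\<lambda>j. complex_of_real (v j)) \<in> polydisc m v (\<delta> / 2)" using \<delta> by (simp add: polydisc_def)
  then have "cmod (mpartial F (multi_index m k) v) \<le> C * K / real n" using G' by simp
  also have "... \<le> C * K * (ln (real n)) ^ 4 / real n" using n K(1) C(1) by (intro ln_power_ge_1) auto
  finally show "cmod (mpartial F (multi_index m k) v) \<le> C * K * (ln (real n)) ^ 4 / real n" .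
 qed
qed

end
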